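(* Let $R$ be a regular ring and let $\epsilon>0$. For every $x\in K_1(R[t,t^{-1}])$ there exists an $\epsilon$-automorphism $\xi$ in $\mathcal{T}^{\langle t\rangle}(\mathbb{R})$ such that $\mathbb{U}([\xi])=x$.
   Context: $\langle t\rangle$ is the infinite cyclic group acting freely on $\mathbb{R}$ with $t$ acting by $x\mapsto x+1$; its group ring is $R\langle t\rangle=R[t,t^{-1}]$. A geometric $R$-module over $\mathbb{R}$ is a family $A=(A_x)_{x\in \mathbb{R}}$ of finitely generated free $R$-modules whose support $\{x: A_x\neq 0\}$ is locally finite in $\mathbb{R}$. A morphism $\varphi:A\to B$ is a family of $R$-module maps $\varphi_x^y:A_x\to B_y$ such that for every $y$ the set $\{x:\varphi_x^y\ne0\}$ is finite and for every $x$ the set $\{y:\varphi_x^y\neq 0\}$ is finite; composition is matrix multiplication; $\operatorname{supp}(\varphi)=\{(x,y):\varphi_x^y\neq0\}$. $A$ is $\langle t\rangle$-invariant if $A_{x+1}=A_x$ for all $x$, and $\varphi$ is $\langle t\rangle$-invariant if $\varphi_{x+1}^{y+1}=\varphi_x^y$ for all $x,y$. $\mathcal{T}^{\langle t\rangle}(\mathbb{R})$ is the category of $\langle t\rangle$-invariant geometric $R$-modules over $\mathbb{R}$ (with support contained in $\langle t\rangle\cdot K$ for some compact $K$) and $\langle t\rangle$-invariant morphisms. The functor $\mathbb{U}$ from $\mathcal{T}^{\langle t\rangle}(\mathbb{R})$ to finitely generated free $R[t,t^{-1}]$-modules forgets geometry: $\mathbb{U}(A)=\bigoplus_{x\in\mathbb{R}}A_x$,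 where $t$ acts by carrying the summand $A_x$ identically to $A_{x+1}=A_x$, and $\mathbb{U}(\varphi)$ is the map with components $\varphi_x^y$. It is an equivalence of categories; the induced isomorphism $K_1(\mathcal{T}^{\langle t\rangle}(\mathbb{R}))\to K_1(R[t,t^{-1}])$ is also denoted $\mathbb{U}$. For $\epsilon>0$, a morphism $\varphi$ is $\epsilon$-controlled if $|x-y|<\epsilon$ for all $(x,y)\in\operatorname{supp}(\varphi)$. An $\epsilon$-automorphism is an automorphism $\varphi$ such that $\varphi$ and $\varphi^{-1}$ are both $\epsilon$-controlled. *)

theory Defs
  imports Complex_Main "HOL-Algebra.Algebra"
begin

section \<open>Modules over a ring that need not be commutative\<close>

text \<open>
  The locale \<^locale>\<open>module\<close> of the library requires a commutative ring of scalars. Here scalars form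
  an arbitrary associative unital ring, and modules are left modules. The record type of the library
  is kept; its fields for a multiplication and a unit on the module itself are never used.
\<close>

locale left_module = R?: ring R + M?: abelian_group M
  for R :: "('a, 'k) ring_scheme" (structure) and M :: "('a, 'm) module" (structure) +
  assumes smult_closed:
      "\<lbrakk>a \<in> carrier R; x \<in> carrier M\<rbrakk> \<Longrightarrow> a \<odot>\<^bsub>M\<^esub> x \<in> carrier M"
    and smult_l_distr:
      "\<lbrakk>a \<in> carrier R; b \<in> carrier R; x \<in> carrier M\<rbrakk> \<Longrightarrow>
        (a \<oplus>\<^bsub>R\<^esub> b) \<odot>\<^bsub>M\<^esub> x = a \<odot>\<^bsub>M\<^esub> x \<oplus>\<^bsub>M\<^esub> b \<odot>\<^bsub>M\<^esub> x"
    and smult_r_distr: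
      "\<lbrakk>a \<in> carrier R; x \<in> carrier M; y \<in> carrier M\<rbrakk> \<Longrightarrow>
        a \<odot>\<^bsub>M\<^esub> (x \<oplus>\<^bsub>M\<^esub> y) = a \<odot>\<^bsub>M\<^esub> x \<oplus>\<^bsub>M\<^esub> a \<odot>\<^bsub>M\<^esub> y"
    and smult_assoc:
      "\<lbrakk>a \<in> carrier R; b \<in> carrier R; x \<in> carrier M\<rbrakk> \<Longrightarrow>
        (a \<otimes>\<^bsub>R\<^esub> b) \<odot>\<^bsub>M\<^esub> x = a \<odot>\<^bsub>M\<^esub> (b \<odot>\<^bsub>M\<^esub> x)"
    and smult_one:
      "x \<in> carrier M \<Longrightarrow> \<one>\<^bsub>R\<^esub> \<odot>\<^bsub>M\<^esub> x = x"

text \<open>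
  Module maps are extensional functions, so that two of them are equal iff they agree on the carrier
  of their source.
\<close>

definition lmod_hom ::
    "('a, 'k) ring_scheme \<Rightarrow> ('a, 'm) module \<Rightarrow> ('a, 'n) module \<Rightarrow> ('m \<Rightarrow> 'n) set" where
  "lmod_hom R M N = {f \<in> carrier M \<rightarrow>\<^sub>E carrier N.
     (\<forall>x\<in>carrier M. \<forall>y\<in>carrier M. f (x \<oplus>\<^bsub>M\<^esub> y) = f x \<oplus>\<^bsub>N\<^esub> f y) \<and>
     (\<forall>a\<in>carrier R. \<forall>x\<in>carrier M. f (a \<odot>\<^bsub>M\<^esub> x) = a \<odot>\<^bsub>N\<^esub> f x)}"

definition zero_map :: "('a, 'm) module \<Rightarrow> ('a, 'n) module \<Rightarrow> 'm \<Rightarrow> 'n" where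
  "zero_map M N = (\<lambda>x\<in>carrier M. \<zero>\<^bsub>N\<^esub>)"

definition fg_module :: "('a, 'k) ring_scheme \<Rightarrow> ('a, 'm) module \<Rightarrow> bool" where
  "fg_module R M \<longleftrightarrow> left_module R M \<and>
     (\<exists>B. finite B \<and> B \<subseteq> carrier M \<and>
       (\<forall>m\<in>carrier M. \<exists>c\<in>B \<rightarrow>\<^sub>E carrier R. m = (\<Oplus>\<^bsub>M\<^esub>b\<in>B. c b \<odot>\<^bsub>M\<^esub> b)))"

definition fg_free_module :: "('a, 'k) ring_scheme \<Rightarrow> ('a, 'm) module \<Rightarrow> bool" where
  "fg_free_module R M \<longleftrightarrow> left_module R M \<and>
     (\<exists>B. finite B \<and> B \<subseteq> carrier M \<and>
       (\<forall>m\<in>carrier M. \<exists>!c. c \<in> B \<rightarrow>\<^sub>E carrier R \<and> m = (\<Oplus>\<^bsub>M\<^esub>b\<in>B. c b \<odot>\<^bsub>M\<^esub> b)))"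


section \<open>Regular rings\<close>

definition regular_module :: "('a, 'k) ring_scheme \<Rightarrow> ('a, 'a) module" where
  "regular_module R = \<lparr>carrier = carrier R, monoid.mult = monoid.mult R, monoid.one = \<one>\<^bsub>R\<^esub>,
     ring.zero = \<zero>\<^bsub>R\<^esub>, ring.add = ring.add R, smult = monoid.mult R\<rparr>"

definition left_noetherian :: "('a, 'k) ring_scheme \<Rightarrow> bool" where
  "left_noetherian R \<longleftrightarrow> ring R \<and>
     (\<forall>I \<subseteq> carrier R. left_module R ((regular_module R)\<lparr>carrier := I\<rparr>) \<longrightarrow>
        fg_module R ((regular_module R)\<lparr>carrier := I\<rparr>))"

text \<open>
  The modules in the lifting property have carriers in the same type as \<open>P\<close>. For finitely
  generated \<open>P\<close> and the type \<open>nat \<Rightarrow> 'a\<close>, the only case used below, this is no restriction: that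
  type contains a copy of every finitely generated module over a ring with elements in \<open>'a\<close>
  (choose coset representatives in a quotient of \<open>R\<^sup>n\<close>), and surjections between finitely generated
  modules suffice to test projectivity.
\<close>

definition projective_module :: "('a, 'k) ring_scheme \<Rightarrow> ('a, 'm) module \<Rightarrow> bool" where
  "projective_module R P \<longleftrightarrow> left_module R P \<and>
     (\<forall>(M :: ('a, 'm) module) (N :: ('a, 'm) module) p f.
        left_module R M \<and> left_module R N \<and> p \<in> lmod_hom R M N \<and> p ` carrier M = carrier N \<and>
        f \<in> lmod_hom R P N \<longrightarrow>
        (\<exists>g\<in>lmod_hom R P M. \<forall>x\<in>carrier P. p (g x) = f x))"

text \<open>
  An exact sequence \<open>0 \<rightarrow> Q (n + 1) \<rightarrow> \<dots> \<rightarrow> Q 1 \<rightarrow> Q 0 = M \<rightarrow> 0\<close> with \<open>Q 1, \<dots>, Q (n + 1)\<close> finitely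
  generated projective and \<open>d i : Q (i + 1) \<rightarrow> Q i\<close>.
\<close>

definition has_finite_projective_resolution ::
    "('a, 'k) ring_scheme \<Rightarrow> ('a, 'm) module \<Rightarrow> bool" where
  "has_finite_projective_resolution R M \<longleftrightarrow>
     (\<exists>(n :: nat) (Q :: nat \<Rightarrow> ('a, 'm) module) (d :: nat \<Rightarrow> 'm \<Rightarrow> 'm).
        Q 0 = M \<and>
        (\<forall>i\<le>n. fg_module R (Q (Suc i)) \<and> projective_module R (Q (Suc i))) \<and>
        (\<forall>i\<le>n. d i \<in> lmod_hom R (Q (Suc i)) (Q i)) \<and>
        d 0 ` carrier (Q 1) = carrier M \<and>
        (\<forall>i<n. d (Suc i) ` carrier (Q (Suc (Suc i))) =
                {x \<in> carrier (Q (Suc i)). d i x = \<zero>\<^bsub>Q i\<^esub>}) \<and>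
        inj_on (d n) (carrier (Q (Suc n))))"

definition regular_ring :: "('a, 'k) ring_scheme \<Rightarrow> bool" where
  "regular_ring R \<longleftrightarrow> left_noetherian R \<and>
     (\<forall>M :: ('a, nat \<Rightarrow> 'a) module. fg_module R M \<longrightarrow> has_finite_projective_resolution R M)"


section \<open>\<open>K\<^sub>1\<close> of an additive category\<close>

text \<open>
  Composition and addition receive the objects involved as arguments:
  \<open>cat_comp \<C> A B C g f\<close> is \<open>g \<circ> f\<close> for \<open>f : A \<rightarrow> B\<close> and \<open>g : B \<rightarrow> C\<close>, and
  \<open>cat_add \<C> A B f g\<close> is \<open>f + g\<close> for \<open>f, g : A \<rightarrow> B\<close>.
\<close>

record ('o, 'h) add_cat =
  cat_obj :: "'o set"
  cat_hom :: "'o \<Rightarrow> 'o \<Rightarrow> 'h set"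
  cat_id :: "'o \<Rightarrow> 'h"
  cat_comp :: "'o \<Rightarrow> 'o \<Rightarrow> 'o \<Rightarrow> 'h \<Rightarrow> 'h \<Rightarrow> 'h"
  cat_add :: "'o \<Rightarrow> 'o \<Rightarrow> 'h \<Rightarrow> 'h \<Rightarrow> 'h"

definition cat_inverse_pair :: "('o, 'h) add_cat \<Rightarrow> 'o \<Rightarrow> 'h \<Rightarrow> 'h \<Rightarrow> bool" where
  "cat_inverse_pair \<C> A f g \<longleftrightarrow> f \<in> cat_hom \<C> A A \<and> g \<in> cat_hom \<C> A A \<and>
     cat_comp \<C> A A A g f = cat_id \<C> A \<and> cat_comp \<C> A A A f g = cat_id \<C> A"

definition cat_aut :: "('o, 'h) add_cat \<Rightarrow> ('o \<times> 'h) set" where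
  "cat_aut \<C> = {(A, f). A \<in> cat_obj \<C> \<and> (\<exists>g. cat_inverse_pair \<C> A f g)}"

definition split_exact :: "('o, 'h) add_cat \<Rightarrow> 'o \<Rightarrow> 'o \<Rightarrow> 'o \<Rightarrow> 'h \<Rightarrow> 'h \<Rightarrow> bool" where
  "split_exact \<C> A B C i p \<longleftrightarrow> i \<in> cat_hom \<C> A B \<and> p \<in> cat_hom \<C> B C \<and>
     (\<exists>r\<in>cat_hom \<C> B A. \<exists>s\<in>cat_hom \<C> C B.
        cat_comp \<C> A B A r i = cat_id \<C> A \<and>
        cat_comp \<C> C B C p s = cat_id \<C> C \<and>
        cat_add \<C> B B (cat_comp \<C> B A B i r) (cat_comp \<C> B C B s p) = cat_id \<C> B)"

text \<open>
  \<open>K\<^sub>1\<close> is generated by the automorphisms of objects, subject to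
  \<open>[f \<circ> g] = [f] + [g]\<close> and to \<open>[b] = [a] + [c]\<close> for every automorphism \<open>(a, b, c)\<close> of a split short
  exact sequence \<open>A \<rightarrow> B \<rightarrow> C\<close>. The library writes the free abelian group additively on elements,
  but as a multiplicative group record.
\<close>

definition K1_gens :: "('o, 'h) add_cat \<Rightarrow> (('o \<times> 'h) \<Rightarrow>\<^sub>0 int) monoid" where
  "K1_gens \<C> = free_Abelian_group (cat_aut \<C>)"

definition K1_rels :: "('o, 'h) add_cat \<Rightarrow> (('o \<times> 'h) \<Rightarrow>\<^sub>0 int) set" where
  "K1_rels \<C> =
     {frag_of (A, cat_comp \<C> A A A f g) - (frag_of (A, f) + frag_of (A, g)) | A f g.
        (A, f) \<in> cat_aut \<C> \<and> (A, g) \<in> cat_aut \<C>} \<union>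
     {frag_of (B, b) - (frag_of (A, a) + frag_of (C, c)) | A B C a b c.
        (A, a) \<in> cat_aut \<C> \<and> (B, b) \<in> cat_aut \<C> \<and> (C, c) \<in> cat_aut \<C> \<and>
        (\<exists>i p. split_exact \<C> A B C i p \<and>
           cat_comp \<C> A B B b i = cat_comp \<C> A A B i a \<and>
           cat_comp \<C> B B C p b = cat_comp \<C> B C C c p)}"

definition K1_relgroup :: "('o, 'h) add_cat \<Rightarrow> (('o \<times> 'h) \<Rightarrow>\<^sub>0 int) set" where
  "K1_relgroup \<C> = generate (K1_gens \<C>) (K1_rels \<C>)"

definition K1 :: "('o, 'h) add_cat \<Rightarrow> (('o \<times> 'h) \<Rightarrow>\<^sub>0 int) set monoid" where
  "K1 \<C> = K1_gens \<C> Mod K1_relgroup \<C>"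

definition K1_class :: "('o, 'h) add_cat \<Rightarrow> 'o \<Rightarrow> 'h \<Rightarrow> (('o \<times> 'h) \<Rightarrow>\<^sub>0 int) set" where
  "K1_class \<C> A f = K1_relgroup \<C> #>\<^bsub>K1_gens \<C>\<^esub> frag_of (A, f)"

text \<open>
  The map \<open>[A, f] \<mapsto> [F A, F f]\<close> from \<open>K1 \<C>\<close> to \<open>K1 \<D>\<close> induced by an additive functor \<open>F : \<C> \<rightarrow> \<D>\<close>
  with object part \<open>Fo\<close> and morphism part \<open>Fh A B\<close> on \<open>cat_hom \<C> A B\<close>. A coset is sent to its image
  under the extension of \<open>(A, f) \<mapsto> (F A, F f)\<close> to the free abelian groups, enlarged to the coset of
  the relations of \<open>\<D>\<close> containing it.
\<close>

definition K1_map ::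
    "('o2, 'h2) add_cat \<Rightarrow> ('o1 \<Rightarrow> 'o2) \<Rightarrow> ('o1 \<Rightarrow> 'o1 \<Rightarrow> 'h1 \<Rightarrow> 'h2) \<Rightarrow>
     (('o1 \<times> 'h1) \<Rightarrow>\<^sub>0 int) set \<Rightarrow> (('o2 \<times> 'h2) \<Rightarrow>\<^sub>0 int) set" where
  "K1_map \<D> Fo Fh \<kappa> =
     K1_relgroup \<D> <#>\<^bsub>K1_gens \<D>\<^esub>
       (frag_extend (\<lambda>(A, f). frag_of (Fo A, Fh A A f)) ` \<kappa>)"


section \<open>Finitely generated free modules and \<open>K\<^sub>1\<close> of a ring\<close>

definition free_mod_cat ::
    "('a, 'k) ring_scheme \<Rightarrow> (('a, 'm) module, 'm \<Rightarrow> 'm) add_cat" where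
  "free_mod_cat R =
     \<lparr>cat_obj = {M. fg_free_module R M},
      cat_hom = lmod_hom R,
      cat_id = (\<lambda>M. \<lambda>x\<in>carrier M. x),
      cat_comp = (\<lambda>L M N g f. compose (carrier L) g f),
      cat_add = (\<lambda>M N f g. \<lambda>x\<in>carrier M. f x \<oplus>\<^bsub>N\<^esub> g x)\<rparr>"

text \<open>
  The group ring of the infinite cyclic group \<open>\<langle>t\<rangle>\<close>, that is \<open>R[t, t\<inverse>]\<close> with \<open>t\<close> central: \<open>p n\<close> is the
  coefficient of \<open>t\<^sup>n\<close>.
\<close>

definition laurent_ring :: "('a, 'k) ring_scheme \<Rightarrow> (int \<Rightarrow> 'a) ring" where
  "laurent_ring R =
     \<lparr>carrier = {p. (\<forall>n. p n \<in> carrier R) \<and> finite {n. p n \<noteq> \<zero>\<^bsub>R\<^esub>}},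
      monoid.mult = (\<lambda>p q n. \<Oplus>\<^bsub>R\<^esub>k\<in>{k. p k \<noteq> \<zero>\<^bsub>R\<^esub>}. p k \<otimes>\<^bsub>R\<^esub> q (n - k)),
      monoid.one = (\<lambda>n. if n = 0 then \<one>\<^bsub>R\<^esub> else \<zero>\<^bsub>R\<^esub>),
      ring.zero = (\<lambda>n. \<zero>\<^bsub>R\<^esub>),
      ring.add = (\<lambda>p q n. p n \<oplus>\<^bsub>R\<^esub> q n)\<rparr>"

text \<open>
  \<open>K\<^sub>1(R[t, t\<inverse>])\<close> is \<open>K\<^sub>1\<close> of the category of finitely generated free \<open>R[t, t\<inverse>]\<close>-modules, the target
  of the functor \<open>\<U>\<close> below. For a set-sized category the carriers are taken in
  \<open>real \<Rightarrow> nat \<Rightarrow> 'a\<close>; this type contains a copy of \<open>(R[t, t\<inverse>])\<^sup>n\<close> for every \<open>n\<close>.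
\<close>

abbreviation laurent_free_cat ::
    "('a, 'k) ring_scheme \<Rightarrow>
     ((int \<Rightarrow> 'a, real \<Rightarrow> nat \<Rightarrow> 'a) module, (real \<Rightarrow> nat \<Rightarrow> 'a) \<Rightarrow> (real \<Rightarrow> nat \<Rightarrow> 'a)) add_cat" where
  "laurent_free_cat R \<equiv> free_mod_cat (laurent_ring R)"


section \<open>Geometric modules over the real line\<close>

text \<open>
  The modules \<open>A x\<close> of a geometric module have carriers in \<open>nat \<Rightarrow> 'a\<close>, which contains a copy
  of \<open>R\<^sup>n\<close> for every \<open>n\<close>; apart from that they are arbitrary finitely generated free modules.
\<close>

type_synonym 'a geo_module = "real \<Rightarrow> ('a, nat \<Rightarrow> 'a) module"
type_synonym 'a geo_map = "real \<Rightarrow> real \<Rightarrow> (nat \<Rightarrow> 'a) \<Rightarrow> (nat \<Rightarrow> 'a)"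

definition geo_support :: "'a geo_module \<Rightarrow> real set" where
  "geo_support A = {x. carrier (A x) \<noteq> {\<zero>\<^bsub>A x\<^esub>}}"

definition geometric_module :: "('a, 'k) ring_scheme \<Rightarrow> 'a geo_module \<Rightarrow> bool" where
  "geometric_module R A \<longleftrightarrow> (\<forall>x. fg_free_module R (A x)) \<and>
     (\<forall>x. \<exists>U. open U \<and> x \<in> U \<and> finite (U \<inter> geo_support A))"

definition map_support ::
    "'a geo_module \<Rightarrow> 'a geo_module \<Rightarrow> 'a geo_map \<Rightarrow> (real \<times> real) set" where
  "map_support A B \<phi> = {(x, y). \<phi> x y \<noteq> zero_map (A x) (B y)}"

text \<open>\<open>\<phi> x y\<close> is the component from \<open>A x\<close> to \<open>B y\<close>.\<close>

definition geometric_hom ::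
    "('a, 'k) ring_scheme \<Rightarrow> 'a geo_module \<Rightarrow> 'a geo_module \<Rightarrow> 'a geo_map set" where
  "geometric_hom R A B = {\<phi>. (\<forall>x y. \<phi> x y \<in> lmod_hom R (A x) (B y)) \<and>
     (\<forall>y. finite {x. (x, y) \<in> map_support A B \<phi>}) \<and>
     (\<forall>x. finite {y. (x, y) \<in> map_support A B \<phi>})}"

definition geo_id :: "'a geo_module \<Rightarrow> 'a geo_map" where
  "geo_id A = (\<lambda>x y. if x = y then (\<lambda>v\<in>carrier (A x). v) else zero_map (A x) (A y))"

definition geo_comp ::
    "'a geo_module \<Rightarrow> 'a geo_module \<Rightarrow> 'a geo_module \<Rightarrow> 'a geo_map \<Rightarrow> 'a geo_map \<Rightarrow> 'a geo_map" where
  "geo_comp A B C \<psi> \<phi> = (\<lambda>x z. \<lambda>v\<in>carrier (A x).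
     \<Oplus>\<^bsub>C z\<^esub>y\<in>{y. (x, y) \<in> map_support A B \<phi>}. \<psi> y z (\<phi> x y v))"

definition geo_add ::
    "'a geo_module \<Rightarrow> 'a geo_module \<Rightarrow> 'a geo_map \<Rightarrow> 'a geo_map \<Rightarrow> 'a geo_map" where
  "geo_add A B \<phi> \<psi> = (\<lambda>x y. \<lambda>v\<in>carrier (A x). \<phi> x y v \<oplus>\<^bsub>B y\<^esub> \<psi> x y v)"

definition invariant_geo_module :: "'a geo_module \<Rightarrow> bool" where
  "invariant_geo_module A \<longleftrightarrow> (\<forall>x. A (x + 1) = A x)"

definition invariant_geo_map :: "'a geo_map \<Rightarrow> bool" where
  "invariant_geo_map \<phi> \<longleftrightarrow> (\<forall>x y. \<phi> (x + 1) (y + 1) = \<phi> x y)"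

definition cocompact_support :: "'a geo_module \<Rightarrow> bool" where
  "cocompact_support A \<longleftrightarrow>
     (\<exists>K. compact K \<and> geo_support A \<subseteq> {x + of_int n | x n. x \<in> K})"

definition geo_cat ::
    "('a, 'k) ring_scheme \<Rightarrow> ('a geo_module, 'a geo_map) add_cat" (\<open>\<T>\<close>) where
  "\<T> R =
     \<lparr>cat_obj = {A. geometric_module R A \<and> invariant_geo_module A \<and> cocompact_support A},
      cat_hom = (\<lambda>A B. {\<phi> \<in> geometric_hom R A B. invariant_geo_map \<phi>}),
      cat_id = geo_id,
      cat_comp = geo_comp,
      cat_add = geo_add\<rparr>"


section \<open>Forgetting geometry\<close>

text \<open>
  Elements of the direct sum are functions \<open>v\<close> of finite support with \<open>v x \<in> A x\<close>. As \<open>t\<close> carries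
  the summand \<open>A x\<close> identically to \<open>A (x + 1) = A x\<close>, we have \<open>(t\<^sup>n v) x = v (x - n)\<close>.
\<close>

definition forget_obj ::
    "('a, 'k) ring_scheme \<Rightarrow> 'a geo_module \<Rightarrow> (int \<Rightarrow> 'a, real \<Rightarrow> nat \<Rightarrow> 'a) module" (\<open>\<U>\<^sub>o\<close>) where
  "\<U>\<^sub>o R A =
     \<lparr>carrier = {v. (\<forall>x. v x \<in> carrier (A x)) \<and> finite {x. v x \<noteq> \<zero>\<^bsub>A x\<^esub>}},
      monoid.mult = undefined,
      monoid.one = undefined,
      ring.zero = (\<lambda>x. \<zero>\<^bsub>A x\<^esub>),
      ring.add = (\<lambda>v w x. v x \<oplus>\<^bsub>A x\<^esub> w x),
      smult = (\<lambda>p v x. \<Oplus>\<^bsub>A x\<^esub>n\<in>{n. p n \<noteq> \<zero>\<^bsub>R\<^esub>}. p n \<odot>\<^bsub>A x\<^esub> v (x - of_int n))\<rparr>"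

definition forget_map ::
    "('a, 'k) ring_scheme \<Rightarrow> 'a geo_module \<Rightarrow> 'a geo_module \<Rightarrow> 'a geo_map \<Rightarrow>
     (real \<Rightarrow> nat \<Rightarrow> 'a) \<Rightarrow> (real \<Rightarrow> nat \<Rightarrow> 'a)" (\<open>\<U>\<^sub>h\<close>) where
  "\<U>\<^sub>h R A B \<phi> = (\<lambda>v\<in>carrier (\<U>\<^sub>o R A). \<lambda>y. \<Oplus>\<^bsub>B y\<^esub>x\<in>{x. v x \<noteq> \<zero>\<^bsub>A x\<^esub>}. \<phi> x y (v x))"

definition forget_K1 ::
    "('a, 'k) ring_scheme \<Rightarrow> (('a geo_module \<times> 'a geo_map) \<Rightarrow>\<^sub>0 int) set \<Rightarrow>
     (((int \<Rightarrow> 'a, real \<Rightarrow> nat \<Rightarrow> 'a) module \<times> ((real \<Rightarrow> nat \<Rightarrow> 'a) \<Rightarrow> (real \<Rightarrow> nat \<Rightarrow> 'a))) \<Rightarrow>\<^sub>0 int) set"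
    (\<open>\<U>\<close>) where
  "\<U> R = K1_map (laurent_free_cat R) (\<U>\<^sub>o R) (\<U>\<^sub>h R)"


section \<open>Controlled automorphisms\<close>

definition controlled :: "real \<Rightarrow> 'a geo_module \<Rightarrow> 'a geo_module \<Rightarrow> 'a geo_map \<Rightarrow> bool" where
  "controlled \<epsilon> A B \<phi> \<longleftrightarrow> (\<forall>(x, y)\<in>map_support A B \<phi>. \<bar>x - y\<bar> < \<epsilon>)"

definition eps_automorphism ::
    "('a, 'k) ring_scheme \<Rightarrow> real \<Rightarrow> 'a geo_module \<Rightarrow> 'a geo_map \<Rightarrow> bool" where
  "eps_automorphism R \<epsilon> A \<phi> \<longleftrightarrow> A \<in> cat_obj (\<T> R) \<and>
     (\<exists>\<psi>. cat_inverse_pair (\<T> R) A \<phi> \<psi> \<and> controlled \<epsilon> A A \<phi> \<and> controlled \<epsilon> A A \<psi>)"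

end

theory Submission
 imports Defs
begin

text \<open>
 Let \<open>T\<close> be the ring of endomorphisms of the free module of countable rank over \<open>R[t, t\<inverse>]\<close>. Every class in
 \<open>K\<^sub>1\<close> is the class of a unit of \<open>T\<close> that differs from the identity by a finitary map, and the units whose
 class is represented by an \<open>\<epsilon>\<close>-automorphism contain all commutators. As in the fundamental theorem of
 algebraic \<open>K\<close>-theory, Higman's trick reduces to linear units \<open>a + b t\<close>, and these are products of constant
 units, of units \<open>1 - p + p t\<close> with \<open>p\<close> idempotent, and of units \<open>1 + \<nu> s\<close> with \<open>\<nu>\<close> nilpotent and \<open>s\<close>
 central. Constant units are controlled at once, the idempotent units after spreading over small steps
 around the circle. For a nilpotent \<open>\<nu>\<close>, regularity resolves the graded pieces of the kernel filtration, which
 reduces \<open>1 + \<nu> s\<close> to strictly triangular matrices; these are products of commutators.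
\<close>

section \<open>Sums, left modules and linear maps over a noncommutative ring\<close>

section \<open>Finite sums and modules\<close>

text \<open>Three obstacles shape the proof. (1) Matrices of all sizes must be compared. In a ring
  of infinite matrices they live together, and doubling the size is an embedding of the ring into a
  corner of itself, so the algebra can be done in an abstract ring with a group \<open>H\<close> of
  good units. (2) Composing adds the lengths of maps. Therefore \<open>controllable\<close> is a
  condition on the class alone, and a product is realised by a block sum, which does not lengthen
  anything. Since \<open>K1\<close> is abelian, commutators and the passage from 1 + xy to 1 + yx
  then cost nothing. (3) Multiplication by t has length 1. The remedy is to expand around t = 1: a
  linear unit divided by its value there has the form 1 + a (t - 1), and invertibility forces a^n (1
  - a)^n = 0. The generalised eigenvalue 1 gives the idempotent, and the two nilpotents occur with s
  = t - 1 and s = 1 - 1/t. A nilpotent over a general ring need not be triangular in any useful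
  sense, because the graded pieces of its kernel filtration need not be projective; regularity is
  what repairs this.\<close>

context abelian_monoid
begin

lemma finsum_superset:
 assumes "finite B" "A \<subseteq> B" "!!i. i \<in> B ==> f i \<in> carrier G" "!!i. i \<in> B ==> i \<notin> A ==> f i = \<zero>"
 shows "finsum G f A = finsum G f B"
 by (rule add.finprod_mono_neutral_cong_left) (use assms in auto)

lemma finsum_eq_term:
 assumes "finite A" "i \<in> A" "!!j. j \<in> A ==> f j \<in> carrier G"
  "!!j. j \<in> A ==> j ~= i ==> f j = \<zero>"
 shows "finsum G f A = f i"
proof -
 have "finsum G f {i} = finsum G f A"
  by (rule finsum_superset) (use assms in auto)
 moreover have "finsum G f {i} = f i"
  using assms by (subst finsum_insert) auto
 ultimately show ?thesis by simp
qed

lemma finsum_swap: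
 assumes "finite A" "finite B" "!!a b. a \<in> A ==> b \<in> B ==> f a b \<in> carrier G"
 shows "(\<Oplus>a\<in>A. \<Oplus>b\<in>B. f a b) = (\<Oplus>b\<in>B. \<Oplus>a\<in>A. f a b)"
 using assms
proof (induction A rule: finite_induct)
 case empty
 then show ?case by (simp add: finsum_zero)
next
 case (insert a A)
 have "(\<Oplus>b\<in>B. \<Oplus>a\<in>insert a A. f a b) = (\<Oplus>b\<in>B. f a b \<oplus> (\<Oplus>a\<in>A. f a b))"
  by (rule finsum_cong') (use insert in "auto intro!: finsum_insert a_closed finsum_closed")
 also have "... = (\<Oplus>b\<in>B. f a b) \<oplus> (\<Oplus>b\<in>B. \<Oplus>a\<in>A. f a b)"
  by (rule finsum_addf) (use insert in "auto intro!: finsum_closed")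
 also have "(\<Oplus>b\<in>B. \<Oplus>a\<in>A. f a b) = (\<Oplus>a\<in>A. \<Oplus>b\<in>B. f a b)"
  using insert by auto
 also have "(\<Oplus>b\<in>B. f a b) \<oplus> ... = (\<Oplus>a\<in>insert a A. \<Oplus>b\<in>B. f a b)"
  by (subst finsum_insert) (use insert in "auto intro!: finsum_closed")
 finally show ?case by simp
qed

end

text \<open>Evaluations, coordinates and linear maps all pass through sums by this fact. An infinite
  index set is a case of its own because the sum is then zero by convention.\<close>

lemma finsum_additive:
 assumes "abelian_monoid G" "abelian_monoid K"
  and cl: "!!x. x \<in> carrier G ==> h x \<in> carrier K"
  and add: "!!x y. x \<in> carrier G ==> y \<in> carrier G ==> h (x \<oplus>\<^bsub>G\<^esub> y) = h x \<oplus>\<^bsub>K\<^esub> h y"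
  and zero: "h \<zero>\<^bsub>G\<^esub> = \<zero>\<^bsub>K\<^esub>"
  and f: "!!i. i \<in> A ==> f i \<in> carrier G"
 shows "h (finsum G f A) = finsum K (%i. h (f i)) A"
proof -
 interpret G: abelian_monoid G by fact
 interpret K: abelian_monoid K by fact
 show ?thesis
 proof (cases "finite A")
  case True
  then show ?thesis using f
  proof (induction A rule: finite_induct)
   case empty
   then show ?case by (simp add: zero)
  next
   case (insert a A)
   then show ?case
    by (subst G.finsum_insert, simp, simp, auto, subst K.finsum_insert)
     (auto intro!: cl simp: add Pi_def)
  qed
 qed (simp add: zero G.finsum_infinite K.finsum_infinite)
qed

context left_module
begin

lemma is_left_module: "left_module R M" ..

lemma smult_l_null [simp]:
 assumes x: "x \<in> carrier M" shows "\<zero> \<odot>\<^bsub>M\<^esub> x = \<zero>\<^bsub>M\<^esub>"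
proof -
 have "\<zero> \<odot>\<^bsub>M\<^esub> x \<oplus>\<^bsub>M\<^esub> \<zero> \<odot>\<^bsub>M\<^esub> x = \<zero> \<odot>\<^bsub>M\<^esub> x"
  using smult_l_distr[of \<zero> \<zero> x] x by simp
 then show ?thesis
  using M.add.r_cancel_one' smult_closed[OF R.zero_closed x] by (metis M.add.l_cancel_one')
qed

lemma smult_r_null [simp]:
 assumes a: "a \<in> carrier R" shows "a \<odot>\<^bsub>M\<^esub> \<zero>\<^bsub>M\<^esub> = \<zero>\<^bsub>M\<^esub>"
proof -
 have "a \<odot>\<^bsub>M\<^esub> \<zero>\<^bsub>M\<^esub> \<oplus>\<^bsub>M\<^esub> a \<odot>\<^bsub>M\<^esub> \<zero>\<^bsub>M\<^esub> = a \<odot>\<^bsub>M\<^esub> \<zero>\<^bsub>M\<^esub>"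
  using smult_r_distr[of a "\<zero>\<^bsub>M\<^esub>" "\<zero>\<^bsub>M\<^esub>"] a by simp
 then show ?thesis
  using smult_closed[OF a M.zero_closed] by (metis M.add.l_cancel_one')
qed

lemma smult_r_minus:
 assumes a: "a \<in> carrier R" and x: "x \<in> carrier M"
 shows "a \<odot>\<^bsub>M\<^esub> (\<ominus>\<^bsub>M\<^esub> x) = \<ominus>\<^bsub>M\<^esub> (a \<odot>\<^bsub>M\<^esub> x)"
proof -
 have "a \<odot>\<^bsub>M\<^esub> (\<ominus>\<^bsub>M\<^esub> x) \<oplus>\<^bsub>M\<^esub> a \<odot>\<^bsub>M\<^esub> x = \<zero>\<^bsub>M\<^esub>"
  using a x smult_r_distr[of a "\<ominus>\<^bsub>M\<^esub> x" x] by (simp add: M.l_neg)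
 then show ?thesis
  using M.minus_equality a x smult_closed by (metis M.add.inv_closed)
qed

lemma smult_l_minus:
 assumes a: "a \<in> carrier R" and x: "x \<in> carrier M"
 shows "(\<ominus> a) \<odot>\<^bsub>M\<^esub> x = \<ominus>\<^bsub>M\<^esub> (a \<odot>\<^bsub>M\<^esub> x)"
proof -
 have "(\<ominus> a) \<odot>\<^bsub>M\<^esub> x \<oplus>\<^bsub>M\<^esub> a \<odot>\<^bsub>M\<^esub> x = \<zero>\<^bsub>M\<^esub>"
  using a x smult_l_distr[of "\<ominus> a" a x] by (simp add: R.l_neg)
 then show ?thesis
  using M.minus_equality a x smult_closed by (metis R.add.inv_closed)
qed

lemma smult_finsum_right:
 assumes "a \<in> carrier R" "!!i. i \<in> A ==> f i \<in> carrier M"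
 shows "a \<odot>\<^bsub>M\<^esub> (\<Oplus>\<^bsub>M\<^esub>i\<in>A. f i) = (\<Oplus>\<^bsub>M\<^esub>i\<in>A. a \<odot>\<^bsub>M\<^esub> f i)"
 by (rule finsum_additive) (use assms M.abelian_monoid_axioms in "auto simp: smult_r_distr smult_closed")

lemma smult_finsum_left:
 assumes "x \<in> carrier M" "!!i. i \<in> A ==> f i \<in> carrier R"
 shows "(\<Oplus>i\<in>A. f i) \<odot>\<^bsub>M\<^esub> x = (\<Oplus>\<^bsub>M\<^esub>i\<in>A. f i \<odot>\<^bsub>M\<^esub> x)"
 by (rule finsum_additive) (use assms M.abelian_monoid_axioms R.abelian_monoid_axioms in "auto simp: smult_l_distr smult_closed")

end

lemma left_moduleI:
 fixes R (structure) and M (structure)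
 assumes "ring R" "abelian_group M"
  "!!a x. [|a \<in> carrier R; x \<in> carrier M|] ==> a \<odot>\<^bsub>M\<^esub> x \<in> carrier M"
  "!!a b x. [|a \<in> carrier R; b \<in> carrier R; x \<in> carrier M|] ==>
    (a \<oplus>\<^bsub>R\<^esub> b) \<odot>\<^bsub>M\<^esub> x = a \<odot>\<^bsub>M\<^esub> x \<oplus>\<^bsub>M\<^esub> b \<odot>\<^bsub>M\<^esub> x"
  "!!a x y. [|a \<in> carrier R; x \<in> carrier M; y \<in> carrier M|] ==>
    a \<odot>\<^bsub>M\<^esub> (x \<oplus>\<^bsub>M\<^esub> y) = a \<odot>\<^bsub>M\<^esub> x \<oplus>\<^bsub>M\<^esub> a \<odot>\<^bsub>M\<^esub> y"
  "!!a b x. [|a \<in> carrier R; b \<in> carrier R; x \<in> carrier M|] ==>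
    (a \<otimes>\<^bsub>R\<^esub> b) \<odot>\<^bsub>M\<^esub> x = a \<odot>\<^bsub>M\<^esub> (b \<odot>\<^bsub>M\<^esub> x)"
  "!!x. x \<in> carrier M ==> \<one>\<^bsub>R\<^esub> \<odot>\<^bsub>M\<^esub> x = x"
 shows "left_module R M"
 using assms by (simp add: left_module_def left_module_axioms_def)

lemma (in ring) left_module_regular: "left_module R (regular_module R)"
proof (rule left_moduleI)
 have "abelian_group (regular_module R)"
  by (rule abelian_groupI) (auto simp: regular_module_def a_ac intro: add.l_inv_ex)
 then show "abelian_group (regular_module R)" .
qed (auto simp: regular_module_def ring_simprules ring_axioms)

lemma (in left_module) finsum_lin_comb:
 assumes "!!i. i \<in> A ==> f i \<in> carrier R" "!!i. i \<in> A ==> b i \<in> carrier M"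
 shows "(\<Oplus>\<^bsub>M\<^esub>i\<in>A. f i \<odot>\<^bsub>M\<^esub> b i) \<in> carrier M"
 by (rule M.finsum_closed) (use assms in "auto intro: smult_closed")

subsection \<open>Module maps and submodules\<close>

lemma lmod_homI:
 assumes "!!x. x \<in> carrier M ==> f x \<in> carrier N" "!!x. x \<notin> carrier M ==> f x = undefined"
  "!!x y. x \<in> carrier M ==> y \<in> carrier M ==> f (x \<oplus>\<^bsub>M\<^esub> y) = f x \<oplus>\<^bsub>N\<^esub> f y"
  "!!a x. a \<in> carrier R ==> x \<in> carrier M ==> f (a \<odot>\<^bsub>M\<^esub> x) = a \<odot>\<^bsub>N\<^esub> f x"
 shows "f \<in> lmod_hom R M N"
 using assms by (auto simp: lmod_hom_def)

lemma lmod_hom_closed: "f \<in> lmod_hom R M N ==> x \<in> carrier M ==> f x \<in> carrier N"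
 and lmod_hom_add: "f \<in> lmod_hom R M N ==> x \<in> carrier M ==> y \<in> carrier M ==>
   f (x \<oplus>\<^bsub>M\<^esub> y) = f x \<oplus>\<^bsub>N\<^esub> f y"
 and lmod_hom_smult: "f \<in> lmod_hom R M N ==> a \<in> carrier R ==> x \<in> carrier M ==>
   f (a \<odot>\<^bsub>M\<^esub> x) = a \<odot>\<^bsub>N\<^esub> f x"
 and lmod_hom_undefined: "f \<in> lmod_hom R M N ==> x \<notin> carrier M ==> f x = undefined"
 by (auto simp: lmod_hom_def)

lemma lmod_hom_eqI:
 assumes "f \<in> lmod_hom R M N" "g \<in> lmod_hom R M N'" "!!x. x \<in> carrier M ==> f x = g x"
 shows "f = g"
 using assms by (metis ext lmod_hom_undefined)

lemma lmod_hom_zero: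
 assumes "left_module R M" "left_module R N" "f \<in> lmod_hom R M N"
 shows "f \<zero>\<^bsub>M\<^esub> = \<zero>\<^bsub>N\<^esub>"
proof -
 interpret M: left_module R M by fact
 interpret N: left_module R N by fact
 have "f \<zero>\<^bsub>M\<^esub> = f (\<zero>\<^bsub>R\<^esub> \<odot>\<^bsub>M\<^esub> \<zero>\<^bsub>M\<^esub>)" by simp
 also have "... = \<zero>\<^bsub>N\<^esub>"
  by (subst lmod_hom_smult[OF assms(3)]) (auto simp: lmod_hom_closed[OF assms(3)])
 finally show ?thesis .
qed

lemma lmod_hom_uminus:
 assumes "left_module R M" "left_module R N" "f \<in> lmod_hom R M N" "x \<in> carrier M"
 shows "f (\<ominus>\<^bsub>M\<^esub> x) = \<ominus>\<^bsub>N\<^esub> f x"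
proof -
 interpret M: left_module R M by fact
 interpret N: left_module R N by fact
 have "f (\<ominus>\<^bsub>M\<^esub> x) \<oplus>\<^bsub>N\<^esub> f x = f (\<ominus>\<^bsub>M\<^esub> x \<oplus>\<^bsub>M\<^esub> x)"
  using assms by (subst lmod_hom_add[OF assms(3)]) auto
 also have "... = \<zero>\<^bsub>N\<^esub>"
  using assms by (simp add: M.M.l_neg lmod_hom_zero[OF assms(1-3)])
 finally show ?thesis
  using assms N.M.minus_equality lmod_hom_closed[OF assms(3)] by (metis M.M.add.inv_closed)
qed

lemma lmod_hom_finsum:
 assumes "left_module R M" "left_module R N" "f \<in> lmod_hom R M N" "!!i. i \<in> A ==> g i \<in> carrier M"
 shows "f (\<Oplus>\<^bsub>M\<^esub>i\<in>A. g i) = (\<Oplus>\<^bsub>N\<^esub>i\<in>A. f (g i))"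
proof -
 interpret M: left_module R M by fact
 interpret N: left_module R N by fact
 show ?thesis
  by (rule finsum_additive)
   (use assms M.M.abelian_monoid_axioms N.M.abelian_monoid_axioms in
    \<open>auto simp: lmod_hom_add lmod_hom_closed lmod_hom_zero\<close>)
qed

lemma lmod_hom_compose:
 assumes "left_module R L" "f \<in> lmod_hom R L M" "g \<in> lmod_hom R M N"
 shows "compose (carrier L) g f \<in> lmod_hom R L N"
proof -
 interpret L: left_module R L by fact
 show ?thesis
  by (rule lmod_homI) (use assms in \<open>auto simp: compose_def lmod_hom_closed lmod_hom_add
    lmod_hom_smult L.smult_closed\<close>)
qed

lemma lmod_hom_id:
 assumes "left_module R M" shows "(\<lambda>x\<in>carrier M. x) \<in> lmod_hom R M M"
proof -
 interpret M: left_module R M by fact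
 show ?thesis by (auto simp: lmod_hom_def M.smult_closed)
qed

lemma lmod_hom_zero_map:
 assumes "left_module R M" "left_module R N"
 shows "(\<lambda>x\<in>carrier M. \<zero>\<^bsub>N\<^esub>) \<in> lmod_hom R M N"
proof -
 interpret M: left_module R M by fact
 interpret N: left_module R N by fact
 show ?thesis by (auto simp: lmod_hom_def M.smult_closed)
qed

lemma lmod_hom_sum:
 assumes "left_module R M" "left_module R N" "f \<in> lmod_hom R M N" "g \<in> lmod_hom R M N"
 shows "(\<lambda>x\<in>carrier M. f x \<oplus>\<^bsub>N\<^esub> g x) \<in> lmod_hom R M N"
proof -
 interpret M: left_module R M by fact
 interpret N: left_module R N by fact
 show ?thesis
  by (rule lmod_homI) (use assms in \<open>auto simp: lmod_hom_closed lmod_hom_add lmod_hom_smult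
    M.smult_closed N.smult_r_distr N.M.a_ac\<close>)
qed

lemma lmod_hom_minus_map:
 assumes "left_module R M" "left_module R N" "f \<in> lmod_hom R M N"
 shows "(\<lambda>x\<in>carrier M. \<ominus>\<^bsub>N\<^esub> f x) \<in> lmod_hom R M N"
proof -
 interpret M: left_module R M by fact
 interpret N: left_module R N by fact
 show ?thesis
  by (rule lmod_homI) (use assms in \<open>auto simp: lmod_hom_closed lmod_hom_add lmod_hom_smult
    M.smult_closed N.smult_r_minus N.M.minus_add N.M.a_ac\<close>)
qed

text \<open>A submodule is a set \<open>W\<close>; the module it stands for is
  \<open>M\<lparr>carrier := W\<rparr>\<close>, so that the operations are shared and sums formed in
  either module agree.\<close>

definition submod :: "('a, 'k) ring_scheme => ('a, 'm) module => 'm set => bool" where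
 "submod R M W \<longleftrightarrow> W \<subseteq> carrier M & \<zero>\<^bsub>M\<^esub> \<in> W & (\<forall>x\<in>W. \<forall>y\<in>W. x \<oplus>\<^bsub>M\<^esub> y \<in> W) \<and>
   (\<forall>a\<in>carrier R. \<forall>x\<in>W. a \<odot>\<^bsub>M\<^esub> x \<in> W)"

lemma submodI:
 assumes "W \<subseteq> carrier M" "\<zero>\<^bsub>M\<^esub> \<in> W" "!!x y. x \<in> W ==> y \<in> W ==> x \<oplus>\<^bsub>M\<^esub> y \<in> W"
  "!!a x. a \<in> carrier R ==> x \<in> W ==> a \<odot>\<^bsub>M\<^esub> x \<in> W"
 shows "submod R M W"
 using assms by (auto simp: submod_def)

lemma submod_subset: "submod R M W ==> W \<subseteq> carrier M"
 and submod_zero: "submod R M W ==> \<zero>\<^bsub>M\<^esub> \<in> W"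
 and submod_add: "submod R M W ==> x \<in> W ==> y \<in> W ==> x \<oplus>\<^bsub>M\<^esub> y \<in> W"
 and submod_smult: "submod R M W ==> a \<in> carrier R ==> x \<in> W ==> a \<odot>\<^bsub>M\<^esub> x \<in> W"
 by (auto simp: submod_def)

text \<open>The scalar minus one supplies the inverse.\<close>

lemma submod_uminus:
 assumes "left_module R M" "submod R M W" "x \<in> W" shows "\<ominus>\<^bsub>M\<^esub> x \<in> W"
proof -
 interpret left_module R M by fact
 have x: "x \<in> carrier M" using assms submod_subset by blast
 have "(\<ominus>\<^bsub>R\<^esub> \<one>\<^bsub>R\<^esub>) \<odot>\<^bsub>M\<^esub> x \<in> W" by (rule submod_smult[OF assms(2) _ assms(3)]) simp
 then show ?thesis using x by (simp add: smult_l_minus smult_one)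
qed

lemma left_module_submod:
 assumes "left_module R M" "submod R M W"
 shows "left_module R (M\<lparr>carrier := W\<rparr>)"
proof -
 interpret left_module R M by fact
 note sub = submod_subset[OF assms(2), THEN subsetD]
 have "abelian_group (M\<lparr>carrier := W\<rparr>)"
 proof (rule abelian_groupI)
  fix x assume "x \<in> carrier (M\<lparr>carrier := W\<rparr>)"
  then have "\<ominus>\<^bsub>M\<^esub> x \<in> W" "\<ominus>\<^bsub>M\<^esub> x \<oplus>\<^bsub>M\<^esub> x = \<zero>\<^bsub>M\<^esub>"
   using submod_uminus[OF assms] sub by (auto simp: M.l_neg)
  then show "\<exists>y\<in>carrier (M\<lparr>carrier := W\<rparr>). y \<oplus>\<^bsub>M\<lparr>carrier := W\<rparr>\<^esub> x = \<zero>\<^bsub>M\<lparr>carrier := W\<rparr>\<^esub>"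
   by auto
 qed (use assms(2) in "auto simp: submod_add submod_zero sub M.a_ac")
 then show ?thesis
  by (intro left_moduleI)
   (use assms(2) in "auto simp: submod_smult sub smult_l_distr smult_r_distr smult_assoc smult_one R.ring_axioms")
qed

lemma finsum_submod:
 assumes "left_module R M" "submod R M W" "!!i. i \<in> A ==> f i \<in> W"
 shows "finsum (M\<lparr>carrier := W\<rparr>) f A = finsum M f A" "finsum M f A \<in> W"
proof -
 interpret left_module R M by fact
 interpret W: left_module R "M\<lparr>carrier := W\<rparr>" by (rule left_module_submod) fact+
 have "(%x. x) (finsum (M\<lparr>carrier := W\<rparr>) f A) = finsum M (%i. f i) A"
  by (rule finsum_additive)
   (use assms submod_subset[OF assms(2)] M.abelian_monoid_axioms W.M.abelian_monoid_axioms in auto)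
 then show "finsum (M\<lparr>carrier := W\<rparr>) f A = finsum M f A" by simp
 moreover have "finsum (M\<lparr>carrier := W\<rparr>) f A \<in> W"
  using W.M.finsum_closed[of f A] assms by auto
 ultimately show "finsum M f A \<in> W" by simp
qed

lemma submod_kernel:
 assumes "left_module R M" "left_module R N" "f \<in> lmod_hom R M N"
 shows "submod R M {x \<in> carrier M. f x = \<zero>\<^bsub>N\<^esub>}"
proof -
 interpret M: left_module R M by fact
 interpret N: left_module R N by fact
 show ?thesis
  by (rule submodI) (use assms in "auto simp: lmod_hom_add lmod_hom_smult lmod_hom_zero M.smult_closed")
qed

lemma submod_image:
 assumes "left_module R M" "left_module R N" "f \<in> lmod_hom R M N" "submod R M W"
 shows "submod R N (f ` W)"
proof -
 interpret M: left_module R M by fact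
 interpret N: left_module R N by fact
 note sub = submod_subset[OF assms(4), THEN subsetD]
 show ?thesis
 proof (rule submodI)
  show "f ` W \<subseteq> carrier N" using lmod_hom_closed[OF assms(3)] sub by auto
  show "\<zero>\<^bsub>N\<^esub> \<in> f ` W"
   using lmod_hom_zero[OF assms(1-3)] submod_zero[OF assms(4)] by (metis imageI)
 next
  fix x y assume "x \<in> f ` W" "y \<in> f ` W"
  then obtain u v where "x = f u" "y = f v" "u \<in> W" "v \<in> W" by auto
  then show "x \<oplus>\<^bsub>N\<^esub> y \<in> f ` W"
   using lmod_hom_add[OF assms(3)] sub submod_add[OF assms(4)] by (metis imageI)
 next
  fix a x assume "a \<in> carrier R" "x \<in> f ` W"
  then obtain u where "x = f u" "u \<in> W" by auto
  then show "a \<odot>\<^bsub>N\<^esub> x \<in> f ` W"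
   using lmod_hom_smult[OF assms(3)] sub submod_smult[OF assms(4)] \<open>a \<in> carrier R\<close> by (metis imageI)
 qed
qed

section \<open>Laurent polynomials as convolution operators\<close>

section \<open>The Laurent polynomial ring\<close>

definition supp :: "('a, 'k) ring_scheme => (int => 'a) => int set" where
 "supp R p = {n. p n ~= \<zero>\<^bsub>R\<^esub>}"

text \<open>With \<open>w k = q (n - k)\<close> this is the degree \<open>n\<close> coefficient of a
  product of Laurent polynomials; with \<open>w k = v (x - k)\<close> it is the action on the module
  underlying a geometric module. Ring axioms and module axioms thus follow from the same few
  lemmas.\<close>

definition conv :: "('a, 'k) ring_scheme => ('a, 'm) module => (int => 'a) => (int => 'm) => 'm" where
 "conv R M p w = (\<Oplus>\<^bsub>M\<^esub>n\<in>supp R p. p n \<odot>\<^bsub>M\<^esub> w n)"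

lemma carrier_laurent_iff:
 "p \<in> carrier (laurent_ring R) \<longleftrightarrow> (\<forall>n. p n \<in> carrier R) & finite (supp R p)"
 by (simp add: laurent_ring_def supp_def)

context left_module
begin

lemma conv_eq:
 assumes "p \<in> carrier (laurent_ring R)" "finite A" "supp R p \<subseteq> A" "!!n. w n \<in> carrier M"
 shows "conv R M p w = (\<Oplus>\<^bsub>M\<^esub>n\<in>A. p n \<odot>\<^bsub>M\<^esub> w n)"
 unfolding conv_def
 by (rule M.finsum_superset) (use assms in "auto simp: carrier_laurent_iff supp_def smult_closed")

lemma conv_closed:
 assumes "p \<in> carrier (laurent_ring R)" "!!n. w n \<in> carrier M"
 shows "conv R M p w \<in> carrier M"
 unfolding conv_def by (rule finsum_lin_comb) (use assms in "auto simp: carrier_laurent_iff")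

lemma conv_add_left:
 assumes p: "p \<in> carrier (laurent_ring R)" and q: "q \<in> carrier (laurent_ring R)"
  and w: "!!n. w n \<in> carrier M"
 shows "conv R M (%n. p n \<oplus> q n) w = conv R M p w \<oplus>\<^bsub>M\<^esub> conv R M q w"
proof -
 let ?A = "supp R p \<union> supp R q"
 have fin: "finite ?A" using p q by (auto simp: carrier_laurent_iff)
 have sub: "supp R (%n. p n \<oplus> q n) \<subseteq> ?A" by (auto simp: supp_def)
 have "(%n. p n \<oplus> q n) \<in> carrier (laurent_ring R)"
  using p q finite_subset[OF sub fin] by (auto simp: carrier_laurent_iff)
 then have "conv R M (%n. p n \<oplus> q n) w = (\<Oplus>\<^bsub>M\<^esub>n\<in>?A. (p n \<oplus> q n) \<odot>\<^bsub>M\<^esub> w n)"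
  by (rule conv_eq) (use fin sub w in auto)
 also have "... = (\<Oplus>\<^bsub>M\<^esub>n\<in>?A. p n \<odot>\<^bsub>M\<^esub> w n \<oplus>\<^bsub>M\<^esub> q n \<odot>\<^bsub>M\<^esub> w n)"
  by (rule M.finsum_cong') (use p q w in "auto simp: carrier_laurent_iff smult_l_distr smult_closed")
 also have "... = (\<Oplus>\<^bsub>M\<^esub>n\<in>?A. p n \<odot>\<^bsub>M\<^esub> w n) \<oplus>\<^bsub>M\<^esub> (\<Oplus>\<^bsub>M\<^esub>n\<in>?A. q n \<odot>\<^bsub>M\<^esub> w n)"
  by (rule M.finsum_addf) (use p q w in "auto simp: carrier_laurent_iff smult_closed")
 also have "... = conv R M p w \<oplus>\<^bsub>M\<^esub> conv R M q w"
  using conv_eq[OF p fin _ w] conv_eq[OF q fin _ w] by auto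
 finally show ?thesis .
qed

lemma conv_add_right:
 assumes p: "p \<in> carrier (laurent_ring R)" and w: "!!n. w n \<in> carrier M" "!!n. w' n \<in> carrier M"
 shows "conv R M p (%n. w n \<oplus>\<^bsub>M\<^esub> w' n) = conv R M p w \<oplus>\<^bsub>M\<^esub> conv R M p w'"
proof -
 have "conv R M p (%n. w n \<oplus>\<^bsub>M\<^esub> w' n) =
   (\<Oplus>\<^bsub>M\<^esub>n\<in>supp R p. p n \<odot>\<^bsub>M\<^esub> w n \<oplus>\<^bsub>M\<^esub> p n \<odot>\<^bsub>M\<^esub> w' n)"
  unfolding conv_def
  by (rule M.finsum_cong') (use p w in "auto simp: carrier_laurent_iff smult_r_distr smult_closed")
 also have "... = conv R M p w \<oplus>\<^bsub>M\<^esub> conv R M p w'"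
  unfolding conv_def
  by (rule M.finsum_addf) (use p w in "auto simp: carrier_laurent_iff smult_closed")
 finally show ?thesis .
qed

lemma laurent_mult: "p \<otimes>\<^bsub>laurent_ring R\<^esub> q = (%n. conv R (regular_module R) p (%k. q (n - k)))"
 by (simp add: laurent_ring_def conv_def supp_def regular_module_def finsum_def fun_eq_iff finprod_def)

lemma laurent_mult_eq:
 assumes "p \<in> carrier (laurent_ring R)" "q \<in> carrier (laurent_ring R)" "finite A" "supp R p \<subseteq> A"
 shows "(p \<otimes>\<^bsub>laurent_ring R\<^esub> q) n = (\<Oplus>k\<in>A. p k \<otimes> q (n - k))"
proof -
 have "(p \<otimes>\<^bsub>laurent_ring R\<^esub> q) n = (\<Oplus>k\<in>supp R p. p k \<otimes> q (n - k))"
  by (simp add: laurent_ring_def supp_def)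
 also have "... = (\<Oplus>k\<in>A. p k \<otimes> q (n - k))"
  by (rule R.finsum_superset) (use assms in "auto simp: carrier_laurent_iff supp_def")
 finally show ?thesis .
qed

lemma laurent_mult_supp:
 assumes "p \<in> carrier (laurent_ring R)" "q \<in> carrier (laurent_ring R)"
 shows "supp R (p \<otimes>\<^bsub>laurent_ring R\<^esub> q) \<subseteq> (%(a, b). a + b) ` (supp R p \<times> supp R q)"
proof
 fix n assume n: "n \<in> supp R (p \<otimes>\<^bsub>laurent_ring R\<^esub> q)"
 have fin: "finite (supp R p)" using assms by (simp add: carrier_laurent_iff)
 have "\<exists>k\<in>supp R p. q (n - k) ~= \<zero>"
 proof (rule ccontr)
  assume "\<not> ?thesis"
  then have "(\<Oplus>k\<in>supp R p. p k \<otimes> q (n - k)) = (\<Oplus>k\<in>supp R p. \<zero>)"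
   by (intro R.finsum_cong') (use assms in "auto simp: carrier_laurent_iff")
  then show False
   using n laurent_mult_eq[OF assms fin subset_refl, of n] by (simp add: supp_def R.finsum_zero)
 qed
 then obtain k where "k \<in> supp R p" "n - k \<in> supp R q" by (auto simp: supp_def)
 then show "n \<in> (%(a, b). a + b) ` (supp R p \<times> supp R q)"
  by (intro image_eqI[where x = "(k, n - k)"]) auto
qed

lemma laurent_mult_closed:
 assumes "p \<in> carrier (laurent_ring R)" "q \<in> carrier (laurent_ring R)"
 shows "p \<otimes>\<^bsub>laurent_ring R\<^esub> q \<in> carrier (laurent_ring R)"
proof -
 have fin: "finite (supp R p)" using assms by (simp add: carrier_laurent_iff)
 have "(p \<otimes>\<^bsub>laurent_ring R\<^esub> q) n \<in> carrier R" for n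
  unfolding laurent_mult_eq[OF assms fin subset_refl]
  by (rule R.finsum_closed) (use assms in "auto simp: carrier_laurent_iff")
 moreover have "finite (supp R (p \<otimes>\<^bsub>laurent_ring R\<^esub> q))"
  by (rule finite_subset[OF laurent_mult_supp[OF assms]]) (use assms in "auto simp: carrier_laurent_iff")
 ultimately show ?thesis by (simp add: carrier_laurent_iff)
qed

text \<open>Associativity of the Laurent product and the law (pq) v = p (q v) are both instances.
  The double sum is regrouped by the total degree n = k + m; for fixed \<open>k\<close> only those
  \<open>n\<close> contribute for which \<open>n - k\<close> is in the support of
  \<open>q\<close>.\<close>

lemma conv_mult:
 assumes p: "p \<in> carrier (laurent_ring R)" and q: "q \<in> carrier (laurent_ring R)"
  and w: "!!n. w n \<in> carrier M"
 shows "conv R M (p \<otimes>\<^bsub>laurent_ring R\<^esub> q) w = conv R M p (%k. conv R M q (%m. w (k + m)))"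
proof -
 let ?A = "supp R p" and ?B = "supp R q"
 let ?C = "(%(a, b). a + b) ` (?A \<times> ?B)"
 have A: "finite ?A" and B: "finite ?B" using p q by (auto simp: carrier_laurent_iff)
 then have C: "finite ?C" by auto
 have pc: "p n \<in> carrier R" and qc: "q n \<in> carrier R" for n using p q by (auto simp: carrier_laurent_iff)
 have "conv R M (p \<otimes>\<^bsub>laurent_ring R\<^esub> q) w = (\<Oplus>\<^bsub>M\<^esub>n\<in>?C. (p \<otimes>\<^bsub>laurent_ring R\<^esub> q) n \<odot>\<^bsub>M\<^esub> w n)"
  by (rule conv_eq[OF laurent_mult_closed[OF p q] C laurent_mult_supp[OF p q] w])
 also have "... = (\<Oplus>\<^bsub>M\<^esub>n\<in>?C. \<Oplus>\<^bsub>M\<^esub>k\<in>?A. p k \<otimes> q (n - k) \<odot>\<^bsub>M\<^esub> w n)"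
 proof (rule M.finsum_cong')
  fix n
  show "(p \<otimes>\<^bsub>laurent_ring R\<^esub> q) n \<odot>\<^bsub>M\<^esub> w n = (\<Oplus>\<^bsub>M\<^esub>k\<in>?A. p k \<otimes> q (n - k) \<odot>\<^bsub>M\<^esub> w n)"
   unfolding laurent_mult_eq[OF p q A subset_refl]
   by (rule smult_finsum_left) (use w pc qc in auto)
 qed (use w pc qc in "auto intro!: M.finsum_closed smult_closed")
 also have "... = (\<Oplus>\<^bsub>M\<^esub>k\<in>?A. \<Oplus>\<^bsub>M\<^esub>n\<in>?C. p k \<otimes> q (n - k) \<odot>\<^bsub>M\<^esub> w n)"
  by (rule M.finsum_swap) (use A C w pc qc in "auto intro!: smult_closed")
 also have "... = (\<Oplus>\<^bsub>M\<^esub>k\<in>?A. p k \<odot>\<^bsub>M\<^esub> conv R M q (%m. w (k + m)))"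
 proof (rule M.finsum_cong')
  fix k assume k: "k \<in> ?A"
  have "(\<Oplus>\<^bsub>M\<^esub>n\<in>?C. p k \<otimes> q (n - k) \<odot>\<^bsub>M\<^esub> w n) =
    (\<Oplus>\<^bsub>M\<^esub>n\<in>(%m. k + m) ` ?B. p k \<otimes> q (n - k) \<odot>\<^bsub>M\<^esub> w n)"
  proof (rule M.finsum_superset[symmetric])
   show "(%m. k + m) ` ?B \<subseteq> ?C" using k by auto
   fix n assume n: "n \<notin> (%m. k + m) ` ?B"
   have "q (n - k) = \<zero>"
   proof (rule ccontr)
    assume "q (n - k) ~= \<zero>"
    then have "n - k \<in> ?B" by (simp add: supp_def)
    then have "n \<in> (%m. k + m) ` ?B" by (intro image_eqI[where x = "n - k"]) auto
    with n show False by simp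
   qed
   then show "p k \<otimes> q (n - k) \<odot>\<^bsub>M\<^esub> w n = \<zero>\<^bsub>M\<^esub>" using w pc by simp
  qed (use C w pc qc in "auto intro!: smult_closed")
  also have "... = (\<Oplus>\<^bsub>M\<^esub>m\<in>?B. p k \<otimes> q (k + m - k) \<odot>\<^bsub>M\<^esub> w (k + m))"
   by (rule M.finsum_reindex) (use w pc qc in "auto intro!: smult_closed inj_onI")
  also have "... = (\<Oplus>\<^bsub>M\<^esub>m\<in>?B. p k \<odot>\<^bsub>M\<^esub> (q m \<odot>\<^bsub>M\<^esub> w (k + m)))"
   by (rule M.finsum_cong') (use w pc qc in "auto intro!: smult_closed simp: smult_assoc")
  also have "... = p k \<odot>\<^bsub>M\<^esub> conv R M q (%m. w (k + m))"
   unfolding conv_def by (rule smult_finsum_right[symmetric]) (use w pc qc in "auto intro!: smult_closed")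
  finally show "(\<Oplus>\<^bsub>M\<^esub>n\<in>?C. p k \<otimes> q (n - k) \<odot>\<^bsub>M\<^esub> w n) = p k \<odot>\<^bsub>M\<^esub> conv R M q (%m. w (k + m))" .
 qed (use w pc q in "auto intro!: M.finsum_closed smult_closed conv_closed")
 also have "... = conv R M p (%k. conv R M q (%m. w (k + m)))"
  by (simp add: conv_def)
 finally show ?thesis .
qed

end

text \<open>The monomial a t^k. Laurent polynomials are finite sums of these, so linear maps are
  tested on them.\<close>

definition lmon :: "('a, 'k) ring_scheme => int => 'a => int => 'a" where
 "lmon R k a = (%n. if n = k then a else \<zero>\<^bsub>R\<^esub>)"

lemma (in ring) lmon_closed: "a \<in> carrier R ==> lmon R k a \<in> carrier (laurent_ring R)"
proof -
 assume "a \<in> carrier R"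
 moreover have "finite (supp R (lmon R k a))"
  by (rule finite_subset[of _ "{k}"]) (auto simp: supp_def lmon_def)
 ultimately show ?thesis by (auto simp: carrier_laurent_iff lmon_def)
qed

lemma (in left_module) conv_lmon:
 assumes "a \<in> carrier R" "!!n. w n \<in> carrier M"
 shows "conv R M (lmon R k a) w = a \<odot>\<^bsub>M\<^esub> w k"
proof -
 have "conv R M (lmon R k a) w = (\<Oplus>\<^bsub>M\<^esub>n\<in>{k}. lmon R k a n \<odot>\<^bsub>M\<^esub> w n)"
  by (rule conv_eq) (use assms in "auto simp: R.lmon_closed", auto simp: supp_def lmon_def split: if_splits)
 also have "... = lmon R k a k \<odot>\<^bsub>M\<^esub> w k"
  by (rule M.finsum_eq_term) (use assms in "auto simp: lmon_def smult_closed")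
 finally show ?thesis by (simp add: lmon_def)
qed

lemma laurent_one: "\<one>\<^bsub>laurent_ring R\<^esub> = lmon R 0 \<one>\<^bsub>R\<^esub>"
 by (auto simp: laurent_ring_def lmon_def)

lemma (in ring) ring_laurent: "ring (laurent_ring R)"
proof -
 interpret N: left_module R "regular_module R" by (rule left_module_regular)
 have car: "carrier (regular_module R) = carrier R" and
  ops: "add (regular_module R) = add R" "smult (regular_module R) = monoid.mult R" "\<zero>\<^bsub>regular_module R\<^esub> = \<zero>"
  by (auto simp: regular_module_def)
 have sub: "supp R (%n. p n \<oplus> q n) \<subseteq> supp R p \<union> supp R q" for p q by (auto simp: supp_def)
 have add: "p \<oplus>\<^bsub>laurent_ring R\<^esub> q = (%n. p n \<oplus> q n)" for p q by (simp add: laurent_ring_def)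
 have zero: "\<zero>\<^bsub>laurent_ring R\<^esub> = (%n. \<zero>)" by (simp add: laurent_ring_def)
 have addc: "(%n. p n \<oplus> q n) \<in> carrier (laurent_ring R)"
  if "p \<in> carrier (laurent_ring R)" "q \<in> carrier (laurent_ring R)" for p q
  using that finite_subset[OF sub[of p q]] by (auto simp: carrier_laurent_iff)
 have ab: "abelian_group (laurent_ring R)"
 proof (rule abelian_groupI)
  fix p assume p: "p \<in> carrier (laurent_ring R)"
  have "supp R (%n. \<ominus> p n) \<subseteq> supp R p" by (auto simp: supp_def)
  then have "(%n. \<ominus> p n) \<in> carrier (laurent_ring R)"
   using p finite_subset by (auto simp: carrier_laurent_iff)
  then show "\<exists>q\<in>carrier (laurent_ring R). q \<oplus>\<^bsub>laurent_ring R\<^esub> p = \<zero>\<^bsub>laurent_ring R\<^esub>"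
   using p by (intro bexI[of _ "%n. \<ominus> p n"]) (auto simp: add zero l_neg carrier_laurent_iff)
 next
  show "\<zero>\<^bsub>laurent_ring R\<^esub> \<in> carrier (laurent_ring R)"
   by (auto simp: zero carrier_laurent_iff supp_def)
 qed (auto simp: add addc zero, auto simp: carrier_laurent_iff a_ac)
 have coef: "p n \<in> carrier R" if "p \<in> carrier (laurent_ring R)" for p n
  using that by (simp add: carrier_laurent_iff)
 have mon: "monoid (laurent_ring R)"
 proof (rule monoidI)
  show "\<one>\<^bsub>laurent_ring R\<^esub> \<in> carrier (laurent_ring R)" by (simp add: laurent_one lmon_closed)
 next
  fix p q assume "p \<in> carrier (laurent_ring R)" "q \<in> carrier (laurent_ring R)"
  then show "p \<otimes>\<^bsub>laurent_ring R\<^esub> q \<in> carrier (laurent_ring R)" by (rule N.laurent_mult_closed)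
 next
  fix p q r assume p: "p \<in> carrier (laurent_ring R)" and q: "q \<in> carrier (laurent_ring R)"
   and r: "r \<in> carrier (laurent_ring R)"
  have "((p \<otimes>\<^bsub>laurent_ring R\<^esub> q) \<otimes>\<^bsub>laurent_ring R\<^esub> r) n = (p \<otimes>\<^bsub>laurent_ring R\<^esub> (q \<otimes>\<^bsub>laurent_ring R\<^esub> r)) n" for n
   using N.conv_mult[OF p q, of "%k. r (n - k)"] coef[OF r]
   by (simp add: N.laurent_mult car diff_diff_eq)
  then show "(p \<otimes>\<^bsub>laurent_ring R\<^esub> q) \<otimes>\<^bsub>laurent_ring R\<^esub> r = p \<otimes>\<^bsub>laurent_ring R\<^esub> (q \<otimes>\<^bsub>laurent_ring R\<^esub> r)"
   by blast
 next
  fix p assume p: "p \<in> carrier (laurent_ring R)"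
  show "\<one>\<^bsub>laurent_ring R\<^esub> \<otimes>\<^bsub>laurent_ring R\<^esub> p = p"
   using coef[OF p] by (simp add: laurent_one N.laurent_mult N.conv_lmon car ops)
  \<comment> \<open>The right unit law is a sum over the support of \<open>p\<close>, which may miss
    \<open>n\<close>. Enlarging the index set by \<open>n\<close> makes the one surviving term
    always present.\<close>
  have fin: "finite (insert n (supp R p))" for n using p by (simp add: carrier_laurent_iff)
  have "(p \<otimes>\<^bsub>laurent_ring R\<^esub> \<one>\<^bsub>laurent_ring R\<^esub>) n = p n" for n
  proof -
   have "(p \<otimes>\<^bsub>laurent_ring R\<^esub> \<one>\<^bsub>laurent_ring R\<^esub>) n =
     (\<Oplus>k\<in>insert n (supp R p). p k \<otimes> \<one>\<^bsub>laurent_ring R\<^esub> (n - k))"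
    by (rule N.laurent_mult_eq) (use p fin in "auto simp: laurent_one lmon_closed")
   also have "... = p n \<otimes> \<one>\<^bsub>laurent_ring R\<^esub> (n - n)"
    by (rule finsum_eq_term) (use fin coef[OF p] in "auto simp: laurent_one lmon_def")
   finally show ?thesis using coef[OF p] by (simp add: laurent_one lmon_def)
  qed
  then show "p \<otimes>\<^bsub>laurent_ring R\<^esub> \<one>\<^bsub>laurent_ring R\<^esub> = p" by blast
 qed
 show ?thesis
 proof (rule ringI[OF ab mon])
  fix p q r assume p: "p \<in> carrier (laurent_ring R)" and q: "q \<in> carrier (laurent_ring R)"
   and r: "r \<in> carrier (laurent_ring R)"
  show "(p \<oplus>\<^bsub>laurent_ring R\<^esub> q) \<otimes>\<^bsub>laurent_ring R\<^esub> r =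
    p \<otimes>\<^bsub>laurent_ring R\<^esub> r \<oplus>\<^bsub>laurent_ring R\<^esub> q \<otimes>\<^bsub>laurent_ring R\<^esub> r"
   using N.conv_add_left[OF p q] coef[OF r] by (simp add: add N.laurent_mult car ops)
  show "r \<otimes>\<^bsub>laurent_ring R\<^esub> (p \<oplus>\<^bsub>laurent_ring R\<^esub> q) =
    r \<otimes>\<^bsub>laurent_ring R\<^esub> p \<oplus>\<^bsub>laurent_ring R\<^esub> r \<otimes>\<^bsub>laurent_ring R\<^esub> q"
  proof
   fix n
   show "(r \<otimes>\<^bsub>laurent_ring R\<^esub> (p \<oplus>\<^bsub>laurent_ring R\<^esub> q)) n =
    (r \<otimes>\<^bsub>laurent_ring R\<^esub> p \<oplus>\<^bsub>laurent_ring R\<^esub> r \<otimes>\<^bsub>laurent_ring R\<^esub> q) n"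
    using N.conv_add_right[OF r, of "%k. p (n - k)" "%k. q (n - k)"] coef[OF p] coef[OF q]
    by (simp add: add N.laurent_mult car ops)
  qed
 qed
qed

section \<open>Indexed bases with coordinate functions\<close>

section \<open>Bases\<close>

text \<open>Indexing admits repetitions, which do occur over the zero ring, and explicit coordinates
  \<open>co\<close> replace the unique existence in \<open>fg_free_module\<close>.\<close>

definition free_basis ::
  "('a, 'k) ring_scheme => ('a, 'm) module => 'j set => ('j => 'm) => ('m => 'j => 'a) => bool" where
 "free_basis R M J b co \<longleftrightarrow> finite J & (\<forall>j\<in>J. b j \<in> carrier M) \<and>
   (\<forall>m\<in>carrier M. \<forall>j\<in>J. co m j \<in> carrier R) \<and>
   (\<forall>m\<in>carrier M. m = (\<Oplus>\<^bsub>M\<^esub>j\<in>J. co m j \<odot>\<^bsub>M\<^esub> b j)) \<and>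
   (\<forall>c. (\<forall>j\<in>J. c j \<in> carrier R) \<longrightarrow> (\<forall>j\<in>J. co (\<Oplus>\<^bsub>M\<^esub>j\<in>J. c j \<odot>\<^bsub>M\<^esub> b j) j = c j))"

lemma free_basisD:
 assumes "free_basis R M J b co"
 shows "finite J" "!!j. j \<in> J ==> b j \<in> carrier M"
  "!!m j. m \<in> carrier M ==> j \<in> J ==> co m j \<in> carrier R"
  "!!m. m \<in> carrier M ==> (\<Oplus>\<^bsub>M\<^esub>j\<in>J. co m j \<odot>\<^bsub>M\<^esub> b j) = m"
  "!!c j. (!!j. j \<in> J ==> c j \<in> carrier R) ==> j \<in> J ==> co (\<Oplus>\<^bsub>M\<^esub>j\<in>J. c j \<odot>\<^bsub>M\<^esub> b j) j = c j"
 using assms unfolding free_basis_def by metis+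

context left_module
begin

lemma free_basis_coord_add:
 assumes bas: "free_basis R M J b co" and x: "x \<in> carrier M" and y: "y \<in> carrier M" and j: "j \<in> J"
 shows "co (x \<oplus>\<^bsub>M\<^esub> y) j = co x j \<oplus> co y j"
proof -
 note b = free_basisD[OF bas]
 have "(\<Oplus>\<^bsub>M\<^esub>j\<in>J. (co x j \<oplus> co y j) \<odot>\<^bsub>M\<^esub> b j) =
   (\<Oplus>\<^bsub>M\<^esub>j\<in>J. co x j \<odot>\<^bsub>M\<^esub> b j \<oplus>\<^bsub>M\<^esub> co y j \<odot>\<^bsub>M\<^esub> b j)"
  by (rule M.finsum_cong') (use b x y in "auto simp: smult_l_distr smult_closed")
 also have "... = (\<Oplus>\<^bsub>M\<^esub>j\<in>J. co x j \<odot>\<^bsub>M\<^esub> b j) \<oplus>\<^bsub>M\<^esub> (\<Oplus>\<^bsub>M\<^esub>j\<in>J. co y j \<odot>\<^bsub>M\<^esub> b j)"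
  by (rule M.finsum_addf) (use b x y in "auto simp: smult_closed")
 also have "... = x \<oplus>\<^bsub>M\<^esub> y" by (simp add: b(4) x y)
 finally show ?thesis
  using b(5)[of "%j. co x j \<oplus> co y j" j] b(3) x y j by simp
qed

lemma free_basis_coord_smult:
 assumes bas: "free_basis R M J b co" and x: "x \<in> carrier M" and a: "a \<in> carrier R" and j: "j \<in> J"
 shows "co (a \<odot>\<^bsub>M\<^esub> x) j = a \<otimes> co x j"
proof -
 note b = free_basisD[OF bas]
 have "(\<Oplus>\<^bsub>M\<^esub>j\<in>J. (a \<otimes> co x j) \<odot>\<^bsub>M\<^esub> b j) = (\<Oplus>\<^bsub>M\<^esub>j\<in>J. a \<odot>\<^bsub>M\<^esub> (co x j \<odot>\<^bsub>M\<^esub> b j))"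
  by (rule M.finsum_cong') (use b x a in "auto simp: smult_assoc smult_closed")
 also have "... = a \<odot>\<^bsub>M\<^esub> (\<Oplus>\<^bsub>M\<^esub>j\<in>J. co x j \<odot>\<^bsub>M\<^esub> b j)"
  by (rule smult_finsum_right[symmetric]) (use b x a in "auto simp: smult_closed")
 also have "... = a \<odot>\<^bsub>M\<^esub> x" by (simp add: b(4) x)
 finally show ?thesis
  using b(5)[of "%j. a \<otimes> co x j" j] b(3) x a j by simp
qed

lemma free_basis_coord_zero:
 assumes bas: "free_basis R M J b co" and j: "j \<in> J"
 shows "co \<zero>\<^bsub>M\<^esub> j = \<zero>"
 using free_basis_coord_smult[OF bas M.zero_closed R.zero_closed j] free_basisD(3)[OF bas M.zero_closed j]
 by simp

text \<open>Enumerating the basis set by an initial segment of the naturals allows a module to be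
  identified later with the standard one of the same rank.\<close>

lemma fg_free_imp_basis:
 assumes "fg_free_module R M"
 obtains n b co where "free_basis R M {..<n::nat} b co"
proof -
 obtain B where B: "finite B" "B \<subseteq> carrier M"
  and ex: "!!m. m \<in> carrier M ==> \<exists>!c. c \<in> B \<rightarrow>\<^sub>E carrier R & m = (\<Oplus>\<^bsub>M\<^esub>b\<in>B. c b \<odot>\<^bsub>M\<^esub> b)"
  using assms unfolding fg_free_module_def by (elim conjE exE) (rule that, assumption, assumption, erule (1) bspec)
 obtain b where b: "bij_betw b {..<card B} B"
  using ex_bij_betw_nat_finite[OF B(1)] by (auto simp: atLeast0LessThan)
 define cf where "cf m = (THE c. c \<in> B \<rightarrow>\<^sub>E carrier R & m = (\<Oplus>\<^bsub>M\<^esub>b\<in>B. c b \<odot>\<^bsub>M\<^esub> b))" for m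
 have cf: "cf m \<in> B \<rightarrow>\<^sub>E carrier R" "m = (\<Oplus>\<^bsub>M\<^esub>b\<in>B. cf m b \<odot>\<^bsub>M\<^esub> b)" if "m \<in> carrier M" for m
  using theI'[OF ex[OF that]] unfolding cf_def by auto
 have cfu: "cf (\<Oplus>\<^bsub>M\<^esub>b\<in>B. c b \<odot>\<^bsub>M\<^esub> b) = c" if c: "c \<in> B \<rightarrow>\<^sub>E carrier R" for c
 proof -
  have "(\<Oplus>\<^bsub>M\<^esub>b\<in>B. c b \<odot>\<^bsub>M\<^esub> b) \<in> carrier M"
   by (rule finsum_lin_comb) (use c B in auto)
  from ex[OF this] cf[OF this] c show ?thesis by blast
 qed
 have bB: "b j \<in> B" if "j < card B" for j using b that by (auto simp: bij_betw_def)
 have bi: "inj_on b {..<card B}" and bim: "b ` {..<card B} = B" using b by (auto simp: bij_betw_def)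
 have tr: "(\<Oplus>\<^bsub>M\<^esub>j\<in>{..<card B}. c (b j) \<odot>\<^bsub>M\<^esub> b j) = (\<Oplus>\<^bsub>M\<^esub>x\<in>B. c x \<odot>\<^bsub>M\<^esub> x)"
  if "!!x. x \<in> B ==> c x \<in> carrier R" for c
  using M.finsum_reindex[OF _ bi, of "%x. c x \<odot>\<^bsub>M\<^esub> x"] that B unfolding bim
  by (auto simp: Pi_def smult_closed subset_eq)
 have "free_basis R M {..<card B} b (%m j. cf m (b j))"
  unfolding free_basis_def
 proof (intro conjI ballI allI impI)
  fix m assume m: "m \<in> carrier M"
  show "m = (\<Oplus>\<^bsub>M\<^esub>j\<in>{..<card B}. cf m (b j) \<odot>\<^bsub>M\<^esub> b j)"
   using trans[OF cf(2)[OF m] tr[of "cf m", symmetric]] cf(1)[OF m] by auto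
 next
  fix c j assume c: "\<forall>j\<in>{..<card B}. c j \<in> carrier R" and j: "j \<in> {..<card B}"
  define c' where "c' = (\<lambda>x\<in>B. c (inv_into {..<card B} b x))"
  have c': "c' \<in> B \<rightarrow>\<^sub>E carrier R"
   using c inv_into_into[of _ b "{..<card B}"] bim unfolding c'_def by force
  have c'b: "c' (b j) = c j" if "j < card B" for j
   using that bi bB by (simp add: c'_def)
  have "(\<Oplus>\<^bsub>M\<^esub>j\<in>{..<card B}. c j \<odot>\<^bsub>M\<^esub> b j) = (\<Oplus>\<^bsub>M\<^esub>j\<in>{..<card B}. c' (b j) \<odot>\<^bsub>M\<^esub> b j)"
   by (rule M.finsum_cong') (use c c'b bB B in "auto simp: smult_closed subset_eq")
  also have "... = (\<Oplus>\<^bsub>M\<^esub>x\<in>B. c' x \<odot>\<^bsub>M\<^esub> x)"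
   by (rule tr) (use c' in auto)
  finally show "cf (\<Oplus>\<^bsub>M\<^esub>j\<in>{..<card B}. c j \<odot>\<^bsub>M\<^esub> b j) (b j) = c j"
   using cfu[OF c'] c'b j by simp
 qed (use bB B cf in "auto simp: subset_eq Pi_def PiE_def")
 then show ?thesis by (rule that)
qed

lemma basis_imp_fg_free:
 assumes bas: "free_basis R M J b co"
 shows "fg_free_module R M"
proof (cases "\<one> = \<zero>")
 \<comment> \<open>Over the zero ring the family \<open>b\<close> need not be injective, so its
   image cannot serve as the basis set; but then every module is zero and the empty set
   does.\<close>
 case True
 have "x = \<zero>\<^bsub>M\<^esub>" if x: "x \<in> carrier M" for x
  using smult_one[OF x] smult_l_null[OF x] True by simp
 then show ?thesis
  unfolding fg_free_module_def using is_left_module by (intro conjI exI[of _ "{}"]) auto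
next
 case False
 note B = free_basisD[OF bas]
 have delta: "co (b j) k = (if k = j then \<one> else \<zero>)" if j: "j \<in> J" and k: "k \<in> J" for j k
 proof -
  have "(\<Oplus>\<^bsub>M\<^esub>i\<in>J. (if i = j then \<one> else \<zero>) \<odot>\<^bsub>M\<^esub> b i) = (if j = j then \<one> else \<zero>) \<odot>\<^bsub>M\<^esub> b j"
   by (rule M.finsum_eq_term) (use B j in "auto simp: smult_one")
  then show ?thesis
   using B(5)[of "%i. if i = j then \<one> else \<zero>" k] B(2) j k by (auto simp: smult_one)
 qed
 have inj: "inj_on b J"
 proof (rule inj_onI)
  fix j k assume "j \<in> J" "k \<in> J" "b j = b k"
  then show "j = k" using delta[of j j] delta[of k j] False by (auto split: if_splits)
 qed
 have tr: "(\<Oplus>\<^bsub>M\<^esub>x\<in>b ` J. c x \<odot>\<^bsub>M\<^esub> x) = (\<Oplus>\<^bsub>M\<^esub>j\<in>J. c (b j) \<odot>\<^bsub>M\<^esub> b j)"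
  if "!!x. x \<in> b ` J ==> c x \<in> carrier R" for c
  by (rule M.finsum_reindex[OF _ inj]) (use that B in "auto simp: smult_closed")
 show ?thesis
  unfolding fg_free_module_def
 proof (intro conjI exI[of _ "b ` J"] ballI)
  fix m assume m: "m \<in> carrier M"
  define c where "c = (\<lambda>x\<in>b ` J. co m (inv_into J b x))"
  have cb: "c (b j) = co m j" if "j \<in> J" for j using that inj by (simp add: c_def)
  have "m = (\<Oplus>\<^bsub>M\<^esub>j\<in>J. c (b j) \<odot>\<^bsub>M\<^esub> b j)"
  proof -
   have "(\<Oplus>\<^bsub>M\<^esub>j\<in>J. c (b j) \<odot>\<^bsub>M\<^esub> b j) = (\<Oplus>\<^bsub>M\<^esub>j\<in>J. co m j \<odot>\<^bsub>M\<^esub> b j)"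
    by (rule M.finsum_cong') (use B m cb in "auto simp: smult_closed")
   then show ?thesis by (simp add: B(4) m)
  qed
  moreover have c: "c \<in> b ` J \<rightarrow>\<^sub>E carrier R" using B m inj by (auto simp: c_def)
  ultimately show "\<exists>!c. c \<in> b ` J \<rightarrow>\<^sub>E carrier R & m = (\<Oplus>\<^bsub>M\<^esub>x\<in>b ` J. c x \<odot>\<^bsub>M\<^esub> x)"
  proof (intro ex1I[of _ c] conjI)
   fix d assume d: "d \<in> b ` J \<rightarrow>\<^sub>E carrier R & m = (\<Oplus>\<^bsub>M\<^esub>x\<in>b ` J. d x \<odot>\<^bsub>M\<^esub> x)"
   have dm: "m = (\<Oplus>\<^bsub>M\<^esub>j\<in>J. d (b j) \<odot>\<^bsub>M\<^esub> b j)" using d tr[of d] by auto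
   have dR: "d (b j) \<in> carrier R" if "j \<in> J" for j using d that by auto
   have "d (b j) = c (b j)" if "j \<in> J" for j
    using B(5)[of "%j. d (b j)" j, OF dR that] cb[OF that] by (simp flip: dm)
   then show "d = c" using d c by (intro PiE_ext[of d "b ` J" _ c]) auto
  qed (use tr[of c] PiE_mem[OF c] in auto)
 qed (use B in "auto simp: is_left_module")
qed

end

section \<open>The Laurent module underlying a periodic family of modules\<close>

section \<open>The module underlying an equivariant family\<close>

text \<open>Periodicity is what makes the direct sum a module over the Laurent ring. Stated in this
  generality, the lemmas also serve the family over the integers whose fibres have countable
  rank.\<close>

locale equivariant_family = ring R for R :: "('a, 'k) ring_scheme" (structure) +
 fixes A :: "'a geo_module"
 assumes fam: "left_module R (A x)" and fam_1: "A (x + 1) = A x"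
begin

abbreviation L where "L \<equiv> laurent_ring R"
abbreviation U where "U \<equiv> forget_obj R A"

lemma fam_shift [simp]: "A (x + of_int n) = A x"
proof -
 have nat: "A (y + of_nat m) = A y" for y m
 proof (induction m)
  case (Suc m)
  then show ?case using fam_1[of "y + of_nat m"] by (simp add: add_ac)
 qed simp
 show ?thesis
 proof (cases "n \<ge> 0")
  case True
  then show ?thesis using nat[of x "Int.nat n"] by simp
 next
  case False
  then show ?thesis using nat[of "x + of_int n" "Int.nat (- n)"] by simp
 qed
qed

lemma fam_shift' [simp]: "A (x - of_int n) = A x"
 using fam_shift[of x "- n"] by simp

lemma fam_zero_closed [simp]: "\<zero>\<^bsub>A x\<^esub> \<in> carrier (A x)"
proof -
 interpret Ax: left_module R "A x" by (rule fam)
 show ?thesis by simp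
qed

lemma forget_carrier: "v \<in> carrier U \<longleftrightarrow> (\<forall>x. v x \<in> carrier (A x)) & finite {x. v x ~= \<zero>\<^bsub>A x\<^esub>}"
 by (simp add: forget_obj_def)

lemma forget_add: "v \<oplus>\<^bsub>U\<^esub> w = (%x. v x \<oplus>\<^bsub>A x\<^esub> w x)"
 and forget_zero: "\<zero>\<^bsub>U\<^esub> = (%x. \<zero>\<^bsub>A x\<^esub>)"
 by (simp_all add: forget_obj_def)

lemma forget_smult: "p \<odot>\<^bsub>U\<^esub> v = (%x. conv R (A x) p (%n. v (x - of_int n)))"
 by (simp add: forget_obj_def conv_def supp_def)

lemma forget_apply_closed: "v \<in> carrier U ==> v x \<in> carrier (A x)"
 by (simp add: forget_carrier)

lemma forget_finite: "v \<in> carrier U ==> finite {x. v x ~= \<zero>\<^bsub>A x\<^esub>}"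
 by (simp add: forget_carrier)

lemma forget_shift_closed: "v \<in> carrier U ==> v (x - of_int n) \<in> carrier (A x)"
 using forget_apply_closed[of v "x - of_int n"] by simp

lemma forget_smult_support:
 assumes p: "p \<in> carrier L" and v: "v \<in> carrier U" and x: "(p \<odot>\<^bsub>U\<^esub> v) x ~= \<zero>\<^bsub>A x\<^esub>"
 shows "x \<in> (%(n, y). y + of_int n) ` (supp R p \<times> {y. v y ~= \<zero>\<^bsub>A y\<^esub>})"
proof -
 interpret Ax: left_module R "A x" by (rule fam)
 have "\<exists>n\<in>supp R p. v (x - of_int n) ~= \<zero>\<^bsub>A x\<^esub>"
 proof (rule ccontr)
  assume "\<not> ?thesis"
  then have "conv R (A x) p (%n. v (x - of_int n)) = (\<Oplus>\<^bsub>A x\<^esub>n\<in>supp R p. \<zero>\<^bsub>A x\<^esub>)"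
   unfolding conv_def using p by (intro Ax.M.finsum_cong') (auto simp: carrier_laurent_iff)
  then show False using x by (simp add: forget_smult Ax.M.finsum_zero)
 qed
 then obtain n where "n \<in> supp R p" "v (x - of_int n) ~= \<zero>\<^bsub>A (x - of_int n)\<^esub>" by auto
 then show ?thesis by (intro image_eqI[where x = "(n, x - of_int n)"]) auto
qed

lemma left_module_forget: "left_module L U"
proof (rule left_moduleI)
 show "ring L" by (rule ring_laurent)
 show "abelian_group U"
 proof (rule abelian_groupI)
  fix v w assume "v \<in> carrier U" "w \<in> carrier U"
  then have "finite ({x. v x ~= \<zero>\<^bsub>A x\<^esub>} \<union> {x. w x ~= \<zero>\<^bsub>A x\<^esub>})" by (simp add: forget_carrier)
  moreover have "{x. v x \<oplus>\<^bsub>A x\<^esub> w x ~= \<zero>\<^bsub>A x\<^esub>} \<subseteq> {x. v x ~= \<zero>\<^bsub>A x\<^esub>} \<union> {x. w x ~= \<zero>\<^bsub>A x\<^esub>}"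
  proof
   fix x assume x: "x \<in> {x. v x \<oplus>\<^bsub>A x\<^esub> w x ~= \<zero>\<^bsub>A x\<^esub>}"
   interpret Ax: left_module R "A x" by (rule fam)
   from x show "x \<in> {x. v x ~= \<zero>\<^bsub>A x\<^esub>} \<union> {x. w x ~= \<zero>\<^bsub>A x\<^esub>}" by auto
  qed
  ultimately have "finite {x. v x \<oplus>\<^bsub>A x\<^esub> w x ~= \<zero>\<^bsub>A x\<^esub>}" by (rule finite_subset[rotated])
  moreover have "v x \<oplus>\<^bsub>A x\<^esub> w x \<in> carrier (A x)" for x
  proof -
   interpret Ax: left_module R "A x" by (rule fam)
   show ?thesis using \<open>v \<in> carrier U\<close> \<open>w \<in> carrier U\<close> by (simp add: forget_carrier)
  qed
  ultimately show "v \<oplus>\<^bsub>U\<^esub> w \<in> carrier U" by (simp add: forget_add forget_carrier)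
 next
  show "\<zero>\<^bsub>U\<^esub> \<in> carrier U" by (simp add: forget_zero forget_carrier)
 next
  fix u v w assume uvw: "u \<in> carrier U" "v \<in> carrier U" "w \<in> carrier U"
  have "u x \<oplus>\<^bsub>A x\<^esub> v x \<oplus>\<^bsub>A x\<^esub> w x = u x \<oplus>\<^bsub>A x\<^esub> (v x \<oplus>\<^bsub>A x\<^esub> w x)" for x
  proof -
   interpret Ax: left_module R "A x" by (rule fam)
   show ?thesis using uvw by (simp add: forget_carrier Ax.M.a_assoc)
  qed
  then show "u \<oplus>\<^bsub>U\<^esub> v \<oplus>\<^bsub>U\<^esub> w = u \<oplus>\<^bsub>U\<^esub> (v \<oplus>\<^bsub>U\<^esub> w)" by (simp add: forget_add)
 next
  fix u v assume uv: "u \<in> carrier U" "v \<in> carrier U"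
  have "u x \<oplus>\<^bsub>A x\<^esub> v x = v x \<oplus>\<^bsub>A x\<^esub> u x" for x
  proof -
   interpret Ax: left_module R "A x" by (rule fam)
   show ?thesis using uv by (simp add: forget_carrier Ax.M.a_comm)
  qed
  then show "u \<oplus>\<^bsub>U\<^esub> v = v \<oplus>\<^bsub>U\<^esub> u" by (simp add: forget_add)
 next
  fix v assume v: "v \<in> carrier U"
  have *: "\<zero>\<^bsub>A x\<^esub> \<oplus>\<^bsub>A x\<^esub> v x = v x & \<ominus>\<^bsub>A x\<^esub> v x \<oplus>\<^bsub>A x\<^esub> v x = \<zero>\<^bsub>A x\<^esub> & \<ominus>\<^bsub>A x\<^esub> v x \<in> carrier (A x) \<and>
    (v x = \<zero>\<^bsub>A x\<^esub> \<longrightarrow> \<ominus>\<^bsub>A x\<^esub> v x = \<zero>\<^bsub>A x\<^esub>)" for x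
  proof -
   interpret Ax: left_module R "A x" by (rule fam)
   show ?thesis using v by (simp add: forget_carrier Ax.M.l_neg)
  qed
  then show "\<zero>\<^bsub>U\<^esub> \<oplus>\<^bsub>U\<^esub> v = v" by (simp add: forget_add forget_zero)
  have "finite {x. \<ominus>\<^bsub>A x\<^esub> v x ~= \<zero>\<^bsub>A x\<^esub>}"
   by (rule finite_subset[OF _ forget_finite[OF v]]) (use * in auto)
  then show "\<exists>w\<in>carrier U. w \<oplus>\<^bsub>U\<^esub> v = \<zero>\<^bsub>U\<^esub>"
   using * by (intro bexI[of _ "%x. \<ominus>\<^bsub>A x\<^esub> v x"]) (auto simp: forget_add forget_zero forget_carrier)
 qed
next
 fix p v assume p: "p \<in> carrier L" and v: "v \<in> carrier U"
 have "finite {x. (p \<odot>\<^bsub>U\<^esub> v) x ~= \<zero>\<^bsub>A x\<^esub>}"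
  by (rule finite_subset[where B = "(%(n, y). y + of_int n) ` (supp R p \<times> {y. v y ~= \<zero>\<^bsub>A y\<^esub>})"])
   (use forget_smult_support[OF p v] p v in "auto simp: carrier_laurent_iff forget_finite")
 moreover have "(p \<odot>\<^bsub>U\<^esub> v) x \<in> carrier (A x)" for x
 proof -
  interpret Ax: left_module R "A x" by (rule fam)
  show ?thesis using v p by (simp add: forget_smult Ax.conv_closed forget_shift_closed)
 qed
 ultimately show "p \<odot>\<^bsub>U\<^esub> v \<in> carrier U" by (simp add: forget_carrier)
next
 fix p q v assume pq: "p \<in> carrier L" "q \<in> carrier L" and v: "v \<in> carrier U"
 have "((p \<oplus>\<^bsub>L\<^esub> q) \<odot>\<^bsub>U\<^esub> v) x = (p \<odot>\<^bsub>U\<^esub> v) x \<oplus>\<^bsub>A x\<^esub> (q \<odot>\<^bsub>U\<^esub> v) x \<and>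
   ((p \<otimes>\<^bsub>L\<^esub> q) \<odot>\<^bsub>U\<^esub> v) x = (p \<odot>\<^bsub>U\<^esub> (q \<odot>\<^bsub>U\<^esub> v)) x" for x
 proof -
  interpret Ax: left_module R "A x" by (rule fam)
  have add: "p \<oplus>\<^bsub>L\<^esub> q = (%n. p n \<oplus> q n)" by (simp add: laurent_ring_def)
  show ?thesis
   using Ax.conv_add_left[OF pq, of "%n. v (x - of_int n)"]
    Ax.conv_mult[OF pq, of "%n. v (x - of_int n)"] forget_shift_closed[OF v]
   by (simp add: forget_smult add diff_diff_eq)
 qed
 then show "(p \<oplus>\<^bsub>L\<^esub> q) \<odot>\<^bsub>U\<^esub> v = p \<odot>\<^bsub>U\<^esub> v \<oplus>\<^bsub>U\<^esub> q \<odot>\<^bsub>U\<^esub> v" "(p \<otimes>\<^bsub>L\<^esub> q) \<odot>\<^bsub>U\<^esub> v = p \<odot>\<^bsub>U\<^esub> (q \<odot>\<^bsub>U\<^esub> v)"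
  by (auto simp: forget_add)
next
 fix p v w assume p: "p \<in> carrier L" and v: "v \<in> carrier U" and w: "w \<in> carrier U"
 have "(p \<odot>\<^bsub>U\<^esub> (v \<oplus>\<^bsub>U\<^esub> w)) x = (p \<odot>\<^bsub>U\<^esub> v) x \<oplus>\<^bsub>A x\<^esub> (p \<odot>\<^bsub>U\<^esub> w) x" for x
 proof -
  interpret Ax: left_module R "A x" by (rule fam)
  show ?thesis
   using Ax.conv_add_right[OF p, of "%n. v (x - of_int n)" "%n. w (x - of_int n)"]
    forget_shift_closed[OF v] forget_shift_closed[OF w]
   by (simp add: forget_smult forget_add)
 qed
 then show "p \<odot>\<^bsub>U\<^esub> (v \<oplus>\<^bsub>U\<^esub> w) = p \<odot>\<^bsub>U\<^esub> v \<oplus>\<^bsub>U\<^esub> p \<odot>\<^bsub>U\<^esub> w"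
  by (auto simp: forget_add)
next
 fix v assume v: "v \<in> carrier U"
 have "(\<one>\<^bsub>L\<^esub> \<odot>\<^bsub>U\<^esub> v) x = v x" for x
 proof -
  interpret Ax: left_module R "A x" by (rule fam)
  show ?thesis
   using Ax.conv_lmon[of \<one> "%n. v (x - of_int n)" 0]
    forget_shift_closed[OF v] forget_apply_closed[OF v]
   by (simp add: forget_smult laurent_one Ax.smult_one)
 qed
 then show "\<one>\<^bsub>L\<^esub> \<odot>\<^bsub>U\<^esub> v = v" by auto
qed

lemma forget_lmon:
 assumes a: "a \<in> carrier R" and v: "v \<in> carrier U"
 shows "lmon R k a \<odot>\<^bsub>U\<^esub> v = (%x. a \<odot>\<^bsub>A x\<^esub> v (x - of_int k))"
proof
 fix x
 interpret Ax: left_module R "A x" by (rule fam)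
 show "(lmon R k a \<odot>\<^bsub>U\<^esub> v) x = a \<odot>\<^bsub>A x\<^esub> v (x - of_int k)"
  using Ax.conv_lmon[OF a, of "%n. v (x - of_int n)" k] forget_shift_closed[OF v]
  by (simp add: forget_smult)
qed

lemma forget_lmon_one:
 assumes v: "v \<in> carrier U"
 shows "lmon R k \<one> \<odot>\<^bsub>U\<^esub> v = (%x. v (x - of_int k))"
proof -
 have "\<one> \<odot>\<^bsub>A x\<^esub> v (x - of_int k) = v (x - of_int k)" for x
 proof -
  interpret Ax: left_module R "A x" by (rule fam)
  show ?thesis using forget_shift_closed[OF v] by (simp add: Ax.smult_one)
 qed
 then show ?thesis using v by (simp add: forget_lmon)
qed

lemma forget_shift_in: "v \<in> carrier U ==> (%x. v (x - of_int k)) \<in> carrier U"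
proof -
 assume v: "v \<in> carrier U"
 interpret U: left_module L U by (rule left_module_forget)
 show ?thesis
  using U.smult_closed[OF lmon_closed[OF one_closed, of k] v] by (simp add: forget_lmon_one v)
qed

lemma forget_finsum_apply:
 assumes "!!i. i \<in> I ==> f i \<in> carrier U"
 shows "(\<Oplus>\<^bsub>U\<^esub>i\<in>I. f i) x = (\<Oplus>\<^bsub>A x\<^esub>i\<in>I. f i x)"
proof -
 interpret U: left_module L U by (rule left_module_forget)
 interpret Ax: left_module R "A x" by (rule fam)
 show ?thesis
  by (rule finsum_additive[where h = "%v. v x"])
   (use assms U.M.abelian_monoid_axioms Ax.M.abelian_monoid_axioms in
    \<open>auto simp: forget_add forget_zero forget_apply_closed\<close>)
qed

definition single :: "real => (nat => 'a) => real => nat => 'a" where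
 "single x u = (%y. if y = x then u else \<zero>\<^bsub>A y\<^esub>)"

lemma single_closed:
 assumes "u \<in> carrier (A x)" shows "single x u \<in> carrier U"
proof -
 have "{y. single x u y ~= \<zero>\<^bsub>A y\<^esub>} \<subseteq> {x}" by (auto simp: single_def)
 then have "finite {y. single x u y ~= \<zero>\<^bsub>A y\<^esub>}" by (rule finite_subset) simp
 then show ?thesis using assms by (auto simp: forget_carrier single_def)
qed

lemma single_add:
 "u \<in> carrier (A x) ==> w \<in> carrier (A x) ==> single x (u \<oplus>\<^bsub>A x\<^esub> w) = single x u \<oplus>\<^bsub>U\<^esub> single x w"
proof
 fix y
 interpret Ay: left_module R "A y" by (rule fam)
 show "single x (u \<oplus>\<^bsub>A x\<^esub> w) y = (single x u \<oplus>\<^bsub>U\<^esub> single x w) y"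
  by (simp add: single_def forget_add)
qed

lemma single_lmon:
 assumes a: "a \<in> carrier R" and u: "u \<in> carrier (A x)"
 shows "lmon R k a \<odot>\<^bsub>U\<^esub> single x u = single (x + of_int k) (a \<odot>\<^bsub>A x\<^esub> u)"
proof
 fix y
 interpret Ay: left_module R "A y" by (rule fam)
 show "(lmon R k a \<odot>\<^bsub>U\<^esub> single x u) y = single (x + of_int k) (a \<odot>\<^bsub>A x\<^esub> u) y"
  unfolding forget_lmon[OF a single_closed[OF u]] using a by (auto simp: single_def)
qed

lemma forget_decomp:
 assumes v: "v \<in> carrier U"
 shows "v = (\<Oplus>\<^bsub>U\<^esub>x\<in>{x. v x ~= \<zero>\<^bsub>A x\<^esub>}. single x (v x))"
proof
 fix y
 interpret Ay: left_module R "A y" by (rule fam)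
 have "(\<Oplus>\<^bsub>U\<^esub>x\<in>{x. v x ~= \<zero>\<^bsub>A x\<^esub>}. single x (v x)) y = (\<Oplus>\<^bsub>A y\<^esub>x\<in>{x. v x ~= \<zero>\<^bsub>A x\<^esub>}. single x (v x) y)"
  by (rule forget_finsum_apply) (simp add: single_closed forget_apply_closed v)
 also have "... = (\<Oplus>\<^bsub>A y\<^esub>x\<in>insert y {x. v x ~= \<zero>\<^bsub>A x\<^esub>}. single x (v x) y)"
  by (rule Ay.M.finsum_superset) (use v in "auto simp: single_def forget_finite forget_apply_closed")
 also have "... = single y (v y) y"
  by (rule Ay.M.finsum_eq_term) (use v in "auto simp: single_def forget_finite forget_apply_closed")
 finally show "v y = (\<Oplus>\<^bsub>U\<^esub>x\<in>{x. v x ~= \<zero>\<^bsub>A x\<^esub>}. single x (v x)) y"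
  by (simp add: single_def)
qed

text \<open>By finite support every element is a sum of elements living at a single point.\<close>

lemma forget_hom_eqI:
 assumes N: "left_module L N" and h: "h \<in> lmod_hom L U N" "h' \<in> lmod_hom L U N"
  and eq: "!!x u. u \<in> carrier (A x) ==> h (single x u) = h' (single x u)"
 shows "h = h'"
proof (rule lmod_hom_eqI[OF h])
 fix v assume v: "v \<in> carrier U"
 interpret N: left_module L N by (rule N)
 let ?S = "{x. v x ~= \<zero>\<^bsub>A x\<^esub>}"
 have s: "single x (v x) \<in> carrier U" for x by (simp add: single_closed forget_apply_closed v)
 have "h v = (\<Oplus>\<^bsub>N\<^esub>x\<in>?S. h (single x (v x)))"
  by (subst (1) forget_decomp[OF v], subst lmod_hom_finsum[OF left_module_forget N h(1)]) (auto simp: s)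
 also have "... = (\<Oplus>\<^bsub>N\<^esub>x\<in>?S. h' (single x (v x)))"
  by (rule N.M.finsum_cong') (use h s eq v in "auto simp: lmod_hom_closed forget_apply_closed")
 also have "... = h' v"
  by (subst (3) forget_decomp[OF v], subst lmod_hom_finsum[OF left_module_forget N h(2)]) (auto simp: s)
 finally show "h v = h' v" .
qed

lemma smult_decomp:
 assumes p: "p \<in> carrier L" and v: "v \<in> carrier U"
 shows "p \<odot>\<^bsub>U\<^esub> v = (\<Oplus>\<^bsub>U\<^esub>n\<in>supp R p. lmon R n (p n) \<odot>\<^bsub>U\<^esub> v)"
proof
 fix x
 interpret U: left_module L U by (rule left_module_forget)
 have pn: "p n \<in> carrier R" for n using p by (simp add: carrier_laurent_iff)
 have "(\<Oplus>\<^bsub>U\<^esub>n\<in>supp R p. lmon R n (p n) \<odot>\<^bsub>U\<^esub> v) x = (\<Oplus>\<^bsub>A x\<^esub>n\<in>supp R p. (lmon R n (p n) \<odot>\<^bsub>U\<^esub> v) x)"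
  by (rule forget_finsum_apply) (simp add: U.smult_closed lmon_closed pn v)
 then show "(p \<odot>\<^bsub>U\<^esub> v) x = (\<Oplus>\<^bsub>U\<^esub>n\<in>supp R p. lmon R n (p n) \<odot>\<^bsub>U\<^esub> v) x"
  by (simp add: forget_lmon pn v) (simp add: forget_smult conv_def)
qed

end

text \<open>Laurent scalars are finite sums of monomials. Given additivity it is therefore enough to
  test a t^k, that is, a scalar of \<open>R\<close> combined with a shift by
  \<open>k\<close>.\<close>

lemma forget_homI:
 assumes A: "equivariant_family R A" and B: "equivariant_family R B"
  and cl: "!!v. v \<in> carrier (\<U>\<^sub>o R A) ==> h v \<in> carrier (\<U>\<^sub>o R B)"
  and un: "!!v. v \<notin> carrier (\<U>\<^sub>o R A) ==> h v = undefined"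
  and add: "!!v w. v \<in> carrier (\<U>\<^sub>o R A) ==> w \<in> carrier (\<U>\<^sub>o R A) ==>
   h (%x. v x \<oplus>\<^bsub>A x\<^esub> w x) = (%x. h v x \<oplus>\<^bsub>B x\<^esub> h w x)"
  and lm: "!!v a k. v \<in> carrier (\<U>\<^sub>o R A) ==> a \<in> carrier R ==>
   h (%x. a \<odot>\<^bsub>A x\<^esub> v (x - of_int k)) = (%x. a \<odot>\<^bsub>B x\<^esub> h v (x - of_int k))"
 shows "h \<in> lmod_hom (laurent_ring R) (\<U>\<^sub>o R A) (\<U>\<^sub>o R B)"
proof (rule lmod_homI[OF cl un])
 interpret A: equivariant_family R A by fact
 interpret B: equivariant_family R B by fact
 interpret UA: left_module "laurent_ring R" "\<U>\<^sub>o R A" by (rule A.left_module_forget)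
 interpret UB: left_module "laurent_ring R" "\<U>\<^sub>o R B" by (rule B.left_module_forget)
 show hadd: "h (v \<oplus>\<^bsub>\<U>\<^sub>o R A\<^esub> w) = h v \<oplus>\<^bsub>\<U>\<^sub>o R B\<^esub> h w"
  if "v \<in> carrier (\<U>\<^sub>o R A)" "w \<in> carrier (\<U>\<^sub>o R A)" for v w
  using add[OF that] by (simp add: A.forget_add B.forget_add)
 have "h \<zero>\<^bsub>\<U>\<^sub>o R A\<^esub> \<oplus>\<^bsub>\<U>\<^sub>o R B\<^esub> h \<zero>\<^bsub>\<U>\<^sub>o R A\<^esub> = h \<zero>\<^bsub>\<U>\<^sub>o R A\<^esub>"
  using hadd[of "\<zero>\<^bsub>\<U>\<^sub>o R A\<^esub>" "\<zero>\<^bsub>\<U>\<^sub>o R A\<^esub>"] by simp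
 then have zero: "h \<zero>\<^bsub>\<U>\<^sub>o R A\<^esub> = \<zero>\<^bsub>\<U>\<^sub>o R B\<^esub>"
  using cl[of "\<zero>\<^bsub>\<U>\<^sub>o R A\<^esub>"] by (metis UA.M.zero_closed UB.M.add.l_cancel_one')
 fix p v assume p: "p \<in> carrier (laurent_ring R)" and v: "v \<in> carrier (\<U>\<^sub>o R A)"
 have pn: "p n \<in> carrier R" for n using p by (simp add: carrier_laurent_iff)
 have "h (p \<odot>\<^bsub>\<U>\<^sub>o R A\<^esub> v) = (\<Oplus>\<^bsub>\<U>\<^sub>o R B\<^esub>n\<in>supp R p. h (lmon R n (p n) \<odot>\<^bsub>\<U>\<^sub>o R A\<^esub> v))"
  unfolding A.smult_decomp[OF p v]
  by (rule finsum_additive[where h = h])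
   (use UA.M.abelian_monoid_axioms UB.M.abelian_monoid_axioms hadd zero cl in
    \<open>auto simp: UA.smult_closed A.lmon_closed pn v\<close>)
 also have "(%n. h (lmon R n (p n) \<odot>\<^bsub>\<U>\<^sub>o R A\<^esub> v)) = (%n. lmon R n (p n) \<odot>\<^bsub>\<U>\<^sub>o R B\<^esub> h v)"
  using lm v pn cl by (simp add: A.forget_lmon B.forget_lmon)
 also have "(\<Oplus>\<^bsub>\<U>\<^sub>o R B\<^esub>n\<in>supp R p. lmon R n (p n) \<odot>\<^bsub>\<U>\<^sub>o R B\<^esub> h v) = p \<odot>\<^bsub>\<U>\<^sub>o R B\<^esub> h v"
  by (rule B.smult_decomp[symmetric]) (use p v cl in auto)
 finally show "h (p \<odot>\<^bsub>\<U>\<^sub>o R A\<^esub> v) = p \<odot>\<^bsub>\<U>\<^sub>o R B\<^esub> h v" .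
qed

section \<open>Objects of the geometric category\<close>

lemma geo_obj_family:
 assumes "ring R" "A \<in> cat_obj (\<T> R)" shows "equivariant_family R A"
 using assms by (auto simp: equivariant_family_def equivariant_family_axioms_def geo_cat_def
   geometric_module_def fg_free_module_def invariant_geo_module_def)

lemma locally_finite_Icc:
 fixes S :: "real set"
 assumes "!!x. \<exists>V. open V & x \<in> V & finite (V \<inter> S)"
 shows "finite ({a..b} \<inter> S)"
proof -
 obtain V where V: "!!x. open (V x)" "!!x. x \<in> V x" "!!x. finite (V x \<inter> S)"
  using choice[of "%x V. open V & x \<in> V & finite (V \<inter> S)"] assms by auto
 obtain C where C: "finite C" "{a..b} \<subseteq> (\<Union>c\<in>C. V c)"
  by (rule compactE_image[OF compact_Icc, of "{a..b}" V a b]) (use V in auto)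
 have "finite (\<Union>c\<in>C. V c \<inter> S)" using C(1) V(3) by (intro finite_UN_I)
 then show ?thesis by (rule finite_subset[rotated]) (use C in auto)
qed

lemma geo_obj_finite:
 assumes "A \<in> cat_obj (\<T> R)" shows "finite ({a..b} \<inter> geo_support A)"
 by (rule locally_finite_Icc) (use assms in "auto simp: geo_cat_def geometric_module_def")

text \<open>Translations act freely: a point \<open>y\<close> is reached from \<open>x\<close> in
  [0, 1) by one power of t only, the floor of \<open>y\<close>, and only if \<open>x\<close> is the
  fractional part of \<open>y\<close>.\<close>

lemma (in equivariant_family) forget_smult_single_apply:
 assumes p: "p \<in> carrier L" and u: "u \<in> carrier (A x)" and x: "0 \<le> x" "x < 1"
 shows "(p \<odot>\<^bsub>U\<^esub> single x u) y = (if x = frac y then p \<lfloor>y\<rfloor> \<odot>\<^bsub>A y\<^esub> u else \<zero>\<^bsub>A y\<^esub>)"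
proof -
 interpret Ay: left_module R "A y" by (rule fam)
 have pn: "p n \<in> carrier R" for n using p by (simp add: carrier_laurent_iff)
 have fin: "finite (insert \<lfloor>y\<rfloor> (supp R p))" using p by (simp add: carrier_laurent_iff)
 have eq: "y - of_int n = x \<longleftrightarrow> x = frac y & n = \<lfloor>y\<rfloor>" for n
 proof
  assume "y - of_int n = x"
  moreover then have "\<lfloor>y\<rfloor> = n" using x by (simp add: floor_eq_iff)
  ultimately show "x = frac y & n = \<lfloor>y\<rfloor>" by (simp add: frac_def)
 qed (simp add: frac_def)
 have Axy: "A y = A x" if "x = frac y" using that by (simp add: frac_def)
 have "(p \<odot>\<^bsub>U\<^esub> single x u) y = (\<Oplus>\<^bsub>A y\<^esub>n\<in>insert \<lfloor>y\<rfloor> (supp R p). p n \<odot>\<^bsub>A y\<^esub> single x u (y - of_int n))"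
  unfolding forget_smult
  by (rule Ay.conv_eq[OF p fin]) (use forget_shift_closed[OF single_closed[OF u]] in auto)
 also have "... = p \<lfloor>y\<rfloor> \<odot>\<^bsub>A y\<^esub> single x u (y - of_int \<lfloor>y\<rfloor>)"
  by (rule Ay.M.finsum_eq_term[OF fin])
   (use forget_shift_closed[OF single_closed[OF u]] pn eq in "auto simp: Ay.smult_closed, auto simp: single_def")
 finally show ?thesis using eq[of "\<lfloor>y\<rfloor>"] pn by (auto simp: single_def)
qed

text \<open>The support points in [0, 1) represent the orbits and are finite in number by local
  finiteness. Bases of the modules at these points together form a Laurent basis because the action
  is free.\<close>

lemma fg_free_forget:
 assumes R: "ring R" and A: "A \<in> cat_obj (\<T> R)"
 shows "fg_free_module (laurent_ring R) (\<U>\<^sub>o R A)"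
proof -
 interpret equivariant_family R A by (rule geo_obj_family[OF assms])
 interpret U: left_module L U by (rule left_module_forget)
 define F where "F = geo_support A \<inter> {0..<1}"
 have F: "finite F"
  by (rule finite_subset[OF _ geo_obj_finite[OF A, of 0 1]]) (auto simp: F_def)
 have "\<exists>n b co. free_basis R (A x) {..<n::nat} b co" for x
 proof -
  interpret Ax: left_module R "A x" by (rule fam)
  have "fg_free_module R (A x)" using A by (simp add: geo_cat_def geometric_module_def)
  then show ?thesis using Ax.fg_free_imp_basis by metis
 qed
 then obtain n b co where bas: "!!x. free_basis R (A x) {..<n x::nat} (b x) (co x)" by metis
 define J where "J = Sigma F (%x. {..<n x})"
 define b' where "b' = (%(x, j). single x (b x j))"
 \<comment> \<open>The coordinate at \<open>(x, j)\<close> collects the \<open>j\<close>-th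
   coordinates of \<open>v\<close> along the orbit of \<open>x\<close> into one Laurent
   polynomial.\<close>
 define co' where "co' v = (%(x, j) k. co x (v (x + of_int k)) j)" for v :: "real => nat => 'a"
 have J: "finite J" using F by (auto simp: J_def)
 have Jx: "0 \<le> x" "x < 1" if "(x, j) \<in> J" for x j using that by (auto simp: J_def F_def)
 have bc: "b x j \<in> carrier (A x)" if "j < n x" for x j using free_basisD(2)[OF bas] that by auto
 have sum: "(\<Oplus>\<^bsub>U\<^esub>i\<in>J. c i \<odot>\<^bsub>U\<^esub> b' i) y =
   (if frac y \<in> F then (\<Oplus>\<^bsub>A y\<^esub>j\<in>{..<n (frac y)}. c (frac y, j) \<lfloor>y\<rfloor> \<odot>\<^bsub>A y\<^esub> b (frac y) j) else \<zero>\<^bsub>A y\<^esub>)"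
  if c: "!!i. i \<in> J ==> c i \<in> carrier L" for c y
 proof -
  interpret Ay: left_module R "A y" by (rule fam)
  have Ay: "A (frac y) = A y" by (simp add: frac_def)
  have cn: "c i k \<in> carrier R" if "i \<in> J" for i k using c[OF that] by (simp add: carrier_laurent_iff)
  let ?g = "%i. if fst i = frac y then c i \<lfloor>y\<rfloor> \<odot>\<^bsub>A y\<^esub> b (fst i) (snd i) else \<zero>\<^bsub>A y\<^esub>"
  have g: "?g i \<in> carrier (A y)" if "i \<in> J" for i
   using cn[OF that, of "\<lfloor>y\<rfloor>"] that bc[of "snd i" "fst i"] Ay
   by (cases i) (auto simp: J_def intro!: Ay.smult_closed)
  have "(\<Oplus>\<^bsub>U\<^esub>i\<in>J. c i \<odot>\<^bsub>U\<^esub> b' i) y = (\<Oplus>\<^bsub>A y\<^esub>i\<in>J. (c i \<odot>\<^bsub>U\<^esub> b' i) y)"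
   by (rule forget_finsum_apply) (use c in "auto simp: J_def b'_def intro!: U.smult_closed single_closed bc")
  also have "... = (\<Oplus>\<^bsub>A y\<^esub>i\<in>J. ?g i)"
  proof (rule Ay.M.finsum_cong')
   fix i assume i: "i \<in> J"
   obtain x j where ij: "i = (x, j)" by (cases i)
   have "j < n x" "0 \<le> x" "x < 1" using i ij Jx[of x j] by (auto simp: J_def)
   then show "(c i \<odot>\<^bsub>U\<^esub> b' i) y = ?g i"
    using forget_smult_single_apply[OF c[OF i] bc[of j x], of y] by (simp add: b'_def ij)
  qed (use g in auto)
  also have "... = (if frac y \<in> F then (\<Oplus>\<^bsub>A y\<^esub>j\<in>{..<n (frac y)}. c (frac y, j) \<lfloor>y\<rfloor> \<odot>\<^bsub>A y\<^esub> b (frac y) j) else \<zero>\<^bsub>A y\<^esub>)"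
  proof (cases "frac y \<in> F")
   case True
   have "(\<Oplus>\<^bsub>A y\<^esub>i\<in>J. ?g i) = (\<Oplus>\<^bsub>A y\<^esub>i\<in>Pair (frac y) ` {..<n (frac y)}. ?g i)"
    by (rule Ay.M.finsum_superset[symmetric]) (use J g True in "auto simp: J_def")
   also have "... = (\<Oplus>\<^bsub>A y\<^esub>j\<in>{..<n (frac y)}. ?g (frac y, j))"
    by (rule Ay.M.finsum_reindex) (use g True in "auto simp: J_def inj_on_def")
   finally show ?thesis using True by simp
  next
   case False
   have "(\<Oplus>\<^bsub>A y\<^esub>i\<in>J. ?g i) = (\<Oplus>\<^bsub>A y\<^esub>i\<in>J. \<zero>\<^bsub>A y\<^esub>)"
    by (rule Ay.M.finsum_cong') (use False in "auto simp: J_def")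
   then show ?thesis using False by (simp add: Ay.M.finsum_zero)
  qed
  finally show ?thesis .
 qed
 have coL: "co' v i \<in> carrier L" if v: "v \<in> carrier U" and i: "i \<in> J" for v i
 proof -
  obtain x j where ij: "i = (x, j)" by (cases i)
  have j: "j \<in> {..<n x}" using i ij by (auto simp: J_def)
  interpret Ax: left_module R "A x" by (rule fam)
  have vk: "v (x + of_int k) \<in> carrier (A x)" for k using forget_apply_closed[OF v, of "x + of_int k"] by simp
  have "supp R (co' v i) \<subseteq> (%k. x + of_int k) -` {y. v y ~= \<zero>\<^bsub>A y\<^esub>}"
   using Ax.free_basis_coord_zero[OF bas j] by (auto simp: supp_def co'_def ij)
  moreover have "finite ((%k. x + of_int k) -` {y. v y ~= \<zero>\<^bsub>A y\<^esub>})"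
   by (rule finite_vimageI[OF forget_finite[OF v]]) (auto simp: inj_def)
  ultimately show ?thesis
   using free_basisD(3)[OF bas vk j] by (auto simp: carrier_laurent_iff co'_def ij finite_subset)
 qed
 have "free_basis L U J b' co'"
  unfolding free_basis_def
 proof (intro conjI ballI allI impI)
  fix v assume v: "v \<in> carrier U"
  show "v = (\<Oplus>\<^bsub>U\<^esub>i\<in>J. co' v i \<odot>\<^bsub>U\<^esub> b' i)"
  proof
   fix y
   have Ay: "A (frac y) = A y" by (simp add: frac_def)
   have fy: "frac y + of_int \<lfloor>y\<rfloor> = y" by (simp add: frac_def)
   show "v y = (\<Oplus>\<^bsub>U\<^esub>i\<in>J. co' v i \<odot>\<^bsub>U\<^esub> b' i) y"
   proof (cases "frac y \<in> F")
    case True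
    then show ?thesis
     using sum[of "co' v" y, OF coL[OF v]] free_basisD(4)[OF bas[of "frac y"], of "v y"] forget_apply_closed[OF v, of y]
     by (simp add: co'_def fy Ay)
   next
    case False
    then have "carrier (A y) = {\<zero>\<^bsub>A y\<^esub>}"
     using Ay frac_lt_1[of y] by (auto simp: F_def geo_support_def)
    then show ?thesis
     using sum[of "co' v" y, OF coL[OF v]] False forget_apply_closed[OF v, of y] by auto
   qed
  qed
 next
  fix c i assume c: "\<forall>j\<in>J. c j \<in> carrier L" and i: "i \<in> J"
  obtain x j where ij: "i = (x, j)" by (cases i)
  have xj: "x \<in> F" "j < n x" "0 \<le> x" "x < 1" using i ij by (auto simp: J_def F_def)
  show "co' (\<Oplus>\<^bsub>U\<^esub>j\<in>J. c j \<odot>\<^bsub>U\<^esub> b' j) i = c i"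
  proof
   fix k
   have fr: "frac (x + of_int k) = x" "\<lfloor>x + of_int k\<rfloor> = k"
    using xj by (auto simp: frac_def floor_eq_iff)
   have "c (x, j) k \<in> carrier R" if "j < n x" for j
    using c that xj by (auto simp: carrier_laurent_iff J_def)
   then show "co' (\<Oplus>\<^bsub>U\<^esub>j\<in>J. c j \<odot>\<^bsub>U\<^esub> b' j) i k = c i k"
    using sum[of c "x + of_int k"] c xj free_basisD(5)[OF bas[of x], of "%j. c (x, j) k" j]
    by (simp add: co'_def ij fr)
  qed
 qed (use J coL bc in "auto simp: b'_def J_def intro: single_closed")
 then show ?thesis by (rule U.basis_imp_fg_free)
qed

section \<open>Functoriality, additivity and fullness of the forgetful functor\<close>

section \<open>The functor forgetting geometry\<close>

locale equivariant_map = A: equivariant_family R A + B: equivariant_family R B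
 for R :: "('a, 'k) ring_scheme" (structure) and A B :: "'a geo_module" +
 fixes \<phi> :: "'a geo_map"
 assumes comp: "\<phi> x y \<in> lmod_hom R (A x) (B y)"
  and fin: "finite {y. (x, y) \<in> map_support A B \<phi>}"
  and inv_1: "\<phi> (x + 1) (y + 1) = \<phi> x y"

lemma geo_hom_equivariant:
 assumes "ring R" "A \<in> cat_obj (\<T> R)" "B \<in> cat_obj (\<T> R)" "\<phi> \<in> cat_hom (\<T> R) A B"
 shows "equivariant_map R A B \<phi>"
 using assms geo_obj_family[OF assms(1)]
 by (auto simp: equivariant_map_def equivariant_map_axioms_def geo_cat_def geometric_hom_def invariant_geo_map_def)

context equivariant_map
begin

lemma inv_shift: "\<phi> (x + of_int n) (y + of_int n) = \<phi> x y"
proof -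
 have nat: "\<phi> (x + of_nat m) (y + of_nat m) = \<phi> x y" for x y m
 proof (induction m)
  case (Suc m)
  then show ?case using inv_1[of "x + of_nat m" "y + of_nat m"] by (simp add: add_ac)
 qed simp
 show ?thesis
 proof (cases "n \<ge> 0")
  case True
  then show ?thesis using nat[of x "Int.nat n" y] by simp
 next
  case False
  then show ?thesis using nat[of "x + of_int n" "Int.nat (- n)" "y + of_int n"] by simp
 qed
qed

lemma comp_closed: "u \<in> carrier (A x) ==> \<phi> x y u \<in> carrier (B y)"
 by (rule lmod_hom_closed[OF comp])

lemma comp_zero: "\<phi> x y \<zero>\<^bsub>A x\<^esub> = \<zero>\<^bsub>B y\<^esub>"
 by (rule lmod_hom_zero[OF A.fam B.fam comp])

lemma comp_support: "(x, y) \<notin> map_support A B \<phi> ==> u \<in> carrier (A x) ==> \<phi> x y u = \<zero>\<^bsub>B y\<^esub>"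
 by (simp add: map_support_def zero_map_def)

text \<open>Sums over the supports of different vectors can be compared only over a common index
  set, hence the freedom in \<open>Q\<close>.\<close>

lemma forget_map_eq:
 assumes v: "v \<in> carrier A.U" and "finite Q" "{x. v x ~= \<zero>\<^bsub>A x\<^esub>} \<subseteq> Q"
 shows "\<U>\<^sub>h R A B \<phi> v y = (\<Oplus>\<^bsub>B y\<^esub>x\<in>Q. \<phi> x y (v x))"
proof -
 interpret By: left_module R "B y" by (rule B.fam)
 have "(\<Oplus>\<^bsub>B y\<^esub>x\<in>{x. v x ~= \<zero>\<^bsub>A x\<^esub>}. \<phi> x y (v x)) = (\<Oplus>\<^bsub>B y\<^esub>x\<in>Q. \<phi> x y (v x))"
  by (rule By.M.finsum_superset)
   (use assms in "auto simp: comp_closed comp_zero A.forget_apply_closed")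
 then show ?thesis using v by (simp add: forget_map_def)
qed

lemma forget_map_finite:
 assumes v: "v \<in> carrier A.U" shows "finite {y. \<U>\<^sub>h R A B \<phi> v y ~= \<zero>\<^bsub>B y\<^esub>}"
proof (rule finite_subset)
 show "finite (\<Union>x\<in>{x. v x ~= \<zero>\<^bsub>A x\<^esub>}. {y. (x, y) \<in> map_support A B \<phi>})"
  using A.forget_finite[OF v] fin by auto
 show "{y. \<U>\<^sub>h R A B \<phi> v y ~= \<zero>\<^bsub>B y\<^esub>} \<subseteq> (\<Union>x\<in>{x. v x ~= \<zero>\<^bsub>A x\<^esub>}. {y. (x, y) \<in> map_support A B \<phi>})"
 proof
  fix y assume y: "y \<in> {y. \<U>\<^sub>h R A B \<phi> v y ~= \<zero>\<^bsub>B y\<^esub>}"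
  interpret By: left_module R "B y" by (rule B.fam)
  show "y \<in> (\<Union>x\<in>{x. v x ~= \<zero>\<^bsub>A x\<^esub>}. {y. (x, y) \<in> map_support A B \<phi>})"
  proof (rule ccontr)
   assume "\<not> ?thesis"
   then have "!!x. x \<in> {x. v x ~= \<zero>\<^bsub>A x\<^esub>} ==> \<phi> x y (v x) = \<zero>\<^bsub>B y\<^esub>"
    using v by (auto simp: comp_support A.forget_apply_closed)
   then have "(\<Oplus>\<^bsub>B y\<^esub>x\<in>{x. v x ~= \<zero>\<^bsub>A x\<^esub>}. \<phi> x y (v x)) = (\<Oplus>\<^bsub>B y\<^esub>x\<in>{x. v x ~= \<zero>\<^bsub>A x\<^esub>}. \<zero>\<^bsub>B y\<^esub>)"
    by (intro By.M.finsum_cong') auto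
   then show False using y v by (simp add: forget_map_def By.M.finsum_zero)
  qed
 qed
qed

lemma forget_map_apply_closed:
 assumes v: "v \<in> carrier A.U" shows "\<U>\<^sub>h R A B \<phi> v y \<in> carrier (B y)"
proof -
 interpret By: left_module R "B y" by (rule B.fam)
 show ?thesis using v
  by (auto simp: forget_map_def comp_closed A.forget_apply_closed intro!: By.M.finsum_closed)
qed

lemma forget_map_closed: "v \<in> carrier A.U ==> \<U>\<^sub>h R A B \<phi> v \<in> carrier B.U"
 by (simp add: B.forget_carrier forget_map_apply_closed forget_map_finite)

lemma forget_map_hom: "\<U>\<^sub>h R A B \<phi> \<in> lmod_hom A.L A.U B.U"
proof (rule forget_homI)
 show "equivariant_family R A" "equivariant_family R B" by unfold_locales
next
 fix v w assume v: "v \<in> carrier A.U" and w: "w \<in> carrier A.U"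
 interpret UA: left_module A.L A.U by (rule A.left_module_forget)
 have vw: "(%x. v x \<oplus>\<^bsub>A x\<^esub> w x) \<in> carrier A.U"
  using UA.M.add.m_closed[OF v w] by (simp add: A.forget_add)
 let ?X = "{x. v x ~= \<zero>\<^bsub>A x\<^esub>} \<union> {x. w x ~= \<zero>\<^bsub>A x\<^esub>}"
 have X: "finite ?X" using v w by (simp add: A.forget_finite)
 have sub: "{x. v x \<oplus>\<^bsub>A x\<^esub> w x ~= \<zero>\<^bsub>A x\<^esub>} \<subseteq> ?X"
 proof
  fix x assume x: "x \<in> {x. v x \<oplus>\<^bsub>A x\<^esub> w x ~= \<zero>\<^bsub>A x\<^esub>}"
  interpret Ax: left_module R "A x" by (rule A.fam)
  from x show "x \<in> ?X" by auto
 qed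
 show "\<U>\<^sub>h R A B \<phi> (%x. v x \<oplus>\<^bsub>A x\<^esub> w x) = (%y. \<U>\<^sub>h R A B \<phi> v y \<oplus>\<^bsub>B y\<^esub> \<U>\<^sub>h R A B \<phi> w y)"
 proof
  fix y
  interpret By: left_module R "B y" by (rule B.fam)
  have "\<U>\<^sub>h R A B \<phi> (%x. v x \<oplus>\<^bsub>A x\<^esub> w x) y = (\<Oplus>\<^bsub>B y\<^esub>x\<in>?X. \<phi> x y (v x \<oplus>\<^bsub>A x\<^esub> w x))"
   by (rule forget_map_eq[OF vw X sub])
  also have "... = (\<Oplus>\<^bsub>B y\<^esub>x\<in>?X. \<phi> x y (v x) \<oplus>\<^bsub>B y\<^esub> \<phi> x y (w x))"
   by (rule By.M.finsum_cong')
    (use v w in "auto simp: comp_closed A.forget_apply_closed lmod_hom_add[OF comp]")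
  also have "... = (\<Oplus>\<^bsub>B y\<^esub>x\<in>?X. \<phi> x y (v x)) \<oplus>\<^bsub>B y\<^esub> (\<Oplus>\<^bsub>B y\<^esub>x\<in>?X. \<phi> x y (w x))"
   by (rule By.M.finsum_addf) (use v w in "auto simp: comp_closed A.forget_apply_closed")
  also have "... = \<U>\<^sub>h R A B \<phi> v y \<oplus>\<^bsub>B y\<^esub> \<U>\<^sub>h R A B \<phi> w y"
   using forget_map_eq[OF v X, of y] forget_map_eq[OF w X, of y] by simp
  finally show "\<U>\<^sub>h R A B \<phi> (%x. v x \<oplus>\<^bsub>A x\<^esub> w x) y = \<U>\<^sub>h R A B \<phi> v y \<oplus>\<^bsub>B y\<^esub> \<U>\<^sub>h R A B \<phi> w y" .
 qed
next
 fix v a and k :: int assume v: "v \<in> carrier A.U" and a: "a \<in> carrier R"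
 interpret UA: left_module A.L A.U by (rule A.left_module_forget)
 have av: "(%x. a \<odot>\<^bsub>A x\<^esub> v (x - of_int k)) \<in> carrier A.U"
  using UA.smult_closed[OF A.lmon_closed[OF a, of k] v] by (simp add: A.forget_lmon a v)
 let ?S = "{x. v x ~= \<zero>\<^bsub>A x\<^esub>}"
 have sub: "{x. a \<odot>\<^bsub>A x\<^esub> v (x - of_int k) ~= \<zero>\<^bsub>A x\<^esub>} \<subseteq> (%x. x + of_int k) ` ?S"
 proof
  fix x assume x: "x \<in> {x. a \<odot>\<^bsub>A x\<^esub> v (x - of_int k) ~= \<zero>\<^bsub>A x\<^esub>}"
  interpret Ax: left_module R "A x" by (rule A.fam)
  from x a have "x - of_int k \<in> ?S" by auto
  then show "x \<in> (%x. x + of_int k) ` ?S" by (rule rev_image_eqI) simp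
 qed
 show "\<U>\<^sub>h R A B \<phi> (%x. a \<odot>\<^bsub>A x\<^esub> v (x - of_int k)) = (%y. a \<odot>\<^bsub>B y\<^esub> \<U>\<^sub>h R A B \<phi> v (y - of_int k))"
 proof
  fix y
  interpret By: left_module R "B y" by (rule B.fam)
  have inv: "\<phi> (x + of_int k) y = \<phi> x (y - of_int k)" for x
   using inv_shift[of x k "y - of_int k"] by simp
  have cl: "\<phi> x (y - of_int k) (v x) \<in> carrier (B y)" for x
   using comp_closed[of "v x" x "y - of_int k"] v by (simp add: A.forget_apply_closed)
  have avc: "a \<odot>\<^bsub>A x\<^esub> v x \<in> carrier (A x)" for x
  proof -
   interpret Ax: left_module R "A x" by (rule A.fam)
   show ?thesis using a v by (simp add: A.forget_apply_closed Ax.smult_closed)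
  qed
  have "\<U>\<^sub>h R A B \<phi> (%x. a \<odot>\<^bsub>A x\<^esub> v (x - of_int k)) y =
    (\<Oplus>\<^bsub>B y\<^esub>x\<in>(%x. x + of_int k) ` ?S. \<phi> x y (a \<odot>\<^bsub>A x\<^esub> v (x - of_int k)))"
   by (rule forget_map_eq[OF av _ sub]) (simp add: A.forget_finite v)
  also have "... = (\<Oplus>\<^bsub>B y\<^esub>x\<in>?S. \<phi> (x + of_int k) y (a \<odot>\<^bsub>A (x + of_int k)\<^esub> v (x + of_int k - of_int k)))"
   by (rule By.M.finsum_reindex)
    (use avc in "auto simp: inj_on_def intro!: comp_closed")
  also have "... = (\<Oplus>\<^bsub>B y\<^esub>x\<in>?S. a \<odot>\<^bsub>B y\<^esub> \<phi> x (y - of_int k) (v x))"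
   by (rule By.M.finsum_cong')
    (use v a cl in "auto simp: inv A.forget_apply_closed lmod_hom_smult[OF comp] By.smult_closed")
  also have "... = a \<odot>\<^bsub>B y\<^esub> (\<Oplus>\<^bsub>B y\<^esub>x\<in>?S. \<phi> x (y - of_int k) (v x))"
   by (rule By.smult_finsum_right[symmetric]) (use a cl in auto)
  also have "... = a \<odot>\<^bsub>B y\<^esub> \<U>\<^sub>h R A B \<phi> v (y - of_int k)"
   using v by (simp add: forget_map_def)
  finally show "\<U>\<^sub>h R A B \<phi> (%x. a \<odot>\<^bsub>A x\<^esub> v (x - of_int k)) y = a \<odot>\<^bsub>B y\<^esub> \<U>\<^sub>h R A B \<phi> v (y - of_int k)" .
 qed
qed (auto simp: forget_map_closed, simp add: forget_map_def)

end

lemma forget_map_single: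
 assumes "equivariant_family R A" "equivariant_family R B"
  and u: "u \<in> carrier (A x)" and cl: "\<phi> x y u \<in> carrier (B y)" and zero: "\<phi> x y \<zero>\<^bsub>A x\<^esub> = \<zero>\<^bsub>B y\<^esub>"
 shows "\<U>\<^sub>h R A B \<phi> (equivariant_family.single A x u) y = \<phi> x y u"
proof -
 interpret A: equivariant_family R A by fact
 interpret B: equivariant_family R B by fact
 interpret By: left_module R "B y" by (rule B.fam)
 have "{z. A.single x u z ~= \<zero>\<^bsub>A z\<^esub>} = (if u = \<zero>\<^bsub>A x\<^esub> then {} else {x})"
  by (auto simp: A.single_def)
 moreover have "(\<Oplus>\<^bsub>B y\<^esub>z\<in>{x}. \<phi> z y (A.single x u z)) = \<phi> x y u"
  by (subst By.M.finsum_eq_term[of _ x]) (use cl in "auto simp: A.single_def")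
 ultimately show ?thesis
  using A.single_closed[OF u] zero by (auto simp: forget_map_def)
qed

lemma forget_map_id:
 assumes "equivariant_family R A"
 shows "\<U>\<^sub>h R A A (geo_id A) = (\<lambda>v\<in>carrier (\<U>\<^sub>o R A). v)"
proof (rule ext)
 fix v
 interpret A: equivariant_family R A by fact
 show "\<U>\<^sub>h R A A (geo_id A) v = (\<lambda>v\<in>carrier (\<U>\<^sub>o R A). v) v"
 proof (cases "v \<in> carrier A.U")
  case v: True
  have "\<U>\<^sub>h R A A (geo_id A) v y = v y" for y
  proof -
   interpret Ay: left_module R "A y" by (rule A.fam)
   note vy = A.forget_apply_closed[OF v]
   have "(\<Oplus>\<^bsub>A y\<^esub>x\<in>{x. v x ~= \<zero>\<^bsub>A x\<^esub>}. geo_id A x y (v x)) =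
     (\<Oplus>\<^bsub>A y\<^esub>x\<in>insert y {x. v x ~= \<zero>\<^bsub>A x\<^esub>}. geo_id A x y (v x))"
    by (rule Ay.M.finsum_superset)
     (use vy A.forget_finite[OF v] in "auto simp: geo_id_def zero_map_def")
   also have "... = geo_id A y y (v y)"
    by (rule Ay.M.finsum_eq_term)
     (use vy A.forget_finite[OF v] in "auto simp: geo_id_def zero_map_def")
   also have "... = v y" using vy by (simp add: geo_id_def)
   finally show ?thesis using v by (simp add: forget_map_def)
  qed
  then show ?thesis using v by auto
 qed (auto simp: forget_map_def)
qed

lemma forget_map_comp:
 assumes "equivariant_map R A B \<phi>" "equivariant_map R B C \<psi>"
 shows "\<U>\<^sub>h R A C (geo_comp A B C \<psi> \<phi>) = compose (carrier (\<U>\<^sub>o R A)) (\<U>\<^sub>h R B C \<psi>) (\<U>\<^sub>h R A B \<phi>)"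
proof (rule ext)
 fix v
 interpret F: equivariant_map R A B \<phi> by fact
 interpret G: equivariant_map R B C \<psi> by fact
 show "\<U>\<^sub>h R A C (geo_comp A B C \<psi> \<phi>) v = compose (carrier (\<U>\<^sub>o R A)) (\<U>\<^sub>h R B C \<psi>) (\<U>\<^sub>h R A B \<phi>) v"
 proof (cases "v \<in> carrier F.A.U")
  case v: True
  let ?S = "{x. v x ~= \<zero>\<^bsub>A x\<^esub>}" and ?w = "\<U>\<^sub>h R A B \<phi> v"
  have w: "?w \<in> carrier F.B.U" by (rule F.forget_map_closed[OF v])
  note vc = F.A.forget_apply_closed[OF v]
  \<comment> \<open>Holds all points reached from the support of \<open>v\<close> as well as the
    support of the intermediate vector, so that both sums over \<open>y\<close> run over one finite
    set and can be exchanged with the sum over \<open>x\<close>.\<close>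
  define Y where "Y = (\<Union>x\<in>?S. {y. (x, y) \<in> map_support A B \<phi>}) \<union> {y. ?w y ~= \<zero>\<^bsub>B y\<^esub>}"
  have Y: "finite Y" using F.A.forget_finite[OF v] F.fin F.forget_map_finite[OF v] by (auto simp: Y_def)
  have S: "finite ?S" by (rule F.A.forget_finite[OF v])
  have "\<U>\<^sub>h R A C (geo_comp A B C \<psi> \<phi>) v z = \<U>\<^sub>h R B C \<psi> ?w z" for z
  proof -
   interpret Cz: left_module R "C z" by (rule G.B.fam)
   have cl: "\<psi> y z (\<phi> x y (v x)) \<in> carrier (C z)" for x y
    by (intro G.comp_closed F.comp_closed vc)
   have "\<U>\<^sub>h R A C (geo_comp A B C \<psi> \<phi>) v z = (\<Oplus>\<^bsub>C z\<^esub>x\<in>?S. geo_comp A B C \<psi> \<phi> x z (v x))"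
    using v by (simp add: forget_map_def)
   also have "... = (\<Oplus>\<^bsub>C z\<^esub>x\<in>?S. \<Oplus>\<^bsub>C z\<^esub>y\<in>Y. \<psi> y z (\<phi> x y (v x)))"
   proof (rule Cz.M.finsum_cong')
    fix x assume x: "x \<in> ?S"
    have "geo_comp A B C \<psi> \<phi> x z (v x) = (\<Oplus>\<^bsub>C z\<^esub>y\<in>{y. (x, y) \<in> map_support A B \<phi>}. \<psi> y z (\<phi> x y (v x)))"
     using vc by (simp add: geo_comp_def)
    also have "... = (\<Oplus>\<^bsub>C z\<^esub>y\<in>Y. \<psi> y z (\<phi> x y (v x)))"
     by (rule Cz.M.finsum_superset[OF Y]) (use x cl vc F.comp_support G.comp_zero in "auto simp: Y_def")
    finally show "geo_comp A B C \<psi> \<phi> x z (v x) = (\<Oplus>\<^bsub>C z\<^esub>y\<in>Y. \<psi> y z (\<phi> x y (v x)))" .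
   qed (use cl in "auto intro!: Cz.M.finsum_closed")
   also have "... = (\<Oplus>\<^bsub>C z\<^esub>y\<in>Y. \<Oplus>\<^bsub>C z\<^esub>x\<in>?S. \<psi> y z (\<phi> x y (v x)))"
    by (rule Cz.M.finsum_swap[OF S Y cl])
   also have "... = (\<Oplus>\<^bsub>C z\<^esub>y\<in>Y. \<psi> y z (?w y))"
   proof (rule Cz.M.finsum_cong')
    fix y
    show "(\<Oplus>\<^bsub>C z\<^esub>x\<in>?S. \<psi> y z (\<phi> x y (v x))) = \<psi> y z (?w y)"
     unfolding F.forget_map_eq[OF v S subset_refl]
     by (rule lmod_hom_finsum[OF F.B.fam G.B.fam G.comp, symmetric]) (simp add: F.comp_closed vc)
   qed (auto intro!: G.comp_closed F.forget_map_apply_closed v)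
   also have "... = \<U>\<^sub>h R B C \<psi> ?w z"
    by (rule G.forget_map_eq[OF w Y, symmetric]) (auto simp: Y_def)
   finally show ?thesis .
  qed
  then show ?thesis using v by (auto simp: compose_def)
 qed (auto simp: forget_map_def compose_def)
qed

lemma forget_map_add:
 assumes "equivariant_family R A" "equivariant_family R B"
  and "!!x y u. u \<in> carrier (A x) ==> \<phi> x y u \<in> carrier (B y)" "!!x y u. u \<in> carrier (A x) ==> \<psi> x y u \<in> carrier (B y)"
 shows "\<U>\<^sub>h R A B (geo_add A B \<phi> \<psi>) = (\<lambda>v\<in>carrier (\<U>\<^sub>o R A). \<U>\<^sub>h R A B \<phi> v \<oplus>\<^bsub>\<U>\<^sub>o R B\<^esub> \<U>\<^sub>h R A B \<psi> v)"
proof (rule ext)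
 fix v
 interpret A: equivariant_family R A by fact
 interpret B: equivariant_family R B by fact
 show "\<U>\<^sub>h R A B (geo_add A B \<phi> \<psi>) v = (\<lambda>v\<in>carrier (\<U>\<^sub>o R A). \<U>\<^sub>h R A B \<phi> v \<oplus>\<^bsub>\<U>\<^sub>o R B\<^esub> \<U>\<^sub>h R A B \<psi> v) v"
 proof (cases "v \<in> carrier A.U")
  case v: True
  note vc = A.forget_apply_closed[OF v]
  have "\<U>\<^sub>h R A B (geo_add A B \<phi> \<psi>) v y = \<U>\<^sub>h R A B \<phi> v y \<oplus>\<^bsub>B y\<^esub> \<U>\<^sub>h R A B \<psi> v y" for y
  proof -
   interpret By: left_module R "B y" by (rule B.fam)
   have "(\<Oplus>\<^bsub>B y\<^esub>x\<in>{x. v x ~= \<zero>\<^bsub>A x\<^esub>}. geo_add A B \<phi> \<psi> x y (v x)) =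
      (\<Oplus>\<^bsub>B y\<^esub>x\<in>{x. v x ~= \<zero>\<^bsub>A x\<^esub>}. \<phi> x y (v x) \<oplus>\<^bsub>B y\<^esub> \<psi> x y (v x))"
    by (rule By.M.finsum_cong') (use vc assms in "auto simp: geo_add_def")
   also have "... = (\<Oplus>\<^bsub>B y\<^esub>x\<in>{x. v x ~= \<zero>\<^bsub>A x\<^esub>}. \<phi> x y (v x)) \<oplus>\<^bsub>B y\<^esub> (\<Oplus>\<^bsub>B y\<^esub>x\<in>{x. v x ~= \<zero>\<^bsub>A x\<^esub>}. \<psi> x y (v x))"
    by (rule By.M.finsum_addf) (use vc assms in auto)
   finally show ?thesis using v by (simp add: forget_map_def)
  qed
  then show ?thesis using v by (auto simp: B.forget_add)
 qed (auto simp: forget_map_def)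
qed

lemma geo_comp_closed:
 assumes "equivariant_map R A B \<phi>" "equivariant_map R B C \<psi>" "u \<in> carrier (A x)"
 shows "geo_comp A B C \<psi> \<phi> x z u \<in> carrier (C z)"
proof -
 interpret F: equivariant_map R A B \<phi> by fact
 interpret G: equivariant_map R B C \<psi> by fact
 interpret Cz: left_module R "C z" by (rule G.B.fam)
 show ?thesis
  using assms(3) by (auto simp: geo_comp_def intro!: Cz.M.finsum_closed F.comp_closed G.comp_closed)
qed

lemma geo_comp_zero:
 assumes "equivariant_map R A B \<phi>" "equivariant_map R B C \<psi>"
 shows "geo_comp A B C \<psi> \<phi> x z \<zero>\<^bsub>A x\<^esub> = \<zero>\<^bsub>C z\<^esub>"
proof -
 interpret F: equivariant_map R A B \<phi> by fact
 interpret G: equivariant_map R B C \<psi> by fact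
 interpret Cz: left_module R "C z" by (rule G.B.fam)
 show ?thesis by (simp add: geo_comp_def F.comp_zero G.comp_zero Cz.M.finsum_zero)
qed

text \<open>Components are read off from the values at \<open>single x u\<close>, so this identity
  between geometric maps may be proved after forgetting geometry.\<close>

lemma geo_comp_eq_idI:
 assumes F: "equivariant_map R A A \<phi>" and G: "equivariant_map R A A \<psi>"
  and id: "compose (carrier (\<U>\<^sub>o R A)) (\<U>\<^sub>h R A A \<psi>) (\<U>\<^sub>h R A A \<phi>) = (\<lambda>v\<in>carrier (\<U>\<^sub>o R A). v)"
 shows "geo_comp A A A \<psi> \<phi> = geo_id A"
proof (rule ext, rule ext, rule ext)
 fix x z u
 interpret F: equivariant_map R A A \<phi> by fact
 interpret Az: left_module R "A z" by (rule F.A.fam)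
 show "geo_comp A A A \<psi> \<phi> x z u = geo_id A x z u"
 proof (cases "u \<in> carrier (A x)")
  case u: True
  have "geo_comp A A A \<psi> \<phi> x z u = \<U>\<^sub>h R A A (geo_comp A A A \<psi> \<phi>) (F.A.single x u) z"
   by (rule forget_map_single[symmetric])
    (use u geo_comp_zero[OF F G] geo_comp_closed[OF F G] F.A.equivariant_family_axioms in auto)
  also have "... = F.A.single x u z"
   unfolding forget_map_comp[OF F G] id using F.A.single_closed[OF u] by simp
  also have "... = geo_id A x z u"
   using u by (auto simp: F.A.single_def geo_id_def zero_map_def)
  finally show ?thesis .
 qed (auto simp: geo_comp_def geo_id_def zero_map_def)
qed

definition unforget :: "('a, 'k) ring_scheme => 'a geo_module =>
  ((real => nat => 'a) => (real => nat => 'a)) => 'a geo_map" where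
 "unforget R A h = (%x y. \<lambda>u\<in>carrier (A x). h (equivariant_family.single A x u) y)"

text \<open>Fullness must produce the two finiteness conditions. For a fixed source
  \<open>x\<close>, finitely many generators of \<open>A x\<close> go to vectors of finite support.
  For a fixed target \<open>y\<close>, translation moves the source into [0, 1], where the support
  of \<open>A\<close> is finite, and the first condition leaves finitely many translations.\<close>

lemma forget_full:
 assumes R: "ring R" and A: "A \<in> cat_obj (\<T> R)" and B: "B \<in> cat_obj (\<T> R)"
  and h: "h \<in> lmod_hom (laurent_ring R) (\<U>\<^sub>o R A) (\<U>\<^sub>o R B)"
 shows "unforget R A h \<in> cat_hom (\<T> R) A B" "\<U>\<^sub>h R A B (unforget R A h) = h"
proof -
 interpret A: equivariant_family R A by (rule geo_obj_family[OF R A])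
 interpret B: equivariant_family R B by (rule geo_obj_family[OF R B])
 interpret UA: left_module A.L A.U by (rule A.left_module_forget)
 interpret UB: left_module A.L B.U by (rule B.left_module_forget)
 let ?\<xi> = "unforget R A h"
 have hs: "h (A.single x u) \<in> carrier B.U" if "u \<in> carrier (A x)" for x u
  by (rule lmod_hom_closed[OF h A.single_closed[OF that]])
 have hlm: "h (A.single (x + of_int k) (a \<odot>\<^bsub>A x\<^esub> u)) = (%y. a \<odot>\<^bsub>B y\<^esub> h (A.single x u) (y - of_int k))"
  if "u \<in> carrier (A x)" "a \<in> carrier R" for x u a k
  using lmod_hom_smult[OF h A.lmon_closed[OF that(2), of k] A.single_closed[OF that(1)]]
  by (simp add: A.single_lmon that B.forget_lmon hs)
 have comp: "?\<xi> x y \<in> lmod_hom R (A x) (B y)" for x y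
 proof -
  interpret Ax: left_module R "A x" by (rule A.fam)
  show ?thesis
  proof (rule lmod_homI)
   fix u w assume "u \<in> carrier (A x)" "w \<in> carrier (A x)"
   then show "?\<xi> x y (u \<oplus>\<^bsub>A x\<^esub> w) = ?\<xi> x y u \<oplus>\<^bsub>B y\<^esub> ?\<xi> x y w"
    by (simp add: unforget_def A.single_add lmod_hom_add[OF h] A.single_closed B.forget_add)
  next
   fix a u assume "a \<in> carrier R" "u \<in> carrier (A x)"
   then show "?\<xi> x y (a \<odot>\<^bsub>A x\<^esub> u) = a \<odot>\<^bsub>B y\<^esub> ?\<xi> x y u"
    using hlm[of u x a 0] by (simp add: unforget_def Ax.smult_closed)
  qed (auto simp: unforget_def B.forget_apply_closed hs)
 qed
 have inv: "?\<xi> (x + of_int k) (y + of_int k) = ?\<xi> x y" for x y k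
 proof (rule ext)
  fix u
  interpret Ax: left_module R "A x" by (rule A.fam)
  have "u \<in> carrier (A x) ==> \<one>\<^bsub>R\<^esub> \<odot>\<^bsub>B (y + of_int k)\<^esub> h (A.single x u) y = h (A.single x u) y"
   using B.fam[of y] hs[THEN B.forget_apply_closed, of u x y] by (simp add: left_module.smult_one)
  then show "?\<xi> (x + of_int k) (y + of_int k) u = ?\<xi> x y u"
   using hlm[of u x "\<one>\<^bsub>R\<^esub>" k] by (simp add: unforget_def Ax.smult_one)
 qed
 have fin1: "finite {y. (x, y) \<in> map_support A B ?\<xi>}" for x
 proof -
  interpret Ax: left_module R "A x" by (rule A.fam)
  have "fg_free_module R (A x)" using A by (simp add: geo_cat_def geometric_module_def)
  then obtain n b co where bas: "free_basis R (A x) {..<n::nat} b co" by (rule Ax.fg_free_imp_basis)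
  note B' = free_basisD[OF bas]
  show ?thesis
  proof (rule finite_subset)
   show "finite (\<Union>j\<in>{..<n}. {y. h (A.single x (b j)) y ~= \<zero>\<^bsub>B y\<^esub>})"
    using B'(2) by (auto intro!: B.forget_finite hs)
   show "{y. (x, y) \<in> map_support A B ?\<xi>} \<subseteq> (\<Union>j\<in>{..<n}. {y. h (A.single x (b j)) y ~= \<zero>\<^bsub>B y\<^esub>})"
   proof (rule subsetI, rule ccontr)
    fix y assume y: "y \<in> {y. (x, y) \<in> map_support A B ?\<xi>}"
     and "y \<notin> (\<Union>j\<in>{..<n}. {y. h (A.single x (b j)) y ~= \<zero>\<^bsub>B y\<^esub>})"
    then have z: "?\<xi> x y (b j) = \<zero>\<^bsub>B y\<^esub>" if "j < n" for j
     using that B'(2) by (auto simp: unforget_def)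
    interpret By: left_module R "B y" by (rule B.fam)
    have "?\<xi> x y u = zero_map (A x) (B y) u" for u
    proof (cases "u \<in> carrier (A x)")
     case u: True
     have "?\<xi> x y (\<Oplus>\<^bsub>A x\<^esub>j\<in>{..<n}. co u j \<odot>\<^bsub>A x\<^esub> b j) = (\<Oplus>\<^bsub>B y\<^esub>j\<in>{..<n}. ?\<xi> x y (co u j \<odot>\<^bsub>A x\<^esub> b j))"
      by (rule lmod_hom_finsum[OF A.fam B.fam comp]) (use B' u in "auto simp: Ax.smult_closed")
     also have "... = (\<Oplus>\<^bsub>B y\<^esub>j\<in>{..<n}. \<zero>\<^bsub>B y\<^esub>)"
      by (rule By.M.finsum_cong') (use B' u z in "auto simp: lmod_hom_smult[OF comp]")
     finally show ?thesis using B'(4)[OF u] u by (simp add: By.M.finsum_zero zero_map_def)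
    qed (auto simp: unforget_def zero_map_def)
    then show False using y by (auto simp: map_support_def)
   qed
  qed
 qed
 have fin2: "finite {x. (x, y) \<in> map_support A B ?\<xi>}" for y
 proof (rule finite_subset)
  let ?F = "{0..1} \<inter> geo_support A"
  let ?K = "SIGMA x:?F. (%k. y - of_int k) -` {y'. (x, y') \<in> map_support A B ?\<xi>}"
  show "finite ((%(x, k). x + of_int k) ` ?K)"
   using geo_obj_finite[OF A] fin1
   by (intro finite_imageI finite_SigmaI finite_vimageI) (auto simp: inj_def)
  show "{x. (x, y) \<in> map_support A B ?\<xi>} \<subseteq> (%(x, k). x + of_int k) ` ?K"
  proof
   fix x assume x: "x \<in> {x. (x, y) \<in> map_support A B ?\<xi>}"
   have Ax: "A (frac x) = A x" by (simp add: frac_def)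
   have "x \<in> geo_support A"
   proof (rule ccontr)
    assume "x \<notin> geo_support A"
    then have c: "carrier (A x) = {\<zero>\<^bsub>A x\<^esub>}" by (simp add: geo_support_def)
    have "?\<xi> x y u = zero_map (A x) (B y) u" for u
     using lmod_hom_zero[OF A.fam B.fam comp, of x y] c
     by (cases "u = \<zero>\<^bsub>A x\<^esub>") (auto simp: zero_map_def unforget_def)
    then show False using x by (auto simp: map_support_def)
   qed
   then have "frac x \<in> ?F" using Ax frac_lt_1[of x] by (auto simp: geo_support_def less_imp_le)
   moreover have "(frac x, y - of_int \<lfloor>x\<rfloor>) \<in> map_support A B ?\<xi>"
    using x inv[of "frac x" "\<lfloor>x\<rfloor>" "y - of_int \<lfloor>x\<rfloor>"] Ax by (simp add: map_support_def frac_def)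
   ultimately show "x \<in> (%(x, k). x + of_int k) ` ?K"
    by (intro rev_image_eqI[of "(frac x, \<lfloor>x\<rfloor>)"]) (auto simp: frac_def)
  qed
 qed
 show hom: "?\<xi> \<in> cat_hom (\<T> R) A B"
  using comp fin1 fin2 inv[of _ 1] by (auto simp: geo_cat_def geometric_hom_def invariant_geo_map_def)
 interpret X: equivariant_map R A B ?\<xi> by (rule geo_hom_equivariant[OF R A B hom])
 show "\<U>\<^sub>h R A B ?\<xi> = h"
 proof (rule A.forget_hom_eqI[OF B.left_module_forget X.forget_map_hom h])
  fix x u assume u: "u \<in> carrier (A x)"
  show "\<U>\<^sub>h R A B ?\<xi> (A.single x u) = h (A.single x u)"
  proof
   fix y
   show "\<U>\<^sub>h R A B ?\<xi> (A.single x u) y = h (A.single x u) y"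
    using forget_map_single[where \<phi> = ?\<xi>, OF A.equivariant_family_axioms B.equivariant_family_axioms u
      X.comp_closed[OF u, of y] X.comp_zero[of x y]] u
    by (simp add: unforget_def)
  qed
 qed
qed

section \<open>Computing in \<open>K1\<close> by a congruence on formal combinations\<close>

section \<open>\<open>K\<^sub>1\<close> of a category\<close>

lemma K1_relgroup_zero: "0 \<in> K1_relgroup \<C>"
 unfolding K1_relgroup_def K1_gens_def
 using generate.one[of "free_Abelian_group (cat_aut \<C>)" "K1_rels \<C>"] by simp

text \<open>Closure under composition keeps the relations inside the free abelian group on
  \<open>cat_aut\<close>. The congruence \<open>\<approx>\<^sub>K\<close> defined below replaces
  calculations with cosets.\<close>

locale comp_closed_cat =
 fixes \<C> :: "('o, 'h) add_cat"
 assumes aut_comp: "(A, f) \<in> cat_aut \<C> ==> (A, g) \<in> cat_aut \<C> ==> (A, cat_comp \<C> A A A f g) \<in> cat_aut \<C>"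
begin

abbreviation N where "N \<equiv> K1_relgroup \<C>"

lemma K1_rels_keys: "z \<in> K1_rels \<C> ==> Poly_Mapping.keys z \<subseteq> cat_aut \<C>"
 unfolding K1_rels_def using aut_comp
 by (auto dest!: subsetD[OF keys_diff] subsetD[OF keys_add] split: if_splits)

lemma K1_relgroup_subgroup: "subgroup N (free_Abelian_group (cat_aut \<C>))"
 unfolding K1_relgroup_def K1_gens_def
 by (rule group.generate_is_subgroup) (use K1_rels_keys in auto)

lemma K1_relgroup_keys: "z \<in> N ==> Poly_Mapping.keys z \<subseteq> cat_aut \<C>"
 using subgroup.mem_carrier[OF K1_relgroup_subgroup] by auto

lemma K1_relgroup_add: "z \<in> N ==> w \<in> N ==> z + w \<in> N"
 using subgroup.m_closed[OF K1_relgroup_subgroup] by simp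

lemma K1_relgroup_uminus: "z \<in> N ==> - z \<in> N"
 using subgroup.m_inv_closed[OF K1_relgroup_subgroup, of z] K1_relgroup_keys[of z] by simp

lemma K1_relgroup_diff: "z \<in> N ==> w \<in> N ==> z - w \<in> N"
 using K1_relgroup_add[of z "- w"] K1_relgroup_uminus[of w] by simp

lemma K1_rels_in: "z \<in> K1_rels \<C> ==> z \<in> N"
 unfolding K1_relgroup_def K1_gens_def by (rule generate.incl)

definition equivN (infix \<open>\<approx>\<^sub>K\<close> 50) where "z \<approx>\<^sub>K w \<longleftrightarrow> z - w \<in> N"

lemma equivN_refl [simp]: "z \<approx>\<^sub>K z"
 by (simp add: equivN_def K1_relgroup_zero)

lemma equivN_sym: "z \<approx>\<^sub>K w ==> w \<approx>\<^sub>K z"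
 using K1_relgroup_uminus[of "z - w"] by (simp add: equivN_def)

lemma equivN_trans [trans]: "z \<approx>\<^sub>K w ==> w \<approx>\<^sub>K u ==> z \<approx>\<^sub>K u"
 using K1_relgroup_add[of "z - w" "w - u"] by (simp add: equivN_def)

lemma equivN_add: "z \<approx>\<^sub>K w ==> z' \<approx>\<^sub>K w' ==> z + z' \<approx>\<^sub>K w + w'"
 using K1_relgroup_add[of "z - w" "z' - w'"] by (simp add: equivN_def algebra_simps)

lemma equivN_diff: "z \<approx>\<^sub>K w ==> z' \<approx>\<^sub>K w' ==> z - z' \<approx>\<^sub>K w - w'"
 using K1_relgroup_diff[of "z - w" "z' - w'"] by (simp add: equivN_def algebra_simps)

lemma K1_coset: "N #>\<^bsub>K1_gens \<C>\<^esub> z = {n + z |n. n \<in> N}"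
 by (auto simp: r_coset_def K1_gens_def)

lemma K1_coset_eqI:
 assumes "z \<approx>\<^sub>K w" shows "N #>\<^bsub>K1_gens \<C>\<^esub> z = N #>\<^bsub>K1_gens \<C>\<^esub> w"
proof -
 have sub: "{n + z |n. n \<in> N} \<subseteq> {n + w |n. n \<in> N}" if zw: "z \<approx>\<^sub>K w" for z w
 proof
  fix y assume "y \<in> {n + z |n. n \<in> N}"
  then obtain n where n: "n \<in> N" "y = n + z" by auto
  then have "y = (n + (z - w)) + w" "n + (z - w) \<in> N"
   using zw K1_relgroup_add by (auto simp: equivN_def)
  then show "y \<in> {n + w |n. n \<in> N}" by blast
 qed
 show ?thesis
  unfolding K1_coset using sub[OF assms] sub[OF equivN_sym[OF assms]] by (rule equalityI)
qed

lemma K1_carrierE: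
 assumes "x \<in> carrier (K1 \<C>)"
 obtains z where "Poly_Mapping.keys z \<subseteq> cat_aut \<C>" "x = N #>\<^bsub>K1_gens \<C>\<^esub> z"
 using assms by (auto simp: K1_def FactGroup_def RCOSETS_def K1_gens_def)

lemma equivN_comp:
 "(A, f) \<in> cat_aut \<C> ==> (A, g) \<in> cat_aut \<C> ==>
  frag_of (A, cat_comp \<C> A A A f g) \<approx>\<^sub>K frag_of (A, f) + frag_of (A, g)"
 unfolding equivN_def by (rule K1_rels_in) (auto simp: K1_rels_def)

lemma equivN_exact:
 assumes "(A, a) \<in> cat_aut \<C>" "(B, b) \<in> cat_aut \<C>" "(C, c) \<in> cat_aut \<C>" "split_exact \<C> A B C i p"
  "cat_comp \<C> A B B b i = cat_comp \<C> A A B i a" "cat_comp \<C> B B C p b = cat_comp \<C> B C C c p"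
 shows "frag_of (B, b) \<approx>\<^sub>K frag_of (A, a) + frag_of (C, c)"
 unfolding equivN_def by (rule K1_rels_in) (use assms in "auto simp: K1_rels_def")

text \<open>From f f = f one gets [f] = 2 [f]. This covers identity maps.\<close>

lemma equivN_idem:
 assumes f: "(A, f) \<in> cat_aut \<C>" and "cat_comp \<C> A A A f f = f"
 shows "frag_of (A, f) \<approx>\<^sub>K 0"
proof -
 have "frag_of (A, f) \<approx>\<^sub>K frag_of (A, f) + frag_of (A, f)"
  using equivN_comp[OF f f] assms(2) by simp
 from equivN_diff[OF this equivN_refl[of "frag_of (A, f)"]]
 have "0 \<approx>\<^sub>K frag_of (A, f)" by simp
 then show ?thesis by (rule equivN_sym)
qed

end

text \<open>The image of a coset, enlarged by the relations of the target, is a single coset once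
  relations go to relations. The induction over \<open>generate\<close> passes from the defining
  relations to the whole relation group.\<close>

lemma K1_map_class:
 assumes C: "comp_closed_cat \<C>" and D: "comp_closed_cat \<D>"
  and rels: "!!z. z \<in> K1_rels \<C> ==> frag_extend (%(A, f). frag_of (Fo A, Fh A A f)) z \<in> K1_relgroup \<D>"
 shows "K1_map \<D> Fo Fh (K1_class \<C> A f) = K1_relgroup \<D> #>\<^bsub>K1_gens \<D>\<^esub> frag_of (Fo A, Fh A A f)"
proof -
 interpret C: comp_closed_cat \<C> by fact
 interpret D: comp_closed_cat \<D> by fact
 let ?F = "frag_extend (%(A, f). frag_of (Fo A, Fh A A f))"
 have N: "?F z \<in> D.N" if "z \<in> C.N" for z
  using that unfolding K1_relgroup_def[of \<C>] K1_gens_def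
 proof (induction z rule: generate.induct)
  case one
  then show ?case by (simp add: K1_relgroup_zero)
 next
  case (incl h)
  then show ?case by (rule rels)
 next
  case (inv h)
  then show ?case using D.K1_relgroup_uminus[OF rels[OF inv]] C.K1_rels_keys[OF inv]
   by (simp add: frag_extend_minus)
 next
  case (eng h k)
  then show ?case by (simp add: frag_extend_add D.K1_relgroup_add)
 qed
 have "K1_map \<D> Fo Fh (K1_class \<C> A f) = {n + ?F (m + frag_of (A, f)) |n m. n \<in> D.N & m \<in> C.N}"
  unfolding K1_map_def K1_class_def C.K1_coset by (auto simp: set_mult_def K1_gens_def)
 also have "... = {n + frag_of (Fo A, Fh A A f) |n. n \<in> D.N}"
 proof (intro equalityI subsetI)
  fix y assume "y \<in> {n + ?F (m + frag_of (A, f)) |n m. n \<in> D.N & m \<in> C.N}"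
  then obtain n m where "n \<in> D.N" "m \<in> C.N" "y = n + ?F (m + frag_of (A, f))" by blast
  then have "y = (n + ?F m) + frag_of (Fo A, Fh A A f)" "n + ?F m \<in> D.N"
   using D.K1_relgroup_add N by (auto simp: frag_extend_add)
  then show "y \<in> {n + frag_of (Fo A, Fh A A f) |n. n \<in> D.N}" by blast
 next
  fix y assume "y \<in> {n + frag_of (Fo A, Fh A A f) |n. n \<in> D.N}"
  then obtain n where "n \<in> D.N" "y = n + ?F (0 + frag_of (A, f))" by auto
  then show "y \<in> {n + ?F (m + frag_of (A, f)) |n m. n \<in> D.N & m \<in> C.N}"
   using K1_relgroup_zero[of \<C>] by blast
 qed
 finally show ?thesis by (simp add: D.K1_coset)
qed

subsection \<open>Free modules\<close>

lemma free_mod_cat_simps: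
 "cat_obj (free_mod_cat R) = {M. fg_free_module R M}"
 "cat_hom (free_mod_cat R) = lmod_hom R"
 "cat_id (free_mod_cat R) M = (\<lambda>x\<in>carrier M. x)"
 "cat_comp (free_mod_cat R) K M P g f = compose (carrier K) g f"
 "cat_add (free_mod_cat R) M P f g = (\<lambda>x\<in>carrier M. f x \<oplus>\<^bsub>P\<^esub> g x)"
 by (auto simp: free_mod_cat_def)

lemma free_mod_aut_iff:
 "(M, f) \<in> cat_aut (free_mod_cat R) \<longleftrightarrow> fg_free_module R M & f \<in> lmod_hom R M M \<and>
  (\<exists>g\<in>lmod_hom R M M. (\<forall>x\<in>carrier M. g (f x) = x) & (\<forall>x\<in>carrier M. f (g x) = x))"
proof -
 have "compose (carrier M) g f = (\<lambda>x\<in>carrier M. x) \<longleftrightarrow> (\<forall>x\<in>carrier M. g (f x) = x)" for f g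
  by (auto simp: compose_def fun_eq_iff)
 then show ?thesis
  by (auto simp: cat_aut_def cat_inverse_pair_def free_mod_cat_simps)
qed

lemma free_mod_comp_closed: "comp_closed_cat (free_mod_cat R)"
proof
 fix M f g assume fg: "(M, f) \<in> cat_aut (free_mod_cat R)" "(M, g) \<in> cat_aut (free_mod_cat R)"
 then obtain f' g' where f': "f' \<in> lmod_hom R M M" "\<forall>x\<in>carrier M. f' (f x) = x" "\<forall>x\<in>carrier M. f (f' x) = x"
  and g': "g' \<in> lmod_hom R M M" "\<forall>x\<in>carrier M. g' (g x) = x" "\<forall>x\<in>carrier M. g (g' x) = x"
  unfolding free_mod_aut_iff by blast
 have M: "left_module R M" and f: "f \<in> lmod_hom R M M" and g: "g \<in> lmod_hom R M M"
  using fg by (auto simp: free_mod_aut_iff fg_free_module_def)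
 note cl = lmod_hom_closed[OF f] lmod_hom_closed[OF g] lmod_hom_closed[OF f'(1)] lmod_hom_closed[OF g'(1)]
 show "(M, cat_comp (free_mod_cat R) M M M f g) \<in> cat_aut (free_mod_cat R)"
  unfolding free_mod_aut_iff
  by (intro conjI bexI[of _ "compose (carrier M) g' f'"] lmod_hom_compose[OF M])
   (use fg f' g' f g cl in \<open>auto simp: free_mod_aut_iff free_mod_cat_simps compose_def intro: lmod_hom_compose[OF M]
    lmod_hom_compose[OF M, unfolded compose_def]\<close>)
qed

abbreviation mod_eq ::
  "('a, 'k) ring_scheme => ((('a, 'm) module \<times> ('m => 'm)) \<Rightarrow>\<^sub>0 int) => ((('a, 'm) module \<times> ('m => 'm)) \<Rightarrow>\<^sub>0 int) => bool"
 where "mod_eq R \<equiv> comp_closed_cat.equivN (free_mod_cat R)"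

text \<open>The exactness relation in elementwise form, which spares its users the extensional
  composites.\<close>

lemma equivN_free_exact:
 fixes A B C :: "('a, 'm) module"
 assumes auts: "(A, a) \<in> cat_aut (free_mod_cat R)" "(B, b) \<in> cat_aut (free_mod_cat R)"
   "(C, c) \<in> cat_aut (free_mod_cat R)"
  and homs: "i \<in> lmod_hom R A B" "p \<in> lmod_hom R B C" "r \<in> lmod_hom R B A" "s \<in> lmod_hom R C B"
  and ri: "!!x. x \<in> carrier A ==> r (i x) = x" and ps: "!!x. x \<in> carrier C ==> p (s x) = x"
  and dec: "!!x. x \<in> carrier B ==> i (r x) \<oplus>\<^bsub>B\<^esub> s (p x) = x"
  and bi: "!!x. x \<in> carrier A ==> b (i x) = i (a x)" and pb: "!!x. x \<in> carrier B ==> p (b x) = c (p x)"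
 shows "mod_eq R (frag_of (B, b)) (frag_of (A, a) + frag_of (C, c))"
proof (rule comp_closed_cat.equivN_exact[OF free_mod_comp_closed auts])
 show "split_exact (free_mod_cat R) A B C i p"
  unfolding split_exact_def free_mod_cat_simps
  by (intro conjI homs bexI[of _ r] bexI[of _ s])
   (use ri ps dec in "auto simp: compose_def fun_eq_iff")
qed (use bi pb in "auto simp: free_mod_cat_simps compose_def fun_eq_iff")

text \<open>An isomorphism is a split exact sequence with zero quotient. The zero submodule of
  \<open>B\<close> provides a zero object with carrier in the right type, and its identity has
  trivial class.\<close>

lemma equivN_free_iso:
 fixes A B :: "('a, 'm) module"
 assumes auts: "(A, a) \<in> cat_aut (free_mod_cat R)" "(B, b) \<in> cat_aut (free_mod_cat R)"
  and homs: "h \<in> lmod_hom R A B" "k \<in> lmod_hom R B A"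
  and kh: "!!x. x \<in> carrier A ==> k (h x) = x" and hk: "!!x. x \<in> carrier B ==> h (k x) = x"
  and bh: "!!x. x \<in> carrier A ==> b (h x) = h (a x)"
 shows "mod_eq R (frag_of (B, b)) (frag_of (A, a))"
proof -
 interpret K: comp_closed_cat "free_mod_cat R" by (rule free_mod_comp_closed)
 have B: "left_module R B" using auts by (auto simp: free_mod_aut_iff fg_free_module_def)
 interpret B: left_module R B by (rule B)
 let ?Z = "B\<lparr>carrier := {\<zero>\<^bsub>B\<^esub>}\<rparr>"
 let ?z = "\<lambda>x\<in>{\<zero>\<^bsub>B\<^esub>}. x"
 have "submod R B {\<zero>\<^bsub>B\<^esub>}" by (rule submodI) auto
 from left_module_submod[OF B this] have Z: "left_module R ?Z" .
 interpret Z: left_module R ?Z by (rule Z)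
 have "free_basis R ?Z {} (%j. undefined) (%m j. undefined)"
  using Z.M.finsum_empty by (auto simp: free_basis_def)
 then have fZ: "fg_free_module R ?Z" by (rule Z.basis_imp_fg_free)
 have z: "(?Z, ?z) \<in> cat_aut (free_mod_cat R)"
  unfolding free_mod_aut_iff using fZ lmod_hom_id[OF Z] by (auto intro!: bexI[of _ ?z])
 have b: "b \<in> lmod_hom R B B" using auts by (simp add: free_mod_aut_iff)
 have "mod_eq R (frag_of (B, b)) (frag_of (A, a) + frag_of (?Z, ?z))"
 proof (rule equivN_free_exact[OF auts z homs(1) _ homs(2)])
  show "(\<lambda>x\<in>carrier B. \<zero>\<^bsub>B\<^esub>) \<in> lmod_hom R B ?Z" by (rule lmod_homI) (auto simp: B.smult_closed)
  show "?z \<in> lmod_hom R ?Z B" by (rule lmod_homI) auto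
 qed (use kh hk bh lmod_hom_closed[OF b] lmod_hom_closed[OF homs(1)] in auto)
 moreover have "mod_eq R (frag_of (?Z, ?z)) 0"
  by (rule K.equivN_idem[OF z]) (auto simp: free_mod_cat_simps compose_def)
 ultimately show ?thesis
  using K.equivN_trans K.equivN_add[OF K.equivN_refl, of "frag_of (?Z, ?z)" 0 "frag_of (A, a)"] by fastforce
qed

lemma equivN_free_id:
 assumes "fg_free_module R M"
 shows "mod_eq R (frag_of (M, \<lambda>x\<in>carrier M. x)) 0"
proof (rule comp_closed_cat.equivN_idem[OF free_mod_comp_closed])
 have "left_module R M" using assms by (simp add: fg_free_module_def)
 then show "(M, \<lambda>x\<in>carrier M. x) \<in> cat_aut (free_mod_cat R)"
  unfolding free_mod_aut_iff using assms by (auto simp: lmod_hom_id intro!: bexI[of _ "\<lambda>x\<in>carrier M. x"])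
qed (auto simp: free_mod_cat_simps compose_def)

subsection \<open>The map induced by forgetting geometry\<close>

lemma geo_cat_simps:
 "cat_id (\<T> R) = geo_id" "cat_comp (\<T> R) = geo_comp" "cat_add (\<T> R) = geo_add"
 by (auto simp: geo_cat_def)

lemma forget_aut:
 assumes R: "ring R" and f: "(A, \<phi>) \<in> cat_aut (\<T> R)"
 shows "(\<U>\<^sub>o R A, \<U>\<^sub>h R A A \<phi>) \<in> cat_aut (laurent_free_cat R)"
proof -
 from f obtain \<psi> where A: "A \<in> cat_obj (\<T> R)" and p: "cat_inverse_pair (\<T> R) A \<phi> \<psi>"
  by (auto simp: cat_aut_def)
 interpret F: equivariant_map R A A \<phi>
  using p by (intro geo_hom_equivariant[OF R A A]) (auto simp: cat_inverse_pair_def)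
 interpret G: equivariant_map R A A \<psi>
  using p by (intro geo_hom_equivariant[OF R A A]) (auto simp: cat_inverse_pair_def)
 have "compose (carrier F.A.U) (\<U>\<^sub>h R A A \<psi>) (\<U>\<^sub>h R A A \<phi>) = (\<lambda>v\<in>carrier F.A.U. v)"
  "compose (carrier F.A.U) (\<U>\<^sub>h R A A \<phi>) (\<U>\<^sub>h R A A \<psi>) = (\<lambda>v\<in>carrier F.A.U. v)"
  using p forget_map_id[OF F.A.equivariant_family_axioms]
   forget_map_comp[OF F.equivariant_map_axioms G.equivariant_map_axioms]
   forget_map_comp[OF G.equivariant_map_axioms F.equivariant_map_axioms]
  by (auto simp: cat_inverse_pair_def geo_cat_simps)
 then show ?thesis
  using F.forget_map_hom G.forget_map_hom fg_free_forget[OF R A]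
  by (auto simp: cat_aut_def cat_inverse_pair_def free_mod_cat_simps)
qed

text \<open>Once the composite is recognised as the matrix of the composed linear map,
  \<open>forget_full\<close> delivers its finiteness conditions.\<close>

lemma geo_comp_hom:
 assumes R: "ring R" and A: "A \<in> cat_obj (\<T> R)" and B: "B \<in> cat_obj (\<T> R)" and C: "C \<in> cat_obj (\<T> R)"
  and f: "\<phi> \<in> cat_hom (\<T> R) A B" and g: "\<psi> \<in> cat_hom (\<T> R) B C"
 shows "geo_comp A B C \<psi> \<phi> \<in> cat_hom (\<T> R) A C"
proof -
 interpret F: equivariant_map R A B \<phi> by (rule geo_hom_equivariant[OF R A B f])
 interpret G: equivariant_map R B C \<psi> by (rule geo_hom_equivariant[OF R B C g])
 have h: "compose (carrier F.A.U) (\<U>\<^sub>h R B C \<psi>) (\<U>\<^sub>h R A B \<phi>) \<in> lmod_hom F.A.L F.A.U G.B.U"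
  by (rule lmod_hom_compose[OF F.A.left_module_forget F.forget_map_hom G.forget_map_hom])
 have "geo_comp A B C \<psi> \<phi> = unforget R A (compose (carrier F.A.U) (\<U>\<^sub>h R B C \<psi>) (\<U>\<^sub>h R A B \<phi>))"
 proof (rule ext, rule ext, rule ext)
  fix x z u
  show "geo_comp A B C \<psi> \<phi> x z u = unforget R A (compose (carrier F.A.U) (\<U>\<^sub>h R B C \<psi>) (\<U>\<^sub>h R A B \<phi>)) x z u"
  proof (cases "u \<in> carrier (A x)")
   case u: True
   note e = F.equivariant_map_axioms G.equivariant_map_axioms
   show ?thesis
    unfolding forget_map_comp[OF e, symmetric]
    using forget_map_single[where \<phi> = "geo_comp A B C \<psi> \<phi>", OF F.A.equivariant_family_axioms G.B.equivariant_family_axioms u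
      geo_comp_closed[OF e u, of z] geo_comp_zero[OF e, of x z]] u
    by (simp add: unforget_def)
  qed (auto simp: geo_comp_def unforget_def)
 qed
 then show ?thesis using forget_full(1)[OF R A C h] by simp
qed

text \<open>The candidate inverse of f g is g' f'; that it works is a pointwise computation after
  forgetting geometry.\<close>

lemma geo_cat_comp_closed:
 assumes R: "ring R" shows "comp_closed_cat (\<T> R)"
proof
 fix A f g assume f: "(A, f) \<in> cat_aut (\<T> R)" and g: "(A, g) \<in> cat_aut (\<T> R)"
 from f obtain f' where A: "A \<in> cat_obj (\<T> R)" and f': "cat_inverse_pair (\<T> R) A f f'"
  by (auto simp: cat_aut_def)
 from g obtain g' where g': "cat_inverse_pair (\<T> R) A g g'"
  by (auto simp: cat_aut_def)
 note homs = f'[unfolded cat_inverse_pair_def geo_cat_simps] g'[unfolded cat_inverse_pair_def geo_cat_simps]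
 have hom: "geo_comp A A A f g \<in> cat_hom (\<T> R) A A" "geo_comp A A A g' f' \<in> cat_hom (\<T> R) A A"
  using homs geo_comp_hom[OF R A A A] by blast+
 note eq = geo_hom_equivariant[OF R A A]
 have e: "equivariant_map R A A f" "equivariant_map R A A g" "equivariant_map R A A f'" "equivariant_map R A A g'"
  "equivariant_map R A A (geo_comp A A A f g)" "equivariant_map R A A (geo_comp A A A g' f')"
  using homs hom eq by blast+
 interpret F: equivariant_map R A A f by (rule e)
 interpret G: equivariant_map R A A g by (rule e)
 interpret F': equivariant_map R A A f' by (rule e)
 interpret G': equivariant_map R A A g' by (rule e)
 have id: "compose (carrier F.A.U) (\<U>\<^sub>h R A A f') (\<U>\<^sub>h R A A f) = (\<lambda>v\<in>carrier F.A.U. v)"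
  "compose (carrier F.A.U) (\<U>\<^sub>h R A A f) (\<U>\<^sub>h R A A f') = (\<lambda>v\<in>carrier F.A.U. v)"
  "compose (carrier F.A.U) (\<U>\<^sub>h R A A g') (\<U>\<^sub>h R A A g) = (\<lambda>v\<in>carrier F.A.U. v)"
  "compose (carrier F.A.U) (\<U>\<^sub>h R A A g) (\<U>\<^sub>h R A A g') = (\<lambda>v\<in>carrier F.A.U. v)"
  using homs forget_map_id[OF F.A.equivariant_family_axioms] forget_map_comp e by metis+
 note pt = id[THEN fun_cong, unfolded compose_def]
 have pw: "\<U>\<^sub>h R A A f' (\<U>\<^sub>h R A A f v) = v" "\<U>\<^sub>h R A A f (\<U>\<^sub>h R A A f' v) = v"
   "\<U>\<^sub>h R A A g' (\<U>\<^sub>h R A A g v) = v" "\<U>\<^sub>h R A A g (\<U>\<^sub>h R A A g' v) = v" if "v \<in> carrier F.A.U" for v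
  using pt[of v] that by auto
 have "cat_inverse_pair (\<T> R) A (geo_comp A A A f g) (geo_comp A A A g' f')"
  unfolding cat_inverse_pair_def geo_cat_simps
  by (intro conjI hom geo_comp_eq_idI[where R = R] e)
   (auto simp: forget_map_comp e compose_def fun_eq_iff pw F.forget_map_closed G.forget_map_closed
    F'.forget_map_closed G'.forget_map_closed)
 then show "(A, cat_comp (\<T> R) A A A f g) \<in> cat_aut (\<T> R)"
  using A by (auto simp: cat_aut_def geo_cat_simps)
qed

lemma forget_split_exact:
 assumes R: "ring R" and A: "A \<in> cat_obj (\<T> R)" and B: "B \<in> cat_obj (\<T> R)" and C: "C \<in> cat_obj (\<T> R)"
  and ex: "split_exact (\<T> R) A B C i p"
 shows "split_exact (laurent_free_cat R) (\<U>\<^sub>o R A) (\<U>\<^sub>o R B) (\<U>\<^sub>o R C) (\<U>\<^sub>h R A B i) (\<U>\<^sub>h R B C p)"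
proof -
 obtain r s where i: "i \<in> cat_hom (\<T> R) A B" and p: "p \<in> cat_hom (\<T> R) B C"
  and r: "r \<in> cat_hom (\<T> R) B A" and s: "s \<in> cat_hom (\<T> R) C B"
  and eqs: "geo_comp A B A r i = geo_id A" "geo_comp C B C p s = geo_id C"
   "geo_add B B (geo_comp B A B i r) (geo_comp B C B s p) = geo_id B"
  using ex by (auto simp: split_exact_def geo_cat_simps)
 interpret I: equivariant_map R A B i by (rule geo_hom_equivariant[OF R A B i])
 interpret P: equivariant_map R B C p by (rule geo_hom_equivariant[OF R B C p])
 interpret Q: equivariant_map R B A r by (rule geo_hom_equivariant[OF R B A r])
 interpret S: equivariant_map R C B s by (rule geo_hom_equivariant[OF R C B s])
 note ax = I.equivariant_map_axioms P.equivariant_map_axioms Q.equivariant_map_axioms S.equivariant_map_axioms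
 have "compose (carrier I.A.U) (\<U>\<^sub>h R B A r) (\<U>\<^sub>h R A B i) = (\<lambda>x\<in>carrier I.A.U. x)"
  using forget_map_comp[OF ax(1,3)] forget_map_id[OF I.A.equivariant_family_axioms] eqs by simp
 moreover have "compose (carrier P.B.U) (\<U>\<^sub>h R B C p) (\<U>\<^sub>h R C B s) = (\<lambda>x\<in>carrier P.B.U. x)"
  using forget_map_comp[OF ax(4,2)] forget_map_id[OF P.B.equivariant_family_axioms] eqs by simp
 moreover have "(\<lambda>x\<in>carrier I.B.U. compose (carrier I.B.U) (\<U>\<^sub>h R A B i) (\<U>\<^sub>h R B A r) x \<oplus>\<^bsub>I.B.U\<^esub>
    compose (carrier I.B.U) (\<U>\<^sub>h R C B s) (\<U>\<^sub>h R B C p) x) = (\<lambda>x\<in>carrier I.B.U. x)"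
  using forget_map_add[where \<phi> = "geo_comp B A B i r" and \<psi> = "geo_comp B C B s p",
    OF I.B.equivariant_family_axioms I.B.equivariant_family_axioms
    geo_comp_closed[OF ax(3,1)] geo_comp_closed[OF ax(2,4)]]
   forget_map_comp[OF ax(3,1)] forget_map_comp[OF ax(2,4)]
   forget_map_id[OF I.B.equivariant_family_axioms] eqs by simp
 ultimately show ?thesis
  unfolding split_exact_def free_mod_cat_simps
  using I.forget_map_hom P.forget_map_hom Q.forget_map_hom S.forget_map_hom by blast
qed

text \<open>The functor sends each of the two kinds of relation to a relation of the same kind, so
  \<open>K1_map_class\<close> applies.\<close>

lemma forget_K1_class:
 assumes R: "ring R"
 shows "\<U> R (K1_class (\<T> R) A \<phi>) =
  K1_relgroup (laurent_free_cat R) #>\<^bsub>K1_gens (laurent_free_cat R)\<^esub> frag_of (\<U>\<^sub>o R A, \<U>\<^sub>h R A A \<phi>)"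
 unfolding forget_K1_def
proof (rule K1_map_class[OF geo_cat_comp_closed[OF R] free_mod_comp_closed])
 interpret D: comp_closed_cat "laurent_free_cat R" by (rule free_mod_comp_closed)
 let ?F = "frag_extend (%(A, f). frag_of (\<U>\<^sub>o R A, \<U>\<^sub>h R A A f))"
 have eq: "equivariant_map R A B f" if "f \<in> cat_hom (\<T> R) A B" "A \<in> cat_obj (\<T> R)" "B \<in> cat_obj (\<T> R)" for A B f
  by (rule geo_hom_equivariant[OF R that(2,3,1)])
 have aut: "A \<in> cat_obj (\<T> R)" "equivariant_map R A A f" if "(A, f) \<in> cat_aut (\<T> R)" for A f
  using that eq by (auto simp: cat_aut_def cat_inverse_pair_def)
 fix z assume "z \<in> K1_rels (\<T> R)"
 then consider
  (comp) A f g where "z = frag_of (A, geo_comp A A A f g) - (frag_of (A, f) + frag_of (A, g))"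
   "(A, f) \<in> cat_aut (\<T> R)" "(A, g) \<in> cat_aut (\<T> R)"
 | (exact) A B C a b c i p where "z = frag_of (B, b) - (frag_of (A, a) + frag_of (C, c))"
   "(A, a) \<in> cat_aut (\<T> R)" "(B, b) \<in> cat_aut (\<T> R)" "(C, c) \<in> cat_aut (\<T> R)"
   "split_exact (\<T> R) A B C i p" "geo_comp A B B b i = geo_comp A A B i a"
   "geo_comp B B C p b = geo_comp B C C c p"
  unfolding K1_rels_def geo_cat_simps by blast
 then show "?F z \<in> D.N"
 proof cases
  case comp
  then show ?thesis
   using D.equivN_comp[OF forget_aut[OF R comp(2)] forget_aut[OF R comp(3)]]
    forget_map_comp[OF aut(2)[OF comp(3)] aut(2)[OF comp(2)]]
   by (simp add: frag_extend_diff frag_extend_add D.equivN_def free_mod_cat_simps)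
 next
  case exact
  note obj = aut(1)[OF exact(2)] aut(1)[OF exact(3)] aut(1)[OF exact(4)]
  note a = aut(2)[OF exact(2)] note b = aut(2)[OF exact(3)] note c = aut(2)[OF exact(4)]
  have i: "equivariant_map R A B i" and p: "equivariant_map R B C p"
   using exact(5) eq obj by (auto simp: split_exact_def)
  show ?thesis
   using D.equivN_exact[OF forget_aut[OF R exact(2)] forget_aut[OF R exact(3)] forget_aut[OF R exact(4)]
     forget_split_exact[OF R obj exact(5)]] exact(1,6,7)
    forget_map_comp[OF i b] forget_map_comp[OF a i] forget_map_comp[OF b p] forget_map_comp[OF p c]
   by (simp add: frag_extend_diff frag_extend_add D.equivN_def free_mod_cat_simps)
 qed
qed

section \<open>The endomorphism ring of a left module\<close>

section \<open>Endomorphism rings\<close>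

definition end_ring :: "('a, 'k) ring_scheme => ('a, 'm) module => ('m => 'm) ring" where
 "end_ring R M = \<lparr>carrier = lmod_hom R M M, monoid.mult = (%f g. compose (carrier M) f g),
   monoid.one = (\<lambda>x\<in>carrier M. x), ring.zero = (\<lambda>x\<in>carrier M. \<zero>\<^bsub>M\<^esub>),
   ring.add = (%f g. \<lambda>x\<in>carrier M. f x \<oplus>\<^bsub>M\<^esub> g x)\<rparr>"

lemma end_ring_carrier: "carrier (end_ring R M) = lmod_hom R M M"
 by (simp add: end_ring_def)

lemma end_mult_apply: "x \<in> carrier M ==> (f \<otimes>\<^bsub>end_ring R M\<^esub> g) x = f (g x)"
 and end_add_apply: "x \<in> carrier M ==> (f \<oplus>\<^bsub>end_ring R M\<^esub> g) x = f x \<oplus>\<^bsub>M\<^esub> g x"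
 and end_one_apply: "x \<in> carrier M ==> \<one>\<^bsub>end_ring R M\<^esub> x = x"
 and end_zero_apply: "x \<in> carrier M ==> \<zero>\<^bsub>end_ring R M\<^esub> x = \<zero>\<^bsub>M\<^esub>"
 by (simp_all add: end_ring_def compose_def)

context left_module
begin

lemma end_closed: "f \<in> carrier (end_ring R M) ==> x \<in> carrier M ==> f x \<in> carrier M"
 by (auto simp: end_ring_carrier lmod_hom_closed)

lemma end_eqI:
 assumes "f \<in> carrier (end_ring R M)" "g \<in> carrier (end_ring R M)" "!!x. x \<in> carrier M ==> f x = g x"
 shows "f = g"
 using lmod_hom_eqI[of f R M M g M] assms by (simp add: end_ring_carrier)

lemma ring_end: "ring (end_ring R M)"
proof -
 note hom = lmod_hom_compose[OF is_left_module] lmod_hom_id[OF is_left_module]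
  lmod_hom_zero_map[OF is_left_module is_left_module] lmod_hom_sum[OF is_left_module is_left_module]
  lmod_hom_minus_map[OF is_left_module is_left_module]
 have cl: "f \<otimes>\<^bsub>end_ring R M\<^esub> g \<in> carrier (end_ring R M)" "f \<oplus>\<^bsub>end_ring R M\<^esub> g \<in> carrier (end_ring R M)"
  if "f \<in> carrier (end_ring R M)" "g \<in> carrier (end_ring R M)" for f g
  using that hom by (auto simp: end_ring_def)
 have cl0: "\<zero>\<^bsub>end_ring R M\<^esub> \<in> carrier (end_ring R M)" "\<one>\<^bsub>end_ring R M\<^esub> \<in> carrier (end_ring R M)"
  using hom by (auto simp: end_ring_def)
 note apply_simps = end_mult_apply end_add_apply end_one_apply end_zero_apply
 have ab: "abelian_group (end_ring R M)"
 proof (rule abelian_groupI)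
  fix f assume f: "f \<in> carrier (end_ring R M)"
  have m: "(\<lambda>x\<in>carrier M. \<ominus>\<^bsub>M\<^esub> f x) \<in> carrier (end_ring R M)"
   using f hom by (auto simp: end_ring_def)
  have "(\<lambda>x\<in>carrier M. \<ominus>\<^bsub>M\<^esub> f x) \<oplus>\<^bsub>end_ring R M\<^esub> f = \<zero>\<^bsub>end_ring R M\<^esub>"
   by (rule end_eqI[OF cl(2)[OF m f] cl0(1)]) (use f end_closed in "auto simp: apply_simps M.l_neg")
  then show "\<exists>g\<in>carrier (end_ring R M). g \<oplus>\<^bsub>end_ring R M\<^esub> f = \<zero>\<^bsub>end_ring R M\<^esub>" using m by blast
 qed (auto simp: cl cl0 apply_simps end_closed M.a_ac intro!: end_eqI)
 have mon: "monoid (end_ring R M)"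
  by (rule monoidI) (auto simp: cl cl0 apply_simps end_closed intro!: end_eqI)
 show ?thesis
 proof (rule ringI[OF ab mon])
  fix f g h assume "f \<in> carrier (end_ring R M)" "g \<in> carrier (end_ring R M)" "h \<in> carrier (end_ring R M)"
  then show "(f \<oplus>\<^bsub>end_ring R M\<^esub> g) \<otimes>\<^bsub>end_ring R M\<^esub> h =
     f \<otimes>\<^bsub>end_ring R M\<^esub> h \<oplus>\<^bsub>end_ring R M\<^esub> g \<otimes>\<^bsub>end_ring R M\<^esub> h"
   "h \<otimes>\<^bsub>end_ring R M\<^esub> (f \<oplus>\<^bsub>end_ring R M\<^esub> g) =
     h \<otimes>\<^bsub>end_ring R M\<^esub> f \<oplus>\<^bsub>end_ring R M\<^esub> h \<otimes>\<^bsub>end_ring R M\<^esub> g"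
   by (auto simp: cl cl0 apply_simps end_closed lmod_hom_add[of h R M M] end_ring_carrier[symmetric]
     intro!: end_eqI)
 qed
qed

lemma end_uminus_apply:
 assumes f: "f \<in> carrier (end_ring R M)" and x: "x \<in> carrier M"
 shows "(\<ominus>\<^bsub>end_ring R M\<^esub> f) x = \<ominus>\<^bsub>M\<^esub> f x"
proof -
 interpret E: ring "end_ring R M" by (rule ring_end)
 have "(\<ominus>\<^bsub>end_ring R M\<^esub> f) x \<oplus>\<^bsub>M\<^esub> f x = (\<ominus>\<^bsub>end_ring R M\<^esub> f \<oplus>\<^bsub>end_ring R M\<^esub> f) x"
  using x by (simp add: end_add_apply)
 also have "... = \<zero>\<^bsub>M\<^esub>" using f x by (simp add: E.l_neg end_zero_apply)
 finally show ?thesis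
  using M.minus_equality end_closed[OF E.a_inv_closed[OF f] x] end_closed[OF f x] by simp
qed

lemma end_minus_apply:
 assumes f: "f \<in> carrier (end_ring R M)" and g: "g \<in> carrier (end_ring R M)" and x: "x \<in> carrier M"
 shows "(f \<ominus>\<^bsub>end_ring R M\<^esub> g) x = f x \<ominus>\<^bsub>M\<^esub> g x"
 using assms by (simp add: a_minus_def end_add_apply end_uminus_apply)

lemma end_finsum_apply:
 assumes "!!i. i \<in> A ==> f i \<in> carrier (end_ring R M)" and x: "x \<in> carrier M"
 shows "(\<Oplus>\<^bsub>end_ring R M\<^esub>i\<in>A. f i) x = (\<Oplus>\<^bsub>M\<^esub>i\<in>A. f i x)"
proof -
 interpret E: ring "end_ring R M" by (rule ring_end)
 show ?thesis
  by (rule finsum_additive[where h = "%f. f x"])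
   (use assms E.abelian_monoid_axioms M.abelian_monoid_axioms in
    \<open>auto simp: end_closed end_add_apply end_zero_apply\<close>)
qed

end

section \<open>The stable ring: endomorphisms in countable rank, constants and coefficients\<close>

section \<open>Standard free modules\<close>

text \<open>Vectors have finite support even for infinite \<open>J\<close>, so this is the free
  module and not a product. All ranks share one type, with the finite ones inside the countable
  one.\<close>

definition free_on :: "('a, 'k) ring_scheme => nat set => ('a, nat => 'a) module" where
 "free_on R J = \<lparr>carrier = {u. (\<forall>i. u i \<in> carrier R) & (\<forall>i. i \<notin> J \<longrightarrow> u i = \<zero>\<^bsub>R\<^esub>) & finite {i. u i ~= \<zero>\<^bsub>R\<^esub>}},
   monoid.mult = undefined, monoid.one = undefined, ring.zero = (%i. \<zero>\<^bsub>R\<^esub>),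
   ring.add = (%u w i. u i \<oplus>\<^bsub>R\<^esub> w i), smult = (%a u i. a \<otimes>\<^bsub>R\<^esub> u i)\<rparr>"

definition unit_vec :: "('a, 'k) ring_scheme => nat => nat => 'a" where
 "unit_vec R i = (%j. if j = i then \<one>\<^bsub>R\<^esub> else \<zero>\<^bsub>R\<^esub>)"

text \<open>The basis vector \<open>i\<close> sits on the orbit of \<open>pos i\<close>. For finite
  \<open>J\<close> the positions influence only the lengths of maps: after forgetting geometry all
  choices become isomorphic through \<open>reposition\<close>.\<close>

definition std_geo :: "('a, 'k) ring_scheme => (nat => real) => nat set => 'a geo_module" where
 "std_geo R pos J = (%x. free_on R {i \<in> J. x - pos i \<in> \<int>})"

lemma free_on_simps:
 "\<zero>\<^bsub>free_on R J\<^esub> = (%i. \<zero>\<^bsub>R\<^esub>)" "u \<oplus>\<^bsub>free_on R J\<^esub> w = (%i. u i \<oplus>\<^bsub>R\<^esub> w i)"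
 "a \<odot>\<^bsub>free_on R J\<^esub> u = (%i. a \<otimes>\<^bsub>R\<^esub> u i)"
 by (simp_all add: free_on_def)

lemma free_on_carrier:
 "u \<in> carrier (free_on R J) \<longleftrightarrow>
  (\<forall>i. u i \<in> carrier R) & (\<forall>i. i \<notin> J \<longrightarrow> u i = \<zero>\<^bsub>R\<^esub>) & finite {i. u i ~= \<zero>\<^bsub>R\<^esub>}"
 by (simp add: free_on_def)

lemma std_geo_simps:
 "\<zero>\<^bsub>std_geo R pos J x\<^esub> = (%i. \<zero>\<^bsub>R\<^esub>)" "u \<oplus>\<^bsub>std_geo R pos J x\<^esub> w = (%i. u i \<oplus>\<^bsub>R\<^esub> w i)"
 "a \<odot>\<^bsub>std_geo R pos J x\<^esub> u = (%i. a \<otimes>\<^bsub>R\<^esub> u i)"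
 by (simp_all add: std_geo_def free_on_def)

lemma std_geo_carrier:
 "u \<in> carrier (std_geo R pos J x) \<longleftrightarrow>
  (\<forall>i. u i \<in> carrier R) & (\<forall>i. i \<in> J \<longrightarrow> x - pos i \<in> \<int> \<or> u i = \<zero>\<^bsub>R\<^esub>) \<and>
  (\<forall>i. i \<notin> J \<longrightarrow> u i = \<zero>\<^bsub>R\<^esub>) & finite {i. u i ~= \<zero>\<^bsub>R\<^esub>}"
 by (auto simp: std_geo_def free_on_def)

text \<open>\<open>F\<close> is free of countable rank over \<open>R\<close>, and \<open>V\<close>
  is its extension to the Laurent ring, placed over the integers, with \<open>Vn n\<close> spanned
  by the first \<open>n\<close> basis vectors. \<open>E\<close> and \<open>T\<close> are the
  endomorphism rings; \<open>E\<close> enters \<open>T\<close> as the constants.\<close>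

locale stable_setting = ring R for R :: "('a, 'k) ring_scheme" (structure)
begin

abbreviation "F \<equiv> free_on R UNIV"
abbreviation "E \<equiv> end_ring R F"
abbreviation "L \<equiv> laurent_ring R"
abbreviation "V \<equiv> \<U>\<^sub>o R (std_geo R (%_. 0) UNIV)"
abbreviation "Vn n \<equiv> \<U>\<^sub>o R (std_geo R (%_. 0) {..<n})"
abbreviation "T \<equiv> end_ring L V"

lemma left_module_free_on: "left_module R (free_on R J)"
proof (rule left_moduleI)
 have fin: "finite {i. u i \<oplus> w i ~= \<zero>}" if "finite {i. u i ~= \<zero>}" "finite {i. w i ~= \<zero>}" for u w :: "nat => 'a"
  by (rule finite_subset[of _ "{i. u i ~= \<zero>} \<union> {i. w i ~= \<zero>}"]) (use that in auto)
 show "abelian_group (free_on R J)"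
 proof (rule abelian_groupI)
  fix u assume u: "u \<in> carrier (free_on R J)"
  have "finite {i. \<ominus> u i ~= \<zero>}"
   by (rule finite_subset[of _ "{i. u i ~= \<zero>}"]) (use u in "auto simp: free_on_carrier")
  then show "\<exists>w\<in>carrier (free_on R J). w \<oplus>\<^bsub>free_on R J\<^esub> u = \<zero>\<^bsub>free_on R J\<^esub>"
   using u by (intro bexI[of _ "%i. \<ominus> u i"]) (auto simp: free_on_carrier free_on_simps l_neg)
 qed (auto simp: free_on_carrier free_on_simps fin a_ac)
 fix a u assume "a \<in> carrier R" "u \<in> carrier (free_on R J)"
 then show "a \<odot>\<^bsub>free_on R J\<^esub> u \<in> carrier (free_on R J)"
  by (auto simp: free_on_carrier free_on_simps intro: finite_subset[of _ "{i. u i ~= \<zero>}"])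
qed (auto simp: free_on_carrier free_on_simps ring_simprules ring_axioms)

lemma free_on_finsum_apply:
 assumes "!!a. a \<in> A ==> f a \<in> carrier (free_on R J)"
 shows "(\<Oplus>\<^bsub>free_on R J\<^esub>a\<in>A. f a) i = (\<Oplus>a\<in>A. f a i)"
proof -
 interpret J: left_module R "free_on R J" by (rule left_module_free_on)
 show ?thesis
  by (rule finsum_additive[where h = "%u. u i"])
   (use assms J.M.abelian_monoid_axioms abelian_monoid_axioms in "auto simp: free_on_simps, auto simp: free_on_carrier")
qed

lemma unit_vec_closed: "i \<in> J ==> unit_vec R i \<in> carrier (free_on R J)"
 by (auto simp: free_on_carrier unit_vec_def intro: finite_subset[of _ "{i}"])

lemma unit_vec_F [simp]: "unit_vec R i \<in> carrier F"
 by (simp add: unit_vec_closed)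

lemma free_on_basis:
 assumes "finite J" shows "free_basis R (free_on R J) J (unit_vec R) (%u. u)"
proof -
 interpret J: left_module R "free_on R J" by (rule left_module_free_on)
 have sum: "(\<Oplus>\<^bsub>free_on R J\<^esub>j\<in>J. c j \<odot>\<^bsub>free_on R J\<^esub> unit_vec R j) i = (if i \<in> J then c i else \<zero>)"
  if c: "!!j. j \<in> J ==> c j \<in> carrier R" for c i
 proof -
  have "(\<Oplus>\<^bsub>free_on R J\<^esub>j\<in>J. c j \<odot>\<^bsub>free_on R J\<^esub> unit_vec R j) i =
    (\<Oplus>j\<in>J. (c j \<odot>\<^bsub>free_on R J\<^esub> unit_vec R j) i)"
   by (rule free_on_finsum_apply) (simp add: c J.smult_closed unit_vec_closed)
  also have "... = (\<Oplus>j\<in>J. if j = i then c j else \<zero>)"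
   by (rule finsum_cong') (use c in "auto simp: free_on_simps unit_vec_def")
  also have "... = (if i \<in> J then c i else \<zero>)"
  proof (cases "i \<in> J")
   case True
   then show ?thesis using c assms by (subst finsum_eq_term[of _ i]) auto
  next
   case False
   then have "(\<Oplus>j\<in>J. if j = i then c j else \<zero>) = (\<Oplus>j\<in>J. \<zero>)" by (intro finsum_cong') auto
   then show ?thesis using False by (simp add: finsum_zero)
  qed
  finally show ?thesis .
 qed
 have eq: "u = (\<Oplus>\<^bsub>free_on R J\<^esub>j\<in>J. u j \<odot>\<^bsub>free_on R J\<^esub> unit_vec R j)" if u: "u \<in> carrier (free_on R J)" for u
 proof
  fix i show "u i = (\<Oplus>\<^bsub>free_on R J\<^esub>j\<in>J. u j \<odot>\<^bsub>free_on R J\<^esub> unit_vec R j) i"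
   using u by (subst sum) (auto simp: free_on_carrier)
 qed
 show ?thesis
  unfolding free_basis_def using assms unit_vec_closed sum eq by (auto simp: free_on_carrier)
qed

lemma fg_free_free_on: "finite J ==> fg_free_module R (free_on R J)"
 using left_module.basis_imp_fg_free[OF left_module_free_on free_on_basis] .

sublocale FM: left_module R F by (rule left_module_free_on)

lemma std_geo_family: "equivariant_family R (std_geo R pos J)"
proof (intro equivariant_family.intro equivariant_family_axioms.intro ring_axioms)
 fix x
 show "left_module R (std_geo R pos J x)" by (simp add: std_geo_def left_module_free_on)
 have "x + 1 - pos i \<in> \<int> \<longleftrightarrow> x - pos i \<in> \<int>" for i
  using Ints_add[of "x - pos i" 1] Ints_diff[of "x + 1 - pos i" 1] by (auto simp: algebra_simps)
 then show "std_geo R pos J (x + 1) = std_geo R pos J x" by (simp add: std_geo_def)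
qed

lemma compact_finite:
 fixes S :: "real set"
 assumes "finite S" shows "compact S"
proof (rule compactI)
 fix C assume C: "\<forall>t\<in>C. open t" "S \<subseteq> \<Union> C"
 then have "\<forall>x\<in>S. \<exists>c. c \<in> C & x \<in> c" by auto
 then obtain c where "\<forall>x\<in>S. c x \<in> C & x \<in> c x" using bchoice by meson
 then show "\<exists>C'\<subseteq>C. finite C' & S \<subseteq> \<Union> C'" using assms by (intro exI[of _ "c ` S"]) auto
qed

lemma std_geo_obj:
 assumes J: "finite J" shows "std_geo R pos J \<in> cat_obj (\<T> R)"
proof -
 interpret S: equivariant_family R "std_geo R pos J" by (rule std_geo_family)
 have supp: "geo_support (std_geo R pos J) \<subseteq> {x. \<exists>i\<in>J. x - pos i \<in> \<int>}"
 proof (rule subsetI, rule ccontr)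
  fix x assume x: "x \<in> geo_support (std_geo R pos J)" and "x \<notin> {x. \<exists>i\<in>J. x - pos i \<in> \<int>}"
  then have "{i \<in> J. x - pos i \<in> \<int>} = {}" by auto
  then have "carrier (std_geo R pos J x) = {\<zero>\<^bsub>std_geo R pos J x\<^esub>}"
   by (auto simp: std_geo_def free_on_simps free_on_carrier)
  then show False using x by (simp add: geo_support_def)
 qed
 have "finite ({x - 1<..<x + 1} \<inter> geo_support (std_geo R pos J))" for x
 proof (rule finite_subset)
  show "finite (\<Union>i\<in>J. (%n. of_int n + pos i) ` {\<lfloor>x - 1 - pos i\<rfloor>..\<lceil>x + 1 - pos i\<rceil>})" using J by auto
  show "{x - 1<..<x + 1} \<inter> geo_support (std_geo R pos J) \<subseteq>
    (\<Union>i\<in>J. (%n. of_int n + pos i) ` {\<lfloor>x - 1 - pos i\<rfloor>..\<lceil>x + 1 - pos i\<rceil>})"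
  proof
   fix y assume y: "y \<in> {x - 1<..<x + 1} \<inter> geo_support (std_geo R pos J)"
   then obtain i where iJ: "i \<in> J" and "y - pos i \<in> \<int>" using supp by blast
   then obtain n where n: "y - pos i = of_int n" by (auto elim: Ints_cases)
   note i = iJ n
   then have "n \<in> {\<lfloor>x - 1 - pos i\<rfloor>..\<lceil>x + 1 - pos i\<rceil>}" using y by (auto simp: floor_le_iff le_ceiling_iff)
   then show "y \<in> (\<Union>i\<in>J. (%n. of_int n + pos i) ` {\<lfloor>x - 1 - pos i\<rfloor>..\<lceil>x + 1 - pos i\<rceil>})"
    using i by (intro UN_I[of i] image_eqI[of _ _ n]) auto
  qed
 qed
 then have "\<exists>U. open U & x \<in> U & finite (U \<inter> geo_support (std_geo R pos J))" for x
  by (intro exI[of _ "{x - 1<..<x + 1}"]) auto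
 moreover have "geo_support (std_geo R pos J) \<subseteq> {x + of_int n | x n. x \<in> pos ` J}"
 proof
  fix y assume "y \<in> geo_support (std_geo R pos J)"
  then obtain i where iJ: "i \<in> J" and "y - pos i \<in> \<int>" using supp by blast
  then obtain n where n: "y - pos i = of_int n" by (auto elim: Ints_cases)
  from iJ n have "y = pos i + of_int n" "pos i \<in> pos ` J" by auto
  then show "y \<in> {x + of_int n | x n. x \<in> pos ` J}" by blast
 qed
 ultimately show ?thesis
  using J fg_free_free_on S.fam_1
  by (auto simp: geo_cat_def geometric_module_def invariant_geo_module_def cocompact_support_def
    std_geo_def intro!: exI[of _ "pos ` J"] compact_finite)
qed

sublocale VF: equivariant_family R "std_geo R (%_. 0) UNIV" by (rule std_geo_family)
sublocale VM: left_module L V by (rule VF.left_module_forget)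
sublocale E: ring E by (rule FM.ring_end)
sublocale T: ring T by (rule VM.ring_end)

abbreviation "cF \<equiv> carrier F"
abbreviation "cE \<equiv> carrier E"
abbreviation "cV \<equiv> carrier V"
abbreviation "cT \<equiv> carrier T"
abbreviation mult_T (infixl \<open>\<star>\<close> 70) where "f \<star> g \<equiv> f \<otimes>\<^bsub>T\<^esub> g"
abbreviation add_T (infixl \<open>\<oplus>\<^sub>T\<close> 65) where "f \<oplus>\<^sub>T g \<equiv> f \<oplus>\<^bsub>T\<^esub> g"
abbreviation minus_T (infixl \<open>\<ominus>\<^sub>T\<close> 65) where "f \<ominus>\<^sub>T g \<equiv> f \<ominus>\<^bsub>T\<^esub> g"
abbreviation uminus_T (\<open>\<ominus>\<^sub>T _\<close> [81] 80) where "\<ominus>\<^sub>T f \<equiv> \<ominus>\<^bsub>T\<^esub> f"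
abbreviation one_T (\<open>\<one>\<^sub>T\<close>) where "\<one>\<^sub>T \<equiv> \<one>\<^bsub>T\<^esub>"
abbreviation zero_T (\<open>\<zero>\<^sub>T\<close>) where "\<zero>\<^sub>T \<equiv> \<zero>\<^bsub>T\<^esub>"
abbreviation mult_E (infixl \<open>\<bullet>\<close> 70) where "f \<bullet> g \<equiv> f \<otimes>\<^bsub>E\<^esub> g"
abbreviation add_E (infixl \<open>\<oplus>\<^sub>E\<close> 65) where "f \<oplus>\<^sub>E g \<equiv> f \<oplus>\<^bsub>E\<^esub> g"
abbreviation minus_E (infixl \<open>\<ominus>\<^sub>E\<close> 65) where "f \<ominus>\<^sub>E g \<equiv> f \<ominus>\<^bsub>E\<^esub> g"
abbreviation uminus_E (\<open>\<ominus>\<^sub>E _\<close> [81] 80) where "\<ominus>\<^sub>E f \<equiv> \<ominus>\<^bsub>E\<^esub> f"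
abbreviation one_E (\<open>\<one>\<^sub>E\<close>) where "\<one>\<^sub>E \<equiv> \<one>\<^bsub>E\<^esub>"
abbreviation zero_E (\<open>\<zero>\<^sub>E\<close>) where "\<zero>\<^sub>E \<equiv> \<zero>\<^bsub>E\<^esub>"
abbreviation add_F (infixl \<open>\<oplus>\<^sub>F\<close> 65) where "u \<oplus>\<^sub>F w \<equiv> u \<oplus>\<^bsub>F\<^esub> w"
abbreviation minus_F (infixl \<open>\<ominus>\<^sub>F\<close> 65) where "u \<ominus>\<^sub>F w \<equiv> u \<ominus>\<^bsub>F\<^esub> w"
abbreviation uminus_F (\<open>\<ominus>\<^sub>F _\<close> [81] 80) where "\<ominus>\<^sub>F u \<equiv> \<ominus>\<^bsub>F\<^esub> u"
abbreviation zero_F (\<open>\<zero>\<^sub>F\<close>) where "\<zero>\<^sub>F \<equiv> \<zero>\<^bsub>F\<^esub>"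
abbreviation smult_F (infixl \<open>\<odot>\<^sub>F\<close> 70) where "a \<odot>\<^sub>F u \<equiv> a \<odot>\<^bsub>F\<^esub> u"

end

text \<open>Index maps act contravariantly: \<open>\<rho> i\<close> names the source of coordinate
  \<open>i\<close>. Truncations, embeddings of every N-th coordinate and cyclic shifts are all of
  this form.\<close>

definition relabel :: "('a, 'k) ring_scheme => (nat => nat option) => (nat => 'a) => (nat => 'a)" where
 "relabel R \<rho> = (\<lambda>u\<in>carrier (free_on R UNIV). %i. case \<rho> i of None => \<zero>\<^bsub>R\<^esub> | Some j => u j)"

definition cut :: "nat => nat => nat option" where
 "cut n = (%i. if i < n then Some i else None)"

text \<open>Together with \<open>slot_out\<close> this splits the countable basis into
  \<open>N\<close> copies of itself, the residue classes modulo \<open>N\<close>: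
  \<open>slot_in N j\<close> embeds as class \<open>j\<close> and \<open>slot_out N j\<close> reads
  that class off.\<close>

definition slot_in :: "nat => nat => nat => nat option" where
 "slot_in N j = (%m. if m mod N = j then Some (m div N) else None)"

definition slot_out :: "nat => nat => nat => nat option" where
 "slot_out N j = (%i. Some (i * N + j))"

text \<open>The constant Laurent matrix given by \<open>\<phi>\<close>; multiplication by t^k is
  \<open>tau\<close>.\<close>

definition hat :: "('a, 'k) ring_scheme => ((nat => 'a) => (nat => 'a)) =>
  (real => nat => 'a) => (real => nat => 'a)" where
 "hat R \<phi> = (\<lambda>v\<in>carrier (\<U>\<^sub>o R (std_geo R (%_. 0) UNIV)). %x. \<phi> (v x))"

definition tau :: "('a, 'k) ring_scheme => int => (real => nat => 'a) => (real => nat => 'a)" where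
 "tau R k = (\<lambda>v\<in>carrier (\<U>\<^sub>o R (std_geo R (%_. 0) UNIV)). %x. v (x - of_int k))"

context stable_setting
begin

definition iota :: "int => (nat => 'a) => real => nat => 'a" where
 "iota k u = (%x. if x = of_int k then u else (%i. \<zero>))"

text \<open>The coefficient of t^k, an element of \<open>E\<close>. Looking at degree 0 is enough
  because elements of \<open>T\<close> commute with shifts.\<close>

definition lcoeff :: "int => ((real => nat => 'a) => (real => nat => 'a)) => (nat => 'a) => (nat => 'a)" where
 "lcoeff k f = (\<lambda>u\<in>cF. f (iota 0 u) (of_int k))"

text \<open>Matrices supported in some finite square block. They have no common unit, but any two of
  them share a two-sided identity, the projection onto a large enough block.\<close>

definition finE where "finE = {\<phi> \<in> cE. \<exists>n. relabel R (cut n) \<bullet> \<phi> = \<phi> & \<phi> \<bullet> relabel R (cut n) = \<phi>}"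

definition finT where "finT = {f \<in> cT. \<exists>n. hat R (relabel R (cut n)) \<star> f = f \<and>
  f \<star> hat R (relabel R (cut n)) = f}"

lemma V_carrier: "v \<in> cV \<longleftrightarrow> (\<forall>x. v x \<in> cF) & (\<forall>x. x \<notin> \<int> \<longrightarrow> v x = (%i. \<zero>)) \<and>
  finite {x. v x ~= (%i. \<zero>)}"
 by (auto simp: VF.forget_carrier std_geo_carrier std_geo_simps free_on_carrier fun_eq_iff)

lemma V_simps: "v \<oplus>\<^bsub>V\<^esub> w = (%x i. v x i \<oplus> w x i)" "\<zero>\<^bsub>V\<^esub> = (%x i. \<zero>)"
 by (simp_all add: VF.forget_add VF.forget_zero std_geo_simps free_on_simps)

lemma V_apply_F [simp]: "v \<in> cV ==> v x \<in> cF"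
 by (simp add: V_carrier)

lemma V_apply_R: "v \<in> cV ==> v x i \<in> carrier R"
 by (auto simp: V_carrier free_on_carrier)

lemma F_apply_R: "u \<in> cF ==> u i \<in> carrier R"
 by (auto simp: free_on_carrier)

lemma F_zero [simp]: "(%i. \<zero>) \<in> cF"
 by (auto simp: free_on_carrier)

lemma E_closed [simp]: "\<phi> \<in> cE ==> u \<in> cF ==> \<phi> u \<in> cF"
 by (rule FM.end_closed)

lemma T_closed [simp]: "f \<in> cT ==> v \<in> cV ==> f v \<in> cV"
 by (rule VM.end_closed)

lemma E_zero: "\<phi> \<in> cE ==> \<phi> (%i. \<zero>) = (%i. \<zero>)"
 using lmod_hom_zero[OF FM.is_left_module FM.is_left_module, of \<phi>] by (simp add: end_ring_carrier free_on_simps)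

lemma T_zero: "f \<in> cT ==> f (%x i. \<zero>) = (%x i. \<zero>)"
 using lmod_hom_zero[OF VM.is_left_module VM.is_left_module, of f] by (simp add: end_ring_carrier V_simps)

lemma E_add: "\<phi> \<in> cE ==> u \<in> cF ==> w \<in> cF ==> \<phi> (%i. u i \<oplus> w i) = (%i. \<phi> u i \<oplus> \<phi> w i)"
 using lmod_hom_add[of \<phi> R F F u w] by (simp add: end_ring_carrier free_on_simps)

lemma T_add: "f \<in> cT ==> u \<in> cV ==> w \<in> cV ==> f (%x i. u x i \<oplus> w x i) = (%x i. f u x i \<oplus> f w x i)"
 using lmod_hom_add[of f L V V u w] by (simp add: end_ring_carrier V_simps)

lemma E_smult: "\<phi> \<in> cE ==> u \<in> cF ==> a \<in> carrier R ==> \<phi> (%i. a \<otimes> u i) = (%i. a \<otimes> \<phi> u i)"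
 using lmod_hom_smult[of \<phi> R F F a u] by (simp add: end_ring_carrier free_on_simps)

lemma T_lmon:
 assumes f: "f \<in> cT" and v: "v \<in> cV" and a: "a \<in> carrier R"
 shows "f (%x i. a \<otimes> v (x - of_int k) i) = (%x i. a \<otimes> f v (x - of_int k) i)"
 using lmod_hom_smult[of f L V V "lmon R k a" v] f v a VF.forget_lmon[OF a v, of k] VF.forget_lmon[OF a T_closed[OF f v], of k]
 by (simp add: end_ring_carrier lmon_closed std_geo_simps free_on_simps)

lemma T_smult: "f \<in> cT ==> v \<in> cV ==> a \<in> carrier R ==> f (%x i. a \<otimes> v x i) = (%x i. a \<otimes> f v x i)"
 using T_lmon[of f v a 0] by simp

lemma T_shift:
 assumes f: "f \<in> cT" and v: "v \<in> cV"
 shows "f (%x. v (x - of_int k)) = (%x. f v (x - of_int k))"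
 using lmod_hom_smult[of f L V V "lmon R k \<one>" v] f v VF.forget_lmon_one[OF v, of k] VF.forget_lmon_one[OF T_closed[OF f v], of k]
 by (simp add: end_ring_carrier lmon_closed)

lemma shift_V: "v \<in> cV ==> (%x. v (x - of_int k)) \<in> cV"
 by (rule VF.forget_shift_in)

lemma EI:
 assumes "!!u. u \<in> cF ==> \<phi> u \<in> cF" "!!u. u \<notin> cF ==> \<phi> u = undefined"
  "!!u w. u \<in> cF ==> w \<in> cF ==> \<phi> (%i. u i \<oplus> w i) = (%i. \<phi> u i \<oplus> \<phi> w i)"
  "!!u a. u \<in> cF ==> a \<in> carrier R ==> \<phi> (%i. a \<otimes> u i) = (%i. a \<otimes> \<phi> u i)"
 shows "\<phi> \<in> cE"
 unfolding end_ring_carrier by (rule lmod_homI) (use assms in "auto simp: free_on_simps")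

lemma TI:
 assumes "!!v. v \<in> cV ==> f v \<in> cV" "!!v. v \<notin> cV ==> f v = undefined"
  "!!v w. v \<in> cV ==> w \<in> cV ==> f (%x i. v x i \<oplus> w x i) = (%x i. f v x i \<oplus> f w x i)"
  "!!v a k. v \<in> cV ==> a \<in> carrier R ==> f (%x i. a \<otimes> v (x - of_int k) i) = (%x i. a \<otimes> f v (x - of_int k) i)"
 shows "f \<in> cT"
 unfolding end_ring_carrier
 by (rule forget_homI[OF std_geo_family std_geo_family]) (use assms in "auto simp: std_geo_simps free_on_simps")

lemma shifted_int_iff [simp]: "(x :: real) - of_int k \<in> \<int> \<longleftrightarrow> x \<in> \<int>"
 using Ints_add[of "x - of_int k" "of_int k"] Ints_diff[of x "of_int k"] by auto

lemma F_smult_closed: "a \<in> carrier R ==> u \<in> cF ==> (%i. a \<otimes> u i) \<in> cF"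
 using FM.smult_closed[of a u] by (simp add: free_on_simps)

lemma F_add_closed: "u \<in> cF ==> w \<in> cF ==> (%i. u i \<oplus> w i) \<in> cF"
 using FM.M.a_closed[of u w] by (simp add: free_on_simps)

lemma V_lmon_closed: "v \<in> cV ==> a \<in> carrier R ==> (%x i. a \<otimes> v (x - of_int k) i) \<in> cV"
 using VM.smult_closed[OF lmon_closed[of a k], of v] VF.forget_lmon[of a v k] by (simp add: std_geo_simps free_on_simps)

lemma V_add_closed: "v \<in> cV ==> w \<in> cV ==> (%x i. v x i \<oplus> w x i) \<in> cV"
 using VM.M.a_closed[of v w] by (simp add: V_simps)

lemma hat_apply: "v \<in> cV ==> hat R \<phi> v = (%x. \<phi> (v x))"
 by (simp add: hat_def)

lemma hat_closed [simp]: "\<phi> \<in> cE ==> hat R \<phi> \<in> cT"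
proof (rule TI)
 assume \<phi>: "\<phi> \<in> cE"
 fix v assume v: "v \<in> cV"
 have "finite {x. \<phi> (v x) ~= (%i. \<zero>)}"
  by (rule finite_subset[of _ "{x. v x ~= (%i. \<zero>)}"]) (use v E_zero[OF \<phi>] in "auto simp: V_carrier")
 then show "hat R \<phi> v \<in> cV"
  using v \<phi> E_zero[OF \<phi>] by (simp add: hat_apply, auto simp: V_carrier)
qed (auto simp: hat_apply V_add_closed V_lmon_closed E_add E_smult, simp add: hat_def)

lemma hat_comp_closed [simp]: "\<psi> \<in> cE ==> v \<in> cV ==> (%x. \<psi> (v x)) \<in> cV"
 using T_closed[OF hat_closed, of \<psi> v] by (simp add: hat_apply)

lemma hat_mult: "\<phi> \<in> cE ==> \<psi> \<in> cE ==> hat R (\<phi> \<bullet> \<psi>) = hat R \<phi> \<star> hat R \<psi>"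
 by (rule VM.end_eqI) (auto simp: end_mult_apply hat_apply)

lemma hat_add: "\<phi> \<in> cE ==> \<psi> \<in> cE ==> hat R (\<phi> \<oplus>\<^sub>E \<psi>) = hat R \<phi> \<oplus>\<^sub>T hat R \<psi>"
 by (rule VM.end_eqI) (auto simp: end_add_apply hat_apply V_simps free_on_simps)

lemma hat_one: "hat R \<one>\<^sub>E = \<one>\<^sub>T"
 by (rule VM.end_eqI) (auto simp: end_one_apply hat_apply)

lemma hat_zero: "hat R \<zero>\<^sub>E = \<zero>\<^sub>T"
 by (rule VM.end_eqI) (auto simp: end_zero_apply hat_apply V_simps free_on_simps)

lemma hat_uminus: "\<phi> \<in> cE ==> hat R (\<ominus>\<^sub>E \<phi>) = \<ominus>\<^sub>T hat R \<phi>"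
 by (rule T.minus_equality[symmetric]) (auto simp: hat_add[symmetric] hat_zero E.l_neg)

lemma hat_minus: "\<phi> \<in> cE ==> \<psi> \<in> cE ==> hat R (\<phi> \<ominus>\<^sub>E \<psi>) = hat R \<phi> \<ominus>\<^sub>T hat R \<psi>"
 by (simp add: a_minus_def hat_add hat_uminus)

lemma tau_apply: "v \<in> cV ==> tau R k v = (%x. v (x - of_int k))"
 by (simp add: tau_def)

lemma tau_closed [simp]: "tau R k \<in> cT"
 by (rule TI) (auto simp: tau_apply shift_V V_add_closed V_lmon_closed diff_diff_eq add.commute, simp add: tau_def)

lemma tau_central: "f \<in> cT ==> f \<star> tau R k = tau R k \<star> f"
 by (rule VM.end_eqI) (auto simp: end_mult_apply tau_apply T_shift)

lemma tau_mult: "tau R k \<star> tau R l = tau R (k + l)"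
 by (rule VM.end_eqI) (auto simp: end_mult_apply tau_apply shift_V diff_diff_eq)

lemma tau_zero: "tau R 0 = \<one>\<^sub>T"
 by (rule VM.end_eqI) (auto simp: end_one_apply tau_apply)

lemma iota_closed [simp]: "u \<in> cF ==> iota k u \<in> cV"
 by (auto simp: V_carrier iota_def intro: finite_subset[of _ "{of_int k}"])

lemma tau_iota: "u \<in> cF ==> tau R l (iota k u) = iota (k + l) u"
 by (auto simp: tau_apply) (auto simp: iota_def fun_eq_iff)

lemma hat_iota: "u \<in> cF ==> \<phi> \<in> cE ==> hat R \<phi> (iota k u) = iota k (\<phi> u)"
 using E_zero[of \<phi>] by (auto simp: hat_apply) (auto simp: iota_def fun_eq_iff)

lemma iota_add: "u \<in> cF ==> w \<in> cF ==> iota k (%i. u i \<oplus> w i) = (%x i. iota k u x i \<oplus> iota k w x i)"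
 by (auto simp: iota_def fun_eq_iff)

lemma iota_smult: "a \<in> carrier R ==> iota k (%i. a \<otimes> u i) = (%x i. a \<otimes> iota k u x i)"
 by (auto simp: iota_def fun_eq_iff)

lemma T_eqI_iota:
 assumes f: "f \<in> cT" and g: "g \<in> cT" and eq: "!!u. u \<in> cF ==> f (iota 0 u) = g (iota 0 u)"
 shows "f = g"
proof (rule VF.forget_hom_eqI[OF VM.is_left_module])
 fix x u assume u: "u \<in> carrier (std_geo R (%_. 0) UNIV x)"
 have uF: "u \<in> cF" and u0: "x \<notin> \<int> ==> u = (%i. \<zero>)"
  using u by (auto simp: std_geo_carrier free_on_carrier)
 show "f (VF.single x u) = g (VF.single x u)"
 proof (cases "x \<in> \<int>")
  case True
  then obtain k where k: "x = of_int k" by (auto elim: Ints_cases)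
  have "VF.single x u = tau R k (iota 0 u)"
   using tau_iota[OF uF, of k 0] by (auto simp: VF.single_def iota_def std_geo_simps free_on_simps k fun_eq_iff)
  moreover have "h (tau R k (iota 0 u)) = tau R k (h (iota 0 u))" if "h \<in> cT" for h
   using tau_central[OF that, of k] end_mult_apply[OF iota_closed[OF uF, of 0], where R = L] by metis
  ultimately show ?thesis using eq[OF uF] f g by simp
 next
  case False
  then have "VF.single x u = (%x i. \<zero>)"
   using u0 by (auto simp: VF.single_def std_geo_simps free_on_simps fun_eq_iff)
  then show ?thesis using T_zero f g by simp
 qed
qed (use f g in "auto simp: end_ring_carrier")

lemma F_decomp:
 assumes u: "u \<in> cF"
 shows "u = (\<Oplus>\<^bsub>F\<^esub>i\<in>{i. u i ~= \<zero>}. u i \<odot>\<^sub>F unit_vec R i)"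
proof
 fix j
 have fin: "finite (insert j {i. u i ~= \<zero>})" using u by (auto simp: free_on_carrier)
 have "(\<Oplus>\<^bsub>F\<^esub>i\<in>{i. u i ~= \<zero>}. u i \<odot>\<^sub>F unit_vec R i) j = (\<Oplus>i\<in>{i. u i ~= \<zero>}. (u i \<odot>\<^sub>F unit_vec R i) j)"
  by (rule free_on_finsum_apply) (use u in "auto intro!: FM.smult_closed simp: F_apply_R")
 also have "... = (\<Oplus>i\<in>insert j {i. u i ~= \<zero>}. (u i \<odot>\<^sub>F unit_vec R i) j)"
  by (rule finsum_superset[OF fin]) (use F_apply_R[OF u] in "auto simp: free_on_simps unit_vec_def")
 also have "... = (u j \<odot>\<^sub>F unit_vec R j) j"
  by (rule finsum_eq_term[OF fin]) (use F_apply_R[OF u] in "auto simp: free_on_simps unit_vec_def")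
 finally show "u j = (\<Oplus>\<^bsub>F\<^esub>i\<in>{i. u i ~= \<zero>}. u i \<odot>\<^sub>F unit_vec R i) j"
  using F_apply_R[OF u] by (simp add: free_on_simps unit_vec_def)
qed

lemma F_hom_eqI:
 assumes N: "left_module R N" and h: "h \<in> lmod_hom R F N" "h' \<in> lmod_hom R F N"
  and eq: "!!i. h (unit_vec R i) = h' (unit_vec R i)"
 shows "h = h'"
proof (rule lmod_hom_eqI[OF h])
 fix u assume u: "u \<in> cF"
 have "k u = (\<Oplus>\<^bsub>N\<^esub>i\<in>{i. u i ~= \<zero>}. u i \<odot>\<^bsub>N\<^esub> k (unit_vec R i))" if k: "k \<in> lmod_hom R F N" for k
 proof -
  interpret N: left_module R N by (rule N)
  have "k u = (\<Oplus>\<^bsub>N\<^esub>i\<in>{i. u i ~= \<zero>}. k (u i \<odot>\<^sub>F unit_vec R i))"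
   by (subst F_decomp[OF u], rule lmod_hom_finsum[OF FM.is_left_module N k])
    (auto intro!: FM.smult_closed simp: F_apply_R u)
  also have "... = (\<Oplus>\<^bsub>N\<^esub>i\<in>{i. u i ~= \<zero>}. u i \<odot>\<^bsub>N\<^esub> k (unit_vec R i))"
   by (rule N.M.finsum_cong')
    (auto simp: lmod_hom_smult[OF k] F_apply_R[OF u] intro!: N.smult_closed lmod_hom_closed[OF k])
  finally show ?thesis .
 qed
 from this[OF h(1)] this[OF h(2)] show "h u = h' u" by (simp add: eq)
qed

lemma E_eqI:
 assumes "\<phi> \<in> cE" "\<psi> \<in> cE" "!!i. \<phi> (unit_vec R i) = \<psi> (unit_vec R i)" shows "\<phi> = \<psi>"
 by (rule F_hom_eqI[OF FM.is_left_module]) (use assms in "auto simp: end_ring_carrier")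

lemma lcoeff_apply: "u \<in> cF ==> lcoeff k f u = f (iota 0 u) (of_int k)"
 by (simp add: lcoeff_def)

lemma lcoeff_closed [simp]: "f \<in> cT ==> lcoeff k f \<in> cE"
 by (rule EI) (auto simp: lcoeff_apply iota_add iota_smult T_add T_smult F_add_closed F_smult_closed, simp add: lcoeff_def)

lemma lcoeff_eqI:
 assumes f: "f \<in> cT" and g: "g \<in> cT" and eq: "!!k. lcoeff k f = lcoeff k g"
 shows "f = g"
proof (rule T_eqI_iota[OF f g])
 fix u assume u: "u \<in> cF"
 show "f (iota 0 u) = g (iota 0 u)"
 proof
  fix x
  show "f (iota 0 u) x = g (iota 0 u) x"
  proof (cases "x \<in> \<int>")
   case True
   then show ?thesis using eq[THEN fun_cong, of _ u] u by (auto simp: lcoeff_apply elim!: Ints_cases)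
  next
   case False
   then show ?thesis
    using T_closed[OF f iota_closed[OF u]] T_closed[OF g iota_closed[OF u]] by (simp add: V_carrier)
  qed
 qed
qed

lemma T_eqI:
 assumes f: "f \<in> cT" and g: "g \<in> cT"
  and eq: "!!i. f (iota 0 (unit_vec R i)) = g (iota 0 (unit_vec R i))"
 shows "f = g"
proof (rule lcoeff_eqI[OF f g])
 fix k show "lcoeff k f = lcoeff k g"
  by (rule E_eqI) (use f g eq in "auto simp: lcoeff_apply")
qed

lemma lcoeff_add: "f \<in> cT ==> g \<in> cT ==> lcoeff k (f \<oplus>\<^sub>T g) = lcoeff k f \<oplus>\<^sub>E lcoeff k g"
 by (rule FM.end_eqI) (auto simp: lcoeff_apply end_add_apply V_simps free_on_simps)

lemma lcoeff_zero: "lcoeff k \<zero>\<^sub>T = \<zero>\<^sub>E"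
 by (rule FM.end_eqI) (auto simp: lcoeff_apply end_zero_apply V_simps free_on_simps)

lemma lcoeff_uminus: "f \<in> cT ==> lcoeff k (\<ominus>\<^sub>T f) = \<ominus>\<^sub>E lcoeff k f"
 by (rule E.minus_equality[symmetric]) (auto simp: lcoeff_add[symmetric] lcoeff_zero T.l_neg)

lemma lcoeff_hat_left: "f \<in> cT ==> \<phi> \<in> cE ==> lcoeff k (hat R \<phi> \<star> f) = \<phi> \<bullet> lcoeff k f"
 by (rule FM.end_eqI) (auto simp: lcoeff_apply end_mult_apply hat_apply)

lemma lcoeff_hat_right: "f \<in> cT ==> \<phi> \<in> cE ==> lcoeff k (f \<star> hat R \<phi>) = lcoeff k f \<bullet> \<phi>"
 by (rule FM.end_eqI) (auto simp: lcoeff_apply end_mult_apply hat_iota)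

lemma lcoeff_hat: "\<phi> \<in> cE ==> lcoeff k (hat R \<phi>) = (if k = 0 then \<phi> else \<zero>\<^sub>E)"
 by (rule FM.end_eqI) (auto simp: lcoeff_apply hat_iota end_zero_apply free_on_simps, auto simp: iota_def)

lemma lcoeff_tau: "f \<in> cT ==> lcoeff k (tau R l \<star> f) = lcoeff (k - l) f"
 by (rule FM.end_eqI) (auto simp: lcoeff_apply end_mult_apply tau_apply)

subsection \<open>Relabelling the basis and finitary endomorphisms\<close>

text \<open>Finite fibres of the index map keep supports finite.\<close>

lemma relabel_closed [simp]:
 assumes "!!j. finite {i. \<rho> i = Some j}" shows "relabel R \<rho> \<in> cE"
proof (rule EI)
 fix u assume u: "u \<in> cF"
 have "finite {i. (case \<rho> i of None => \<zero> | Some j => u j) ~= \<zero>}"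
 proof (rule finite_subset)
  show "finite (\<Union>j\<in>{j. u j ~= \<zero>}. {i. \<rho> i = Some j})" using u assms by (auto simp: free_on_carrier)
 qed (auto split: option.splits)
 then show "relabel R \<rho> u \<in> cF"
  using u by (auto simp: relabel_def free_on_carrier split: option.splits)
qed (auto simp: relabel_def F_add_closed F_smult_closed fun_eq_iff split: option.splits)

lemma relabel_apply: "u \<in> cF ==> relabel R \<rho> u i = (case \<rho> i of None => \<zero> | Some j => u j)"
 by (simp add: relabel_def)

lemma finite_cut [simp]: "finite {i. cut n i = Some j}"
 by (rule finite_subset[of _ "{j}"]) (auto simp: cut_def split: if_splits)

lemma finite_slot_in [simp]: "N > 0 ==> finite {i. slot_in N k i = Some j}"
proof (rule finite_subset)
 assume "N > 0"
 show "{i. slot_in N k i = Some j} \<subseteq> {j * N + k}"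
 proof
  fix i assume "i \<in> {i. slot_in N k i = Some j}"
  then have "i mod N = k" "i div N = j" by (auto simp: slot_in_def split: if_splits)
  then show "i \<in> {j * N + k}" using div_mult_mod_eq[of i N] by simp
 qed
qed simp

lemma finite_slot_out [simp]: "N > 0 ==> finite {i. slot_out N k i = Some j}"
proof (rule finite_subset)
 assume N: "N > 0"
 show "{i. slot_out N k i = Some j} \<subseteq> {..j}"
 proof
  fix i assume "i \<in> {i. slot_out N k i = Some j}"
  then have "j = i * N + k" by (simp add: slot_out_def)
  moreover have "i \<le> i * N" using N by simp
  ultimately show "i \<in> {..j}" by (metis atMost_iff le_add1 le_trans)
 qed
qed simp

abbreviation "proj n \<equiv> relabel R (cut n)"

lemma proj_closed: "proj n \<in> cE" by simp

lemma proj_apply: "u \<in> cF ==> proj n u = (%i. if i < n then u i else \<zero>)"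
 by (auto simp: relabel_apply cut_def fun_eq_iff)

lemma proj_mult: "proj n \<bullet> proj m = proj (min n m)"
 by (rule FM.end_eqI) (auto simp: end_mult_apply relabel_apply cut_def fun_eq_iff)

lemma hat_proj_mult: "hat R (proj n) \<star> hat R (proj m) = hat R (proj (min n m))"
 by (simp add: hat_mult[symmetric] proj_mult)

lemma finE_closed: "\<phi> \<in> finE ==> \<phi> \<in> cE" and finT_closed: "f \<in> finT ==> f \<in> cT"
 by (auto simp: finE_def finT_def)

lemma proj_finE: "proj n \<in> finE"
 unfolding finE_def using proj_mult[of n n] by auto

lemma hat_finE: "\<phi> \<in> finE ==> hat R \<phi> \<in> finT"
proof -
 assume "\<phi> \<in> finE"
 then obtain n where \<phi>: "\<phi> \<in> cE" and n: "proj n \<bullet> \<phi> = \<phi>" "\<phi> \<bullet> proj n = \<phi>" by (auto simp: finE_def)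
 have "hat R (proj n) \<star> hat R \<phi> = hat R \<phi>" "hat R \<phi> \<star> hat R (proj n) = hat R \<phi>"
  using \<phi> by (simp_all add: hat_mult[symmetric] n)
 then show ?thesis using \<phi> by (auto simp: finT_def)
qed

lemma proj_fixed_mono:
 assumes "f \<in> cT" "n \<le> m"
 shows "hat R (proj n) \<star> f = f ==> hat R (proj m) \<star> f = f"
  "f \<star> hat R (proj n) = f ==> f \<star> hat R (proj m) = f"
proof -
 assume a: "hat R (proj n) \<star> f = f"
 have "hat R (proj m) \<star> f = hat R (proj m) \<star> (hat R (proj n) \<star> f)" by (simp add: a)
 also have "... = hat R (proj n) \<star> f"
  using assms by (simp add: T.m_assoc[symmetric] hat_proj_mult min_def)
 finally show "hat R (proj m) \<star> f = f" by (simp add: a)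
next
 assume a: "f \<star> hat R (proj n) = f"
 have "f \<star> hat R (proj m) = (f \<star> hat R (proj n)) \<star> hat R (proj m)" by (simp add: a)
 also have "... = f \<star> hat R (proj n)"
  using assms by (simp add: T.m_assoc hat_proj_mult min_def)
 finally show "f \<star> hat R (proj m) = f" by (simp add: a)
qed

text \<open>Bounding the columns suffices: finitely many basis vectors have finitely many nonzero
  coordinates in their images, so the rows vanish beyond some \<open>m\<close> as well.\<close>

lemma finTI:
 assumes f: "f \<in> cT" and n: "f \<star> hat R (proj n) = f"
 shows "f \<in> finT"
proof -
 define S where "S = (\<Union>i\<in>{..<n}. \<Union>x\<in>{x. f (iota 0 (unit_vec R i)) x ~= (%i. \<zero>)}. {j. f (iota 0 (unit_vec R i)) x j ~= \<zero>})"
 have fV: "f (iota 0 (unit_vec R i)) \<in> cV" for i using f by simp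
 then have "finite S" by (auto simp: S_def V_carrier free_on_carrier)
 then obtain m where m: "!!j. j \<in> S ==> j < m" by (meson finite_nat_set_iff_bounded)
 have "hat R (proj m) \<star> f = f"
 proof (rule T_eqI)
  fix i
  let ?w = "f (iota 0 (unit_vec R i))"
  show "(hat R (proj m) \<star> f) (iota 0 (unit_vec R i)) = ?w"
  proof (cases "i < n")
   case True
   have "?w x j = \<zero>" if "\<not> j < m" for x j
   proof (rule ccontr)
    assume "?w x j ~= \<zero>"
    then have "j \<in> S" unfolding S_def using True by (intro UN_I[of i] UN_I[of x]) (auto simp: fun_eq_iff)
    with m that show False by blast
   qed
   then show ?thesis using fV by (auto simp: end_mult_apply hat_apply proj_apply fun_eq_iff)
  next
   case False
   then have z: "proj n (unit_vec R i) = (%i. \<zero>)"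
    unfolding proj_apply[OF unit_vec_F] by (auto simp: unit_vec_def fun_eq_iff)
   have "iota 0 (%i. \<zero>) = (%x i. \<zero>)" by (auto simp: iota_def)
   then have "?w = (%x i. \<zero>)"
    using arg_cong[OF n, of "%f. f (iota 0 (unit_vec R i))"] T_zero[OF f]
    by (simp add: end_mult_apply hat_iota z)
   then show ?thesis using T_zero[of "hat R (proj m)"] by (simp add: end_mult_apply)
  qed
 qed (use f in auto)
 then have "hat R (proj (max m n)) \<star> f = f" "f \<star> hat R (proj (max m n)) = f"
  using proj_fixed_mono[OF f, of m "max m n"] proj_fixed_mono[OF f, of n "max m n"] n by auto
 then show ?thesis using f by (auto simp: finT_def)
qed

text \<open>The coefficient at degree 0 is a left inverse of \<open>hat\<close>.\<close>

lemma hat_inj: "\<phi> \<in> cE ==> \<psi> \<in> cE ==> hat R \<phi> = hat R \<psi> ==> \<phi> = \<psi>"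
proof -
 assume a: "\<phi> \<in> cE" "\<psi> \<in> cE" and e: "hat R \<phi> = hat R \<psi>"
 have "lcoeff 0 (hat R \<phi>) = lcoeff 0 (hat R \<psi>)" by (rule arg_cong[OF e])
 then show "\<phi> = \<psi>" by (simp only: lcoeff_hat[OF a(1)] lcoeff_hat[OF a(2)] simp_thms if_True)
qed

lemma finEI:
 assumes f: "\<phi> \<in> cE" and n: "\<phi> \<bullet> proj n = \<phi>"
 shows "\<phi> \<in> finE"
proof -
 have "hat R \<phi> \<in> finT"
  by (rule finTI[of _ n]) (use f n in "auto simp: hat_mult[symmetric]")
 then obtain m where "hat R (proj m \<bullet> \<phi>) = hat R \<phi>" "hat R (\<phi> \<bullet> proj m) = hat R \<phi>"
  using f by (auto simp: finT_def hat_mult)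
 then have "proj m \<bullet> \<phi> = \<phi>" "\<phi> \<bullet> proj m = \<phi>" using f by (auto intro: hat_inj)
 then show ?thesis using f by (auto simp: finE_def)
qed

lemma finE_hat: "\<phi> \<in> cE ==> hat R \<phi> \<in> finT ==> \<phi> \<in> finE"
proof -
 assume f: "\<phi> \<in> cE" and "hat R \<phi> \<in> finT"
 then obtain m where "hat R (\<phi> \<bullet> proj m) = hat R \<phi>"
  using f by (auto simp: finT_def hat_mult)
 then have "\<phi> \<bullet> proj m = \<phi>" using f by (auto intro: hat_inj)
 then show ?thesis using f by (intro finEI)
qed

lemma finT_common:
 assumes "f \<in> finT" "g \<in> finT"
 obtains n where "hat R (proj n) \<star> f = f" "f \<star> hat R (proj n) = f"
  "hat R (proj n) \<star> g = g" "g \<star> hat R (proj n) = g"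
proof -
 obtain n m where "hat R (proj n) \<star> f = f" "f \<star> hat R (proj n) = f"
  "hat R (proj m) \<star> g = g" "g \<star> hat R (proj m) = g"
  using assms by (auto simp: finT_def)
 then show ?thesis
  using that[of "max n m"] assms finT_closed proj_fixed_mono[of f n "max n m"] proj_fixed_mono[of g m "max n m"] by auto
qed

lemma finT_add: "f \<in> finT ==> g \<in> finT ==> f \<oplus>\<^sub>T g \<in> finT"
proof -
 assume fg: "f \<in> finT" "g \<in> finT"
 then obtain n where "f \<star> hat R (proj n) = f" "g \<star> hat R (proj n) = g"
  by (rule finT_common)
 then show ?thesis using fg[THEN finT_closed] by (intro finTI[of _ n]) (auto simp: T.l_distr)
qed

lemma finT_uminus: "f \<in> finT ==> \<ominus>\<^sub>T f \<in> finT"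
proof -
 assume f: "f \<in> finT"
 then obtain n where "f \<star> hat R (proj n) = f" by (auto simp: finT_def)
 then show ?thesis using finT_closed[OF f] by (intro finTI[of _ n]) (auto simp: T.l_minus)
qed

lemma finT_mult: "f \<in> cT ==> g \<in> finT ==> f \<star> g \<in> finT"
proof -
 assume f: "f \<in> cT" and g: "g \<in> finT"
 then obtain n where "g \<star> hat R (proj n) = g" by (auto simp: finT_def)
 then show ?thesis using f finT_closed[OF g] by (intro finTI[of _ n]) (auto simp: T.m_assoc)
qed

lemma finT_zero: "\<zero>\<^sub>T \<in> finT"
 by (rule finTI[of _ 0]) auto

end

section \<open>Elementary matrices and commutators in an abstract stable ring\<close>

section \<open>Stable groups of units\<close>

lemma (in ring) mult_zero_assoc:
 "a \<otimes> b = \<zero> ==> a \<in> carrier R ==> b \<in> carrier R ==> z \<in> carrier R ==> a \<otimes> (b \<otimes> z) = \<zero>"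
 by (simp flip: m_assoc)

text \<open>The left side is a commutator, since \<open>\<one> \<ominus> a\<close> and
  \<open>\<one> \<ominus> b\<close> are the inverses. The pattern is that of matrix units a = e12
  and b = e23 with product e13.\<close>

lemma (in ring) commutator_square_zero:
 assumes c: "a \<in> carrier R" "b \<in> carrier R" and z: "a \<otimes> a = \<zero>" "b \<otimes> b = \<zero>" "b \<otimes> a = \<zero>"
 shows "(\<one> \<oplus> a) \<otimes> (\<one> \<oplus> b) \<otimes> (\<one> \<ominus> a) \<otimes> (\<one> \<ominus> b) = \<one> \<oplus> a \<otimes> b"
 using z[THEN mult_zero_assoc] c z r_one by algebra

text \<open>Both 1 + ab and 1 + ba are carried by elementary factors to 1 + a - b. For off-diagonal
  blocks a and b this moves a unit from one diagonal block to the other.\<close>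

lemma (in ring) swap_square_zero:
 assumes c: "a \<in> carrier R" "b \<in> carrier R" and z: "a \<otimes> a = \<zero>" "b \<otimes> b = \<zero>"
 shows "(\<one> \<oplus> b) \<otimes> (\<one> \<oplus> a) \<otimes> (\<one> \<oplus> a \<otimes> b) \<otimes> (\<one> \<ominus> b) \<otimes> (\<one> \<ominus> a) = \<one> \<oplus> b \<otimes> a"
proof -
 have *: "(\<one> \<oplus> a) \<otimes> (\<one> \<oplus> a \<otimes> b) \<otimes> (\<one> \<ominus> b) = \<one> \<oplus> a \<ominus> b"
  using z[THEN mult_zero_assoc] c z r_one by algebra
 have "(\<one> \<oplus> b) \<otimes> (\<one> \<oplus> a \<ominus> b) \<otimes> (\<one> \<ominus> a) = \<one> \<oplus> b \<otimes> a"
  using z[THEN mult_zero_assoc] c z r_one by algebra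
 then show ?thesis using c by (simp add: *[symmetric] m_assoc)
qed

lemma (in ring) units_square_zero:
 assumes c: "a \<in> carrier R" and z: "a \<otimes> a = \<zero>"
 shows "(\<one> \<oplus> a) \<otimes> (\<one> \<ominus> a) = \<one>" "(\<one> \<ominus> a) \<otimes> (\<one> \<oplus> a) = \<one>"
 using c z r_one by algebra+

text \<open>\<open>I\<close> models the finitary matrices and \<open>C\<close> the constants. The
  elements \<open>s1\<close>, \<open>s2\<close> with left inverses \<open>r1\<close>,
  \<open>r2\<close> are two orthogonal copies of the whole inside itself, so that 2 by 2 block
  matrices over the ring are again elements of it. \<open>H\<close> is a group of units that
  contains the commutators and does not notice an added identity block.\<close>

locale stable_units = ring T for T :: "('t, 'k) ring_scheme" (structure) +
 fixes I C H :: "'t set" and s1 s2 r1 r2 :: 't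
 assumes I_sub: "I \<subseteq> carrier T" and I_zero: "\<zero> \<in> I" and I_add: "x \<in> I ==> y \<in> I ==> x \<oplus> y \<in> I"
  and I_uminus: "x \<in> I ==> \<ominus> x \<in> I" and I_lmult: "f \<in> carrier T ==> x \<in> I ==> f \<otimes> x \<in> I"
  and C_sub: "C \<subseteq> carrier T" and C_one: "\<one> \<in> C" and C_add: "x \<in> C ==> y \<in> C ==> x \<oplus> y \<in> C"
  and C_uminus: "x \<in> C ==> \<ominus> x \<in> C" and C_mult: "x \<in> C ==> y \<in> C ==> x \<otimes> y \<in> C"
  and local_unit: "x \<in> I ==> y \<in> I ==>
   \<exists>p\<in>I \<inter> C. p \<otimes> p = p & p \<otimes> x = x & x \<otimes> p = x & p \<otimes> y = y & y \<otimes> p = y"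
  and sr_C: "s1 \<in> C" "s2 \<in> C" "r1 \<in> C" "r2 \<in> C"
  and sr: "r1 \<otimes> s1 = \<one>" "r2 \<otimes> s2 = \<one>" "r1 \<otimes> s2 = \<zero>" "r2 \<otimes> s1 = \<zero>"
  and I_r: "x \<in> I ==> x \<otimes> r1 \<in> I" "x \<in> I ==> x \<otimes> r2 \<in> I"
  and H_sub: "H \<subseteq> {g \<in> Units T. g \<ominus> \<one> \<in> I}"
  and H_mult: "g \<in> H ==> h \<in> H ==> g \<otimes> h \<in> H"
  and H_inv: "g \<in> H ==> inv g \<in> H"
  and H_commutator: "[|g \<in> Units T; g \<ominus> \<one> \<in> I; h \<in> Units T; h \<ominus> \<one> \<in> I|] ==> g \<otimes> h \<otimes> inv g \<otimes> inv h \<in> H"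
  and H_stable: "[|x \<in> I; \<one> \<oplus> x \<in> Units T|] ==> \<one> \<oplus> s1 \<otimes> x \<otimes> r1 \<in> H \<longleftrightarrow> \<one> \<oplus> x \<in> H"
begin

lemma I_carrier [simp]: "x \<in> I ==> x \<in> carrier T" and C_carrier [simp]: "x \<in> C ==> x \<in> carrier T"
 using I_sub C_sub by auto

lemma sr_carrier [simp]: "s1 \<in> carrier T" "s2 \<in> carrier T" "r1 \<in> carrier T" "r2 \<in> carrier T"
 using sr_C by auto

lemma I_minus: "x \<in> I ==> y \<in> I ==> x \<ominus> y \<in> I"
 by (simp add: a_minus_def I_add I_uminus)

lemma C_minus: "x \<in> C ==> y \<in> C ==> x \<ominus> y \<in> C"
 by (simp add: a_minus_def C_add C_uminus)

lemma C_zero: "\<zero> \<in> C"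
 using C_minus[OF C_one C_one] by (simp add: a_minus_def r_neg)

lemma block_I: "x \<in> I ==> s1 \<otimes> x \<otimes> r1 \<in> I" "x \<in> I ==> s1 \<otimes> x \<otimes> r2 \<in> I"
  "x \<in> I ==> s2 \<otimes> x \<otimes> r1 \<in> I" "x \<in> I ==> s2 \<otimes> x \<otimes> r2 \<in> I"
 by (simp_all add: I_r I_lmult)

text \<open>Multiplication of block matrices, with s x r as the entry x in one of four
  positions.\<close>

lemma block_mult:
 assumes "x \<in> carrier T" "y \<in> carrier T" "s \<in> carrier T" "r \<in> carrier T"
 shows "(s \<otimes> x \<otimes> r1) \<otimes> (s1 \<otimes> y \<otimes> r) = s \<otimes> (x \<otimes> y) \<otimes> r"
  "(s \<otimes> x \<otimes> r2) \<otimes> (s2 \<otimes> y \<otimes> r) = s \<otimes> (x \<otimes> y) \<otimes> r"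
  "(s \<otimes> x \<otimes> r1) \<otimes> (s2 \<otimes> y \<otimes> r) = \<zero>"
  "(s \<otimes> x \<otimes> r2) \<otimes> (s1 \<otimes> y \<otimes> r) = \<zero>"
proof -
 have *: "(s \<otimes> x \<otimes> \<rho>) \<otimes> (\<sigma> \<otimes> y \<otimes> r) = s \<otimes> (x \<otimes> ((\<rho> \<otimes> \<sigma>) \<otimes> (y \<otimes> r)))"
  if "\<rho> \<in> carrier T" "\<sigma> \<in> carrier T" for \<rho> \<sigma>
  using assms that by (simp add: m_assoc)
 show "(s \<otimes> x \<otimes> r1) \<otimes> (s1 \<otimes> y \<otimes> r) = s \<otimes> (x \<otimes> y) \<otimes> r"
  "(s \<otimes> x \<otimes> r2) \<otimes> (s2 \<otimes> y \<otimes> r) = s \<otimes> (x \<otimes> y) \<otimes> r"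
  "(s \<otimes> x \<otimes> r1) \<otimes> (s2 \<otimes> y \<otimes> r) = \<zero>"
  "(s \<otimes> x \<otimes> r2) \<otimes> (s1 \<otimes> y \<otimes> r) = \<zero>"
  using assms by (simp_all only: * sr_carrier sr, simp_all add: m_assoc)
qed

lemma minus_one_plus [simp]: "x \<in> carrier T ==> (\<one> \<oplus> x) \<ominus> \<one> = x"
 by (simp add: a_minus_def a_assoc, simp add: a_lcomm r_neg)

lemma plus_minus_one [simp]: "g \<in> carrier T ==> \<one> \<oplus> (g \<ominus> \<one>) = g"
 by (simp add: a_minus_def a_lcomm r_neg)

lemma H_Units: "g \<in> H ==> g \<in> Units T" and H_carrier [simp]: "g \<in> H ==> g \<in> carrier T"
 and H_I: "g \<in> H ==> g \<ominus> \<one> \<in> I"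
 using H_sub by auto

text \<open>By g^-1 - 1 = - g^-1 (g - 1), as \<open>I\<close> is stable under multiplication from
  the left.\<close>

lemma inv_minus_one:
 assumes g: "g \<in> Units T" "g \<ominus> \<one> \<in> I" shows "inv g \<ominus> \<one> \<in> I"
proof -
 have "inv g \<ominus> \<one> = \<ominus> (inv g \<otimes> (g \<ominus> \<one>))"
  using g by (simp add: Units_closed a_minus_def r_distr r_minus minus_add a_comm)
 then show ?thesis using g by (simp add: I_lmult I_uminus)
qed

lemma H_cancel_left:
 assumes g: "g \<in> H" and h: "h \<in> carrier T" and gh: "g \<otimes> h \<in> H" shows "h \<in> H"
proof -
 have "inv g \<otimes> (g \<otimes> h) = h" using h H_Units[OF g] by (simp add: m_assoc[symmetric] Units_closed)
 then show ?thesis using H_mult[OF H_inv[OF g] gh] by simp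
qed

lemma H_cancel_right:
 assumes g: "g \<in> carrier T" and h: "h \<in> H" and gh: "g \<otimes> h \<in> H" shows "g \<in> H"
proof -
 have "g \<otimes> h \<otimes> inv h = g" using g H_Units[OF h] by (simp add: m_assoc Units_closed)
 then show ?thesis using H_mult[OF gh H_inv[OF h]] by simp
qed

lemma H_one: "\<one> \<in> H"
 using H_commutator[of \<one> \<one>] by (simp add: a_minus_def r_neg I_zero)

text \<open>Here \<open>x\<close> is strictly triangular: it vanishes on the image of
  \<open>q\<close> and takes values there. Writing an elementary matrix as a commutator needs room
  for an intermediate index, which the second block provides; \<open>H_stable\<close> then removes
  that block.\<close>

lemma elementary:
 assumes x: "x \<in> I" and q: "q \<in> I" "q \<otimes> q = q" "q \<otimes> x = x" "x \<otimes> q = \<zero>"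
 shows "\<one> \<oplus> x \<in> H"
proof -
 obtain p where p: "p \<in> I" "p \<otimes> p = p" "p \<otimes> x = x" "x \<otimes> p = x" "p \<otimes> q = q" "q \<otimes> p = q"
  using local_unit[OF x q(1)] by auto
 \<comment> \<open>The complement of \<open>q\<close> in a local unit. It acts on \<open>x\<close>
   as the identity from the right and as zero from the left, which gives the two products required
   of the blocks \<open>?a\<close> and \<open>?b\<close>.\<close>
 let ?y = "p \<ominus> q"
 have y: "?y \<in> I" using p q by (simp add: I_minus)
 have xy: "x \<otimes> ?y = x" "?y \<otimes> x = \<zero>"
  using x p q by (simp_all add: a_minus_def r_distr l_distr r_minus l_minus r_neg)
 let ?a = "s1 \<otimes> x \<otimes> r2" and ?b = "s2 \<otimes> ?y \<otimes> r1"
 have ab: "?a \<in> I" "?b \<in> I" using block_I x y by auto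
 have "?a \<otimes> ?a = \<zero>" "?b \<otimes> ?b = \<zero>" using x y by (auto simp: block_mult)
 note z = this
 have ba: "?b \<otimes> ?a = \<zero>" and ab': "?a \<otimes> ?b = s1 \<otimes> x \<otimes> r1"
  using x y xy by (auto simp: block_mult simp del: minus_closed)
 have inv: "\<one> \<oplus> c \<in> Units T & inv (\<one> \<oplus> c) = \<one> \<ominus> c & (\<one> \<oplus> c) \<ominus> \<one> \<in> I"
  if "c \<in> I" "c \<otimes> c = \<zero>" for c
  using that units_square_zero[of c] by (auto simp: Units_def intro!: inv_char)
 have "(\<one> \<oplus> ?a) \<otimes> (\<one> \<oplus> ?b) \<otimes> (\<one> \<ominus> ?a) \<otimes> (\<one> \<ominus> ?b) \<in> H"
  using H_commutator[of "\<one> \<oplus> ?a" "\<one> \<oplus> ?b"] inv[OF ab(1) z(1)] inv[OF ab(2) z(2)] by simp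
 then have "\<one> \<oplus> s1 \<otimes> x \<otimes> r1 \<in> H"
  using commutator_square_zero[OF _ _ z ba] ab by (simp add: ab')
 moreover have "x \<otimes> x = \<zero>"
  using mult_zero_assoc[OF q(4), of x] x q by simp
 then have "\<one> \<oplus> x \<in> Units T" using inv x by blast
 ultimately show ?thesis using H_stable x by blast
qed

lemma elementary_block:
 assumes x: "x \<in> I" shows "\<one> \<oplus> s1 \<otimes> x \<otimes> r2 \<in> H" "\<one> \<oplus> s2 \<otimes> x \<otimes> r1 \<in> H"
proof -
 obtain p where p: "p \<in> I" "p \<otimes> p = p" "p \<otimes> x = x" using local_unit[OF x x] by auto
 show "\<one> \<oplus> s1 \<otimes> x \<otimes> r2 \<in> H"
  by (rule elementary[of _ "s1 \<otimes> p \<otimes> r1"]) (use x p in "auto simp: block_I block_mult")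
 show "\<one> \<oplus> s2 \<otimes> x \<otimes> r1 \<in> H"
  by (rule elementary[of _ "s2 \<otimes> p \<otimes> r2"]) (use x p in "auto simp: block_I block_mult")
qed

lemma elementary_block_minus:
 assumes x: "x \<in> I" shows "\<one> \<ominus> s1 \<otimes> x \<otimes> r2 \<in> H" "\<one> \<ominus> s2 \<otimes> x \<otimes> r1 \<in> H"
 using elementary_block[OF I_uminus[OF x]] x by (simp_all add: r_minus l_minus a_minus_def)

lemma swap_blocks:
 assumes "x \<in> I" "y \<in> I"
 shows "\<one> \<oplus> s1 \<otimes> (x \<otimes> y) \<otimes> r1 \<in> H ==> \<one> \<oplus> s2 \<otimes> (y \<otimes> x) \<otimes> r2 \<in> H"
  "\<one> \<oplus> s2 \<otimes> (y \<otimes> x) \<otimes> r2 \<in> H ==> \<one> \<oplus> s1 \<otimes> (x \<otimes> y) \<otimes> r1 \<in> H"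
proof -
 let ?a = "s1 \<otimes> x \<otimes> r2" and ?b = "s2 \<otimes> y \<otimes> r1"
 have ab: "?a \<in> carrier T" "?b \<in> carrier T" using assms by auto
 have z: "?a \<otimes> ?a = \<zero>" "?b \<otimes> ?b = \<zero>" using assms by (auto simp: block_mult)
 have eq: "?a \<otimes> ?b = s1 \<otimes> (x \<otimes> y) \<otimes> r1" "?b \<otimes> ?a = s2 \<otimes> (y \<otimes> x) \<otimes> r2"
  using assms by (auto simp: block_mult)
 note e = elementary_block(1)[OF assms(1)] elementary_block(2)[OF assms(2)]
  elementary_block_minus(1)[OF assms(1)] elementary_block_minus(2)[OF assms(2)]
 show "\<one> \<oplus> s1 \<otimes> (x \<otimes> y) \<otimes> r1 \<in> H ==> \<one> \<oplus> s2 \<otimes> (y \<otimes> x) \<otimes> r2 \<in> H"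
  using swap_square_zero[OF ab z] e by (metis H_mult eq)
 show "\<one> \<oplus> s2 \<otimes> (y \<otimes> x) \<otimes> r2 \<in> H ==> \<one> \<oplus> s1 \<otimes> (x \<otimes> y) \<otimes> r1 \<in> H"
  using swap_square_zero[OF ab(2,1) z(2,1)] e by (metis H_mult eq)
qed

text \<open>Lets a unit be transported along a factorisation: with x and y viewed as maps between
  two modules, 1 + xy lives on one and 1 + yx on the other. It is used wherever an idempotent or a
  nilpotent changes its place.\<close>

lemma H_swap:
 assumes x: "x \<in> I" and y: "y \<in> I" and H: "\<one> \<oplus> x \<otimes> y \<in> H"
 shows "\<one> \<oplus> y \<otimes> x \<in> H"
proof -
 have xy: "x \<otimes> y \<in> I" and yx: "y \<otimes> x \<in> I" using x y by (auto simp: I_lmult)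
 obtain p where p: "p \<in> I" "p \<otimes> (y \<otimes> x) = y \<otimes> x" "(y \<otimes> x) \<otimes> p = y \<otimes> x"
  using local_unit[OF yx yx] by auto
 have "\<one> \<oplus> s1 \<otimes> (x \<otimes> y) \<otimes> r1 \<in> H" using H_stable[OF xy H_Units[OF H]] H by simp
 then have "\<one> \<oplus> s2 \<otimes> (y \<otimes> x) \<otimes> r2 \<in> H" by (rule swap_blocks(1)[OF x y])
 \<comment> \<open>As \<open>p\<close> is a two-sided identity for yx, swapping the factors yx and p
   brings the unit back from the second block to the first.\<close>
 then have *: "\<one> \<oplus> s1 \<otimes> (y \<otimes> x) \<otimes> r1 \<in> H"
  using swap_blocks(2)[OF yx p(1)] p by simp
 let ?u = "inv (\<one> \<oplus> x \<otimes> y)"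
 have u: "?u \<in> carrier T" "(\<one> \<oplus> x \<otimes> y) \<otimes> ?u = \<one>" "?u \<otimes> (\<one> \<oplus> x \<otimes> y) = \<one>"
  using H_Units[OF H] by auto
 \<comment> \<open>The inverse of 1 + yx is 1 - y (1 + xy)^-1 x; both products are expanded until
   the inner inverse cancels.\<close>
 have 1: "(\<one> \<oplus> y \<otimes> x) \<otimes> (\<one> \<ominus> y \<otimes> ?u \<otimes> x) = \<one> \<oplus> y \<otimes> x \<ominus> y \<otimes> ((\<one> \<oplus> x \<otimes> y) \<otimes> ?u) \<otimes> x"
  using I_carrier[OF x] I_carrier[OF y] u(1) r_one by algebra
 have 2: "(\<one> \<ominus> y \<otimes> ?u \<otimes> x) \<otimes> (\<one> \<oplus> y \<otimes> x) = \<one> \<oplus> y \<otimes> x \<ominus> y \<otimes> (?u \<otimes> (\<one> \<oplus> x \<otimes> y)) \<otimes> x"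
  using I_carrier[OF x] I_carrier[OF y] u(1) r_one by algebra
 have "\<one> \<oplus> y \<otimes> x \<in> Units T"
  unfolding Units_def using 1 2 u x y
  by (auto intro!: bexI[of _ "\<one> \<ominus> y \<otimes> ?u \<otimes> x"] simp: a_minus_def a_assoc r_neg)
 then show ?thesis using H_stable[OF yx] * by blast
qed

text \<open>The image of \<open>q\<close> is invariant under \<open>x\<close>. The factors are, in
  this order, the block on the quotient, the off-diagonal block and the block on the invariant
  part.\<close>

lemma triangular_decomp:
 assumes x: "x \<in> carrier T" and q: "q \<in> carrier T" "q \<otimes> q = q" "q \<otimes> (x \<otimes> q) = x \<otimes> q"
 shows "\<one> \<oplus> x = (\<one> \<oplus> (x \<ominus> q \<otimes> x)) \<otimes> ((\<one> \<oplus> (q \<otimes> x \<ominus> x \<otimes> q)) \<otimes> (\<one> \<oplus> x \<otimes> q))"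
proof -
 have rules: "q \<otimes> (q \<otimes> z) = q \<otimes> z" "q \<otimes> (x \<otimes> (q \<otimes> z)) = x \<otimes> (q \<otimes> z)" if "z \<in> carrier T" for z
  using q x that by (simp_all flip: m_assoc)
 have step: "q \<otimes> (x \<otimes> z) = x \<otimes> z" if "z \<in> carrier T" "q \<otimes> z = z" for z
  using rules(2)[OF that(1)] that(2) by simp
 have "q \<otimes> (x \<otimes> (x \<otimes> q)) = x \<otimes> (x \<otimes> q)" by (rule step) (use x q in auto)
 moreover from this have "q \<otimes> (x \<otimes> (x \<otimes> (x \<otimes> q))) = x \<otimes> (x \<otimes> (x \<otimes> q))"
  by (intro step) (use x q in auto)
 ultimately show ?thesis using rules q x r_one by algebra
qed

lemma triangular_elementary:
 assumes x: "x \<in> I" and q: "q \<in> I" "q \<otimes> q = q" "q \<otimes> (x \<otimes> q) = x \<otimes> q"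
 shows "\<one> \<oplus> (q \<otimes> x \<ominus> x \<otimes> q) \<in> H"
proof (rule elementary[of _ q])
 show "q \<otimes> (q \<otimes> x \<ominus> x \<otimes> q) = q \<otimes> x \<ominus> x \<otimes> q"
  using x q by (simp add: a_minus_def r_distr r_minus m_assoc[symmetric])
 show "(q \<otimes> x \<ominus> x \<otimes> q) \<otimes> q = \<zero>"
  using x q by (simp add: a_minus_def l_distr l_minus m_assoc r_neg)
qed (use x q in "auto simp: I_lmult I_minus")

lemma triangular_join:
 assumes x: "x \<in> I" and q: "q \<in> I" "q \<otimes> q = q" "q \<otimes> (x \<otimes> q) = x \<otimes> q"
  and "\<one> \<oplus> x \<otimes> q \<in> H" "\<one> \<oplus> (x \<ominus> q \<otimes> x) \<in> H"
 shows "\<one> \<oplus> x \<in> H"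
 using triangular_decomp[OF I_carrier[OF x] I_carrier[OF q(1)] q(2,3)] triangular_elementary[OF x q] assms H_mult
 by metis

lemma triangular_split:
 assumes x: "x \<in> I" and q: "q \<in> I" "q \<otimes> q = q" "q \<otimes> (x \<otimes> q) = x \<otimes> q"
  and "\<one> \<oplus> x \<otimes> q \<in> H" "\<one> \<oplus> x \<in> H"
 shows "\<one> \<oplus> (x \<ominus> q \<otimes> x) \<in> H"
proof (rule H_cancel_right)
 show "(\<one> \<oplus> (q \<otimes> x \<ominus> x \<otimes> q)) \<otimes> (\<one> \<oplus> x \<otimes> q) \<in> H"
  using triangular_elementary[OF x q] assms H_mult by blast
 show "(\<one> \<oplus> (x \<ominus> q \<otimes> x)) \<otimes> ((\<one> \<oplus> (q \<otimes> x \<ominus> x \<otimes> q)) \<otimes> (\<one> \<oplus> x \<otimes> q)) \<in> H"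
  using triangular_decomp[OF I_carrier[OF x] I_carrier[OF q(1)] q(2,3)] assms by metis
qed (use x q in auto)

text \<open>The images of the \<open>q i\<close> decrease and \<open>x\<close> carries each into the
  next. Going up from \<open>q k = \<zero>\<close>, the step from \<open>q (Suc i)\<close> to
  \<open>q i\<close> adds a quotient on which \<open>x\<close> acts as zero.\<close>

lemma filtered_nilpotent:
 assumes x: "x \<in> I" and q: "!!i. q i \<in> I" "!!i. q i \<otimes> q i = q i" "!!i. q i \<otimes> q (Suc i) = q (Suc i)"
  "!!i. q (Suc i) \<otimes> (x \<otimes> q i) = x \<otimes> q i" "x \<otimes> q 0 = x" "q k = \<zero>"
 shows "\<one> \<oplus> x \<in> H"
proof -
 have "\<one> \<oplus> x \<otimes> q (k - j) \<in> H" if "j \<le> k" for j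
  using that
 proof (induction j)
  case 0
  then show ?case using x q H_one by simp
 next
  case (Suc j)
  define i where "i = k - Suc j"
  have i: "k - j = Suc i" using Suc by (simp add: i_def)
  have e: "(x \<otimes> q i) \<otimes> q (Suc i) = x \<otimes> q (Suc i)" using x q by (simp add: m_assoc)
  have "q (Suc i) \<otimes> (x \<otimes> q (Suc i)) = q (Suc i) \<otimes> (q (Suc (Suc i)) \<otimes> (x \<otimes> q (Suc i)))"
   using q by simp
  also have "... = q (Suc (Suc i)) \<otimes> (x \<otimes> q (Suc i))"
   using x q(1,3) by (simp flip: m_assoc)
  also have "... = x \<otimes> q (Suc i)" using q by simp
  finally have t: "q (Suc i) \<otimes> (x \<otimes> q (Suc i)) = x \<otimes> q (Suc i)" .
  have "\<one> \<oplus> x \<otimes> q i \<in> H"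
   by (rule triangular_join[of _ "q (Suc i)"])
    (use x q Suc e i t H_one in "auto simp: I_lmult a_minus_def r_neg")
  then show ?case by (simp add: i_def)
 qed
 from this[of k] show ?thesis using q by simp
qed

end

section \<open>Linearising and splitting units over an abstract Laurent ring\<close>

section \<open>Reduction to idempotents and nilpotents\<close>

text \<open>Polynomials in \<open>t\<close> of degree at most \<open>d\<close>, in Horner form; the
  induction on the degree peels off one layer at a time.\<close>

primrec laurent_poly :: "('t, 'k) ring_scheme => 't set => 't => nat => 't set" where
 "laurent_poly T C t 0 = C"
| "laurent_poly T C t (Suc d) = {x \<oplus>\<^bsub>T\<^esub> y \<otimes>\<^bsub>T\<^esub> t |x y. x \<in> C & y \<in> laurent_poly T C t d}"

text \<open>Being comaximal with a fixed element is multiplicative, hence passes to powers; this is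
  applied once on either side.\<close>

lemma (in cring) comaximal_powers:
 assumes ab: "a \<in> carrier R" "b \<in> carrier R" "a \<oplus> b = \<one>"
 shows "\<exists>u\<in>carrier R. \<exists>v\<in>carrier R. a [^] (m::nat) \<otimes> u \<oplus> b [^] (n::nat) \<otimes> v = \<one>"
proof -
 have mult: "\<exists>u\<in>carrier R. \<exists>v\<in>carrier R. x \<otimes> u \<oplus> (y \<otimes> z) \<otimes> v = \<one>"
  if c: "x \<in> carrier R" "y \<in> carrier R" "z \<in> carrier R"
   and y: "\<exists>u\<in>carrier R. \<exists>v\<in>carrier R. x \<otimes> u \<oplus> y \<otimes> v = \<one>"
   and z: "\<exists>u\<in>carrier R. \<exists>v\<in>carrier R. x \<otimes> u \<oplus> z \<otimes> v = \<one>" for x y z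
 proof -
  obtain u v u' v' where uv: "u \<in> carrier R" "v \<in> carrier R" "x \<otimes> u \<oplus> y \<otimes> v = \<one>"
   "u' \<in> carrier R" "v' \<in> carrier R" "x \<otimes> u' \<oplus> z \<otimes> v' = \<one>" using y z by blast
  have "x \<otimes> (u \<otimes> (x \<otimes> u' \<oplus> z \<otimes> v') \<oplus> y \<otimes> v \<otimes> u') \<oplus> (y \<otimes> z) \<otimes> (v \<otimes> v') =
    (x \<otimes> u \<oplus> y \<otimes> v) \<otimes> (x \<otimes> u' \<oplus> z \<otimes> v')"
   using c uv(1,2,4,5) by algebra
  then have "x \<otimes> (u \<otimes> (x \<otimes> u' \<oplus> z \<otimes> v') \<oplus> y \<otimes> v \<otimes> u') \<oplus> (y \<otimes> z) \<otimes> (v \<otimes> v') = \<one>"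
   unfolding uv(3) uv(6) by simp
  then show ?thesis using c uv by (intro bexI[where x = "u \<otimes> (x \<otimes> u' \<oplus> z \<otimes> v') \<oplus> y \<otimes> v \<otimes> u'"]
     bexI[where x = "v \<otimes> v'"]) auto
 qed
 have pow: "\<exists>u\<in>carrier R. \<exists>v\<in>carrier R. x \<otimes> u \<oplus> y [^] k \<otimes> v = \<one>"
  if c: "x \<in> carrier R" "y \<in> carrier R" and y: "\<exists>u\<in>carrier R. \<exists>v\<in>carrier R. x \<otimes> u \<oplus> y \<otimes> v = \<one>"
  for x y and k :: nat
 proof (induction k)
  case 0
  show ?case using c by (intro bexI[of _ \<zero>] bexI[of _ \<one>]) auto
 next
  case (Suc k)
  show ?case using mult[OF c(1) _ c(2) Suc y] c by simp
 qed
 have "\<exists>u\<in>carrier R. \<exists>v\<in>carrier R. a \<otimes> u \<oplus> b [^] n \<otimes> v = \<one>"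
  by (rule pow) (use ab in "auto intro!: bexI[of _ \<one>]")
 then obtain u v where uv: "u \<in> carrier R" "v \<in> carrier R" "a \<otimes> u \<oplus> b [^] n \<otimes> v = \<one>" by blast
 have "\<exists>u\<in>carrier R. \<exists>v\<in>carrier R. b [^] n \<otimes> u \<oplus> a [^] m \<otimes> v = \<one>"
 proof (rule pow)
  have "b [^] n \<otimes> v \<oplus> a \<otimes> u = \<one>" using uv ab by (simp add: a_comm)
  then show "\<exists>u\<in>carrier R. \<exists>v\<in>carrier R. b [^] n \<otimes> u \<oplus> a \<otimes> v = \<one>" using uv by blast
 qed (use ab in auto)
 then obtain u' v' where "u' \<in> carrier R" "v' \<in> carrier R" "b [^] n \<otimes> u' \<oplus> a [^] m \<otimes> v' = \<one>" by blast
 then show ?thesis using ab by (intro bexI[of _ v'] bexI[of _ u']) (auto simp: a_comm)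
qed

text \<open>The case in mind is d = t - 1 and d' = 1 - 1/t. On the image of \<open>p\<close> the
  first factor is multiplication by 1 + d = t, and t (1 + \<nu>' d') = 1 + (1 + \<nu>') d; away from
  that image only 1 + \<nu> d acts.\<close>

lemma (in ring) splitting_product:
 assumes c: "p \<in> carrier R" "\<nu> \<in> carrier R" "\<nu>' \<in> carrier R" "d \<in> carrier R" "d' \<in> carrier R"
  and d: "d \<otimes> \<nu> = \<nu> \<otimes> d" "d \<otimes> \<nu>' = \<nu>' \<otimes> d" "d' \<oplus> d \<otimes> d' = d"
  and z: "\<nu> \<otimes> \<nu>' = \<zero>" "p \<otimes> \<nu> = \<zero>" "p \<otimes> \<nu>' = \<nu>'"
 shows "(\<one> \<oplus> p \<otimes> d) \<otimes> ((\<one> \<oplus> \<nu> \<otimes> d) \<otimes> (\<one> \<oplus> \<nu>' \<otimes> d')) = \<one> \<oplus> (p \<oplus> \<nu> \<oplus> \<nu>') \<otimes> d"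
proof -
 have mid: "(x \<otimes> d) \<otimes> (y \<otimes> e) = (x \<otimes> y) \<otimes> (d \<otimes> e)"
  if "x \<in> carrier R" "y \<in> carrier R" "e \<in> carrier R" "d \<otimes> y = y \<otimes> d" for x y e
 proof -
  have "(x \<otimes> d) \<otimes> (y \<otimes> e) = x \<otimes> (d \<otimes> y) \<otimes> e" using that(1-3) c by (simp add: m_assoc)
  then show ?thesis unfolding that(4) using that(1-3) c by (simp add: m_assoc)
 qed
 have "(\<nu> \<otimes> d) \<otimes> (\<nu>' \<otimes> d') = \<zero>" "(p \<otimes> d) \<otimes> (\<nu> \<otimes> d) = \<zero>" "(p \<otimes> d) \<otimes> (\<nu>' \<otimes> d') = \<nu>' \<otimes> (d \<otimes> d')"
  using c d z by (simp_all add: mid)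
 moreover have "(\<one> \<oplus> u) \<otimes> ((\<one> \<oplus> v) \<otimes> (\<one> \<oplus> w)) = \<one> \<oplus> u \<oplus> v \<oplus> (w \<oplus> u \<otimes> w) \<oplus> u \<otimes> v \<oplus> (\<one> \<oplus> u) \<otimes> (v \<otimes> w)"
  if "u \<in> carrier R" "v \<in> carrier R" "w \<in> carrier R" for u v w
  using that r_one by algebra
 ultimately have "(\<one> \<oplus> p \<otimes> d) \<otimes> ((\<one> \<oplus> \<nu> \<otimes> d) \<otimes> (\<one> \<oplus> \<nu>' \<otimes> d')) =
   \<one> \<oplus> p \<otimes> d \<oplus> \<nu> \<otimes> d \<oplus> (\<nu>' \<otimes> d' \<oplus> \<nu>' \<otimes> (d \<otimes> d'))"
  using c by simp
 also have "\<nu>' \<otimes> d' \<oplus> \<nu>' \<otimes> (d \<otimes> d') = \<nu>' \<otimes> d"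
  using c d(3) r_distr[of d' "d \<otimes> d'" \<nu>'] by simp
 finally show ?thesis using c by (simp add: l_distr a_assoc)
qed

text \<open>A commutative ring around \<open>a\<close>. It stands in for the polynomials in
  \<open>a\<close> and makes the theory of commutative rings available for the partition of unity in
  \<open>linear_special\<close>.\<close>

definition (in ring) bicommutant :: "'a => 'a set" where
 "bicommutant a = {z \<in> carrier R. \<forall>w\<in>carrier R. w \<otimes> a = a \<otimes> w \<longrightarrow> w \<otimes> z = z \<otimes> w}"

lemma (in ring) cring_bicommutant:
 assumes a: "a \<in> carrier R" and C: "C \<subseteq> carrier R" "\<one> \<in> C" "a \<in> C" "!!x. x \<in> C ==> \<ominus> x \<in> C"
  "!!x y. x \<in> C ==> y \<in> C ==> x \<oplus> y \<in> C" "!!x y. x \<in> C ==> y \<in> C ==> x \<otimes> y \<in> C"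
 shows "cring (R\<lparr>carrier := bicommutant a \<inter> C\<rparr>)" "a \<in> bicommutant a \<inter> C" "\<one> \<in> bicommutant a \<inter> C"
proof -
 let ?Z = "bicommutant a \<inter> C"
 show a': "a \<in> ?Z" "\<one> \<in> ?Z" using a C by (auto simp: bicommutant_def)
 have "subring ?Z R"
 proof (rule subringI)
  fix x y assume xy: "x \<in> ?Z" "y \<in> ?Z"
  have "w \<otimes> (x \<otimes> y) = x \<otimes> y \<otimes> w" if w: "w \<in> carrier R" "w \<otimes> a = a \<otimes> w" for w
  proof -
   have c: "x \<in> carrier R" "y \<in> carrier R" "w \<otimes> x = x \<otimes> w" "w \<otimes> y = y \<otimes> w"
    using w xy by (auto simp: bicommutant_def)
   then show ?thesis using w by (metis m_assoc)
  qed
  then show "x \<otimes> y \<in> ?Z" using C(6) xy by (auto simp: bicommutant_def)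
  show "x \<oplus> y \<in> ?Z" using C(5) xy by (auto simp: bicommutant_def l_distr r_distr)
  show "\<ominus> x \<in> ?Z" using C(4) xy by (auto simp: bicommutant_def l_minus r_minus)
 qed (use a' in "auto simp: bicommutant_def")
 moreover have "x \<otimes> y = y \<otimes> x" if "x \<in> ?Z" "y \<in> ?Z" for x y
 proof -
  have x: "x \<in> carrier R" "!!w. w \<in> carrier R ==> w \<otimes> a = a \<otimes> w ==> w \<otimes> x = x \<otimes> w"
   and y: "!!w. w \<in> carrier R ==> w \<otimes> a = a \<otimes> w ==> w \<otimes> y = y \<otimes> w"
   using that by (auto simp: bicommutant_def)
  show ?thesis by (rule y[OF x(1) x(2)[OF a refl, symmetric]])
 qed
 ultimately have "subcring ?Z R" by (rule subcringI)
 moreover have "?Z \<subseteq> carrier R" by (auto simp: bicommutant_def)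
 ultimately show "cring (R\<lparr>carrier := ?Z\<rparr>)" by (simp only: subcring_iff)
qed

text \<open>Adds a central unit \<open>t\<close> and coefficient maps linear over the constants.
  \<open>H_const\<close>, \<open>H_idem\<close> and \<open>H_nil\<close> are the three kinds of
  units to which all others will be reduced.\<close>

locale stable_laurent = stable_units T I C H s1 s2 r1 r2
 for T :: "('t, 'k) ring_scheme" (structure) and I C H :: "'t set" and s1 s2 r1 r2 :: 't +
 fixes t t' :: 't and cf :: "int => 't => 't"
 assumes t_carrier [simp]: "t \<in> carrier T" "t' \<in> carrier T"
  and t_inv: "t \<otimes> t' = \<one>" "t' \<otimes> t = \<one>"
  and t_central: "f \<in> carrier T ==> t \<otimes> f = f \<otimes> t" "f \<in> carrier T ==> t' \<otimes> f = f \<otimes> t'"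
  and I_t: "x \<in> I ==> x \<otimes> t \<in> I"
  and cf_C: "f \<in> carrier T ==> cf k f \<in> C"
  and cf_add: "f \<in> carrier T ==> g \<in> carrier T ==> cf k (f \<oplus> g) = cf k f \<oplus> cf k g"
  and cf_left: "f \<in> carrier T ==> a \<in> C ==> cf k (a \<otimes> f) = a \<otimes> cf k f"
  and cf_right: "f \<in> carrier T ==> a \<in> C ==> cf k (f \<otimes> a) = cf k f \<otimes> a"
  and cf_t: "f \<in> carrier T ==> cf k (t \<otimes> f) = cf (k - 1) f"
  and cf_one: "cf k \<one> = (if k = 0 then \<one> else \<zero>)"
  and cf_finite: "x \<in> I ==> \<exists>K. \<forall>k. \<bar>k\<bar> > K \<longrightarrow> cf k x = \<zero>"
  and I_poly: "x \<in> I ==> \<exists>K d. t [^] (K::nat) \<otimes> x \<in> laurent_poly T (I \<inter> C) t d"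
  and H_const: "[|g \<in> Units T; g \<in> C; inv g \<in> C; g \<ominus> \<one> \<in> I|] ==> g \<in> H"
  and H_idem: "[|p \<in> I \<inter> C; p \<otimes> p = p|] ==> \<one> \<ominus> p \<oplus> p \<otimes> t \<in> H"
  and H_nil: "[|\<nu> \<in> I \<inter> C; \<nu> [^] (n::nat) = \<zero>|] ==> \<one> \<oplus> \<nu> \<otimes> (t \<ominus> \<one>) \<in> H"
   "[|\<nu> \<in> I \<inter> C; \<nu> [^] (n::nat) = \<zero>|] ==> \<one> \<oplus> \<nu> \<otimes> (\<one> \<ominus> t') \<in> H"
begin

abbreviation "Pol \<equiv> laurent_poly T (I \<inter> C) t"

lemma pol_SucI: "x \<in> I \<inter> C ==> y \<in> Pol d ==> x \<oplus> y \<otimes> t \<in> Pol (Suc d)"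
 by auto

lemma pol_zero: "\<zero> \<in> Pol d"
proof (induction d)
 case (Suc d)
 from pol_SucI[OF _ this, of \<zero>] show ?case using I_zero C_zero by simp
qed (use I_zero C_zero in auto)

lemma pol_I: "x \<in> Pol d ==> x \<in> I"
 by (induction d arbitrary: x) (auto intro: I_add I_t)

lemma pol_mono: "x \<in> Pol d ==> x \<in> Pol (Suc d)"
proof (induction d arbitrary: x)
 case 0
 then show ?case using pol_SucI[of x \<zero> 0] pol_zero[of 0] by (simp del: laurent_poly.simps(2))
next
 case (Suc d)
 then obtain y z where "x = y \<oplus> z \<otimes> t" "y \<in> I \<inter> C" "z \<in> Pol d" by auto
 then show ?case using pol_SucI[of y z "Suc d"] Suc.IH[of z] by simp
qed

lemma pol_mono':
 assumes "x \<in> Pol d" "d \<le> e" shows "x \<in> Pol e"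
proof -
 have "x \<in> Pol (d + k)" for k
  by (induction k) (use assms pol_mono in "simp_all del: laurent_poly.simps")
 from this[of "e - d"] show ?thesis using assms by simp
qed

lemma pol_t: "x \<in> Pol d ==> x \<otimes> t \<in> Pol (Suc d)"
 using pol_SucI[of \<zero> x d] I_zero C_zero pol_I[of x d] by (simp del: laurent_poly.simps)

lemma pol_add: "x \<in> Pol d ==> y \<in> Pol d ==> x \<oplus> y \<in> Pol d"
proof (induction d arbitrary: x y)
 case (Suc d)
 then obtain a b a' b' where xy: "x = a \<oplus> b \<otimes> t" "y = a' \<oplus> b' \<otimes> t" "a \<in> I \<inter> C" "a' \<in> I \<inter> C"
  "b \<in> Pol d" "b' \<in> Pol d" by auto
 then have "x \<oplus> y = (a \<oplus> a') \<oplus> (b \<oplus> b') \<otimes> t"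
  using pol_I[of b] pol_I[of b'] by (simp add: l_distr a_ac)
 then show ?case using pol_SucI[OF _ Suc.IH[of b b'], of "a \<oplus> a'"] xy I_add C_add by simp
qed (auto intro: I_add C_add)

lemma pol_uminus: "x \<in> Pol d ==> \<ominus> x \<in> Pol d"
proof (induction d arbitrary: x)
 case (Suc d)
 then obtain a b where x: "x = a \<oplus> b \<otimes> t" "a \<in> I \<inter> C" "b \<in> Pol d" by auto
 then have "\<ominus> x = (\<ominus> a) \<oplus> (\<ominus> b) \<otimes> t"
  using pol_I[of b] by (simp add: l_minus minus_add)
 then show ?case using pol_SucI[OF _ Suc.IH[of b], of "\<ominus> a"] x I_uminus C_uminus by simp
qed (auto intro: I_uminus C_uminus)

lemma pol_block:
 assumes s: "s \<in> {s1, s2}" and r: "r \<in> {r1, r2}"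
 shows "x \<in> Pol d ==> s \<otimes> x \<otimes> r \<in> Pol d"
proof (induction d arbitrary: x)
 case 0
 then show ?case using s r block_I sr_C C_mult by auto
next
 case (Suc d)
 then obtain a b where x: "x = a \<oplus> b \<otimes> t" "a \<in> I \<inter> C" "b \<in> Pol d" by auto
 have c: "s \<in> carrier T" "r \<in> carrier T" "s \<in> C" "r \<in> C" using s r sr_C by auto
 have "s \<otimes> x \<otimes> r = s \<otimes> a \<otimes> r \<oplus> (s \<otimes> b \<otimes> r) \<otimes> t"
  using x c pol_I[of b] t_central[of r] by (simp add: r_distr l_distr m_assoc)
 moreover have "s \<otimes> a \<otimes> r \<in> I \<inter> C" using s r x block_I sr_C C_mult by auto
 ultimately show ?case using Suc.IH[of b] x by auto
qed

text \<open>Put b = 1 - a and compare coefficients in (1 + a (t - 1)) h = 1: the sum b c_k + a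
  c_(k-1) is 1 for k = 0 and 0 otherwise. As h has finitely many coefficients, descending from the
  top gives a^(K+1) c_0 = 0 and ascending from the bottom gives b^K c_(-1) = 0. Multiplying the
  relation at k = 0 by powers of a and b kills both of its terms.\<close>

lemma linear_factor:
 assumes a: "a \<in> I \<inter> C" and u: "\<one> \<oplus> a \<otimes> (t \<ominus> \<one>) \<in> Units T"
 shows "\<exists>n::nat. a [^] n \<otimes> (\<one> \<ominus> a) [^] n = \<zero>"
proof -
 define h where "h = inv (\<one> \<oplus> a \<otimes> (t \<ominus> \<one>))"
 have aI: "a \<in> I" "a \<in> C" "a \<in> carrier T" using a by auto
 have gI: "(\<one> \<oplus> a \<otimes> (t \<ominus> \<one>)) \<ominus> \<one> \<in> I"
 proof -
  have "a \<otimes> (t \<ominus> \<one>) = a \<otimes> t \<ominus> a" using aI by (simp add: a_minus_def r_distr r_minus)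
  then show ?thesis using aI by (simp add: I_minus I_t)
 qed
 have h: "h \<in> carrier T" and gh: "(\<one> \<oplus> a \<otimes> (t \<ominus> \<one>)) \<otimes> h = \<one>"
  using u by (auto simp: h_def)
 have hI: "h \<ominus> \<one> \<in> I" unfolding h_def by (rule inv_minus_one[OF u gI])
 define c where "c k = cf k h" for k
 have c: "c k \<in> carrier T" for k using cf_C[OF h] by (simp add: c_def)
 obtain K0 where K0: "!!k. \<bar>k\<bar> > K0 ==> cf k (h \<ominus> \<one>) = \<zero>" using cf_finite[OF hI] by blast
 \<comment> \<open>\<open>K0\<close> is an arbitrary integer. Adding one makes \<open>K\<close>
   positive, so that the ascending induction gets as far as the coefficient at -1.\<close>
 define K where "K = nat \<bar>K0\<bar> + 1"
 have cK: "c k = \<zero>" if "\<bar>k\<bar> > int K" for k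
 proof -
  have "k ~= 0" using that by auto
  have "c k = cf k (\<one> \<oplus> (h \<ominus> \<one>))" using h by (simp add: c_def)
  also have "cf k (\<one> \<oplus> (h \<ominus> \<one>)) = \<zero>" using that \<open>k ~= 0\<close> K0[of k] hI by (simp add: cf_add cf_one K_def)
  finally show ?thesis .
 qed
 let ?b = "\<one> \<ominus> a"
 have b: "?b \<in> C" "?b \<in> carrier T" using aI C_one C_minus by auto
 have ab: "a \<otimes> ?b = ?b \<otimes> a" using aI r_one by algebra
 have rel: "?b \<otimes> c k \<oplus> a \<otimes> c (k - 1) = (if k = 0 then \<one> else \<zero>)" for k
 proof -
  have "(\<one> \<oplus> a \<otimes> (t \<ominus> \<one>)) \<otimes> h = ?b \<otimes> h \<oplus> a \<otimes> (t \<otimes> h)" using aI h t_carrier r_one by algebra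
  then have "cf k (?b \<otimes> h \<oplus> a \<otimes> (t \<otimes> h)) = cf k \<one>" using gh by simp
  then show ?thesis using aI b h by (simp add: cf_add cf_left cf_t cf_one c_def)
 qed
 have rel1: "a \<otimes> c (k - 1) = \<ominus> (?b \<otimes> c k)" and rel2: "?b \<otimes> c k = \<ominus> (a \<otimes> c (k - 1))" if "k ~= 0" for k
  using rel[of k] that c b aI by (auto intro: minus_equality[symmetric] simp: a_comm)
 have up: "j \<le> K ==> a [^] Suc j \<otimes> c (int K - int j) = \<zero>" for j
 proof (induction j)
  case 0
  then show ?case using rel1[of "int K + 1"] cK[of "int K + 1"] aI b by simp
 next
  case (Suc j)
  have "a [^] Suc (Suc j) \<otimes> c (int K - int (Suc j)) = a [^] Suc j \<otimes> (a \<otimes> c ((int K - int j) - 1))"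
   using aI c by (simp add: m_assoc diff_diff_eq add.commute)
  also have "... = \<ominus> (a [^] Suc j \<otimes> (?b \<otimes> c (int K - int j)))"
   using rel1[of "int K - int j"] Suc aI b c by (simp add: r_minus del: nat_pow_Suc minus_closed)
  also have "a [^] Suc j \<otimes> (?b \<otimes> c (int K - int j)) = ?b \<otimes> (a [^] Suc j \<otimes> c (int K - int j))"
   using ab aI b c group_commutes_pow[of a ?b "Suc j"] by (simp flip: m_assoc del: nat_pow_Suc)
  finally show ?case using Suc b by (simp del: nat_pow_Suc)
 qed
 have down: "j < K ==> ?b [^] Suc j \<otimes> c (int j - int K) = \<zero>" for j
 proof (induction j)
  case 0
  then show ?case using rel2[of "- int K"] cK[of "- int K - 1"] aI b by simp
 next
  case (Suc j)
  have "?b [^] Suc (Suc j) \<otimes> c (int (Suc j) - int K) = ?b [^] Suc j \<otimes> (?b \<otimes> c (int (Suc j) - int K))"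
   using b c by (simp add: m_assoc del: minus_closed)
  also have "... = \<ominus> (?b [^] Suc j \<otimes> (a \<otimes> c (int j - int K)))"
   using rel2[of "int (Suc j) - int K"] Suc aI b c by (simp add: r_minus algebra_simps del: nat_pow_Suc minus_closed)
  also have "?b [^] Suc j \<otimes> (a \<otimes> c (int j - int K)) = a \<otimes> (?b [^] Suc j \<otimes> c (int j - int K))"
   using ab aI b c group_commutes_pow[of ?b a "Suc j"] by (simp flip: m_assoc del: nat_pow_Suc)
  finally show ?case using Suc aI b by (simp del: nat_pow_Suc)
 qed
 have K1: "K \<ge> 1" by (simp add: K_def)
 have A: "a [^] Suc K \<otimes> c 0 = \<zero>" using up[of K] by simp
 have B: "?b [^] K \<otimes> c (- 1) = \<zero>" using down[of "K - 1"] K1 by (simp add: of_nat_diff del: nat_pow_Suc)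
 let ?aK = "a [^] Suc K" and ?bK = "?b [^] Suc K"
 have pc: "?aK \<in> carrier T" "?bK \<in> carrier T" using aI b by auto
 have comm1: "?aK \<otimes> ?bK \<otimes> ?b = ?bK \<otimes> ?b \<otimes> ?aK"
 proof -
  have "?b \<otimes> a = a \<otimes> ?b" using ab by simp
  from group_commutes_pow[OF this b(2) aI(3), of "Suc (Suc K)"]
  have "?b [^] Suc (Suc K) \<otimes> a = a \<otimes> ?b [^] Suc (Suc K)" .
  then have "a \<otimes> ?b [^] Suc (Suc K) = ?b [^] Suc (Suc K) \<otimes> a" by simp
  from group_commutes_pow[OF this, of "Suc K"] show ?thesis using aI b by (simp add: m_assoc del: minus_closed)
 qed
 have comm2: "?bK \<otimes> a = a \<otimes> ?bK"
  by (rule group_commutes_pow) (use ab aI b in auto)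
 have "?aK \<otimes> ?bK = ?aK \<otimes> ?bK \<otimes> (?b \<otimes> c 0 \<oplus> a \<otimes> c (- 1))"
  using rel[of 0] pc by simp
 also have "... = ?aK \<otimes> ?bK \<otimes> ?b \<otimes> c 0 \<oplus> ?aK \<otimes> (?bK \<otimes> a) \<otimes> c (- 1)"
  using pc b aI c by (simp only: r_distr m_assoc m_closed)
 also have "?aK \<otimes> ?bK \<otimes> ?b \<otimes> c 0 = ?bK \<otimes> ?b \<otimes> (?aK \<otimes> c 0)"
  unfolding comm1 using pc b c by (simp only: m_assoc m_closed)
 also have "?aK \<otimes> (?bK \<otimes> a) \<otimes> c (- 1) = ?aK \<otimes> a \<otimes> (?bK \<otimes> c (- 1))"
  unfolding comm2 using pc aI c by (simp only: m_assoc m_closed)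
 also have "?bK \<otimes> c (- 1) = ?b \<otimes> (?b [^] K \<otimes> c (- 1))"
  using nat_pow_comm[of ?b K 1] b c by (simp flip: m_assoc del: minus_closed)
 finally have "?aK \<otimes> ?bK = \<zero>" using A B aI b pc by (simp del: nat_pow_Suc)
 then show ?thesis by blast
qed

text \<open>From a^n (1 - a)^n = 0 one splits off generalised eigenvalues 1 and 0: an idempotent P
  on which a - 1 is nilpotent, and its complement Q on which a is nilpotent. Then a = P + a Q + (a -
  1) P, and \<open>splitting_product\<close> turns this sum into a product of the assumed
  units.\<close>

lemma linear_special:
 assumes a: "a \<in> I \<inter> C" and u: "\<one> \<oplus> a \<otimes> (t \<ominus> \<one>) \<in> Units T"
 shows "\<one> \<oplus> a \<otimes> (t \<ominus> \<one>) \<in> H"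
proof -
 have aI: "a \<in> I" "a \<in> C" "a \<in> carrier T" using a by auto
 obtain n0 :: nat where n0: "a [^] n0 \<otimes> (\<one> \<ominus> a) [^] n0 = \<zero>" using linear_factor[OF assms] by blast
 let ?b = "\<one> \<ominus> a"
 let ?Z = "bicommutant a \<inter> C"
 let ?S = "T\<lparr>carrier := ?Z\<rparr>"
 have cr: "cring ?S" and aZ: "a \<in> ?Z" and oZ: "\<one> \<in> ?Z"
  using cring_bicommutant[of a C] aI C_sub C_one C_add C_uminus C_mult by auto
 interpret Z: cring ?S by (rule cr)
 \<comment> \<open>Unlike sums and products, negation depends on the carrier of the record, so it is
   compared by hand.\<close>
 have minus: "\<ominus>\<^bsub>?S\<^esub> x = \<ominus> x" if "x \<in> ?Z" for x
 proof -
  have "x \<oplus> (\<ominus>\<^bsub>?S\<^esub> x) = \<zero>" "\<ominus>\<^bsub>?S\<^esub> x \<in> ?Z" using Z.r_neg[of x] Z.a_inv_closed[of x] that by auto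
  then show ?thesis using that minus_equality[of "\<ominus>\<^bsub>?S\<^esub> x" x] by (auto simp: bicommutant_def a_comm)
 qed
 have bZ: "?b \<in> ?Z" using Z.minus_closed[of \<one> a] aZ oZ minus[OF aZ] by (simp add: a_minus_def)
 have pow: "x [^]\<^bsub>?S\<^esub> (k::nat) = x [^] k" for x k
  by (simp add: nat_pow_def)
 \<comment> \<open>A positive exponent makes \<open>P\<close> a multiple of \<open>a\<close>, hence
   an element of \<open>I\<close>, and leaves a factor to absorb in the proof of nilpotency.\<close>
 define n where "n = Suc n0"
 have abn: "a [^] n \<otimes> ?b [^] n = \<zero>"
 proof -
  have "a [^] n \<otimes> ?b [^] n = (a \<otimes> ?b) \<otimes> (a [^] n0 \<otimes> ?b [^] n0)"
  proof -
   have Z: "a [^] n0 \<in> ?Z" "?b [^] n0 \<in> ?Z"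
    using Z.nat_pow_closed[of a n0] Z.nat_pow_closed[of ?b n0] aZ bZ by (simp_all add: pow)
   have "a [^] n \<otimes> ?b [^] n = (a \<otimes> a [^] n0) \<otimes> (?b \<otimes> ?b [^] n0)"
    using Z.m_comm[of a "a [^] n0"] Z.m_comm[of ?b "?b [^] n0"] Z aZ bZ by (simp add: n_def)
   also have "... = a \<otimes> (a [^] n0 \<otimes> (?b \<otimes> ?b [^] n0))" using Z.m_assoc[of a "a [^] n0" "?b \<otimes> ?b [^] n0"] Z.m_closed[of ?b "?b [^] n0"] Z aZ bZ by simp
   also have "a [^] n0 \<otimes> (?b \<otimes> ?b [^] n0) = ?b \<otimes> (a [^] n0 \<otimes> ?b [^] n0)"
    using Z.m_lcomm[of "a [^] n0" ?b "?b [^] n0"] Z aZ bZ by simp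
   finally show ?thesis using Z.m_assoc[of a ?b "a [^] n0 \<otimes> ?b [^] n0"] Z.m_closed[of "a [^] n0" "?b [^] n0"] Z aZ bZ by simp
  qed
  then show ?thesis using n0 aI by simp
 qed
 have "a \<oplus> ?b = \<one>" using aI r_one by algebra
 then have "\<exists>u\<in>?Z. \<exists>v\<in>?Z. a [^] n \<otimes> u \<oplus> ?b [^] n \<otimes> v = \<one>"
  using Z.comaximal_powers[of a ?b n n] aZ bZ by (simp add: pow)
 then obtain u v where uv: "u \<in> ?Z" "v \<in> ?Z" "a [^] n \<otimes> u \<oplus> ?b [^] n \<otimes> v = \<one>" by blast
 define P where "P = a [^] n \<otimes> u"
 define Q where "Q = ?b [^] n \<otimes> v"
 have an: "a [^] k \<in> ?Z" and bn: "?b [^] k \<in> ?Z" for k :: nat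
  using Z.nat_pow_closed[of a k] Z.nat_pow_closed[of ?b k] aZ bZ by (simp_all add: pow)
 have PQ: "P \<in> ?Z" "Q \<in> ?Z" using Z.m_closed an bn uv by (simp_all add: P_def Q_def)
 have sum: "P \<oplus> Q = \<one>" using uv by (simp add: P_def Q_def)
 have cZ [simp]: "x \<in> ?Z ==> x \<in> carrier T" for x by (auto simp: bicommutant_def)
 have comm: "x \<otimes> y = y \<otimes> x" if "x \<in> ?Z" "y \<in> ?Z" for x y using Z.m_comm that by simp
 have "P \<otimes> Q = a [^] n \<otimes> (u \<otimes> ?b [^] n) \<otimes> v"
  using an bn uv by (simp add: P_def Q_def m_assoc del: IntE minus_closed)
 also have "... = (a [^] n \<otimes> ?b [^] n) \<otimes> (u \<otimes> v)"
  unfolding comm[OF uv(1) bn] using an bn uv by (simp add: m_assoc del: minus_closed)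
 finally have "P \<otimes> Q = (a [^] n \<otimes> ?b [^] n) \<otimes> (u \<otimes> v)" .
 then have PQ0: "P \<otimes> Q = \<zero>" using abn uv by simp
 have comm: "x \<otimes> y = y \<otimes> x" if "x \<in> ?Z" "y \<in> ?Z" for x y using Z.m_comm that by simp
 have QP0: "Q \<otimes> P = \<zero>" using PQ0 comm PQ by simp
 have Q: "Q = \<one> \<ominus> P" using sum PQ by (metis (no_types, lifting) a_minus_def cZ minus_equality a_comm add.inv_solve_right one_closed)
 have PP: "P \<otimes> P = P"
 proof -
  have "P = P \<otimes> (P \<oplus> Q)" using sum PQ by simp
  also have "... = P \<otimes> P" using PQ PQ0 by (simp add: r_distr)
  finally show ?thesis by simp
 qed
 have anQ: "a [^] n \<otimes> Q = \<zero>"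
  using abn uv an bn mult_zero_assoc[OF abn] by (simp add: Q_def)
 have bnP: "?b [^] n \<otimes> P = \<zero>"
 proof -
  have "?b [^] n \<otimes> P = (a [^] n \<otimes> ?b [^] n) \<otimes> u"
   using Z.m_ac an bn uv by (simp add: P_def)
  then show ?thesis using abn uv by simp
 qed
 have powI: "x \<in> I ==> x [^] Suc k \<in> I" for x and k :: nat
  by (simp add: I_lmult)
 have P_I: "P \<in> I" unfolding P_def comm[OF an uv(1)] using uv powI[OF aI(1), of n0] by (simp add: n_def I_lmult del: nat_pow_Suc)
 have nil: "(x \<otimes> y) [^] n = \<zero>" if "x \<in> ?Z" "y \<in> ?Z" "x [^] n \<otimes> y = \<zero>" for x y
 proof -
  have yk: "y [^] k \<in> ?Z" "x [^] k \<in> ?Z" for k :: nat using Z.nat_pow_closed[of y k] Z.nat_pow_closed[of x k] that by (simp_all add: pow)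
  have "(x \<otimes> y) [^] n = x [^] n \<otimes> y [^] n"
   using Z.nat_pow_distrib[of x y n] that by (simp add: pow)
  also have "y [^] n = y \<otimes> y [^] n0"
   using comm[OF yk(1) that(2)] by (simp add: n_def)
  also have "x [^] n \<otimes> (y \<otimes> y [^] n0) = \<zero>"
   by (rule mult_zero_assoc[OF that(3)]) (use yk that in auto)
  finally show ?thesis .
 qed
 let ?\<nu> = "a \<otimes> Q" and ?\<nu>' = "(a \<ominus> \<one>) \<otimes> P"
 have PC: "P \<in> C" "Q \<in> C" using PQ by auto
 have nu: "?\<nu> \<in> I \<inter> C" unfolding comm[OF aZ PQ(2)] using aI PQ PC by (simp add: I_lmult C_mult)
 have nu': "?\<nu>' \<in> I \<inter> C" using aI PQ PC P_I C_one by (simp add: I_lmult C_mult C_minus)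
 have b': "a \<ominus> \<one> = \<ominus> ?b" using aI by (simp add: a_minus_def minus_add a_comm)
 have nuP: "?\<nu>' = ?b \<otimes> (\<ominus> P)" unfolding b' using PQ bZ by (simp add: l_minus r_minus del: minus_closed)
 have mP: "\<ominus> P \<in> ?Z" using Z.a_inv_closed[of P] minus[OF PQ(1)] PQ by simp
 have e1: "\<one> \<oplus> ?\<nu> \<otimes> (t \<ominus> \<one>) \<in> H"
  by (rule H_nil(1)[OF nu nil[OF aZ PQ(2) anQ]])
 have e2: "\<one> \<oplus> ?\<nu>' \<otimes> (\<one> \<ominus> t') \<in> H"
  by (rule H_nil(2)[OF nu']) (unfold nuP, rule nil[OF bZ mP], use bnP bn PQ in "simp add: r_minus")
 have e3: "\<one> \<ominus> P \<oplus> P \<otimes> t \<in> H" by (rule H_idem) (use P_I PC PP in auto)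
 have "(\<one> \<ominus> P \<oplus> P \<otimes> t) \<otimes> ((\<one> \<oplus> ?\<nu> \<otimes> (t \<ominus> \<one>)) \<otimes> (\<one> \<oplus> ?\<nu>' \<otimes> (\<one> \<ominus> t'))) = \<one> \<oplus> a \<otimes> (t \<ominus> \<one>)"
 proof -
  have c: "a \<in> carrier T" "P \<in> carrier T" "Q \<in> carrier T" using aI PQ by auto
  have cn: "?\<nu> \<in> carrier T" "?\<nu>' \<in> carrier T" using c by auto
  have cd: "t \<ominus> \<one> \<in> carrier T" "\<one> \<ominus> t' \<in> carrier T" by auto
  have d: "(t \<ominus> \<one>) \<otimes> x = x \<otimes> (t \<ominus> \<one>)" if "x \<in> carrier T" for x
   using that t_central[of x] by (simp add: a_minus_def l_distr r_distr l_minus r_minus)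
  have d': "\<one> \<ominus> t' \<oplus> (t \<ominus> \<one>) \<otimes> (\<one> \<ominus> t') = t \<ominus> \<one>"
   using t_inv t_carrier r_one by algebra
  have aQ: "a \<otimes> Q = Q \<otimes> a" by (rule comm[OF aZ PQ(2)])
  have aP: "(a \<ominus> \<one>) \<otimes> P = P \<otimes> (a \<ominus> \<one>)"
   using comm[OF aZ PQ(1)] c by (simp add: a_minus_def l_distr r_distr l_minus r_minus)
  have z1: "?\<nu> \<otimes> ?\<nu>' = \<zero>"
   unfolding aP using mult_zero_assoc[OF QP0] c by (simp add: m_assoc)
  have z2: "P \<otimes> ?\<nu> = \<zero>" unfolding aQ using mult_zero_assoc[OF PQ0] c by simp
  have z3: "P \<otimes> ?\<nu>' = ?\<nu>'" unfolding aP using PP c by (simp flip: m_assoc)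
  have s1: "\<one> \<ominus> P \<oplus> P \<otimes> t = \<one> \<oplus> P \<otimes> (t \<ominus> \<one>)" using c t_carrier r_one by algebra
  have s2: "P \<oplus> ?\<nu> \<oplus> ?\<nu>' = a" unfolding Q using c(1,2) r_one by algebra
  show ?thesis
   unfolding s1 using splitting_product[OF c(2) cn cd d[OF cn(1)] d[OF cn(2)] d' z1 z2 z3] unfolding s2 .
 qed
 then show ?thesis using e1 e2 e3 H_mult by metis
qed

text \<open>The value at t = 1 is the constant \<alpha> = 1 + m0 + m1; dividing by it leaves the
  special form. Its inverse ought to be the value of \<open>h\<close> at t = 1, and this is formed
  by adding up the coefficients of \<open>h\<close>.\<close>

lemma linear:
 assumes m: "m0 \<in> I \<inter> C" "m1 \<in> I \<inter> C" and u: "\<one> \<oplus> (m0 \<oplus> m1 \<otimes> t) \<in> Units T"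
 shows "\<one> \<oplus> (m0 \<oplus> m1 \<otimes> t) \<in> H"
proof -
 let ?g = "\<one> \<oplus> (m0 \<oplus> m1 \<otimes> t)"
 define h where "h = inv ?g"
 have mI: "m0 \<in> I" "m0 \<in> C" "m1 \<in> I" "m1 \<in> C" "m0 \<in> carrier T" "m1 \<in> carrier T" using m by auto
 have gI: "?g \<ominus> \<one> \<in> I" using mI by (simp add: I_add I_t)
 have h: "h \<in> carrier T" and gh: "?g \<otimes> h = \<one>" and hg: "h \<otimes> ?g = \<one>" using u by (auto simp: h_def)
 have hI: "h \<ominus> \<one> \<in> I" unfolding h_def by (rule inv_minus_one[OF u gI])
 define c where "c k = cf k h" for k
 have cC: "c k \<in> C" "c k \<in> carrier T" for k using cf_C[OF h] by (auto simp: c_def)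
 obtain K0 where K0: "!!k. \<bar>k\<bar> > K0 ==> cf k (h \<ominus> \<one>) = \<zero>" using cf_finite[OF hI] by blast
 define K where "K = nat \<bar>K0\<bar> + 1"
 have cK: "c k = \<zero>" if "\<bar>k\<bar> > int K" for k
 proof -
  have "k ~= 0" using that by auto
  have "c k = cf k (\<one> \<oplus> (h \<ominus> \<one>))" using h by (simp add: c_def)
  also have "cf k (\<one> \<oplus> (h \<ominus> \<one>)) = \<zero>" using that \<open>k ~= 0\<close> K0[of k] hI by (simp add: cf_add cf_one K_def)
  finally show ?thesis .
 qed
 let ?m = "\<one> \<oplus> m0"
 have mC: "?m \<in> C" "?m \<in> carrier T" using mI C_one C_add by auto
 have rel: "?m \<otimes> c k \<oplus> m1 \<otimes> c (k - 1) = (if k = 0 then \<one> else \<zero>)" for k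
 proof -
  have "?g \<otimes> h = ?m \<otimes> h \<oplus> m1 \<otimes> (t \<otimes> h)" using mI h t_carrier r_one by algebra
  then have "cf k (?m \<otimes> h \<oplus> m1 \<otimes> (t \<otimes> h)) = cf k \<one>" using gh by simp
  then show ?thesis using mI mC h by (simp add: cf_add cf_left cf_t cf_one c_def)
 qed
 have rel': "c k \<otimes> ?m \<oplus> c (k - 1) \<otimes> m1 = (if k = 0 then \<one> else \<zero>)" for k
 proof -
  have "h \<otimes> ?g = h \<otimes> ?m \<oplus> (h \<otimes> m1) \<otimes> t" using mI h t_carrier r_one by algebra
  also have "(h \<otimes> m1) \<otimes> t = t \<otimes> h \<otimes> m1" using t_central[of "h \<otimes> m1"] h mI by (simp add: m_assoc)
  finally have "cf k (h \<otimes> ?m \<oplus> t \<otimes> h \<otimes> m1) = cf k \<one>" using hg by simp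
  then show ?thesis using mI mC h by (simp add: cf_add cf_right cf_t cf_one c_def)
 qed
 define \<alpha> where "\<alpha> = ?m \<oplus> m1"
 have \<alpha>: "\<alpha> \<in> C" "\<alpha> \<in> carrier T" using mC mI C_add by (auto simp: \<alpha>_def)
 \<comment> \<open>Partial sums of the coefficients, starting at degree -K, below which all vanish.
   Multiplication by \<alpha> makes them telescope.\<close>
 define S where "S = rec_nat \<zero> (%j s. s \<oplus> c (int j - int K))"
 have S_Suc: "S (Suc j) = S j \<oplus> c (int j - int K)" and S_0: "S 0 = \<zero>" for j by (auto simp: S_def)
 have S: "S j \<in> C" for j by (induction j) (auto simp: S_Suc S_0 C_zero C_add cC)
 have S': "S j \<in> carrier T" for j using S by auto
 have tel: "\<alpha> \<otimes> S j = (if j > K then \<one> else \<zero>) \<oplus> m1 \<otimes> c (int j - int K - 1) \<and>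
   S j \<otimes> \<alpha> = (if j > K then \<one> else \<zero>) \<oplus> c (int j - int K - 1) \<otimes> m1" for j
 proof (induction j)
  case 0
  then show ?case using cK[of "- int K - 1"] \<alpha> mI by (simp add: S_0)
 next
  case (Suc j)
  let ?d = "if int j - int K = 0 then \<one> else \<zero>" and ?e = "if j > K then \<one> else \<zero>"
  let ?c = "c (int j - int K)" and ?c' = "c (int j - int K - 1)"
  have de: "?d \<in> carrier T" "?e \<in> carrier T" by auto
  have e: "(if Suc j > K then \<one> else \<zero>) = ?e \<oplus> ?d" by auto
  have 1: "\<alpha> \<otimes> S (Suc j) = (?e \<oplus> m1 \<otimes> ?c') \<oplus> (?m \<otimes> ?c \<oplus> m1 \<otimes> ?c)"
   unfolding S_Suc using Suc \<alpha> S' cC mC mI by (simp add: r_distr) (simp add: \<alpha>_def l_distr cC mI)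
  have "(?e \<oplus> m1 \<otimes> ?c') \<oplus> (?m \<otimes> ?c \<oplus> m1 \<otimes> ?c) = ?e \<oplus> (?m \<otimes> ?c \<oplus> m1 \<otimes> ?c') \<oplus> m1 \<otimes> ?c"
   using de cC mC mI by (simp only: a_ac a_closed m_closed)
  then have l: "\<alpha> \<otimes> S (Suc j) = ?e \<oplus> ?d \<oplus> m1 \<otimes> ?c" unfolding 1 rel by simp
  have 2: "S (Suc j) \<otimes> \<alpha> = (?e \<oplus> ?c' \<otimes> m1) \<oplus> (?c \<otimes> ?m \<oplus> ?c \<otimes> m1)"
   unfolding S_Suc using Suc \<alpha> S' cC mC mI by (simp add: l_distr) (simp add: \<alpha>_def r_distr cC mI)
  have "(?e \<oplus> ?c' \<otimes> m1) \<oplus> (?c \<otimes> ?m \<oplus> ?c \<otimes> m1) = ?e \<oplus> (?c \<otimes> ?m \<oplus> ?c' \<otimes> m1) \<oplus> ?c \<otimes> m1"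
   using de cC mC mI by (simp only: a_ac a_closed m_closed)
  then have r: "S (Suc j) \<otimes> \<alpha> = ?e \<oplus> ?d \<oplus> ?c \<otimes> m1" unfolding 2 rel' by simp
  show ?case unfolding l r e by simp
 qed
 \<comment> \<open>These \<open>2 * K + 2\<close> terms cover the degrees from -K to K + 1, so what
   remains of the telescope is the coefficient at K + 1, which is zero.\<close>
 define \<beta> where "\<beta> = S (2 * K + 2)"
 have \<beta>: "\<beta> \<in> C" "\<beta> \<in> carrier T" "\<alpha> \<otimes> \<beta> = \<one>" "\<beta> \<otimes> \<alpha> = \<one>"
  using S S' tel[of "2 * K + 2"] cK[of "1 + int K"] mI by (auto simp: \<beta>_def)
 have \<alpha>u: "\<alpha> \<in> Units T" "inv \<alpha> = \<beta>" using \<alpha> \<beta> by (auto simp: Units_def intro!: inv_char)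
 have "\<alpha> \<ominus> \<one> \<in> I" using minus_one_plus[of "m0 \<oplus> m1"] mI by (simp add: \<alpha>_def a_assoc I_add)
 then have \<alpha>H: "\<alpha> \<in> H" using \<alpha>u \<alpha> \<beta> by (intro H_const) auto
 let ?a = "\<beta> \<otimes> m1"
 have aIC: "?a \<in> I \<inter> C" using \<beta> mI by (simp add: I_lmult C_mult)
 have "?g = \<alpha> \<oplus> m1 \<otimes> (t \<ominus> \<one>)" unfolding \<alpha>_def using mI r_one t_carrier by algebra
 also have "... = \<alpha> \<otimes> (\<one> \<oplus> ?a \<otimes> (t \<ominus> \<one>))"
 proof -
  have "\<alpha> \<otimes> (\<one> \<oplus> ?a \<otimes> (t \<ominus> \<one>)) = \<alpha> \<oplus> (\<alpha> \<otimes> \<beta>) \<otimes> (m1 \<otimes> (t \<ominus> \<one>))"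
   using \<beta>(2) \<alpha>(2) mI by (simp add: r_distr m_assoc)
  then show ?thesis using \<beta> mI by simp
 qed
 finally have g: "?g = \<alpha> \<otimes> (\<one> \<oplus> ?a \<otimes> (t \<ominus> \<one>))" .
 have "\<one> \<oplus> ?a \<otimes> (t \<ominus> \<one>) = \<beta> \<otimes> ?g"
  unfolding g using \<beta> \<alpha> mI by (simp flip: m_assoc)
 moreover have "\<beta> \<in> Units T" using \<alpha>u Units_inv_Units by metis
 ultimately have "\<one> \<oplus> ?a \<otimes> (t \<ominus> \<one>) \<in> Units T" using u by simp
 then have "\<one> \<oplus> ?a \<otimes> (t \<ominus> \<one>) \<in> H" by (rule linear_special[OF aIC])
 then show ?thesis unfolding g using H_mult \<alpha>H by blast
qed

text \<open>Higman's trick: at the price of doubling the size, the degree drops by one.\<close>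

lemma polynomial:
 assumes "x \<in> Pol (Suc d)" "\<one> \<oplus> x \<in> Units T" shows "\<one> \<oplus> x \<in> H"
 using assms
proof (induction d arbitrary: x)
 case 0
 then show ?case using linear by auto
next
 case (Suc d)
 then obtain m y where x: "x = m \<oplus> y \<otimes> t" "m \<in> I \<inter> C" "y \<in> Pol (Suc d)" by auto
 have yI: "y \<in> I" using x pol_I by blast
 have xI: "x \<in> I" using Suc(2) pol_I by blast
 \<comment> \<open>A finitary substitute for the identity: y t = y (q t), and the second factor
   stays in \<open>I\<close>.\<close>
 obtain q where q: "q \<in> I \<inter> C" "y \<otimes> q = y" using local_unit[OF yI yI] by blast
 have qt: "q \<otimes> t \<in> I" using q I_t by auto
 let ?a = "s1 \<otimes> y \<otimes> r2" and ?b = "s2 \<otimes> (q \<otimes> t) \<otimes> r1" and ?m = "s1 \<otimes> m \<otimes> r1"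
 have c: "?a \<in> carrier T" "?b \<in> carrier T" "?m \<in> carrier T" using yI q x by auto
 have ab: "?a \<otimes> ?b = s1 \<otimes> (y \<otimes> t) \<otimes> r1"
 proof -
  have "?a \<otimes> ?b = s1 \<otimes> (y \<otimes> (q \<otimes> t)) \<otimes> r1" by (rule block_mult(2)) (use yI qt in auto)
  also have "y \<otimes> (q \<otimes> t) = y \<otimes> t" using yI q by (simp flip: m_assoc)
  finally show ?thesis .
 qed
 have z: "?a \<otimes> ?a = \<zero>" "?b \<otimes> ?b = \<zero>" "?a \<otimes> ?m = \<zero>" "?m \<otimes> ?b = \<zero>"
  using yI qt x by (simp_all only: block_mult I_carrier sr_carrier m_closed IntE, simp_all add: block_mult)
 have sx: "s1 \<otimes> x \<otimes> r1 = ?m \<oplus> ?a \<otimes> ?b"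
  unfolding ab using x yI by (simp add: r_distr l_distr)
 \<comment> \<open>The block matrix with rows (m, -y) and (q t, 0). The product y t has been
   replaced by its two factors, each of degree at most \<open>Suc d\<close>.\<close>
 let ?w = "?m \<ominus> ?a \<oplus> ?b"
 have eq: "(\<one> \<ominus> ?a) \<otimes> (\<one> \<oplus> s1 \<otimes> x \<otimes> r1) \<otimes> (\<one> \<oplus> ?b) = \<one> \<oplus> ?w"
 proof -
  have "(\<one> \<ominus> \<alpha>) \<otimes> (\<one> \<oplus> (\<mu> \<oplus> \<alpha> \<otimes> \<beta>)) \<otimes> (\<one> \<oplus> \<beta>) = \<one> \<oplus> (\<mu> \<ominus> \<alpha> \<oplus> \<beta>)"
   if "\<alpha> \<in> carrier T" "\<beta> \<in> carrier T" "\<mu> \<in> carrier T"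
    and z: "\<alpha> \<otimes> \<alpha> = \<zero>" "\<beta> \<otimes> \<beta> = \<zero>" "\<alpha> \<otimes> \<mu> = \<zero>" "\<mu> \<otimes> \<beta> = \<zero>" for \<alpha> \<beta> \<mu>
   using that z[THEN mult_zero_assoc] r_one by algebra
  from this[OF c z] show ?thesis unfolding sx .
 qed
 note el = elementary_block_minus(1)[OF yI] elementary_block(2)[OF qt]
 obtain h where h: "h \<in> carrier T" "(\<one> \<oplus> x) \<otimes> h = \<one>" "h \<otimes> (\<one> \<oplus> x) = \<one>" using Suc(3) by (auto simp: Units_def)
 \<comment> \<open>Write the inverse of 1 + x as 1 + y; placed in the same corner, y gives the
   inverse of the block sum.\<close>
 have su: "\<one> \<oplus> s1 \<otimes> x \<otimes> r1 \<in> Units T"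
 proof -
  define y where "y = h \<ominus> \<one>"
  have y: "y \<in> carrier T" "h = \<one> \<oplus> y" using h by (auto simp: y_def)
  have sum0: "x \<oplus> (y \<oplus> x \<otimes> y) = \<zero>" "x \<oplus> (y \<oplus> y \<otimes> x) = \<zero>"
  proof -
   have "x \<oplus> (y \<oplus> x \<otimes> y) = (\<one> \<oplus> x) \<otimes> (\<one> \<oplus> y) \<ominus> \<one>" "x \<oplus> (y \<oplus> y \<otimes> x) = (\<one> \<oplus> y) \<otimes> (\<one> \<oplus> x) \<ominus> \<one>"
    using xI[THEN I_carrier] y(1) r_one by algebra+
   then show "x \<oplus> (y \<oplus> x \<otimes> y) = \<zero>" "x \<oplus> (y \<oplus> y \<otimes> x) = \<zero>" using h y by (auto simp: a_minus_def r_neg)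
  qed
  have gen: "(\<one> \<oplus> s1 \<otimes> u \<otimes> r1) \<otimes> (\<one> \<oplus> s1 \<otimes> w \<otimes> r1) = \<one> \<oplus> s1 \<otimes> (u \<oplus> (w \<oplus> u \<otimes> w)) \<otimes> r1"
   if "u \<in> carrier T" "w \<in> carrier T" for u w
  proof -
   have "s1 \<otimes> (u \<oplus> (w \<oplus> u \<otimes> w)) \<otimes> r1 = s1 \<otimes> u \<otimes> r1 \<oplus> (s1 \<otimes> w \<otimes> r1 \<oplus> s1 \<otimes> (u \<otimes> w) \<otimes> r1)"
    using that by (simp add: r_distr l_distr)
   also have "s1 \<otimes> (u \<otimes> w) \<otimes> r1 = (s1 \<otimes> u \<otimes> r1) \<otimes> (s1 \<otimes> w \<otimes> r1)" using that by (simp add: block_mult)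
   finally show ?thesis using that by (simp add: r_distr l_distr a_ac)
  qed
  show ?thesis
   unfolding Units_def using gen[of x y] gen[of y x] sum0 xI y by (auto intro!: bexI[of _ "\<one> \<oplus> s1 \<otimes> y \<otimes> r1"] simp: a_ac)
 qed
 have wP: "?w \<in> Pol (Suc d)"
 proof -
  have "?m \<in> Pol (Suc d)" using pol_block[of s1 r1 m 0] x(2) pol_mono'[of ?m 0 "Suc d"] by simp
  moreover have "?a \<in> Pol (Suc d)" by (rule pol_block) (use x in auto)
  moreover have "?b \<in> Pol (Suc d)"
  proof (rule pol_block)
   have "q \<otimes> t \<in> Pol (Suc 0)" by (rule pol_t) (use q in auto)
   then show "q \<otimes> t \<in> Pol (Suc d)" by (rule pol_mono') simp
  qed auto
  ultimately show ?thesis unfolding a_minus_def by (intro pol_add pol_uminus)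
 qed
 have "\<one> \<oplus> ?w \<in> Units T"
  unfolding eq[symmetric] using el[THEN H_Units] su by (intro Units_m_closed) auto
 then have "\<one> \<oplus> ?w \<in> H" by (rule Suc.IH[OF wP])
 then have "(\<one> \<ominus> ?a) \<otimes> (\<one> \<oplus> s1 \<otimes> x \<otimes> r1) \<otimes> (\<one> \<oplus> ?b) \<in> H" unfolding eq .
 then have "(\<one> \<ominus> ?a) \<otimes> (\<one> \<oplus> s1 \<otimes> x \<otimes> r1) \<in> H"
  by (rule H_cancel_right[OF _ el(2), rotated]) (use c su in auto)
 then have "\<one> \<oplus> s1 \<otimes> x \<otimes> r1 \<in> H"
  by (rule H_cancel_left[OF el(1), rotated]) (use su in auto)
 then show ?case using H_stable[OF xI Suc(3)] by simp
qed

text \<open>Negative powers of t are cleared by 1 - p + p t^K with a local unit \<open>p\<close> for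
  \<open>x\<close>, since t^K itself does not differ from 1 by an element of \<open>I\<close>. The
  unit used is a product of \<open>K\<close> units given by \<open>H_idem\<close>.\<close>

theorem all_units:
 assumes x: "x \<in> I" and u: "\<one> \<oplus> x \<in> Units T" shows "\<one> \<oplus> x \<in> H"
proof -
 obtain K d where Kd: "t [^] (K::nat) \<otimes> x \<in> Pol d" using I_poly[OF x] by blast
 obtain p where p: "p \<in> I \<inter> C" "p \<otimes> p = p" "p \<otimes> x = x" using local_unit[OF x x] by blast
 have pc: "p \<in> carrier T" "x \<in> carrier T" using p x by auto
 have tk: "t [^] k \<otimes> p = p \<otimes> t [^] k" for k :: nat
  by (rule group_commutes_pow) (use pc t_central in auto)
 have tau: "\<one> \<ominus> p \<oplus> p \<otimes> t [^] k \<in> H & p \<otimes> t [^] k \<in> Pol k" for k :: nat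
 proof (induction k)
  case 0
  then show ?case using p pc H_one by (simp add: a_minus_def a_assoc l_neg)
 next
  case (Suc k)
  have rule: "t [^] k \<otimes> (p \<otimes> z) = p \<otimes> (t [^] k \<otimes> z)" "p \<otimes> (p \<otimes> z) = p \<otimes> z" if "z \<in> carrier T" for z
   using tk[of k] p pc that by (simp_all flip: m_assoc)
  define w where "w = t [^] k"
  have w: "w \<in> carrier T" by (simp add: w_def)
  note rule' = rule[folded w_def] tk[of k, folded w_def]
  have "(\<one> \<ominus> p \<oplus> p \<otimes> w) \<otimes> (\<one> \<ominus> p \<oplus> p \<otimes> t) = \<one> \<ominus> p \<oplus> p \<otimes> (w \<otimes> t)"
   using pc(1) w p(2) rule' r_one t_carrier by algebra
  then have "\<one> \<ominus> p \<oplus> p \<otimes> t [^] Suc k \<in> H"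
   using H_mult[OF _ H_idem[OF p(1,2)], of "\<one> \<ominus> p \<oplus> p \<otimes> t [^] k"] Suc by (simp add: w_def)
  moreover have "p \<otimes> t [^] Suc k \<in> Pol (Suc k)"
   using pol_t[of "p \<otimes> t [^] k" k] Suc pc by (simp add: m_assoc del: laurent_poly.simps)
  ultimately show ?case by blast
 qed
 let ?\<tau> = "\<one> \<ominus> p \<oplus> p \<otimes> t [^] K"
 let ?e = "Suc (max K d)"
 have "?\<tau> \<otimes> (\<one> \<oplus> x) = \<one> \<oplus> (p \<otimes> t [^] K \<ominus> p \<oplus> t [^] K \<otimes> x)"
 proof -
  define w where "w = t [^] K"
  have w: "w \<in> carrier T" "p \<otimes> (w \<otimes> x) = w \<otimes> x"
  proof -
   show w: "w \<in> carrier T" by (simp add: w_def)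
   have "p \<otimes> (w \<otimes> x) = (p \<otimes> w) \<otimes> x" using pc w by (simp add: m_assoc)
   also have "... = w \<otimes> (p \<otimes> x)" unfolding w_def tk[symmetric] using pc by (simp add: m_assoc)
   finally show "p \<otimes> (w \<otimes> x) = w \<otimes> x" using p by simp
  qed
  show ?thesis unfolding w_def[symmetric] using w pc p(3) r_one by algebra
 qed
 moreover have "p \<otimes> t [^] K \<ominus> p \<oplus> t [^] K \<otimes> x \<in> Pol ?e"
 proof -
  have "p \<otimes> t [^] K \<in> Pol ?e" by (rule pol_mono'[of _ K]) (use tau[of K] in auto)
  moreover have "p \<in> Pol ?e" by (rule pol_mono'[of _ 0]) (use p in auto)
  moreover have "t [^] K \<otimes> x \<in> Pol ?e" by (rule pol_mono'[OF Kd]) auto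
  ultimately show ?thesis unfolding a_minus_def by (intro pol_add pol_uminus)
 qed
 moreover have "?\<tau> \<otimes> (\<one> \<oplus> x) \<in> Units T" using tau[of K] u H_Units by auto
 ultimately have "?\<tau> \<otimes> (\<one> \<oplus> x) \<in> H" using polynomial by metis
 then show ?thesis using tau[of K] pc by (auto intro: H_cancel_left)
qed

end

section \<open>The class in \<open>K1\<close> of a stable unit\<close>

section \<open>Classes of automorphisms of standard modules\<close>

text \<open>Applied in both directions, the second claim makes the two maps between modules with
  equally indexed bases mutually inverse.\<close>

lemma free_basis_iso:
 assumes M: "left_module R M" "free_basis R M J b co" and N: "left_module R N" "free_basis R N J b' co'"
 shows "(\<lambda>m\<in>carrier M. \<Oplus>\<^bsub>N\<^esub>j\<in>J. co m j \<odot>\<^bsub>N\<^esub> b' j) \<in> lmod_hom R M N"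
  "m \<in> carrier M ==> (\<Oplus>\<^bsub>M\<^esub>j\<in>J. co' (\<Oplus>\<^bsub>N\<^esub>j\<in>J. co m j \<odot>\<^bsub>N\<^esub> b' j) j \<odot>\<^bsub>M\<^esub> b j) = m"
proof -
 interpret M: left_module R M by (rule M)
 interpret N: left_module R N by (rule N)
 note B = free_basisD[OF M(2)] and B' = free_basisD[OF N(2)]
 have cl: "(\<Oplus>\<^bsub>N\<^esub>j\<in>J. c j \<odot>\<^bsub>N\<^esub> b' j) \<in> carrier N" if "!!j. j \<in> J ==> c j \<in> carrier R" for c
  by (rule N.finsum_lin_comb) (use that B' in auto)
 show "(\<lambda>m\<in>carrier M. \<Oplus>\<^bsub>N\<^esub>j\<in>J. co m j \<odot>\<^bsub>N\<^esub> b' j) \<in> lmod_hom R M N"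
 proof (rule lmod_homI)
  fix x y assume xy: "x \<in> carrier M" "y \<in> carrier M"
  have "(\<Oplus>\<^bsub>N\<^esub>j\<in>J. co (x \<oplus>\<^bsub>M\<^esub> y) j \<odot>\<^bsub>N\<^esub> b' j) = (\<Oplus>\<^bsub>N\<^esub>j\<in>J. co x j \<odot>\<^bsub>N\<^esub> b' j \<oplus>\<^bsub>N\<^esub> co y j \<odot>\<^bsub>N\<^esub> b' j)"
   by (rule N.M.finsum_cong')
    (use xy B B' in "auto simp: M.free_basis_coord_add[OF M(2)] N.smult_l_distr N.smult_closed")
  also have "... = (\<Oplus>\<^bsub>N\<^esub>j\<in>J. co x j \<odot>\<^bsub>N\<^esub> b' j) \<oplus>\<^bsub>N\<^esub> (\<Oplus>\<^bsub>N\<^esub>j\<in>J. co y j \<odot>\<^bsub>N\<^esub> b' j)"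
   by (rule N.M.finsum_addf) (use xy B B' in "auto simp: N.smult_closed")
  finally show "(\<lambda>m\<in>carrier M. \<Oplus>\<^bsub>N\<^esub>j\<in>J. co m j \<odot>\<^bsub>N\<^esub> b' j) (x \<oplus>\<^bsub>M\<^esub> y) =
    (\<lambda>m\<in>carrier M. \<Oplus>\<^bsub>N\<^esub>j\<in>J. co m j \<odot>\<^bsub>N\<^esub> b' j) x \<oplus>\<^bsub>N\<^esub> (\<lambda>m\<in>carrier M. \<Oplus>\<^bsub>N\<^esub>j\<in>J. co m j \<odot>\<^bsub>N\<^esub> b' j) y"
   using xy by simp
 next
  fix a x assume ax: "a \<in> carrier R" "x \<in> carrier M"
  have "(\<Oplus>\<^bsub>N\<^esub>j\<in>J. co (a \<odot>\<^bsub>M\<^esub> x) j \<odot>\<^bsub>N\<^esub> b' j) = (\<Oplus>\<^bsub>N\<^esub>j\<in>J. a \<odot>\<^bsub>N\<^esub> (co x j \<odot>\<^bsub>N\<^esub> b' j))"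
   by (rule N.M.finsum_cong')
    (use ax B B' in "auto simp: M.free_basis_coord_smult[OF M(2)] N.smult_assoc N.smult_closed")
  also have "... = a \<odot>\<^bsub>N\<^esub> (\<Oplus>\<^bsub>N\<^esub>j\<in>J. co x j \<odot>\<^bsub>N\<^esub> b' j)"
   by (rule N.smult_finsum_right[symmetric]) (use ax B B' in "auto simp: N.smult_closed")
  finally show "(\<lambda>m\<in>carrier M. \<Oplus>\<^bsub>N\<^esub>j\<in>J. co m j \<odot>\<^bsub>N\<^esub> b' j) (a \<odot>\<^bsub>M\<^esub> x) =
    a \<odot>\<^bsub>N\<^esub> (\<lambda>m\<in>carrier M. \<Oplus>\<^bsub>N\<^esub>j\<in>J. co m j \<odot>\<^bsub>N\<^esub> b' j) x"
   using ax by (simp add: M.smult_closed)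
 qed (auto simp: cl B)
 assume m: "m \<in> carrier M"
 have "(\<Oplus>\<^bsub>M\<^esub>j\<in>J. co' (\<Oplus>\<^bsub>N\<^esub>j\<in>J. co m j \<odot>\<^bsub>N\<^esub> b' j) j \<odot>\<^bsub>M\<^esub> b j) = (\<Oplus>\<^bsub>M\<^esub>j\<in>J. co m j \<odot>\<^bsub>M\<^esub> b j)"
  by (rule M.M.finsum_cong') (use m B B'(5) in "auto simp: M.smult_closed")
 then show "(\<Oplus>\<^bsub>M\<^esub>j\<in>J. co' (\<Oplus>\<^bsub>N\<^esub>j\<in>J. co m j \<odot>\<^bsub>N\<^esub> b' j) j \<odot>\<^bsub>M\<^esub> b j) = m"
  using B(4)[OF m] by simp
qed

lemma (in ring) minus_one_mult:
 assumes "g \<in> carrier R" "h \<in> carrier R"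
 shows "g \<otimes> h \<ominus> \<one> = g \<otimes> (h \<ominus> \<one>) \<oplus> (g \<ominus> \<one>)"
 using assms r_one by algebra

text \<open>A one-sided inverse in the corner with unit \<open>p\<close> remains one after adding
  the identity on the complement.\<close>

lemma (in ring) corner_unit_mult:
 assumes "p \<in> carrier R" "x \<in> carrier R" "y \<in> carrier R"
  and "p \<otimes> p = p" "x \<otimes> p = x" "p \<otimes> y = y" "x \<otimes> y = p"
 shows "(\<one> \<ominus> p \<oplus> x) \<otimes> (\<one> \<ominus> p \<oplus> y) = \<one>"
 using assms r_one by algebra

lemma (in ring) corner_minus_one: "p \<in> carrier R ==> x \<in> carrier R ==> (\<one> \<ominus> p \<oplus> x) \<ominus> \<one> = x \<ominus> p"
 by algebra

context stable_setting
begin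

sublocale K: comp_closed_cat "laurent_free_cat R" by (rule free_mod_comp_closed)

notation K.equivN (infix \<open>\<approx>\<^sub>K\<close> 50)

abbreviation "proj_T n \<equiv> hat R (proj n)"

definition bnd :: "nat => ((real => nat => 'a) => (real => nat => 'a)) => bool" where
 "bnd n g \<longleftrightarrow> g \<in> cT & proj_T n \<star> (g \<ominus>\<^sub>T \<one>\<^sub>T) = g \<ominus>\<^sub>T \<one>\<^sub>T \<and>
   (g \<ominus>\<^sub>T \<one>\<^sub>T) \<star> proj_T n = g \<ominus>\<^sub>T \<one>\<^sub>T"

definition GL where "GL = {g \<in> Units T. g \<ominus>\<^sub>T \<one>\<^sub>T \<in> finT}"

definition cls where "cls n g = frag_of (Vn n, restrict g (carrier (Vn n)))"

text \<open>The class should be a function of \<open>g\<close>, so some \<open>n\<close> must be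
  fixed; the least is taken, and \<open>cls_kap\<close> shows that any other bound gives the same
  class.\<close>

definition kap where "kap g = cls (LEAST n. bnd n g) g"

lemma Vn_carrier: "v \<in> carrier (Vn n) \<longleftrightarrow> v \<in> cV & (\<forall>x i. n \<le> i \<longrightarrow> v x i = \<zero>)"
proof -
 interpret N: equivariant_family R "std_geo R (%_. 0) {..<n}" by (rule std_geo_family)
 show ?thesis
  unfolding N.forget_carrier VF.forget_carrier by (auto simp: std_geo_carrier std_geo_simps)
qed

lemma Vn_V: "v \<in> carrier (Vn n) ==> v \<in> cV"
 by (simp add: Vn_carrier)

lemma left_module_Vn: "left_module L (Vn n)"
 by (rule equivariant_family.left_module_forget[OF std_geo_family])

lemma Vn_add: "v \<oplus>\<^bsub>Vn n\<^esub> w = v \<oplus>\<^bsub>V\<^esub> w" and Vn_zero: "\<zero>\<^bsub>Vn n\<^esub> = \<zero>\<^bsub>V\<^esub>"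
 by (simp_all add: forget_obj_def std_geo_simps)

lemma fg_free_Vn: "fg_free_module L (Vn n)"
 by (rule fg_free_forget[OF ring_axioms std_geo_obj]) simp

lemma proj_T_apply: "v \<in> cV ==> proj_T n v = (%x i. if i < n then v x i else \<zero>)"
 by (simp add: hat_apply proj_apply)

lemma proj_T_Vn: "v \<in> cV ==> proj_T n v \<in> carrier (Vn n)"
 using T_closed[of "proj_T n" v] by (simp add: Vn_carrier proj_T_apply)

lemma proj_T_fixed: "v \<in> carrier (Vn n) ==> proj_T n v = v"
 by (auto simp: Vn_carrier proj_T_apply fun_eq_iff)

lemma restrict_Vn_hom:
 assumes f: "f \<in> cT" and cl: "!!v. v \<in> carrier (Vn n) ==> f v \<in> carrier (Vn m)"
 shows "restrict f (carrier (Vn n)) \<in> lmod_hom L (Vn n) (Vn m)"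
proof (rule forget_homI[OF std_geo_family std_geo_family])
 interpret N: left_module L "Vn n" by (rule left_module_Vn)
 fix v w assume "v \<in> carrier (Vn n)" "w \<in> carrier (Vn n)"
 then show "restrict f (carrier (Vn n)) (%x. v x \<oplus>\<^bsub>std_geo R (%_. 0) {..<n} x\<^esub> w x) =
   (%x. restrict f (carrier (Vn n)) v x \<oplus>\<^bsub>std_geo R (%_. 0) {..<m} x\<^esub> restrict f (carrier (Vn n)) w x)"
  using N.M.a_closed[of v w] T_add[OF f, of v w] by (simp add: Vn_add V_simps std_geo_simps Vn_V)
next
 fix v a k assume v: "v \<in> carrier (Vn n)" and a: "a \<in> carrier R"
 have "(%x i. a \<otimes> v (x - of_int k) i) \<in> carrier (Vn n)"
  using v V_lmon_closed[of v a k] a by (simp add: Vn_carrier)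
 then show "restrict f (carrier (Vn n)) (%x. a \<odot>\<^bsub>std_geo R (%_. 0) {..<n} x\<^esub> v (x - of_int k)) =
   (%x. a \<odot>\<^bsub>std_geo R (%_. 0) {..<m} x\<^esub> restrict f (carrier (Vn n)) v (x - of_int k))"
  using v a T_lmon[OF f, of v a k] by (simp add: std_geo_simps Vn_V)
qed (use cl in auto)

lemma bnd_T: "bnd n g ==> g \<in> cT"
 by (simp add: bnd_def)

lemma bnd_mono: "bnd n g ==> n \<le> m ==> bnd m g"
 using proj_fixed_mono[of "g \<ominus>\<^sub>T \<one>\<^sub>T" n m] by (simp add: bnd_def)

lemma one_plus_minus: "g \<in> cT ==> \<one>\<^sub>T \<oplus>\<^sub>T (g \<ominus>\<^sub>T \<one>\<^sub>T) = g"
 by (simp add: a_minus_def T.a_lcomm T.r_neg)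

lemma one_plus_minus': "x \<in> cT ==> \<one>\<^sub>T \<oplus>\<^sub>T x \<ominus>\<^sub>T \<one>\<^sub>T = x"
 by (simp add: a_minus_def T.a_assoc, simp add: T.a_lcomm T.r_neg)

lemma bnd_Vn:
 assumes g: "bnd n g" and v: "v \<in> carrier (Vn n)" shows "g v \<in> carrier (Vn n)"
proof -
 interpret N: left_module L "Vn n" by (rule left_module_Vn)
 let ?x = "g \<ominus>\<^sub>T \<one>\<^sub>T"
 have "?x v \<in> carrier (Vn n)"
  using g proj_T_Vn[of "?x v" n] Vn_V[OF v] end_mult_apply[OF Vn_V[OF v], of L "proj_T n" ?x]
  by (simp add: bnd_def)
 moreover have "g v = v \<oplus>\<^bsub>V\<^esub> ?x v"
  using one_plus_minus[OF bnd_T[OF g]] end_add_apply[OF Vn_V[OF v], of L "\<one>\<^sub>T" ?x] Vn_V[OF v]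
  by (simp add: end_one_apply)
 ultimately show ?thesis using N.M.a_closed[OF v] by (simp add: Vn_add)
qed

lemma GL_bnd:
 assumes "g \<in> GL" obtains n where "bnd n g" "bnd n (inv\<^bsub>T\<^esub> g)"
proof -
 from assms obtain n where g: "g \<in> Units T" and n: "bnd n g"
  by (auto simp: GL_def finT_def bnd_def)
 let ?x = "g \<ominus>\<^sub>T \<one>\<^sub>T" and ?h = "inv\<^bsub>T\<^esub> g"
 have c: "g \<in> cT" "?h \<in> cT" using g by auto
 have e: "?h \<ominus>\<^sub>T \<one>\<^sub>T = \<ominus>\<^sub>T (?x \<star> ?h)" "?h \<ominus>\<^sub>T \<one>\<^sub>T = \<ominus>\<^sub>T (?h \<star> ?x)"
  using g c by (simp_all add: a_minus_def T.r_distr T.l_distr T.r_minus T.l_minus T.minus_add T.a_comm)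
 have "bnd n ?h"
  unfolding bnd_def
 proof (intro conjI c)
  show "proj_T n \<star> (?h \<ominus>\<^sub>T \<one>\<^sub>T) = ?h \<ominus>\<^sub>T \<one>\<^sub>T"
   unfolding e(1) using n c by (simp add: bnd_def T.r_minus T.m_assoc[symmetric])
  show "(?h \<ominus>\<^sub>T \<one>\<^sub>T) \<star> proj_T n = ?h \<ominus>\<^sub>T \<one>\<^sub>T"
   unfolding e(2) using n c by (simp add: bnd_def T.l_minus T.m_assoc)
 qed
 then show ?thesis using that n by blast
qed

lemma GL_T: "g \<in> GL ==> g \<in> cT"
 by (auto simp: GL_def)

lemma GL_units_apply:
 assumes g: "g \<in> GL" and v: "v \<in> cV"
 shows "(inv\<^bsub>T\<^esub> g) (g v) = v" "g ((inv\<^bsub>T\<^esub> g) v) = v"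
 using g v end_mult_apply[OF v, of L "inv\<^bsub>T\<^esub> g" g] end_mult_apply[OF v, of L g "inv\<^bsub>T\<^esub> g"]
 by (auto simp: GL_def end_one_apply)

text \<open>For the inverse, w = g^-1 v satisfies v = w + (g - 1) w. The last term lies in
  \<open>Vn n\<close>, hence so does w.\<close>

lemma cls_aut:
 assumes g: "g \<in> GL" "bnd n g"
 shows "(Vn n, restrict g (carrier (Vn n))) \<in> cat_aut (laurent_free_cat R)"
proof -
 obtain m where m: "bnd m g" "bnd m (inv\<^bsub>T\<^esub> g)" using GL_bnd[OF g(1)] by blast
 have c: "inv\<^bsub>T\<^esub> g \<in> cT" using g by (simp add: GL_def)
 have inv: "(inv\<^bsub>T\<^esub> g) v \<in> carrier (Vn n)" if v: "v \<in> carrier (Vn n)" for v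
 proof -
  let ?x = "g \<ominus>\<^sub>T \<one>\<^sub>T" and ?w = "(inv\<^bsub>T\<^esub> g) v"
  have w: "?w \<in> cV" using c v Vn_V by simp
  have "v = ?w \<oplus>\<^bsub>V\<^esub> ?x ?w"
   using GL_units_apply(2)[OF g(1) Vn_V[OF v]] one_plus_minus[OF GL_T[OF g(1)]]
    end_add_apply[OF w, of L "\<one>\<^sub>T" ?x] w by (simp add: end_one_apply)
  moreover have "?x ?w \<in> carrier (Vn n)"
   using g(2) end_mult_apply[OF w, of L "proj_T n" ?x] proj_T_Vn[of "?x ?w" n] w by (simp add: bnd_def)
  ultimately have e: "!!x i. v x i = ?w x i \<oplus> ?x ?w x i" "!!x i. n \<le> i ==> ?x ?w x i = \<zero>"
   by (auto simp: V_simps Vn_carrier fun_eq_iff)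
  have "?w x i = \<zero>" if "n \<le> i" for x i
   using e(1)[of x i] e(2)[of i x] that v V_apply_R[OF w, of x i] by (simp add: Vn_carrier)
  then show ?thesis using w by (simp add: Vn_carrier)
 qed
 show ?thesis
  unfolding free_mod_aut_iff
  by (intro conjI fg_free_Vn restrict_Vn_hom bexI[of _ "restrict (inv\<^bsub>T\<^esub> g) (carrier (Vn n))"])
   (use g c inv GL_T bnd_Vn Vn_V in "auto simp: GL_units_apply")
qed

lemma cls_exact:
 assumes g: "g \<in> GL" "bnd a g" and h: "h \<in> GL" "bnd b h" and k: "k \<in> GL" "bnd c k"
  and T: "i \<in> cT" "p \<in> cT" "r \<in> cT" "s \<in> cT"
  and i: "!!v. v \<in> carrier (Vn a) ==> i v \<in> carrier (Vn b) & r (i v) = v & h (i v) = i (g v)"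
  and p: "!!v. v \<in> carrier (Vn b) ==> p v \<in> carrier (Vn c) & r v \<in> carrier (Vn a) \<and>
   i (r v) \<oplus>\<^bsub>V\<^esub> s (p v) = v & p (h v) = k (p v)"
  and s: "!!v. v \<in> carrier (Vn c) ==> s v \<in> carrier (Vn b) & p (s v) = v"
 shows "cls b h \<approx>\<^sub>K cls a g + cls c k"
 unfolding cls_def
 by (rule equivN_free_exact[OF cls_aut[OF g] cls_aut[OF h] cls_aut[OF k],
    where i = "restrict i (carrier (Vn a))" and p = "restrict p (carrier (Vn b))"
    and r = "restrict r (carrier (Vn b))" and s = "restrict s (carrier (Vn c))"])
  (use T i p s bnd_Vn[OF g(2)] bnd_Vn[OF h(2)] bnd_Vn[OF k(2)] in "auto simp: Vn_add intro!: restrict_Vn_hom")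

lemma one_GL: "\<one>\<^sub>T \<in> GL" and bnd_one: "bnd n \<one>\<^sub>T"
 by (auto simp: GL_def bnd_def a_minus_def T.r_neg finT_zero)

lemma cls_one: "cls n \<one>\<^sub>T \<approx>\<^sub>K 0"
proof -
 have "restrict \<one>\<^sub>T (carrier (Vn n)) = (\<lambda>x\<in>carrier (Vn n). x)"
  by (auto simp: end_one_apply Vn_V)
 then show ?thesis using equivN_free_id[OF fg_free_Vn] by (simp add: cls_def)
qed

text \<open>\<open>Vn n\<close> splits off from \<open>Vn m\<close>, and shifting coordinates down
  by \<open>n\<close> identifies the quotient with \<open>Vn (m - n)\<close>. On it \<open>g\<close>
  induces the identity, whose class is trivial.\<close>

lemma cls_stable:
 assumes g: "g \<in> GL" "bnd n g" and nm: "n \<le> m" shows "cls m g \<approx>\<^sub>K cls n g"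
proof -
 define dn where "dn = relabel R (%i. Some (i + n))"
 define up where "up = relabel R (%i. if n \<le> i then Some (i - n) else None)"
 have dn: "dn \<in> cE" unfolding dn_def
 proof (rule relabel_closed)
  fix j show "finite {i. Some (i + n) = Some j}" by (rule finite_subset[of _ "{j - n}"]) auto
 qed
 have up: "up \<in> cE" unfolding up_def
 proof (rule relabel_closed)
  fix j show "finite {i. (if n \<le> i then Some (i - n) else None) = Some j}"
   by (rule finite_subset[of _ "{j + n}"]) (auto split: if_splits)
 qed
 have dn_apply: "hat R dn v = (%x i. v x (i + n))" if "v \<in> cV" for v
  using that by (auto simp: hat_apply dn_def relabel_apply fun_eq_iff)
 have up_apply: "hat R up v = (%x i. if n \<le> i then v x (i - n) else \<zero>)" if "v \<in> cV" for v
  using that by (auto simp: hat_apply up_def relabel_apply fun_eq_iff)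
 have dnV: "hat R dn v \<in> cV" and upV: "hat R up v \<in> cV" if "v \<in> cV" for v
  using that dn up by simp_all
 have dn_g: "hat R dn (g v) = hat R dn v" if v: "v \<in> cV" for v
 proof -
  let ?x = "g \<ominus>\<^sub>T \<one>\<^sub>T"
  have x: "?x v \<in> cV" "g v \<in> cV" using v g by (auto simp: bnd_def)
  have "?x v = proj_T n (?x v)" using g(2) end_mult_apply[OF v, of L "proj_T n" ?x] by (simp add: bnd_def)
  then have z: "?x v y i = \<zero>" if "n \<le> i" for y i
   using proj_T_Vn[OF x(1), of n] that by (simp add: Vn_carrier)
  have "g v = v \<oplus>\<^bsub>V\<^esub> ?x v"
   using one_plus_minus[OF bnd_T[OF g(2)]] end_add_apply[OF v, of L "\<one>\<^sub>T" ?x] v by (simp add: end_one_apply)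
  then have "g v y i = v y i \<oplus> ?x v y i" for y i by (metis V_simps(1))
  then show ?thesis using x v z V_apply_R[OF v] by (simp add: dn_apply fun_eq_iff)
 qed
 have "cls m g \<approx>\<^sub>K cls n g + cls (m - n) \<one>\<^sub>T"
 proof (rule cls_exact[OF g g(1) bnd_mono[OF g(2) nm] one_GL bnd_one, of "\<one>\<^sub>T" "hat R dn" "proj_T n" "hat R up"])
  show "hat R dn \<in> cT" "hat R up \<in> cT" "\<one>\<^sub>T \<in> cT" "proj_T n \<in> cT"
   using dn up by auto
 next
  fix v assume v: "v \<in> carrier (Vn n)"
  show "\<one>\<^sub>T v \<in> carrier (Vn m) & proj_T n (\<one>\<^sub>T v) = v & g (\<one>\<^sub>T v) = \<one>\<^sub>T (g v)"
   using v nm g bnd_T by (simp add: end_one_apply Vn_V proj_T_fixed) (simp add: Vn_carrier)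
 next
  fix v assume v: "v \<in> carrier (Vn m)"
  have vV: "v \<in> cV" by (rule Vn_V[OF v])
  have "hat R dn v \<in> carrier (Vn (m - n))"
   using v dnV[OF vV] dn_apply[OF vV] by (auto simp: Vn_carrier)
  moreover have "hat R up (hat R dn v) = (%x i. if n \<le> i then v x i else \<zero>)"
   by (subst up_apply[OF dnV[OF vV]], subst dn_apply[OF vV]) (auto simp: fun_eq_iff)
  then have "proj_T n v \<oplus>\<^bsub>V\<^esub> hat R up (hat R dn v) = v"
   unfolding proj_T_apply[OF vV]
   using V_apply_R[OF vV] by (auto simp: V_simps fun_eq_iff)
  ultimately show "hat R dn v \<in> carrier (Vn (m - n)) & proj_T n v \<in> carrier (Vn n) \<and>
     \<one>\<^sub>T (proj_T n v) \<oplus>\<^bsub>V\<^esub> hat R up (hat R dn v) = v & hat R dn (g v) = \<one>\<^sub>T (hat R dn v)"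
   using vV dn by (simp add: end_one_apply dn_g proj_T_Vn)
 next
  fix v assume v: "v \<in> carrier (Vn (m - n))"
  have vV: "v \<in> cV" by (rule Vn_V[OF v])
  have "hat R dn (hat R up v) = v"
   by (subst dn_apply[OF upV[OF vV]], subst up_apply[OF vV]) (auto simp: fun_eq_iff)
  then show "hat R up v \<in> carrier (Vn m) & hat R dn (hat R up v) = v"
   using v upV[OF vV] nm by (auto simp: Vn_carrier up_apply[OF vV])
 qed
 then show ?thesis
  using K.equivN_trans K.equivN_add[OF K.equivN_refl cls_one[of "m - n"], of "cls n g"] by fastforce
qed

lemma cls_kap: assumes "g \<in> GL" "bnd n g" shows "cls n g \<approx>\<^sub>K kap g"
 unfolding kap_def by (rule cls_stable[OF assms(1) LeastI[of "%n. bnd n g", OF assms(2)] Least_le[of "%n. bnd n g", OF assms(2)]])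

lemma GL_mult: assumes "g \<in> GL" "h \<in> GL" shows "g \<star> h \<in> GL"
 using assms T.minus_one_mult[of g h] by (auto simp: GL_def T.Units_closed intro!: finT_add finT_mult)

lemma GL_inv: assumes "g \<in> GL" shows "inv\<^bsub>T\<^esub> g \<in> GL"
proof -
 obtain n where "bnd n (inv\<^bsub>T\<^esub> g)" by (rule GL_bnd[OF assms])
 then show ?thesis using assms by (auto simp: GL_def bnd_def finT_def)
qed

lemma kap_mult:
 assumes g: "g \<in> GL" and h: "h \<in> GL" shows "kap (g \<star> h) \<approx>\<^sub>K kap g + kap h"
proof -
 obtain a b c where "bnd a g" "bnd b h" "bnd c (g \<star> h)"
  using GL_bnd[OF g] GL_bnd[OF h] GL_bnd[OF GL_mult[OF g h]] by metis
 then obtain n where n: "bnd n g" "bnd n h" "bnd n (g \<star> h)"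
  using bnd_mono[of _ _ "max a (max b c)"] by (metis max.cobounded1 max.cobounded2 max.coboundedI2)
 have "restrict (g \<star> h) (carrier (Vn n)) =
   compose (carrier (Vn n)) (restrict g (carrier (Vn n))) (restrict h (carrier (Vn n)))"
  using bnd_Vn[OF n(2)] by (auto simp: compose_def end_mult_apply Vn_V fun_eq_iff)
 then have "cls n (g \<star> h) \<approx>\<^sub>K cls n g + cls n h"
  using K.equivN_comp[OF cls_aut[OF g n(1)] cls_aut[OF h n(2)]] by (simp add: cls_def free_mod_cat_simps)
 then show ?thesis
  using cls_kap[OF g n(1)] cls_kap[OF h n(2)] cls_kap[OF GL_mult[OF g h] n(3)]
   K.equivN_trans K.equivN_add K.equivN_sym by meson
qed

lemma kap_one: "kap \<one>\<^sub>T \<approx>\<^sub>K 0"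
 using K.equivN_trans[OF K.equivN_sym[OF cls_kap[OF one_GL bnd_one]] cls_one] .

lemma kap_inv:
 assumes g: "g \<in> GL" shows "kap (inv\<^bsub>T\<^esub> g) \<approx>\<^sub>K - kap g"
proof -
 have "kap \<one>\<^sub>T \<approx>\<^sub>K kap g + kap (inv\<^bsub>T\<^esub> g)"
  using kap_mult[OF g GL_inv[OF g]] g by (simp add: GL_def)
 then have "0 \<approx>\<^sub>K kap g + kap (inv\<^bsub>T\<^esub> g)"
  using kap_one K.equivN_sym K.equivN_trans by blast
 from K.equivN_diff[OF K.equivN_sym[OF this] K.equivN_refl[of "kap g"]]
 show ?thesis by simp
qed

abbreviation "S1 \<equiv> hat R (relabel R (slot_in 2 0))"
abbreviation "S2 \<equiv> hat R (relabel R (slot_in 2 1))"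
abbreviation "R1 \<equiv> hat R (relabel R (slot_out 2 0))"
abbreviation "R2 \<equiv> hat R (relabel R (slot_out 2 1))"

lemma slot_at: "slot_in N j m = (if m mod N = j then Some (m div N) else None)" "slot_out N j i = Some (i * N + j)"
  "cut n i = (if i < n then Some i else None)"
 by (simp_all add: slot_in_def slot_out_def cut_def)

lemma relabel_mult:
 assumes "!!j. finite {i. \<rho> i = Some j}" "!!j. finite {i. \<rho>' i = Some j}"
 shows "relabel R \<rho> \<bullet> relabel R \<rho>' = relabel R (%i. Option.bind (\<rho> i) \<rho>')"
proof (rule FM.end_eqI)
 have fin: "finite {i. Option.bind (\<rho> i) \<rho>' = Some k}" for k
  by (rule finite_subset[of _ "\<Union>j\<in>{j. \<rho>' j = Some k}. {i. \<rho> i = Some j}"])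
   (use assms in "auto simp: bind_eq_Some_conv")
 show "relabel R (%i. Option.bind (\<rho> i) \<rho>') \<in> cE" by (rule relabel_closed[OF fin])
 fix u assume u: "u \<in> cF"
 have "relabel R \<rho>' u \<in> cF" using assms u by simp
 from relabel_apply[OF this] relabel_apply[OF u]
 show "(relabel R \<rho> \<bullet> relabel R \<rho>') u = relabel R (%i. Option.bind (\<rho> i) \<rho>') u"
  using u by (auto simp: end_mult_apply fun_eq_iff split: option.splits)
qed (use assms in simp)

lemma slot_apply:
 assumes "N > 0" "v \<in> cV"
 shows "hat R (relabel R (slot_in N j)) v = (%x m. if m mod N = j then v x (m div N) else \<zero>)"
  "hat R (relabel R (slot_out N j)) v = (%x i. v x (i * N + j))"
 using assms by (auto simp: hat_apply relabel_apply slot_in_def slot_out_def fun_eq_iff)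

lemma slot_V:
 assumes "N > 0" "v \<in> cV"
 shows "hat R (relabel R (slot_in N j)) v \<in> cV" "hat R (relabel R (slot_out N j)) v \<in> cV"
 using assms by auto

lemma slot_T [simp]: "N > 0 ==> hat R (relabel R (slot_in N j)) \<in> cT"
 "N > 0 ==> hat R (relabel R (slot_out N j)) \<in> cT"
 by simp_all

lemma slot_out_in:
 assumes "N > 0" "j < N" "k < N"
 shows "hat R (relabel R (slot_out N j)) \<star> hat R (relabel R (slot_in N k)) = (if j = k then \<one>\<^sub>T else \<zero>\<^sub>T)"
proof -
 have b: "(%i. Option.bind (slot_out N j i) (slot_in N k)) = (%i. if j = k then Some i else None)"
  using assms by (auto simp: slot_at fun_eq_iff)
 have "relabel R (slot_out N j) \<bullet> relabel R (slot_in N k) = (if j = k then \<one>\<^sub>E else \<zero>\<^sub>E)"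
  using assms by (subst relabel_mult, simp_all add: b, intro conjI impI FM.end_eqI)
   (auto simp: relabel_apply end_one_apply end_zero_apply free_on_simps fun_eq_iff)
 then show ?thesis using assms by (simp add: hat_mult[symmetric] hat_one hat_zero split: if_splits)
qed

lemma two_slots: "S1 \<star> R1 \<oplus>\<^sub>T S2 \<star> R2 = \<one>\<^sub>T"
proof -
 have b: "(%i. Option.bind (slot_in 2 k i) (slot_out 2 k)) = (%i. if i mod 2 = k then Some i else None)" for k
  by (auto simp: slot_at fun_eq_iff)
 have f: "relabel R (%i. if i mod 2 = k then Some i else None) \<in> cE" for k :: nat
  by (rule relabel_closed, rule finite_subset[of _ "{_}"]) (auto split: if_splits)
 have "relabel R (slot_in 2 0) \<bullet> relabel R (slot_out 2 0) \<oplus>\<^sub>E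
   relabel R (slot_in 2 1) \<bullet> relabel R (slot_out 2 1) = \<one>\<^sub>E"
 proof (simp only: relabel_mult finite_slot_in finite_slot_out b zero_less_numeral, rule FM.end_eqI)
  fix u assume u: "u \<in> cF"
  show "(relabel R (%i. if i mod 2 = 0 then Some i else None) \<oplus>\<^sub>E
    relabel R (%i. if i mod 2 = 1 then Some i else None)) u = \<one>\<^sub>E u"
   using u F_apply_R[OF u] by (auto simp: relabel_apply end_add_apply end_one_apply free_on_simps fun_eq_iff)
 qed (use f in auto)
 then show ?thesis by (simp add: hat_mult[symmetric] hat_add[symmetric] hat_one)
qed

lemma slot_Vn:
 assumes N: "N > 0" and j: "j < N"
 shows "v \<in> carrier (Vn n) ==> hat R (relabel R (slot_in N j)) v \<in> carrier (Vn (n * N))"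
  "v \<in> carrier (Vn (n * N)) ==> hat R (relabel R (slot_out N j)) v \<in> carrier (Vn n)"
proof -
 assume v: "v \<in> carrier (Vn n)"
 have "n \<le> i div N" if "n * N \<le> i" for i using div_le_mono[OF that, of N] N by simp
 then show "hat R (relabel R (slot_in N j)) v \<in> carrier (Vn (n * N))"
  using v slot_V(1)[OF N Vn_V[OF v], of j] by (auto simp: Vn_carrier slot_apply N)
next
 assume v: "v \<in> carrier (Vn (n * N))"
 have "n * N \<le> i * N + j" if "n \<le> i" for i using mult_le_mono1[OF that, of N] by linarith
 then show "hat R (relabel R (slot_out N j)) v \<in> carrier (Vn n)"
  using v slot_V(2)[OF N Vn_V[OF v], of j] by (auto simp: Vn_carrier slot_apply N)
qed

text \<open>Multiplication from the right does not preserve \<open>finT\<close> in general. Here a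
  bound \<open>n\<close> on the columns turns into \<open>n * N\<close>.\<close>

lemma finT_slot_out:
 assumes N: "N > 0" "j < N" and x: "x \<in> finT" shows "x \<star> hat R (relabel R (slot_out N j)) \<in> finT"
proof -
 obtain n where xT: "x \<in> cT" and n: "x \<star> proj_T n = x" using x by (auto simp: finT_def)
 let ?r = "hat R (relabel R (slot_out N j))"
 have "i * N + j < n * N" if "i < n" for i
 proof -
  have "i * N + j < Suc i * N" using N by simp
  also have "... \<le> n * N" using that by (intro mult_le_mono1) simp
  finally show ?thesis .
 qed
 then have b: "(%i. Option.bind (cut n i) (%y. Option.bind (slot_out N j y) (cut (n * N)))) = (%i. Option.bind (cut n i) (slot_out N j))"
  by (auto simp: slot_at fun_eq_iff)
 have fin: "finite {i. Option.bind (cut n i) (slot_out N j) = Some k}" for k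
  by (rule finite_subset[of _ "{..<n}"]) (auto simp: slot_at split: if_splits)
 have "proj n \<bullet> relabel R (slot_out N j) \<bullet> proj (n * N) = proj n \<bullet> relabel R (slot_out N j)"
  using N by (simp add: relabel_mult fin b)
 then have "proj_T n \<star> ?r \<star> proj_T (n * N) = proj_T n \<star> ?r"
  using N by (simp add: hat_mult[symmetric])
 then have e: "x \<star> (proj_T n \<star> ?r \<star> proj_T (n * N)) = x \<star> (proj_T n \<star> ?r)" by simp
 have "x \<star> ?r \<star> proj_T (n * N) = x \<star> ?r"
  using e xT N n by (simp add: T.m_assoc[symmetric])
 then show ?thesis using xT N by (intro finTI[of _ "n * N"]) auto
qed

text \<open>Block sum, interleaved along the even and the odd coordinates.\<close>

definition dsum where "dsum g h = S1 \<star> g \<star> R1 \<oplus>\<^sub>T S2 \<star> h \<star> R2"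

lemma dsum_T: "g \<in> cT ==> h \<in> cT ==> dsum g h \<in> cT"
 by (simp add: dsum_def)

lemma dsum_slots:
 assumes "g \<in> cT" "h \<in> cT"
 shows "dsum g h \<star> S1 = S1 \<star> g" "dsum g h \<star> S2 = S2 \<star> h" "R2 \<star> dsum g h = h \<star> R2"
proof -
 have o: "R1 \<star> S1 = \<one>\<^sub>T" "R2 \<star> S1 = \<zero>\<^sub>T" "R2 \<star> S2 = \<one>\<^sub>T" "R1 \<star> S2 = \<zero>\<^sub>T"
  using slot_out_in[of 2 0 0] slot_out_in[of 2 1 0] slot_out_in[of 2 1 1] slot_out_in[of 2 0 1] by auto
 show "dsum g h \<star> S1 = S1 \<star> g" "dsum g h \<star> S2 = S2 \<star> h"
  using assms o by (simp_all add: dsum_def T.l_distr T.m_assoc)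
 have "R2 \<star> dsum g h = (R2 \<star> S1) \<star> (g \<star> R1) \<oplus>\<^sub>T (R2 \<star> S2) \<star> (h \<star> R2)"
  using assms by (simp add: dsum_def T.r_distr T.m_assoc)
 then show "R2 \<star> dsum g h = h \<star> R2" using assms o by simp
qed

lemma dsum_mult:
 assumes "g \<in> cT" "h \<in> cT" "g' \<in> cT" "h' \<in> cT"
 shows "dsum g h \<star> dsum g' h' = dsum (g \<star> g') (h \<star> h')"
proof -
 have "dsum g h \<star> dsum g' h' = (dsum g h \<star> S1) \<star> g' \<star> R1 \<oplus>\<^sub>T (dsum g h \<star> S2) \<star> h' \<star> R2"
  using assms dsum_T[of g h] by (simp add: dsum_def[of g'] T.r_distr T.m_assoc)
 then show ?thesis unfolding dsum_slots[OF assms(1,2)] using assms by (simp add: dsum_def T.m_assoc)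
qed

lemma dsum_one: "dsum \<one>\<^sub>T \<one>\<^sub>T = \<one>\<^sub>T"
 using two_slots by (simp add: dsum_def)

lemma dsum_one_plus:
 assumes "x \<in> cT" "y \<in> cT"
 shows "dsum (\<one>\<^sub>T \<oplus>\<^sub>T x) (\<one>\<^sub>T \<oplus>\<^sub>T y) = \<one>\<^sub>T \<oplus>\<^sub>T dsum x y"
proof -
 have "dsum (\<one>\<^sub>T \<oplus>\<^sub>T x) (\<one>\<^sub>T \<oplus>\<^sub>T y) = dsum \<one>\<^sub>T \<one>\<^sub>T \<oplus>\<^sub>T dsum x y"
  using assms by (simp add: dsum_def T.l_distr T.r_distr T.a_ac)
 then show ?thesis by (simp add: dsum_one)
qed

lemma dsum_inv:
 assumes g: "g \<in> Units T" and h: "h \<in> Units T"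
 shows "dsum g h \<in> Units T" "inv\<^bsub>T\<^esub> (dsum g h) = dsum (inv\<^bsub>T\<^esub> g) (inv\<^bsub>T\<^esub> h)"
proof -
 have c: "g \<in> cT" "h \<in> cT" "inv\<^bsub>T\<^esub> g \<in> cT" "inv\<^bsub>T\<^esub> h \<in> cT" using assms by auto
 have e: "dsum g h \<star> dsum (inv\<^bsub>T\<^esub> g) (inv\<^bsub>T\<^esub> h) = \<one>\<^sub>T" "dsum (inv\<^bsub>T\<^esub> g) (inv\<^bsub>T\<^esub> h) \<star> dsum g h = \<one>\<^sub>T"
  using assms c by (simp_all add: dsum_mult dsum_one)
 then show "dsum g h \<in> Units T" "inv\<^bsub>T\<^esub> (dsum g h) = dsum (inv\<^bsub>T\<^esub> g) (inv\<^bsub>T\<^esub> h)"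
  using c dsum_T by (auto simp: Units_def intro!: T.inv_char)
qed

lemma dsum_GL: assumes "g \<in> GL" "h \<in> GL" shows "dsum g h \<in> GL"
proof -
 have c: "g \<in> cT" "h \<in> cT" using assms GL_T by auto
 have "dsum g h = \<one>\<^sub>T \<oplus>\<^sub>T dsum (g \<ominus>\<^sub>T \<one>\<^sub>T) (h \<ominus>\<^sub>T \<one>\<^sub>T)"
  using dsum_one_plus[of "g \<ominus>\<^sub>T \<one>\<^sub>T" "h \<ominus>\<^sub>T \<one>\<^sub>T"] c by (simp add: one_plus_minus)
 moreover have "dsum (g \<ominus>\<^sub>T \<one>\<^sub>T) (h \<ominus>\<^sub>T \<one>\<^sub>T) \<in> finT"
  unfolding dsum_def by (intro finT_add finT_slot_out finT_mult) (use assms in "auto simp: GL_def")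
 ultimately have "dsum g h \<ominus>\<^sub>T \<one>\<^sub>T \<in> finT" using finT_closed by (simp add: one_plus_minus')
 then show ?thesis using dsum_inv(1) assms by (auto simp: GL_def)
qed

text \<open>The even coordinates form the submodule and the odd ones the quotient of a split exact
  sequence with \<open>Vn (n * 2)\<close> in the middle.\<close>

lemma kap_dsum:
 assumes g: "g \<in> GL" and h: "h \<in> GL" shows "kap (dsum g h) \<approx>\<^sub>K kap g + kap h"
proof -
 obtain a b c where "bnd a g" "bnd b h" "bnd c (dsum g h)"
  using GL_bnd[OF g] GL_bnd[OF h] GL_bnd[OF dsum_GL[OF g h]] by metis
 then obtain n where n: "bnd n g" "bnd n h" "bnd (n * 2) (dsum g h)"
  using bnd_mono[of a g "max a (max b c)"] bnd_mono[of b h "max a (max b c)"] bnd_mono[of c "dsum g h" "max a (max b c) * 2"]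
  by (metis max.cobounded1 max.cobounded2 max.coboundedI2 le_add1 mult_2_right le_trans)
 have c: "g \<in> cT" "h \<in> cT" using g h GL_T by auto
 have "cls (n * 2) (dsum g h) \<approx>\<^sub>K cls n g + cls n h"
 proof (rule cls_exact[OF g n(1) dsum_GL[OF g h] n(3) h n(2), of S1 R2 R1 S2])
  fix v assume v: "v \<in> carrier (Vn n)"
  note vV = Vn_V[OF v]
  show "S1 v \<in> carrier (Vn (n * 2)) & R1 (S1 v) = v & dsum g h (S1 v) = S1 (g v)"
   using slot_Vn(1)[of 2 0 v n] v slot_out_in[of 2 0 0] dsum_slots(1)[OF c]
    end_mult_apply[OF vV, of L R1 S1] end_mult_apply[OF vV, of L "dsum g h" S1] end_mult_apply[OF vV, of L S1 g] vV
   by (simp add: end_one_apply)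
 next
  fix v assume v: "v \<in> carrier (Vn (n * 2))"
  note vV = Vn_V[OF v]
  show "R2 v \<in> carrier (Vn n) & R1 v \<in> carrier (Vn n) & S1 (R1 v) \<oplus>\<^bsub>V\<^esub> S2 (R2 v) = v & R2 (dsum g h v) = h (R2 v)"
   using slot_Vn(2)[of 2 0 v n] slot_Vn(2)[of 2 1 v n] v fun_cong[OF two_slots, of v] dsum_slots(3)[OF c]
    end_mult_apply[OF vV, of L R2 "dsum g h"] end_mult_apply[OF vV, of L h R2] vV
   by (simp add: end_one_apply end_add_apply end_mult_apply)
 next
  fix v assume v: "v \<in> carrier (Vn n)"
  note vV = Vn_V[OF v]
  show "S2 v \<in> carrier (Vn (n * 2)) & R2 (S2 v) = v"
   using slot_Vn(1)[of 2 1 v n] v slot_out_in[of 2 1 1] end_mult_apply[OF vV, of L R2 S2] vV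
   by (simp add: end_one_apply)
 qed auto
 then show ?thesis
  using cls_kap[OF g n(1)] cls_kap[OF h n(2)] cls_kap[OF dsum_GL[OF g h] n(3)]
   K.equivN_trans K.equivN_add K.equivN_sym by meson
qed

text \<open>The coordinate of \<open>v\<close> at \<open>i\<close> is the Laurent polynomial formed
  by its values at the integers.\<close>

lemma Vn_basis: "free_basis L (Vn n) {..<n} (%i. iota 0 (unit_vec R i)) (%v i k. v (of_int k) i)"
proof -
 interpret N: equivariant_family R "std_geo R (%_. 0) {..<n}" by (rule std_geo_family)
 interpret M: left_module L "Vn n" by (rule left_module_Vn)
 have e: "iota 0 (unit_vec R i) = N.single 0 (unit_vec R i)" for i
  by (auto simp: iota_def N.single_def std_geo_simps)
 have ec: "unit_vec R i \<in> carrier (std_geo R (%_. 0) {..<n} 0)" if "i < n" for i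
  using unit_vec_closed[of i "{..<n}"] that by (simp add: std_geo_def lessThan_def)
 have sum: "(\<Oplus>\<^bsub>Vn n\<^esub>j\<in>{..<n}. c j \<odot>\<^bsub>Vn n\<^esub> iota 0 (unit_vec R j)) x i = (if x \<in> \<int> & i < n then c i \<lfloor>x\<rfloor> else \<zero>)"
  if c: "!!j. j < n ==> c j \<in> carrier L" for c x i
 proof -
  have cR: "c j k \<in> carrier R" if "j < n" for j k using c[OF that] by (simp add: carrier_laurent_iff)
  have fr: "0 = frac x \<longleftrightarrow> x \<in> \<int>" using frac_eq_0_iff[of x] by auto
  have sm: "c j \<odot>\<^bsub>Vn n\<^esub> N.single 0 (unit_vec R j) \<in> carrier (Vn n)" if "j < n" for j
   using that by (intro M.smult_closed c N.single_closed ec)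
  have "(\<Oplus>\<^bsub>Vn n\<^esub>j\<in>{..<n}. c j \<odot>\<^bsub>Vn n\<^esub> iota 0 (unit_vec R j)) x i =
    (\<Oplus>j\<in>{..<n}. (c j \<odot>\<^bsub>Vn n\<^esub> N.single 0 (unit_vec R j)) x i)"
   unfolding e
   by (subst N.forget_finsum_apply, use sm in simp, unfold std_geo_def, rule free_on_finsum_apply)
    (use N.forget_apply_closed[OF sm, of _ x] in "auto simp: std_geo_def")
  also have "... = (\<Oplus>j\<in>{..<n}. if x \<in> \<int> & j = i then c j \<lfloor>x\<rfloor> else \<zero>)"
   by (rule finsum_cong')
    (use cR c ec fr in "auto simp: N.forget_smult_single_apply std_geo_simps unit_vec_def")
  also have "... = (if x \<in> \<int> & i < n then c i \<lfloor>x\<rfloor> else \<zero>)"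
  proof (cases "x \<in> \<int> & i < n")
   case True
   then show ?thesis using cR by (subst finsum_eq_term[of _ i]) auto
  next
   case False
   then have "(\<Oplus>j\<in>{..<n}. if x \<in> \<int> & j = i then c j \<lfloor>x\<rfloor> else \<zero>) = (\<Oplus>j\<in>{..<n}. \<zero>)"
    by (intro finsum_cong') auto
   then show ?thesis using False by (auto simp: finsum_zero)
  qed
  finally show ?thesis .
 qed
 have co: "(%k. v (of_int k) i) \<in> carrier L" if v: "v \<in> carrier (Vn n)" for v i
 proof -
  have "finite ((of_int :: int => real) -` {x. v x ~= (%i. \<zero>)})"
   using Vn_V[OF v] by (intro finite_vimageI) (auto simp: V_carrier inj_def)
  then have "finite (supp R (%k. v (of_int k) i))"
   by (rule finite_subset[rotated]) (auto simp: supp_def)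
  then show ?thesis using V_apply_R[OF Vn_V[OF v]] by (simp add: carrier_laurent_iff)
 qed
 show ?thesis
  unfolding free_basis_def
 proof (intro conjI ballI allI impI)
  fix v assume v: "v \<in> carrier (Vn n)"
  show "v = (\<Oplus>\<^bsub>Vn n\<^esub>j\<in>{..<n}. (%k. v (of_int k) j) \<odot>\<^bsub>Vn n\<^esub> iota 0 (unit_vec R j))"
  proof (intro ext)
   fix x i
   have "x \<notin> \<int> ==> v x i = \<zero>" using Vn_V[OF v] by (simp add: V_carrier)
   moreover have "n \<le> i ==> v x i = \<zero>" using v by (simp add: Vn_carrier)
   ultimately show "v x i = (\<Oplus>\<^bsub>Vn n\<^esub>j\<in>{..<n}. (%k. v (of_int k) j) \<odot>\<^bsub>Vn n\<^esub> iota 0 (unit_vec R j)) x i"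
    by (subst sum) (use co[OF v] in "auto elim: Ints_cases simp: not_less")
  qed
 next
  fix c j assume "\<forall>j\<in>{..<n}. c j \<in> carrier L" "j \<in> {..<n}"
  then show "(%k. (\<Oplus>\<^bsub>Vn n\<^esub>j\<in>{..<n}. c j \<odot>\<^bsub>Vn n\<^esub> iota 0 (unit_vec R j)) (of_int k) j) = c j"
   using sum[of c] by auto
 qed (use co N.single_closed[OF ec] in "auto simp: e")
qed

text \<open>A basis identifies \<open>M\<close> with some \<open>Vn n\<close>; the transported
  automorphism is then continued by the identity on the remaining coordinates.\<close>

lemma kap_generates:
 assumes Mf: "(M, f) \<in> cat_aut (laurent_free_cat R)"
 shows "\<exists>g\<in>GL. frag_of (M, f) \<approx>\<^sub>K kap g"
proof -
 have fM: "fg_free_module L M" and M: "left_module L M" and f: "f \<in> lmod_hom L M M"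
  using Mf by (auto simp: free_mod_aut_iff fg_free_module_def)
 obtain f' where f': "f' \<in> lmod_hom L M M" and ff: "!!x. x \<in> carrier M ==> f' (f x) = x" "!!x. x \<in> carrier M ==> f (f' x) = x"
  using Mf by (auto simp: free_mod_aut_iff)
 interpret M: left_module L M by (rule M)
 obtain n b co where bas: "free_basis L M {..<n::nat} b co" using M.fg_free_imp_basis[OF fM] by blast
 note N = left_module_Vn[of n] Vn_basis[of n]
 define h where "h = (\<lambda>m\<in>carrier M. \<Oplus>\<^bsub>Vn n\<^esub>j\<in>{..<n}. co m j \<odot>\<^bsub>Vn n\<^esub> iota 0 (unit_vec R j))"
 define k where "k = (\<lambda>v\<in>carrier (Vn n). \<Oplus>\<^bsub>M\<^esub>j\<in>{..<n}. (%k. v (of_int k) j) \<odot>\<^bsub>M\<^esub> b j)"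
 have h: "h \<in> lmod_hom L M (Vn n)" unfolding h_def by (rule free_basis_iso(1)[OF M bas N])
 have k: "k \<in> lmod_hom L (Vn n) M" unfolding k_def by (rule free_basis_iso(1)[OF N M bas])
 have hc: "x \<in> carrier M ==> h x \<in> carrier (Vn n)" and kc: "v \<in> carrier (Vn n) ==> k v \<in> carrier M" for x v
  using h k lmod_hom_closed by metis+
 have kh: "k (h x) = x" if "x \<in> carrier M" for x
  using free_basis_iso(2)[OF M bas N that] hc[OF that] that by (simp add: k_def h_def)
 have hk: "h (k v) = v" if "v \<in> carrier (Vn n)" for v
  using free_basis_iso(2)[OF N M bas that] kc[OF that] that by (simp add: k_def h_def)
 \<comment> \<open>The endomorphism transported to \<open>Vn n\<close> and continued by zero;
   \<open>?g\<close> below adds the identity on the complement.\<close>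
 define ex where "ex \<phi> = (\<lambda>v\<in>cV. h (\<phi> (k (proj_T n v))))" for \<phi>
 have exN: "ex \<phi> v \<in> carrier (Vn n)" if "\<phi> \<in> lmod_hom L M M" "v \<in> cV" for \<phi> v
  using that proj_T_Vn[OF that(2)] hc kc lmod_hom_closed[OF that(1)] by (simp add: ex_def)
 have exT: "ex \<phi> \<in> cT" if \<phi>: "\<phi> \<in> lmod_hom L M M" for \<phi>
 proof (rule TI)
  interpret N: left_module L "Vn n" by (rule N)
  note cl = hc kc lmod_hom_closed[OF \<phi>] proj_T_Vn
  fix v w assume v: "v \<in> cV" and w: "w \<in> cV"
  have "proj_T n (v \<oplus>\<^bsub>V\<^esub> w) = proj_T n v \<oplus>\<^bsub>Vn n\<^esub> proj_T n w"
   using T_add[of "proj_T n" v w] v w by (simp add: V_simps Vn_add)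
  then have "ex \<phi> (v \<oplus>\<^bsub>V\<^esub> w) = ex \<phi> v \<oplus>\<^bsub>Vn n\<^esub> ex \<phi> w"
   using v w cl by (simp add: ex_def lmod_hom_add[OF h] lmod_hom_add[OF k] lmod_hom_add[OF \<phi>])
  then show "ex \<phi> (%x i. v x i \<oplus> w x i) = (%x i. ex \<phi> v x i \<oplus> ex \<phi> w x i)" by (simp add: V_simps Vn_add)
 next
  interpret N: equivariant_family R "std_geo R (%_. 0) {..<n}" by (rule std_geo_family)
  note cl = hc kc lmod_hom_closed[OF \<phi>] proj_T_Vn
  fix v a q assume v: "v \<in> cV" and a: "a \<in> carrier R"
  have l: "lmon R q a \<in> carrier L" by (rule lmon_closed[OF a])
  have N_lmon: "lmon R q a \<odot>\<^bsub>Vn n\<^esub> w = (%x i. a \<otimes> w (x - of_int q) i)" if "w \<in> carrier (Vn n)" for w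
   using N.forget_lmon[OF a that, of q] by (simp add: std_geo_simps)
  have "proj_T n (%x i. a \<otimes> v (x - of_int q) i) = lmon R q a \<odot>\<^bsub>Vn n\<^esub> proj_T n v"
   using T_lmon[OF _ v a, of "proj_T n" q] N_lmon[OF proj_T_Vn[OF v]] by simp
  then have "ex \<phi> (%x i. a \<otimes> v (x - of_int q) i) = lmon R q a \<odot>\<^bsub>Vn n\<^esub> ex \<phi> v"
   using v a cl l V_lmon_closed[OF v a, of q] by (simp add: ex_def lmod_hom_smult[OF h] lmod_hom_smult[OF k] lmod_hom_smult[OF \<phi>])
  then show "ex \<phi> (%x i. a \<otimes> v (x - of_int q) i) = (%x i. a \<otimes> ex \<phi> v (x - of_int q) i)"
   using N_lmon[OF exN[OF \<phi> v]] by simp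
 qed (use exN[OF \<phi>] Vn_V in "auto, simp add: ex_def")
 have exP: "proj_T n \<star> ex \<phi> = ex \<phi>" "ex \<phi> \<star> proj_T n = ex \<phi>" if \<phi>: "\<phi> \<in> lmod_hom L M M" for \<phi>
 proof -
  show "proj_T n \<star> ex \<phi> = ex \<phi>"
   by (rule VM.end_eqI) (use exT[OF \<phi>] exN[OF \<phi>] in "auto simp: end_mult_apply proj_T_fixed")
  show "ex \<phi> \<star> proj_T n = ex \<phi>"
   by (rule VM.end_eqI) (use exT[OF \<phi>] in "auto simp: end_mult_apply ex_def proj_T_fixed proj_T_Vn Vn_V")
 qed
 have exm: "ex \<phi> \<star> ex \<psi> = proj_T n" if \<phi>: "\<phi> \<in> lmod_hom L M M" and \<psi>: "\<psi> \<in> lmod_hom L M M"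
  and e: "!!x. x \<in> carrier M ==> \<phi> (\<psi> x) = x" for \<phi> \<psi>
 proof (rule VM.end_eqI)
  fix v assume v: "v \<in> cV"
  note w = exN[OF \<psi> v]
  have kP: "k (proj_T n v) \<in> carrier M" using kc proj_T_Vn[OF v] by blast
  have "k (ex \<psi> v) = \<psi> (k (proj_T n v))"
   using v kh lmod_hom_closed[OF \<psi> kP] by (simp add: ex_def)
  then have "ex \<phi> (ex \<psi> v) = h (k (proj_T n v))"
   using Vn_V[OF w] proj_T_fixed[OF w] e[OF kP] by (simp add: ex_def[of \<phi>])
  then show "(ex \<phi> \<star> ex \<psi>) v = proj_T n v" using v hk proj_T_Vn by (simp add: end_mult_apply)
 qed (use exT \<phi> \<psi> in auto)
 let ?P = "proj_T n" and ?g = "%\<phi>. \<one>\<^sub>T \<ominus>\<^sub>T proj_T n \<oplus>\<^sub>T ex \<phi>"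
 have PP: "?P \<star> ?P = ?P" by (simp add: hat_proj_mult)
 have gg: "?g \<phi> \<star> ?g \<psi> = \<one>\<^sub>T" if \<phi>: "\<phi> \<in> lmod_hom L M M" and \<psi>: "\<psi> \<in> lmod_hom L M M"
  and e: "!!x. x \<in> carrier M ==> \<phi> (\<psi> x) = x" for \<phi> \<psi>
 proof -
  show ?thesis
   by (rule T.corner_unit_mult) (use exT exP exm[OF that] \<phi> \<psi> PP in auto)
 qed
 have gT: "?g \<phi> \<in> cT" if "\<phi> \<in> lmod_hom L M M" for \<phi> using exT[OF that] by simp
 have gm: "?g f \<ominus>\<^sub>T \<one>\<^sub>T = ex f \<ominus>\<^sub>T ?P"
  by (rule T.corner_minus_one) (use exT[OF f] in auto)
 have b: "bnd n (?g f)"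
  unfolding bnd_def gm using gT[OF f] exT[OF f] exP[OF f] PP by (simp add: a_minus_def T.r_distr T.l_distr T.r_minus T.l_minus)
 have G: "?g f \<in> GL"
  using gg[OF f f' ff(2)] gg[OF f' f ff(1)] gT f f' b by (auto simp: GL_def Units_def bnd_def finT_def)
 have gv: "?g f v = h (f (k v))" if v: "v \<in> carrier (Vn n)" for v
 proof -
  note vV = Vn_V[OF v]
  have hv: "h (f (k v)) \<in> cV" using v hc kc lmod_hom_closed[OF f] Vn_V by blast
  have "?g f v = (v \<ominus>\<^bsub>V\<^esub> v) \<oplus>\<^bsub>V\<^esub> h (f (k v))"
   using exT[OF f] vV by (simp add: end_add_apply VM.end_minus_apply end_one_apply proj_T_fixed[OF v]) (simp add: ex_def proj_T_fixed[OF v])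
  then show ?thesis using hv vV by (simp add: a_minus_def VM.M.r_neg)
 qed
 have "frag_of (Vn n, restrict (?g f) (carrier (Vn n))) \<approx>\<^sub>K frag_of (M, f)"
  by (rule equivN_free_iso[OF Mf cls_aut[OF G b] h k kh hk]) (use gv hc kh in auto)
 then have "frag_of (M, f) \<approx>\<^sub>K cls n (?g f)" unfolding cls_def by (rule K.equivN_sym)
 then show ?thesis using cls_kap[OF G b] G K.equivN_trans by blast
qed

text \<open>Differences of classes are classes of products with inverses, so a formal combination
  collapses to a single stable unit.\<close>

lemma kap_surj:
 assumes "Poly_Mapping.keys z \<subseteq> cat_aut (laurent_free_cat R)"
 shows "\<exists>g\<in>GL. z \<approx>\<^sub>K kap g"
 using assms
proof (induction z rule: frag_induction[where S = "cat_aut (laurent_free_cat R)"])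
 case zero
 then show ?case using one_GL K.equivN_sym[OF kap_one] by auto
next
 case (one x)
 then show ?case using kap_generates by (cases x) auto
next
 case (diff a b)
 then obtain g h where "g \<in> GL" "a \<approx>\<^sub>K kap g" "h \<in> GL" "b \<approx>\<^sub>K kap h" by auto
 then have "a - b \<approx>\<^sub>K kap g + kap (inv\<^bsub>T\<^esub> h)" "g \<star> inv\<^bsub>T\<^esub> h \<in> GL" "inv\<^bsub>T\<^esub> h \<in> GL"
  using K.equivN_add[of a "kap g" "- b" "kap (inv\<^bsub>T\<^esub> h)"] K.equivN_trans[OF _ K.equivN_sym[OF kap_inv]]
   K.equivN_diff[of 0 0 b "kap h"] GL_mult GL_inv by auto
 then show ?case using kap_mult[OF \<open>g \<in> GL\<close>, of "inv\<^bsub>T\<^esub> h"] K.equivN_trans K.equivN_sym by blast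
qed

end

section \<open>Lengths of matrix entries and their realisation by geometric maps\<close>

section \<open>Controlled automorphisms\<close>

lemma free_basis_hom_eqI:
 assumes M: "left_module R M" "free_basis R M J b co" and N: "left_module R N"
  and f: "f \<in> lmod_hom R M N" "g \<in> lmod_hom R M N" and eq: "!!j. j \<in> J ==> f (b j) = g (b j)"
 shows "f = g"
proof (rule lmod_hom_eqI[OF f])
 interpret M: left_module R M by (rule M)
 interpret N: left_module R N by (rule N)
 note B = free_basisD[OF M(2)]
 fix m assume m: "m \<in> carrier M"
 have "k m = (\<Oplus>\<^bsub>N\<^esub>j\<in>J. co m j \<odot>\<^bsub>N\<^esub> k (b j))" if k: "k \<in> lmod_hom R M N" for k
 proof -
  have "k (\<Oplus>\<^bsub>M\<^esub>j\<in>J. co m j \<odot>\<^bsub>M\<^esub> b j) = (\<Oplus>\<^bsub>N\<^esub>j\<in>J. k (co m j \<odot>\<^bsub>M\<^esub> b j))"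
   by (rule lmod_hom_finsum[OF M(1) N k]) (use B m in "auto intro!: M.smult_closed")
  also have "... = (\<Oplus>\<^bsub>N\<^esub>j\<in>J. co m j \<odot>\<^bsub>N\<^esub> k (b j))"
   by (rule N.M.finsum_cong') (use B m in "auto simp: lmod_hom_smult[OF k] lmod_hom_closed[OF k] N.smult_closed")
  finally show ?thesis using B(4)[OF m] by simp
 qed
 from this[OF f(1)] this[OF f(2)] show "f m = g m"
  using eq lmod_hom_closed[OF f(2)] B m by (auto intro!: N.M.finsum_cong' simp: N.smult_closed)
qed

text \<open>Moves each basis vector from the orbit of \<open>p i\<close> to that of
  \<open>p' i\<close>. Every coordinate is shifted by its own constant, which commutes with the
  common shift by t.\<close>

definition reposition :: "('a, 'k) ring_scheme => nat set => (nat => real) => (nat => real) =>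
  (real => nat => 'a) => real => nat => 'a" where
 "reposition R J p p' = (\<lambda>w\<in>carrier (\<U>\<^sub>o R (std_geo R p J)). %x i. w (x - p' i + p i) i)"

context stable_setting
begin

lemma U_std_carrier:
 "w \<in> carrier (\<U>\<^sub>o R (std_geo R p J)) \<longleftrightarrow> (\<forall>x. w x \<in> cF) \<and>
  (\<forall>x i. w x i ~= \<zero> \<longrightarrow> i \<in> J & x - p i \<in> \<int>) & finite {x. w x ~= (%i. \<zero>)}"
proof -
 interpret S: equivariant_family R "std_geo R p J" by (rule std_geo_family)
 show ?thesis
  unfolding S.forget_carrier by (auto simp: std_geo_carrier std_geo_simps free_on_carrier)
qed

lemma reposition_hom:
 assumes J: "finite J"
 shows "reposition R J p p' \<in> lmod_hom L (\<U>\<^sub>o R (std_geo R p J)) (\<U>\<^sub>o R (std_geo R p' J))"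
proof (rule forget_homI[OF std_geo_family std_geo_family])
 interpret S: equivariant_family R "std_geo R p J" by (rule std_geo_family)
 interpret U: left_module L S.U by (rule S.left_module_forget)
 fix w assume w: "w \<in> carrier (\<U>\<^sub>o R (std_geo R p J))"
 have sh: "x - p' i + p i - p i = x - p' i" for x i by simp
 let ?w = "%x i. w (x - p' i + p i) i"
 have z: "?w x i ~= \<zero> ==> i \<in> J & x - p' i \<in> \<int>" for x i
  using w unfolding U_std_carrier by (metis sh)
 have "{x. ?w x ~= (%i. \<zero>)} \<subseteq> (\<Union>i\<in>J. (%y. y + p' i - p i) ` {y. w y ~= (%i. \<zero>)})"
 proof
  fix x assume "x \<in> {x. ?w x ~= (%i. \<zero>)}"
  then obtain i where i: "?w x i ~= \<zero>" by auto
  then show "x \<in> (\<Union>i\<in>J. (%y. y + p' i - p i) ` {y. w y ~= (%i. \<zero>)})"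
   using z by (intro UN_I[of i] image_eqI[of _ _ "x - p' i + p i"]) (auto simp: fun_eq_iff)
 qed
 moreover have "finite (\<Union>i\<in>J. (%y. y + p' i - p i) ` {y. w y ~= (%i. \<zero>)})"
  using J w by (auto simp: U_std_carrier)
 ultimately have "finite {x. ?w x ~= (%i. \<zero>)}" by (rule finite_subset)
 moreover have "?w x \<in> cF" for x
  using w z by (auto simp: U_std_carrier free_on_carrier intro: finite_subset[OF _ J])
 ultimately show "reposition R J p p' w \<in> carrier (\<U>\<^sub>o R (std_geo R p' J))"
  using w z by (simp add: reposition_def U_std_carrier)
 fix a k assume "a \<in> carrier R"
 then show "reposition R J p p' (%x. a \<odot>\<^bsub>std_geo R p J x\<^esub> w (x - of_int k)) =
   (%x. a \<odot>\<^bsub>std_geo R p' J x\<^esub> reposition R J p p' w (x - of_int k))"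
  using U.smult_closed[OF lmon_closed[of a k] w] S.forget_lmon[of a w k] w
  by (simp add: reposition_def std_geo_simps algebra_simps)
next
 interpret S: equivariant_family R "std_geo R p J" by (rule std_geo_family)
 interpret U: left_module L S.U by (rule S.left_module_forget)
 fix v w assume "v \<in> carrier (\<U>\<^sub>o R (std_geo R p J))" "w \<in> carrier (\<U>\<^sub>o R (std_geo R p J))"
 then show "reposition R J p p' (%x. v x \<oplus>\<^bsub>std_geo R p J x\<^esub> w x) =
   (%x. reposition R J p p' v x \<oplus>\<^bsub>std_geo R p' J x\<^esub> reposition R J p p' w x)"
  using U.M.a_closed[of v w] S.forget_add[of v w] by (simp add: reposition_def std_geo_simps)
qed (simp add: reposition_def)

lemma reposition_inverse:
 assumes J: "finite J" and w: "w \<in> carrier (\<U>\<^sub>o R (std_geo R p J))"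
 shows "reposition R J p' p (reposition R J p p' w) = w"
 using lmod_hom_closed[OF reposition_hom[OF J] w, of p'] w by (simp add: reposition_def)

text \<open>An entry from basis vector \<open>i\<close> to t^k times basis vector \<open>j\<close>
  joins the point \<open>p i\<close> to the point p j + k.\<close>

definition ctl :: "real => (nat => real) => ((real => nat => 'a) => (real => nat => 'a)) => bool" where
 "ctl \<epsilon> p g \<longleftrightarrow> (\<forall>i k j. g (iota 0 (unit_vec R i)) (of_int k) j ~= \<zero> \<longrightarrow> \<bar>p j + of_int k - p i\<bar> < \<epsilon>)"

text \<open>The first \<open>n\<close> basis vectors are placed at the positions \<open>p\<close>.
  Conjugation by \<open>reposition\<close> turns \<open>g\<close> into an automorphism of this
  geometric module whose components have the lengths bounded by \<open>ctl\<close>.\<close>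

lemma realize_controlled:
 assumes g: "g \<in> GL" and c: "ctl \<epsilon> p g" "ctl \<epsilon> p (inv\<^bsub>T\<^esub> g)"
 shows "\<exists>A \<xi>. eps_automorphism R \<epsilon> A \<xi> & frag_of (\<U>\<^sub>o R A, \<U>\<^sub>h R A A \<xi>) \<approx>\<^sub>K kap g"
proof -
 obtain n where n: "bnd n g" "bnd n (inv\<^bsub>T\<^esub> g)" by (rule GL_bnd[OF g])
 let ?A = "std_geo R p {..<n}"
 let ?W = "\<U>\<^sub>o R ?A"
 have A: "?A \<in> cat_obj (\<T> R)" by (rule std_geo_obj) simp
 interpret A: equivariant_family R ?A by (rule std_geo_family)
 define th where "th = reposition R {..<n} p (%_. 0)"
 define th' where "th' = reposition R {..<n} (%_. 0) p"
 have th: "th \<in> lmod_hom L ?W (Vn n)" and th': "th' \<in> lmod_hom L (Vn n) ?W"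
  unfolding th_def th'_def by (rule reposition_hom, simp)+
 note thc = lmod_hom_closed[OF th] and thc' = lmod_hom_closed[OF th']
 have inv: "th' (th w) = w" if "w \<in> carrier ?W" for w
  using reposition_inverse[of "{..<n}" w p "%_. 0"] that by (simp add: th_def th'_def)
 have inv': "th (th' v) = v" if "v \<in> carrier (Vn n)" for v
  using reposition_inverse[of "{..<n}" v "%_. 0" p] that by (simp add: th_def th'_def)
 define hh where "hh f = compose (carrier ?W) th' (compose (carrier ?W) (restrict f (carrier (Vn n))) th)" for f
 have hh_apply: "hh f w = th' (f (th w))" if "w \<in> carrier ?W" for f w
  using that thc[OF that] by (simp add: hh_def compose_def)
 have hh: "hh f \<in> lmod_hom L ?W ?W" if f: "bnd n f" for f
  unfolding hh_def
  by (rule lmod_hom_compose[OF A.left_module_forget lmod_hom_compose[OF A.left_module_forget th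
     restrict_Vn_hom[OF bnd_T[OF f] bnd_Vn[OF f]]] th'])
 define re where "re f = unforget R ?A (hh f)" for f
 have re: "re f \<in> cat_hom (\<T> R) ?A ?A" "\<U>\<^sub>h R ?A ?A (re f) = hh f" if "bnd n f" for f
  unfolding re_def using forget_full[OF ring_axioms A A hh[OF that]] by auto
 have eq: "equivariant_map R ?A ?A (re f)" if "bnd n f" for f
  by (rule geo_hom_equivariant[OF ring_axioms A A re(1)[OF that]])
 have comp: "geo_comp ?A ?A ?A (re f) (re f') = geo_id ?A"
  if f: "bnd n f" "bnd n f'" and ff: "!!v. v \<in> cV ==> f (f' v) = v" for f f'
 proof (rule geo_comp_eq_idI[OF eq[OF f(2)] eq[OF f(1)]])
  show "compose (carrier ?W) (\<U>\<^sub>h R ?A ?A (re f)) (\<U>\<^sub>h R ?A ?A (re f')) = (\<lambda>v\<in>carrier ?W. v)"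
   by (rule ext, simp only: restrict_def compose_def)
    (use f thc thc' bnd_Vn ff[OF Vn_V[where n = n]] in "auto simp: re(2) hh_apply inv inv'")
 qed
 have ctl: "controlled \<epsilon> ?A ?A (re f)" if f: "bnd n f" and cf: "ctl \<epsilon> p f" for f
  unfolding controlled_def
 proof (clarify, rule ccontr)
  fix x y assume xy: "(x, y) \<in> map_support ?A ?A (re f)" and far: "\<not> \<bar>x - y\<bar> < \<epsilon>"
  have lm: "re f x y \<in> lmod_hom R (?A x) (?A y)" using re(1)[OF f] by (simp add: geo_cat_def geometric_hom_def)
  \<comment> \<open>A component that would be too long is shown to vanish on the basis of
    \<open>?A x\<close>, the unit vectors whose orbit contains \<open>x\<close>.\<close>
  have "re f x y = zero_map (?A x) (?A y)"
  proof (rule free_basis_hom_eqI[OF A.fam _ A.fam lm])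
   show "free_basis R (?A x) {i \<in> {..<n}. x - p i \<in> \<int>} (unit_vec R) (%u. u)"
    unfolding std_geo_def by (rule free_on_basis) simp
   show "zero_map (?A x) (?A y) \<in> lmod_hom R (?A x) (?A y)"
    unfolding zero_map_def by (rule lmod_hom_zero_map[OF A.fam A.fam])
   fix i assume i: "i \<in> {i \<in> {..<n}. x - p i \<in> \<int>}"
   then obtain k where k: "x - p i = of_int k" by (auto elim: Ints_cases)
   have u: "unit_vec R i \<in> carrier (?A x)" using i unfolding std_geo_def by (intro unit_vec_closed) auto
   note su = A.single_closed[OF u]
   have ths: "th (A.single x (unit_vec R i)) = iota k (unit_vec R i)"
    using su k by (auto simp: th_def reposition_def A.single_def iota_def unit_vec_def std_geo_simps fun_eq_iff)
   have fV: "f (iota k (unit_vec R i)) = (%x. f (iota 0 (unit_vec R i)) (x - of_int k))"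
    using tau_iota[of "unit_vec R i" k 0] T_shift[OF bnd_T[OF f], of "iota 0 (unit_vec R i)" k] by (simp add: tau_apply)
   have "re f x y (unit_vec R i) j = \<zero>" for j
   proof (rule ccontr)
    assume nz: "re f x y (unit_vec R i) j ~= \<zero>"
    have "re f x y (unit_vec R i) j = th' (f (iota k (unit_vec R i))) y j"
     using u su by (simp add: re_def unforget_def hh_apply ths)
    also have "... = f (iota k (unit_vec R i)) (y - p j) j"
     using bnd_Vn[OF f thc[OF su]] by (simp add: th'_def reposition_def ths)
    also have "... = f (iota 0 (unit_vec R i)) (y - p j - of_int k) j" by (simp add: fV)
    finally have nz': "f (iota 0 (unit_vec R i)) (y - p j - of_int k) j ~= \<zero>" using nz by simp
    have "f (iota 0 (unit_vec R i)) \<in> cV" using bnd_T[OF f] by simp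
    then have "y - p j - of_int k \<in> \<int>"
     using nz' by (metis V_carrier)
    then obtain l where l: "y - p j - of_int k = of_int l" by (rule Ints_cases)
    then have "\<bar>p j + of_int l - p i\<bar> < \<epsilon>" using cf nz' by (simp add: ctl_def)
    moreover have "p j + of_int l - p i = y - x" using l k by simp
    ultimately show False using far by simp
   qed
   then show "re f x y (unit_vec R i) = zero_map (?A x) (?A y) (unit_vec R i)"
    using u by (auto simp: zero_map_def std_geo_simps)
  qed
  then show False using xy by (simp add: map_support_def)
 qed
 have pair: "cat_inverse_pair (\<T> R) ?A (re g) (re (inv\<^bsub>T\<^esub> g))"
  unfolding cat_inverse_pair_def geo_cat_simps
  by (intro conjI re n comp) (simp_all add: GL_units_apply[OF g])
 have "eps_automorphism R \<epsilon> ?A (re g)"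
  unfolding eps_automorphism_def using A pair ctl[OF n(1) c(1)] ctl[OF n(2) c(2)] by blast
 moreover have "frag_of (?W, \<U>\<^sub>h R ?A ?A (re g)) \<approx>\<^sub>K kap g"
 proof -
  have "(?A, re g) \<in> cat_aut (\<T> R)" using A pair by (auto simp: cat_aut_def)
  from forget_aut[OF ring_axioms this]
  have "frag_of (?W, \<U>\<^sub>h R ?A ?A (re g)) \<approx>\<^sub>K frag_of (Vn n, restrict g (carrier (Vn n)))"
   by (rule equivN_free_iso[OF cls_aut[OF g n(1)] _ th' th inv' inv])
    (use re(2)[OF n(1)] bnd_Vn[OF n(1)] thc' inv' in "auto simp: hh_apply")
  then show ?thesis using cls_kap[OF g n(1)] K.equivN_trans by (auto simp: cls_def)
 qed
 ultimately show ?thesis by blast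
qed

text \<open>Control is asked of some stable unit with the same class and not of \<open>g\<close>,
  since lengths would otherwise add up in products.\<close>

definition controllable where
 "controllable \<epsilon> = {g \<in> GL. \<exists>h\<in>GL. kap g \<approx>\<^sub>K kap h & (\<exists>p. ctl \<epsilon> p h & ctl \<epsilon> p (inv\<^bsub>T\<^esub> h))}"

lemma slot_in_unit: "N > 0 ==> j < N ==> hat R (relabel R (slot_in N j)) (iota k (unit_vec R i)) = iota k (unit_vec R (i * N + j))"
proof -
 assume N: "N > 0" "j < N"
 have "m mod N = j & m div N = i \<longleftrightarrow> m = i * N + j" for m
  using N div_mult_mod_eq[of m N] by auto
 then show ?thesis using N
  by (auto simp: slot_apply) (auto simp: iota_def unit_vec_def fun_eq_iff)
qed

lemma ctl_dsum:
 assumes g: "g \<in> cT" "ctl \<epsilon> p g" and h: "h \<in> cT" "ctl \<epsilon> q h"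
 shows "ctl \<epsilon> (%i. if even i then p (i div 2) else q (i div 2)) (dsum g h)"
 unfolding ctl_def
proof (intro allI impI)
 fix i k j
 let ?e = "iota 0 (unit_vec R (i div 2))"
 assume nz: "dsum g h (iota 0 (unit_vec R i)) (of_int k) j ~= \<zero>"
 show "\<bar>(if even j then p (j div 2) else q (j div 2)) + of_int k - (if even i then p (i div 2) else q (i div 2))\<bar> < \<epsilon>"
 proof (cases "even i")
  case True
  then have "iota 0 (unit_vec R i) = S1 ?e" using slot_in_unit[of 2 0 0 "i div 2"] by auto
  then have "dsum g h (iota 0 (unit_vec R i)) = S1 (g ?e)"
   using dsum_slots(1)[OF g(1) h(1)] end_mult_apply[of ?e V L "dsum g h" S1] end_mult_apply[of ?e V L S1 g] by simp
  then have "even j" "g ?e (of_int k) (j div 2) ~= \<zero>"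
   using nz g by (auto simp: slot_apply split: if_splits)
  then show ?thesis using g(2) True by (auto simp: ctl_def)
 next
  case False
  then have "i div 2 * 2 + 1 = i" by presburger
  then have "iota 0 (unit_vec R i) = S2 ?e" using slot_in_unit[of 2 1 0 "i div 2"] by simp
  then have "dsum g h (iota 0 (unit_vec R i)) = S2 (h ?e)"
   using dsum_slots(2)[OF g(1) h(1)] end_mult_apply[of ?e V L "dsum g h" S2] end_mult_apply[of ?e V L S2 h] by simp
  then have "odd j" "h ?e (of_int k) (j div 2) ~= \<zero>"
   using nz h by (auto simp: slot_apply odd_iff_mod_2_eq_one split: if_splits)
  then show ?thesis using h(2) False by (auto simp: ctl_def)
 qed
qed

lemma controllable_GL: "g \<in> controllable \<epsilon> ==> g \<in> GL"
 by (simp add: controllable_def)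

lemma controllable_cong: "g \<in> controllable \<epsilon> ==> h \<in> GL ==> kap g \<approx>\<^sub>K kap h ==> h \<in> controllable \<epsilon>"
 unfolding controllable_def using K.equivN_trans[OF K.equivN_sym] by blast

text \<open>The two representatives may use incompatible positions. Their block sum has the class of
  the product, and even and odd coordinates each keep their own positions.\<close>

lemma controllable_mult:
 assumes "g \<in> controllable \<epsilon>" "h \<in> controllable \<epsilon>" shows "g \<star> h \<in> controllable \<epsilon>"
proof -
 obtain g' p where g': "g' \<in> GL" "kap g \<approx>\<^sub>K kap g'" "ctl \<epsilon> p g'" "ctl \<epsilon> p (inv\<^bsub>T\<^esub> g')"
  using assms by (auto simp: controllable_def)
 obtain h' q where h': "h' \<in> GL" "kap h \<approx>\<^sub>K kap h'" "ctl \<epsilon> q h'" "ctl \<epsilon> q (inv\<^bsub>T\<^esub> h')"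
  using assms by (auto simp: controllable_def)
 note G = assms[THEN controllable_GL]
 have u: "g' \<in> Units T" "h' \<in> Units T" using g' h' by (auto simp: GL_def)
 have "kap (g \<star> h) \<approx>\<^sub>K kap g' + kap h'"
  using K.equivN_trans[OF kap_mult[OF G] K.equivN_add[OF g'(2) h'(2)]] .
 then have "kap (g \<star> h) \<approx>\<^sub>K kap (dsum g' h')"
  using K.equivN_trans[OF _ K.equivN_sym[OF kap_dsum[OF g'(1) h'(1)]]] by blast
 moreover have "ctl \<epsilon> r (dsum g' h') & ctl \<epsilon> r (inv\<^bsub>T\<^esub> (dsum g' h'))"
  if "r = (%i. if even i then p (i div 2) else q (i div 2))" for r
  unfolding that dsum_inv(2)[OF u] using u g' h' by (auto intro!: ctl_dsum)
 ultimately show ?thesis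
  using GL_mult[OF G] dsum_GL[OF g'(1) h'(1)] by (auto simp: controllable_def)
qed

lemma controllable_inv:
 assumes "g \<in> controllable \<epsilon>" shows "inv\<^bsub>T\<^esub> g \<in> controllable \<epsilon>"
proof -
 obtain h p where h: "h \<in> GL" "kap g \<approx>\<^sub>K kap h" "ctl \<epsilon> p h" "ctl \<epsilon> p (inv\<^bsub>T\<^esub> h)"
  using assms by (auto simp: controllable_def)
 note G = assms[THEN controllable_GL]
 have "inv\<^bsub>T\<^esub> (inv\<^bsub>T\<^esub> h) = h" using h by (simp add: GL_def)
 moreover have "kap (inv\<^bsub>T\<^esub> g) \<approx>\<^sub>K kap (inv\<^bsub>T\<^esub> h)"
  using K.equivN_trans[OF kap_inv[OF G] K.equivN_trans[OF _ K.equivN_sym[OF kap_inv[OF h(1)]]]]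
   K.equivN_diff[OF K.equivN_refl[of 0] h(2)] by simp
 ultimately show ?thesis
  using GL_inv[OF G] GL_inv[OF h(1)] h unfolding controllable_def
  by (intro CollectI conjI bexI[of _ "inv\<^bsub>T\<^esub> h"] exI[of _ p]) auto
qed

text \<open>With all basis vectors at 0, constant entries have length 0.\<close>

lemma controllable_const:
 assumes e: "\<epsilon> > 0" and g: "g \<in> GL" "g \<in> hat R ` cE" "inv\<^bsub>T\<^esub> g \<in> hat R ` cE"
 shows "g \<in> controllable \<epsilon>"
proof -
 have "ctl \<epsilon> (%_. 0) (hat R \<phi>)" if "\<phi> \<in> cE" for \<phi>
  using e that by (auto simp: ctl_def hat_iota) (auto simp: iota_def split: if_splits)
 then have "ctl \<epsilon> (%_. 0) g" "ctl \<epsilon> (%_. 0) (inv\<^bsub>T\<^esub> g)" using g by auto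
 then show ?thesis using g(1) unfolding controllable_def by (intro CollectI conjI bexI[of _ g] exI) auto
qed

lemma controllable_one: "\<epsilon> > 0 ==> \<one>\<^sub>T \<in> controllable \<epsilon>"
 by (rule controllable_const[OF _ one_GL]) (auto simp: hat_one[symmetric] T.inv_one[folded hat_one])

end

locale controlled_setting = stable_setting +
 fixes \<epsilon> :: real
 assumes eps: "\<epsilon> > 0"
begin

lemma kap_controllable:
 assumes "g \<in> GL" "kap g \<approx>\<^sub>K 0" shows "g \<in> controllable \<epsilon>"
 by (rule controllable_cong[OF controllable_one[OF eps] assms(1)])
  (rule K.equivN_trans[OF kap_one K.equivN_sym[OF assms(2)]])

text \<open>Classes live in an abelian group, so a commutator has the class of the identity, which
  is controlled; and an added identity block leaves the class unchanged.\<close>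

sublocale SU: stable_units T finT "hat R ` cE" "controllable \<epsilon>" S1 S2 R1 R2
proof
 fix x y assume xy: "x \<in> finT" "y \<in> finT"
 then obtain n where "proj_T n \<star> x = x" "x \<star> proj_T n = x" "proj_T n \<star> y = y" "y \<star> proj_T n = y"
  by (rule finT_common)
 then show "\<exists>p\<in>finT \<inter> hat R ` cE. p \<star> p = p & p \<star> x = x & x \<star> p = x & p \<star> y = y & y \<star> p = y"
  by (intro bexI[of _ "proj_T n"]) (auto simp: hat_proj_mult hat_finE proj_finE)
next
 fix x assume x: "x \<in> finT" "\<one>\<^sub>T \<oplus>\<^sub>T x \<in> Units T"
 have xT: "x \<in> cT" by (rule finT_closed[OF x(1)])
 then have G: "\<one>\<^sub>T \<oplus>\<^sub>T x \<in> GL" using x by (simp add: GL_def one_plus_minus')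
 have e: "\<one>\<^sub>T \<oplus>\<^sub>T S1 \<star> x \<star> R1 = dsum (\<one>\<^sub>T \<oplus>\<^sub>T x) \<one>\<^sub>T"
  using dsum_one_plus[of x "\<zero>\<^sub>T"] xT by (simp add: dsum_def)
 have "kap (dsum (\<one>\<^sub>T \<oplus>\<^sub>T x) \<one>\<^sub>T) \<approx>\<^sub>K kap (\<one>\<^sub>T \<oplus>\<^sub>T x)"
  using K.equivN_trans[OF kap_dsum[OF G one_GL] K.equivN_add[OF K.equivN_refl kap_one]] by simp
 then show "\<one>\<^sub>T \<oplus>\<^sub>T S1 \<star> x \<star> R1 \<in> controllable \<epsilon> \<longleftrightarrow> \<one>\<^sub>T \<oplus>\<^sub>T x \<in> controllable \<epsilon>"
  unfolding e using controllable_cong G dsum_GL[OF G one_GL] K.equivN_sym by blast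
next
 fix g h assume "g \<in> Units T" "g \<ominus>\<^sub>T \<one>\<^sub>T \<in> finT" "h \<in> Units T" "h \<ominus>\<^sub>T \<one>\<^sub>T \<in> finT"
 then have g: "g \<in> GL" and h: "h \<in> GL" by (auto simp: GL_def)
 have "kap (g \<star> h \<star> inv\<^bsub>T\<^esub> g \<star> inv\<^bsub>T\<^esub> h) \<approx>\<^sub>K (kap g + kap h) + - kap g + - kap h"
  by (intro K.equivN_trans[OF kap_mult K.equivN_add] kap_mult kap_inv GL_mult GL_inv g h)
 then show "g \<star> h \<star> inv\<^bsub>T\<^esub> g \<star> inv\<^bsub>T\<^esub> h \<in> controllable \<epsilon>"
  by (intro kap_controllable GL_mult GL_inv g h) simp
next
 show "R1 \<star> S1 = \<one>\<^sub>T" "R2 \<star> S2 = \<one>\<^sub>T" "R1 \<star> S2 = \<zero>\<^sub>T" "R2 \<star> S1 = \<zero>\<^sub>T"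
  using slot_out_in[of 2 0 0] slot_out_in[of 2 1 0] slot_out_in[of 2 1 1] slot_out_in[of 2 0 1] by auto
 show "\<one>\<^sub>T \<in> hat R ` cE" using hat_one by force
 show "S1 \<in> hat R ` cE" "S2 \<in> hat R ` cE" "R1 \<in> hat R ` cE" "R2 \<in> hat R ` cE"
  by auto
 show "controllable \<epsilon> \<subseteq> {g \<in> Units T. g \<ominus>\<^sub>T \<one>\<^sub>T \<in> finT}" by (auto simp: controllable_def GL_def)
qed (auto simp: finT_closed finT_zero finT_add finT_uminus finT_mult finT_slot_out controllable_mult controllable_inv
  hat_add[symmetric] hat_uminus[symmetric] hat_mult[symmetric])

end

section \<open>Spreading t over N equally spaced points of the circle\<close>

section \<open>Spreading an idempotent over the circle\<close>

context stable_setting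
begin

text \<open>The function underlying \<open>slot_out\<close>, without the restriction to
  \<open>cF\<close>; equalities of vectors are checked one residue class at a time.\<close>

definition sout :: "nat => nat => (nat => 'a) => nat => 'a" where
 "sout N j u = (%i. u (i * N + j))"

lemma relabel_slot_out: "N > 0 ==> u \<in> cF ==> relabel R (slot_out N j) u = sout N j u"
 by (auto simp: relabel_apply slot_at sout_def fun_eq_iff)

lemma sout_F: assumes "N > 0" "u \<in> cF" shows "sout N j u \<in> cF"
 using E_closed[OF relabel_closed[OF finite_slot_out[OF assms(1)]] assms(2)] by (simp add: relabel_slot_out[OF assms])

lemma E_hom: "\<phi> \<in> cE \<longleftrightarrow> \<phi> \<in> lmod_hom R F F"
 by (simp add: end_ring_carrier)

lemma E_diff: "\<phi> \<in> cE ==> u \<in> cF ==> w \<in> cF ==> \<phi> (u \<ominus>\<^sub>F w) = \<phi> u \<ominus>\<^sub>F \<phi> w"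
 using lmod_hom_add[of \<phi> R F F u "\<ominus>\<^sub>F w"] lmod_hom_uminus[OF FM.is_left_module FM.is_left_module, of \<phi> w]
 by (simp add: a_minus_def E_hom)

lemma sout_diff: "N > 0 ==> u \<in> cF ==> w \<in> cF ==> sout N j (u \<ominus>\<^sub>F w) = sout N j u \<ominus>\<^sub>F sout N j w"
 using E_diff[of "relabel R (slot_out N j)" u w] by (simp add: relabel_slot_out)

lemma sout_at: "N > 0 ==> u m = sout N (m mod N) u (m div N)"
 by (simp add: sout_def)

lemma sout_eqI:
 assumes "N > 0" "!!j. j < N ==> sout N j u = sout N j w" shows "u = w"
proof
 fix m show "u m = w m" using assms(2)[of "m mod N"] assms(1) by (metis sout_at mod_less_divisor)
qed

lemma sout_add: "sout N j (u \<oplus>\<^sub>F w) = sout N j u \<oplus>\<^sub>F sout N j w"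
 by (simp add: sout_def free_on_simps)

definition blockwise :: "nat => (nat => (nat => 'a) => nat => 'a) => (nat => 'a) => nat => 'a" where
 "blockwise N \<phi> = (\<lambda>u\<in>cF. %m. \<phi> (m mod N) (sout N (m mod N) u) (m div N))"

lemma blockwise_sout: "u \<in> cF ==> j < N ==> sout N j (blockwise N \<phi> u) = \<phi> j (sout N j u)"
 by (simp add: blockwise_def sout_def)

lemma blockwise_closed:
 assumes N: "N > 0" and \<phi>: "!!j. j < N ==> \<phi> j \<in> cE" shows "blockwise N \<phi> \<in> cE"
proof (rule EI)
 fix u assume u: "u \<in> cF"
 have so: "\<phi> j (sout N j u) \<in> cF" if "j < N" for j using \<phi> u N sout_F that by simp
 have "{m. blockwise N \<phi> u m ~= \<zero>} \<subseteq> (%(i, j). i * N + j) ` (SIGMA i:(\<Union>j\<in>{..<N}. {i. \<phi> j (sout N j u) i ~= \<zero>}). {..<N})"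
 proof
  fix m assume "m \<in> {m. blockwise N \<phi> u m ~= \<zero>}"
  then have "m div N \<in> (\<Union>j\<in>{..<N}. {i. \<phi> j (sout N j u) i ~= \<zero>})"
   using u N by (intro UN_I[of "m mod N"]) (auto simp: blockwise_def)
  then show "m \<in> (%(i, j). i * N + j) ` (SIGMA i:(\<Union>j\<in>{..<N}. {i. \<phi> j (sout N j u) i ~= \<zero>}). {..<N})"
   using N by (intro rev_image_eqI[of "(m div N, m mod N)"]) auto
 qed
 moreover have "finite (SIGMA i:(\<Union>j\<in>{..<N}. {i. \<phi> j (sout N j u) i ~= \<zero>}). {..<N})"
  using so by (auto simp: free_on_carrier)
 ultimately have "finite {m. blockwise N \<phi> u m ~= \<zero>}" using finite_subset by blast
 then show "blockwise N \<phi> u \<in> cF"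
  using u F_apply_R[OF so] N by (auto simp: free_on_carrier blockwise_def)
next
 fix u w a assume u: "u \<in> cF"
 note so = sout_F[OF N u, unfolded sout_def]
 show "blockwise N \<phi> (%i. u i \<oplus> w i) = (%i. blockwise N \<phi> u i \<oplus> blockwise N \<phi> w i)" if w: "w \<in> cF"
  using u w E_add[OF \<phi> so sout_F[OF N w, unfolded sout_def]] by (simp add: blockwise_def sout_def F_add_closed N)
 show "blockwise N \<phi> (%i. a \<otimes> u i) = (%i. a \<otimes> blockwise N \<phi> u i)" if a: "a \<in> carrier R"
  using u a E_smult[OF \<phi> so a] by (simp add: blockwise_def sout_def F_smult_closed N)
qed (simp add: blockwise_def)

lemma blockwise_finE:
 assumes N: "N > 0" and \<phi>: "!!j. j < N ==> \<phi> j \<in> finE" shows "blockwise N \<phi> \<in> finE"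
proof -
 have \<phi>E: "\<phi> j \<in> cE" if "j < N" for j using \<phi>[OF that] by (rule finE_closed)
 have "\<forall>j<N. \<exists>n. \<phi> j \<bullet> proj n = \<phi> j" using \<phi> by (auto simp: finE_def)
 then obtain b where b: "\<phi> j \<bullet> proj (b j) = \<phi> j" if "j < N" for j by metis
 define n where "n = (\<Sum>j<N. b j)"
 have n: "\<phi> j (proj n u) = \<phi> j u" if "u \<in> cF" "j < N" for j u
 proof -
  have "b j \<le> n" unfolding n_def using that by (intro member_le_sum) auto
  then have "\<phi> j \<bullet> proj n = \<phi> j"
   using b[OF that(2)] \<phi>E[OF that(2)] proj_mult[of "b j" n] E.m_assoc[of "\<phi> j" "proj (b j)" "proj n"] by (simp add: min_def)
  then show ?thesis using end_mult_apply[OF that(1), of R "\<phi> j" "proj n"] by simp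
 qed
 have pr: "sout N j (proj (n * N) u) = proj n (sout N j u)" if "u \<in> cF" "j < N" for u j
 proof -
  have "i * N + j < n * N \<longleftrightarrow> i < n" for i
  proof
   assume "i < n"
   then have "Suc i * N \<le> n * N" by (intro mult_le_mono1) simp
   then show "i * N + j < n * N" using that by simp
  next
   assume "i * N + j < n * N"
   then have "i * N < n * N" by linarith
   then show "i < n" by simp
  qed
  then show ?thesis using that sout_F[OF N that(1)] by (simp add: proj_apply) (auto simp: sout_def)
 qed
 have "blockwise N \<phi> \<bullet> proj (n * N) = blockwise N \<phi>"
  by (rule FM.end_eqI, use blockwise_closed[OF N \<phi>E] in auto, rule sout_eqI[OF N])
   (auto simp: end_mult_apply blockwise_sout pr n sout_F[OF N])
 then show ?thesis by (intro finEI blockwise_closed N \<phi>E)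
qed

text \<open>Moves residue class \<open>j - 1\<close> to class \<open>j\<close> and the last class to
  class 0; \<open>cyc'\<close> moves them back.\<close>

definition cyc :: "nat => nat => nat option" where
 "cyc N = (%m. Some (if m mod N = 0 then m + N - 1 else m - 1))"

definition cyc' :: "nat => nat => nat option" where
 "cyc' N = (%m. Some (if m mod N = N - 1 then m + 1 - N else m + 1))"

lemma finite_cyc: "N > 0 ==> finite {i. cyc N i = Some j}" "N > 0 ==> finite {i. cyc' N i = Some j}"
 by (rule finite_subset[of _ "{..j + N}"], auto simp: cyc_def cyc'_def split: if_splits)+

lemma cyc_closed: "N > 0 ==> relabel R (cyc N) \<in> cE" "N > 0 ==> relabel R (cyc' N) \<in> cE"
 by (simp_all add: finite_cyc)

lemma sout_cyc:
 assumes "N > 0" "u \<in> cF" "j < N"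
 shows "sout N j (relabel R (cyc N) u) = sout N (if j = 0 then N - 1 else j - 1) u"
  "sout N j (relabel R (cyc' N) u) = sout N (if j = N - 1 then 0 else j + 1) u"
proof -
 have e: "(i * N + j) mod N = j" for i using assms by simp
 show "sout N j (relabel R (cyc N) u) = sout N (if j = 0 then N - 1 else j - 1) u"
  using assms by (auto simp: sout_def relabel_apply cyc_def fun_eq_iff)
 have "i * N + j + 1 - N = i * N" if "j = N - 1" for i using assms that by simp
 then show "sout N j (relabel R (cyc' N) u) = sout N (if j = N - 1 then 0 else j + 1) u"
  using assms by (auto simp: sout_def relabel_apply cyc'_def fun_eq_iff)
qed

end

context controlled_setting
begin

text \<open>
 A constant automorphism does not change the class modulo controllable units, so the corner unit may be
 composed with the constant cyclic shift of \<open>N\<close> copies of the image of \<open>P\<close>; the composite moves each copy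
 one step of length \<open>1 / N\<close> around the circle.
\<close>

lemma corner_controllable:
 assumes P: "P \<in> finE" "P \<bullet> P = P"
 shows "\<one>\<^sub>T \<ominus>\<^sub>T hat R P \<oplus>\<^sub>T hat R P \<star> tau R 1 \<in> controllable \<epsilon>"
proof -
 obtain N0 :: nat where "inverse (real (Suc N0)) < \<epsilon>" using reals_Archimedean[OF eps] by blast
 \<comment> \<open>The number of copies, large enough for a step of length 1 / N to be shorter than
   \<epsilon>.\<close>
 define N where "N = Suc (Suc N0)"
 have N: "N > 0" "N \<ge> 2" and Neps: "1 / real N < \<epsilon>"
 proof -
  have "1 / real N \<le> inverse (real (Suc N0))" by (simp add: N_def field_simps)
  then show "1 / real N < \<epsilon>" using \<open>inverse (real (Suc N0)) < \<epsilon>\<close> by linarith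
 qed (auto simp: N_def)
 have PE: "P \<in> cE" by (rule finE_closed[OF P(1)])
 have PP: "P (P u) = P u" if "u \<in> cF" for u
  using P(2) end_mult_apply[OF that, of R P P] by simp
 note Pm = E_diff[OF PE]
 define pt where "pt = blockwise N (%_. P)"
 define si where "si = relabel R (slot_in N (N - 1))"
 define so where "so = relabel R (slot_out N (N - 1))"
 \<comment> \<open>\<open>P\<close> on the last copy alone, while \<open>pt\<close> is
   \<open>P\<close> on every copy. Only on the last copy will t be applied, once for each turn of
   the circle.\<close>
 define q where "q = si \<bullet> P \<bullet> so"
 define cy where "cy = relabel R (cyc N)"
 define cy' where "cy' = relabel R (cyc' N)"
 have cl: "pt \<in> cE" "si \<in> cE" "so \<in> cE" "q \<in> cE" "cy \<in> cE" "cy' \<in> cE"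
  using N PE by (auto simp: pt_def si_def so_def q_def cy_def cy'_def blockwise_closed cyc_closed)
 note cF = E_closed[OF cl(1)] E_closed[OF cl(4)] E_closed[OF cl(5)] E_closed[OF cl(6)] E_closed[OF PE] sout_F[OF N(1)]
 define pr where "pr j = (if j = 0 then N - 1 else j - 1)" for j
 define nx where "nx j = (if j = N - 1 then 0 else j + 1)" for j
 have prnx: "pr j < N" "nx j < N" "pr (nx j) = j" "nx (pr j) = j" if "j < N" for j
  using that N by (auto simp: pr_def nx_def)
 have so_pt: "sout N j (pt u) = P (sout N j u)" if "u \<in> cF" "j < N" for u j
  using that by (simp add: pt_def blockwise_sout)
 have so_cy: "sout N j (cy u) = sout N (pr j) u" "sout N j (cy' u) = sout N (nx j) u" if "u \<in> cF" "j < N" for u j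
  using sout_cyc[OF N(1) that] by (simp_all add: cy_def cy'_def pr_def nx_def)
 have so_q: "sout N j (q u) = (if j = N - 1 then P (sout N j u) else (%i. \<zero>))" if u: "u \<in> cF" and j: "j < N" for u j
 proof -
  have "so u = sout N (N - 1) u"
   using u N by (simp add: so_def relabel_slot_out)
  moreover have "so u \<in> cF" using u cl by simp
  moreover have "(i * N + N - Suc 0) mod N = N - Suc 0" "(i * N + N - Suc 0) div N = i" for i
  proof -
   have "i * N + N - Suc 0 = i * N + (N - Suc 0)" using N by simp
   moreover have "(i * N + (N - Suc 0)) mod N = (N - Suc 0) mod N" "(i * N + (N - Suc 0)) div N = i + (N - Suc 0) div N"
    by (rule mod_mult_self3) (rule div_mult_self3, use N in simp)
   ultimately show "(i * N + N - Suc 0) mod N = N - Suc 0" "(i * N + N - Suc 0) div N = i" using N by simp_all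
  qed
  ultimately show ?thesis
   using u j cl PE by (auto simp: q_def end_mult_apply) (auto simp: sout_def si_def relabel_apply slot_at fun_eq_iff)
 qed
 have P0: "P (%i. \<zero>) = (%i. \<zero>)" by (rule E_zero[OF PE])
 have eqE: "\<phi> = \<psi>" if "\<phi> \<in> cE" "\<psi> \<in> cE" "!!u j. u \<in> cF ==> j < N ==> sout N j (\<phi> u) = sout N j (\<psi> u)" for \<phi> \<psi>
  by (rule FM.end_eqI[OF that(1,2)], rule sout_eqI[OF N(1)], rule that(3))
 note ss = end_mult_apply end_one_apply so_pt so_cy so_q cF PP P0 prnx
 have rel: "pt \<bullet> pt = pt" "q \<bullet> q = q" "cy \<bullet> pt = pt \<bullet> cy" "cy' \<bullet> pt = pt \<bullet> cy'"
  "cy \<bullet> cy' = \<one>\<^sub>E" "cy' \<bullet> cy = \<one>\<^sub>E"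
 proof -
  show "pt \<bullet> pt = pt" by (rule eqE) (use cl in "auto simp: ss")
  show "q \<bullet> q = q" by (rule eqE) (use cl in "auto simp: ss")
  show "cy \<bullet> pt = pt \<bullet> cy" by (rule eqE) (use cl in "auto simp: ss")
  show "cy' \<bullet> pt = pt \<bullet> cy'" by (rule eqE) (use cl in "auto simp: ss")
  show "cy \<bullet> cy' = \<one>\<^sub>E" by (rule eqE) (use cl in "auto simp: ss")
  show "cy' \<bullet> cy = \<one>\<^sub>E" by (rule eqE) (use cl in "auto simp: ss")
 qed
 have finpt: "pt \<in> finE" unfolding pt_def using N P(1) by (intro blockwise_finE)
 have mid: "c \<bullet> p \<bullet> (c' \<bullet> p) = p"
  if "c \<in> cE" "c' \<in> cE" "p \<in> cE" "p \<bullet> p = p" "c \<bullet> c' = \<one>\<^sub>E" "c' \<bullet> p = p \<bullet> c'" for c c' p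
 proof -
  have "c \<bullet> p \<bullet> (c' \<bullet> p) = c \<bullet> (p \<bullet> p) \<bullet> c'"
   unfolding that(6) using that(1-3) by (simp add: E.m_assoc)
  also have "... = c \<bullet> (c' \<bullet> p)" unfolding that(4) that(6) using that(1-3) by (simp add: E.m_assoc)
  finally show ?thesis using that(1-3,5) by (simp add: E.m_assoc[symmetric])
 qed
 have fix1: "p \<bullet> (c \<bullet> p) = c \<bullet> p"
  if "c \<in> cE" "p \<in> cE" "p \<bullet> p = p" "c \<bullet> p = p \<bullet> c" for c p
  unfolding that(4) using that(1-3) by (simp add: E.m_assoc[symmetric])
 let ?one = "\<one>\<^sub>E"
 \<comment> \<open>The cyclic shift on the image of \<open>pt\<close> and the identity on its
   complement; a constant unit.\<close>
 define g where "g = ?one \<ominus>\<^sub>E pt \<oplus>\<^sub>E cy \<bullet> pt"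
 define g' where "g' = ?one \<ominus>\<^sub>E pt \<oplus>\<^sub>E cy' \<bullet> pt"
 have gE: "g \<in> cE" "g' \<in> cE" using cl by (auto simp: g_def g'_def)
 have gg: "g \<bullet> g' = ?one" "g' \<bullet> g = ?one"
  unfolding g_def g'_def
  by (rule E.corner_unit_mult; use cl rel fix1[OF _ cl(1)] mid[of cy cy' pt] mid[of cy' cy pt] in "simp add: E.m_assoc")+
 define G where "G = hat R g"
 define G' where "G' = hat R g'"
 define Q where "Q = hat R q"
 \<comment> \<open>The corner unit of \<open>P\<close>, moved into the last of the \<open>N\<close>
   copies.\<close>
 define D where "D = \<one>\<^sub>T \<ominus>\<^sub>T Q \<oplus>\<^sub>T Q \<star> tau R 1"
 define D' where "D' = \<one>\<^sub>T \<ominus>\<^sub>T Q \<oplus>\<^sub>T Q \<star> tau R (- 1)"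
 have Tc: "G \<in> cT" "G' \<in> cT" "Q \<in> cT" "D \<in> cT" "D' \<in> cT"
  using gE cl by (auto simp: G_def G'_def Q_def D_def D'_def)
 have GG: "G \<star> G' = \<one>\<^sub>T" "G' \<star> G = \<one>\<^sub>T"
  using gg gE by (simp_all add: G_def G'_def hat_mult[symmetric] hat_one)
 have QQ: "Q \<star> Q = Q" using rel cl by (simp add: Q_def hat_mult[symmetric])
 have Qtau: "Q \<star> tau R k \<star> (Q \<star> tau R l) = Q" if "k + l = 0" for k l
 proof -
  have "Q \<star> tau R k \<star> (Q \<star> tau R l) = Q \<star> (tau R k \<star> Q) \<star> tau R l"
   using Tc by (simp add: T.m_assoc)
  also have "... = (Q \<star> Q) \<star> (tau R k \<star> tau R l)"
   unfolding tau_central[OF Tc(3), symmetric] using Tc by (simp add: T.m_assoc)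
  finally show ?thesis using Tc that by (simp add: QQ tau_mult tau_zero)
 qed
 have Qt: "Q \<star> tau R k \<star> Q = Q \<star> tau R k" "Q \<star> (Q \<star> tau R k) = Q \<star> tau R k" for k
 proof -
  show 1: "Q \<star> (Q \<star> tau R k) = Q \<star> tau R k" using Tc QQ by (simp add: T.m_assoc[symmetric])
  have "Q \<star> tau R k \<star> Q = Q \<star> (tau R k \<star> Q)" using Tc by (simp add: T.m_assoc)
  also have "... = Q \<star> (Q \<star> tau R k)" by (simp only: tau_central[OF Tc(3)])
  finally have "Q \<star> tau R k \<star> Q = Q \<star> (Q \<star> tau R k)" .
  then show "Q \<star> tau R k \<star> Q = Q \<star> tau R k" using 1 by simp
 qed
 have DD: "D \<star> D' = \<one>\<^sub>T" "D' \<star> D = \<one>\<^sub>T"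
  unfolding D_def D'_def by (rule T.corner_unit_mult; use Tc Qt QQ Qtau in simp)+
 have GL_I: "x \<in> GL & inv\<^bsub>T\<^esub> x = y" if "x \<in> cT" "y \<in> cT" "x \<star> y = \<one>\<^sub>T" "y \<star> x = \<one>\<^sub>T"
  "x \<ominus>\<^sub>T \<one>\<^sub>T \<in> finT" for x y
  using that by (auto simp: GL_def Units_def intro!: T.inv_char)
 have finQ: "Q \<in> finT"
 proof -
  have "hat R P \<in> finT" by (rule hat_finE[OF P(1)])
  then have "hat R si \<star> (hat R P \<star> hat R so) \<in> finT"
   using cl N unfolding so_def by (intro finT_mult finT_slot_out) auto
  then show ?thesis using cl PE by (simp add: Q_def q_def hat_mult T.m_assoc)
 qed
 have fin_tau: "x \<star> tau R k \<in> finT" if "x \<in> finT" for x k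
  using tau_central[OF finT_closed[OF that]] finT_mult[OF _ that] by simp
 have GLG: "G \<in> GL" "inv\<^bsub>T\<^esub> G = G'"
 proof -
  have "g \<ominus>\<^sub>E ?one = cy \<bullet> pt \<ominus>\<^sub>E pt" unfolding g_def by (rule E.corner_minus_one) (use cl in auto)
  then have "G \<ominus>\<^sub>T \<one>\<^sub>T = hat R cy \<star> hat R pt \<ominus>\<^sub>T hat R pt"
   using cl gE by (simp add: G_def hat_one[symmetric] hat_minus[symmetric] hat_mult[symmetric])
  moreover have "hat R cy \<star> hat R pt \<ominus>\<^sub>T hat R pt \<in> finT"
   unfolding a_minus_def using hat_finE[OF finpt] cl by (intro finT_add finT_uminus finT_mult) auto
  ultimately show "G \<in> GL" "inv\<^bsub>T\<^esub> G = G'" using GL_I Tc GG by auto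
 qed
 have GLD: "D \<in> GL" "inv\<^bsub>T\<^esub> D = D'"
 proof -
  have "D \<ominus>\<^sub>T \<one>\<^sub>T = Q \<star> tau R 1 \<ominus>\<^sub>T Q" unfolding D_def by (rule T.corner_minus_one) (use Tc in auto)
  then have "D \<ominus>\<^sub>T \<one>\<^sub>T \<in> finT" using finQ fin_tau by (simp add: a_minus_def finT_add finT_uminus)
  then show "D \<in> GL" "inv\<^bsub>T\<^esub> D = D'" using GL_I Tc DD by auto
 qed
 have G_H: "G \<in> controllable \<epsilon>"
  by (rule controllable_const[OF eps GLG(1)]) (use gE GLG(2) in "auto simp: G_def G'_def")
 \<comment> \<open>Copy number m mod N sits at that number divided by N. Measured in steps of 1 / N,
   the power t^k counts for k N steps, and at most one step in total is allowed.\<close>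
 have ctlI: "ctl \<epsilon> (%m. real (m mod N) / real N) f" if f: "!!m k j i. f (iota 0 (unit_vec R m)) (of_int k) (i * N + j) ~= \<zero> ==> j < N ==>
   \<bar>int j + k * int N - int (m mod N)\<bar> \<le> 1" for f
  unfolding ctl_def
 proof (intro allI impI)
  fix m k i assume nz: "f (iota 0 (unit_vec R m)) (of_int k) i ~= \<zero>"
  have "\<bar>int (i mod N) + k * int N - int (m mod N)\<bar> \<le> 1"
   by (rule f[of m k "i div N" "i mod N"]) (use nz N in auto)
  then have "\<bar>real (i mod N) + of_int k * real N - real (m mod N)\<bar> \<le> 1"
   using of_int_le_iff[where 'a = real, of "\<bar>int (i mod N) + k * int N - int (m mod N)\<bar>" 1] by simp
  then have "\<bar>real (i mod N) + of_int k * real N - real (m mod N)\<bar> / real N \<le> 1 / real N"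
   using N by (intro divide_right_mono) auto
  also have "\<bar>real (i mod N) + of_int k * real N - real (m mod N)\<bar> / real N =
    \<bar>real (i mod N) / real N + of_int k - real (m mod N) / real N\<bar>"
  proof -
   have "(real (i mod N) + of_int k * real N - real (m mod N)) / real N =
     real (i mod N) / real N + of_int k - real (m mod N) / real N"
    using N by (simp add: field_simps)
   then show ?thesis using abs_divide[of "real (i mod N) + of_int k * real N - real (m mod N)" "real N"] by simp
  qed
  finally show "\<bar>real (i mod N) / real N + of_int k - real (m mod N) / real N\<bar> < \<epsilon>" using Neps by simp
 qed
 have so_e: "sout N j (unit_vec R m) = (%i. \<zero>)" if "j < N" "j ~= m mod N" for j m
  using that by (auto simp: sout_def unit_vec_def fun_eq_iff)
 have Dact: "(\<one>\<^sub>T \<ominus>\<^sub>T Q \<oplus>\<^sub>T Q \<star> tau R l) (iota 0 u) = iota 0 (u \<ominus>\<^sub>F q u) \<oplus>\<^bsub>V\<^esub> iota l (q u)"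
  if u: "u \<in> cF" for u l
 proof -
  have m: "iota 0 u \<ominus>\<^bsub>V\<^esub> iota 0 (q u) = iota 0 (u \<ominus>\<^sub>F q u)"
  proof -
   have "(hat R (?one \<ominus>\<^sub>E q)) (iota 0 u) = iota 0 (u \<ominus>\<^sub>F q u)"
    using u cl by (simp add: hat_iota FM.end_minus_apply end_one_apply)
   then show ?thesis using u cl by (simp add: hat_minus VM.end_minus_apply hat_one end_one_apply hat_iota)
  qed
  have "(\<one>\<^sub>T \<ominus>\<^sub>T Q \<oplus>\<^sub>T Q \<star> tau R l) (iota 0 u) = (iota 0 u \<ominus>\<^bsub>V\<^esub> Q (iota 0 u)) \<oplus>\<^bsub>V\<^esub> Q (tau R l (iota 0 u))"
   using u Tc by (simp add: end_add_apply VM.end_minus_apply end_one_apply end_mult_apply)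
  then show ?thesis using u cl by (simp add: tau_iota hat_iota Q_def m)
 qed
 note so_m = sout_diff[OF N(1)]
 have zF: "\<zero>\<^sub>F = (%i. \<zero>)" by (simp add: free_on_simps)
 have so_g: "sout N j (g u) = sout N j u \<ominus>\<^sub>F P (sout N j u) \<oplus>\<^sub>F P (sout N (pr j) u)"
  "sout N j (g' u) = sout N j u \<ominus>\<^sub>F P (sout N j u) \<oplus>\<^sub>F P (sout N (nx j) u)" if "u \<in> cF" "j < N" for j u
  using that cl by (simp_all add: g_def g'_def end_add_apply FM.end_minus_apply ss sout_add so_m)
 have so_m_q: "sout N j (u \<ominus>\<^sub>F q u) = (if j = N - 1 then sout N j u \<ominus>\<^sub>F P (sout N j u) else sout N j u)" if "u \<in> cF" "j < N" for j u
  using that cF(6)[OF that(1)] cF(2)[OF that(1)] by (simp add: so_m so_q) (simp add: a_minus_def zF[symmetric])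
 have FmF: "u \<ominus>\<^sub>F u = \<zero>\<^sub>F" "u \<oplus>\<^sub>F \<zero>\<^sub>F = u" "\<zero>\<^sub>F \<oplus>\<^sub>F u = u" "u \<ominus>\<^sub>F \<zero>\<^sub>F = u" if "u \<in> cF" for u
  using that by (auto simp: a_minus_def FM.M.r_neg)
 note eF = unit_vec_F
 \<comment> \<open>\<open>D\<close> acts first and adds a turn on the last copy. Then
   \<open>G\<close> takes the last copy to copy 0, that is from (N - 1) / N to 1, and every other
   copy one step ahead.\<close>
 have ctl1: "ctl \<epsilon> (%m. real (m mod N) / real N) (G \<star> D)"
 proof (rule ctlI)
  fix m k j i assume nz: "(G \<star> D) (iota 0 (unit_vec R m)) (of_int k) (i * N + j) ~= \<zero>" and j: "j < N"
  let ?e = "unit_vec R m"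
  have c: "q ?e \<in> cF" "?e \<ominus>\<^sub>F q ?e \<in> cF" using cF by auto
  have "(G \<star> D) (iota 0 ?e) = iota 0 (g (?e \<ominus>\<^sub>F q ?e)) \<oplus>\<^bsub>V\<^esub> iota 1 (g (q ?e))"
   using Tc gE c lmod_hom_add[of G L V V "iota 0 (?e \<ominus>\<^sub>F q ?e)" "iota 1 (q ?e)"]
   by (simp add: end_mult_apply D_def Dact end_ring_carrier[symmetric]) (simp add: G_def hat_iota)
  then consider (0) "k = 0" "sout N j (g (?e \<ominus>\<^sub>F q ?e)) ~= \<zero>\<^sub>F" | (1) "k = 1" "sout N j (g (q ?e)) ~= \<zero>\<^sub>F"
   using nz c gE F_apply_R[of "g (?e \<ominus>\<^sub>F q ?e)"] F_apply_R[of "g (q ?e)"]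
   by (auto simp: V_simps iota_def sout_def zF fun_eq_iff split: if_splits)
  then show "\<bar>int j + k * int N - int (m mod N)\<bar> \<le> 1"
  proof cases
   case 0
   have "j = m mod N \<or> (j ~= 0 & j - 1 = m mod N)"
   proof (rule ccontr)
    assume n: "\<not> ?thesis"
    then have "sout N j (?e \<ominus>\<^sub>F q ?e) = \<zero>\<^sub>F"
     using j so_e[of j m] by (auto simp: so_m_q zF[symmetric] P0[folded zF] FmF)
    moreover have "P (sout N (pr j) (?e \<ominus>\<^sub>F q ?e)) = \<zero>\<^sub>F"
     using n j so_e[of "pr j" m] prnx[OF j] N cF(6)[OF eF]
     by (cases "j = 0") (auto simp: so_m_q Pm PP cF FmF pr_def P0[folded zF] zF[symmetric])
    ultimately show False using 0 c j by (simp add: so_g P0[folded zF] FmF)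
   qed
   then show ?thesis using 0 by auto
  next
   case 1
   have "j = 0 & m mod N = N - 1"
   proof (rule ccontr)
    assume n: "\<not> ?thesis"
    have z: "sout N (N - 1) (q ?e) = \<zero>\<^sub>F" if "m mod N ~= N - 1"
     using that N so_e[of "N - 1" m] by (simp add: so_q P0 zF)
    have "sout N j (q ?e) \<ominus>\<^sub>F P (sout N j (q ?e)) = \<zero>\<^sub>F"
     using j cF(6)[OF eF] by (simp add: so_q PP cF FmF P0 zF[symmetric] P0[folded zF])
    moreover have "P (sout N (pr j) (q ?e)) = \<zero>\<^sub>F"
     using n z j N prnx[OF j] by (cases "j = 0") (auto simp: pr_def so_q P0 zF)
    ultimately show False using 1 c j by (simp add: so_g FmF)
   qed
   then show ?thesis using 1 N by (auto simp: of_nat_diff)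
  qed
 qed
 \<comment> \<open>The inverse makes the same steps backwards: copy 0 goes to the last copy with one
   turn removed.\<close>
 have ctl2: "ctl \<epsilon> (%m. real (m mod N) / real N) (D' \<star> G')"
 proof (rule ctlI)
  fix m k j i assume nz: "(D' \<star> G') (iota 0 (unit_vec R m)) (of_int k) (i * N + j) ~= \<zero>" and j: "j < N"
  let ?e = "unit_vec R m"
  let ?w = "g' ?e"
  have c: "?w \<in> cF" "q ?w \<in> cF" "?w \<ominus>\<^sub>F q ?w \<in> cF" using cF gE by auto
  have "(D' \<star> G') (iota 0 ?e) = iota 0 (?w \<ominus>\<^sub>F q ?w) \<oplus>\<^bsub>V\<^esub> iota (- 1) (q ?w)"
   using Tc gE c by (simp add: end_mult_apply D'_def G'_def hat_iota Dact)
  then consider (0) "k = 0" "sout N j (?w \<ominus>\<^sub>F q ?w) ~= \<zero>\<^sub>F" | (1) "k = - 1" "sout N j (q ?w) ~= \<zero>\<^sub>F"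
   using nz c F_apply_R[of "?w \<ominus>\<^sub>F q ?w"] F_apply_R[of "q ?w"]
   by (auto simp: V_simps iota_def sout_def zF fun_eq_iff split: if_splits)
  then show "\<bar>int j + k * int N - int (m mod N)\<bar> \<le> 1"
  proof cases
   case 0
   have "j = m mod N \<or> j + 1 = m mod N"
   proof (rule ccontr)
    assume n: "\<not> ?thesis"
    have w: "sout N j ?w = P (sout N (nx j) ?e)"
     using n j so_e[of j m] cF(6)[OF eF] by (simp add: so_g P0 zF[symmetric] P0[folded zF] FmF cF)
    have "sout N j (?w \<ominus>\<^sub>F q ?w) = \<zero>\<^sub>F"
    proof (cases "j = N - 1")
     case True
     then have "sout N j (?w \<ominus>\<^sub>F q ?w) = sout N j ?w \<ominus>\<^sub>F P (sout N j ?w)"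
      using j c by (simp add: so_m_q)
     then show ?thesis using cF(6)[OF eF] unfolding w by (simp add: PP cF FmF)
    next
     case False
     then have "sout N (nx j) ?e = \<zero>\<^sub>F" using n j so_e[of "nx j" m] prnx[OF j] by (simp add: nx_def zF)
     then show ?thesis using False j c by (simp add: so_m_q w P0[folded zF])
    qed
    then show False using 0 by simp
   qed
   then show ?thesis using 0 by auto
  next
   case 1
   have "j = N - 1 & m mod N = 0"
   proof (rule ccontr)
    assume n: "\<not> ?thesis"
    have "P (sout N (N - 1) ?w) = P (sout N 0 ?e)"
     using N cF(6)[OF eF] lmod_hom_add[of P R F F "sout N (N - 1) ?e \<ominus>\<^sub>F P (sout N (N - 1) ?e)" "P (sout N 0 ?e)"] PE
     by (simp add: so_g nx_def end_ring_carrier[symmetric] cF Pm PP FmF)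
    then have "sout N j (q ?w) = \<zero>\<^sub>F"
     using n j c so_e[of 0 m] N by (auto simp: so_q P0 zF)
    then show False using 1 by simp
   qed
   then show ?thesis using 1 N by (auto simp: of_nat_diff)
  qed
 qed
 have "inv\<^bsub>T\<^esub> (G \<star> D) = D' \<star> G'"
 proof (rule T.inv_char)
  have "G \<star> D \<star> (D' \<star> G') = G \<star> (D \<star> D' \<star> G')" using Tc by (simp add: T.m_assoc)
  then show "G \<star> D \<star> (D' \<star> G') = \<one>\<^sub>T" using Tc by (simp add: DD GG)
  have "D' \<star> G' \<star> (G \<star> D) = D' \<star> (G' \<star> G \<star> D)" using Tc by (simp add: T.m_assoc)
  then show "D' \<star> G' \<star> (G \<star> D) = \<one>\<^sub>T" using Tc by (simp add: DD GG)
 qed (use Tc in auto)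
 then have "G \<star> D \<in> controllable \<epsilon>"
  unfolding controllable_def using ctl1 ctl2 GL_mult[OF GLG(1) GLD(1)]
  by (intro CollectI conjI bexI[of _ "G \<star> D"] exI) auto
 then have D_H: "D \<in> controllable \<epsilon>" using SU.H_cancel_left[OF G_H Tc(4)] by simp
 \<comment> \<open>Written as 1 + p s, the corner unit is open to \<open>H_swap\<close>, which
   carries the idempotent from the last copy back to \<open>P\<close>.\<close>
 define s where "s = tau R 1 \<ominus>\<^sub>T \<one>\<^sub>T"
 have sT: "s \<in> cT" by (simp add: s_def)
 have cs: "f \<star> s = s \<star> f" if "f \<in> cT" for f
  using that tau_central[OF that, of 1] by (simp add: s_def a_minus_def T.r_distr T.l_distr T.r_minus T.l_minus)
 have fs: "x \<star> s \<in> finT" if "x \<in> finT" for x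
  unfolding cs[OF finT_closed[OF that]] by (rule finT_mult[OF sT that])
 have corner: "\<one>\<^sub>T \<ominus>\<^sub>T p \<oplus>\<^sub>T p \<star> tau R 1 = \<one>\<^sub>T \<oplus>\<^sub>T p \<star> s" if "p \<in> cT" for p
  using that by (simp add: s_def a_minus_def T.r_distr T.r_minus T.a_ac)
 let ?P = "hat R P" and ?si = "hat R si" and ?so = "hat R so"
 have PT: "?P \<in> finT" "?P \<in> cT" "?P \<star> ?P = ?P" using hat_finE[OF P(1)] PE P(2) by (auto simp: hat_mult[symmetric])
 have sc: "?si \<in> cT" "?so \<in> cT" using cl by auto
 have so_si: "?so \<star> ?si = \<one>\<^sub>T" using slot_out_in[of N "N - 1" "N - 1"] N by (simp add: si_def so_def)
 have "?P \<star> ?so \<in> finT" unfolding so_def using PT N by (intro finT_slot_out) auto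
 note f = finT_mult[OF sc(1) PT(1)] fs[OF this]
 have "?si \<star> ?P \<star> (?P \<star> ?so \<star> s) = ?si \<star> (?P \<star> ?P) \<star> ?so \<star> s"
  using PT(2) sc sT by (simp add: T.m_assoc)
 then have e1: "?si \<star> ?P \<star> (?P \<star> ?so \<star> s) = Q \<star> s"
  using cl PE PT(3) by (simp add: Q_def q_def hat_mult)
 have "?P \<star> ?so \<star> s \<star> (?si \<star> ?P) = ?P \<star> ?so \<star> (s \<star> (?si \<star> ?P))"
  using PT(2) sc sT by (simp add: T.m_assoc)
 also have "... = ?P \<star> (?so \<star> ?si) \<star> ?P \<star> s"
  unfolding cs[OF T.m_closed[OF sc(1) PT(2)], symmetric] using PT(2) sc sT by (simp add: T.m_assoc)
 finally have e2: "?P \<star> ?so \<star> s \<star> (?si \<star> ?P) = ?P \<star> s"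
  unfolding so_si using PT by simp
 have "\<one>\<^sub>T \<oplus>\<^sub>T ?P \<star> s \<in> controllable \<epsilon>"
  using SU.H_swap[OF f] D_H unfolding D_def corner[OF Tc(3)] e1 e2 by simp
 then show ?thesis unfolding corner[OF PT(2)] .
qed

end

section \<open>Projective resolutions and covers inside the free module of countable rank\<close>

section \<open>Finite projective resolutions\<close>

context stable_setting
begin

definition lin :: "('a, 'm) module => nat => (nat => 'm) => (nat => 'a) => 'm" where
 "lin M n b = (\<lambda>u\<in>cF. \<Oplus>\<^bsub>M\<^esub>j\<in>{..<n}. u j \<odot>\<^bsub>M\<^esub> b j)"

lemma lin_hom:
 assumes M: "left_module R M" and b: "!!j. j < n ==> b j \<in> carrier M"
 shows "lin M n b \<in> lmod_hom R F M"
proof -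
 interpret M: left_module R M by (rule M)
 have c: "u j \<odot>\<^bsub>M\<^esub> b j \<in> carrier M" if "u \<in> cF" "j \<in> {..<n}" for u j
  using that b F_apply_R by (auto intro: M.smult_closed)
 show ?thesis
 proof (rule lmod_homI)
  fix u w assume uw: "u \<in> cF" "w \<in> cF"
  have "(\<Oplus>\<^bsub>M\<^esub>j\<in>{..<n}. (u \<oplus>\<^sub>F w) j \<odot>\<^bsub>M\<^esub> b j) = (\<Oplus>\<^bsub>M\<^esub>j\<in>{..<n}. u j \<odot>\<^bsub>M\<^esub> b j \<oplus>\<^bsub>M\<^esub> w j \<odot>\<^bsub>M\<^esub> b j)"
   by (rule M.M.finsum_cong') (use uw b c in "auto simp: free_on_simps M.smult_l_distr F_apply_R")
  also have "... = (\<Oplus>\<^bsub>M\<^esub>j\<in>{..<n}. u j \<odot>\<^bsub>M\<^esub> b j) \<oplus>\<^bsub>M\<^esub> (\<Oplus>\<^bsub>M\<^esub>j\<in>{..<n}. w j \<odot>\<^bsub>M\<^esub> b j)"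
   by (rule M.M.finsum_addf) (use uw c in auto)
  finally show "lin M n b (u \<oplus>\<^sub>F w) = lin M n b u \<oplus>\<^bsub>M\<^esub> lin M n b w" using uw by (simp add: lin_def)
 next
  fix a u assume au: "a \<in> carrier R" "u \<in> cF"
  have "a \<odot>\<^bsub>M\<^esub> (\<Oplus>\<^bsub>M\<^esub>j\<in>{..<n}. u j \<odot>\<^bsub>M\<^esub> b j) = (\<Oplus>\<^bsub>M\<^esub>j\<in>{..<n}. a \<odot>\<^bsub>M\<^esub> (u j \<odot>\<^bsub>M\<^esub> b j))"
   by (rule M.smult_finsum_right) (use au c in auto)
  also have "... = (\<Oplus>\<^bsub>M\<^esub>j\<in>{..<n}. (a \<odot>\<^sub>F u) j \<odot>\<^bsub>M\<^esub> b j)"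
   by (rule M.M.finsum_cong') (use au b c[OF FM.smult_closed[OF au]] in "auto simp: free_on_simps M.smult_assoc F_apply_R")
  finally show "lin M n b (a \<odot>\<^sub>F u) = a \<odot>\<^bsub>M\<^esub> lin M n b u" using au by (simp add: lin_def FM.smult_closed)
 qed (use c in "auto simp: lin_def intro!: M.M.finsum_closed")
qed

lemma lin_unit:
 assumes M: "left_module R M" and b: "!!j. j < n ==> b j \<in> carrier M"
 shows "lin M n b (unit_vec R i) = (if i < n then b i else \<zero>\<^bsub>M\<^esub>)"
proof -
 interpret M: left_module R M by (rule M)
 have "lin M n b (unit_vec R i) = (\<Oplus>\<^bsub>M\<^esub>j\<in>{..<n}. if j = i then b i else \<zero>\<^bsub>M\<^esub>)"
  using b by (simp add: lin_def) (rule M.M.finsum_cong', auto simp: unit_vec_def M.smult_one)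
 also have "... = (if i < n then b i else \<zero>\<^bsub>M\<^esub>)"
 proof (cases "i < n")
  case True
  then show ?thesis using b by (subst M.M.finsum_eq_term[of _ i]) auto
 next
  case False
  then have "(\<Oplus>\<^bsub>M\<^esub>j\<in>{..<n}. if j = i then b i else \<zero>\<^bsub>M\<^esub>) = (\<Oplus>\<^bsub>M\<^esub>j\<in>{..<n}. \<zero>\<^bsub>M\<^esub>)"
   by (intro M.M.finsum_cong') auto
  then show ?thesis using False by (simp add: M.M.finsum_zero)
 qed
 finally show ?thesis .
qed

lemma proj_unit: "proj n (unit_vec R i) = (if i < n then unit_vec R i else \<zero>\<^sub>F)"
 unfolding proj_apply[OF unit_vec_F] by (auto simp: unit_vec_def free_on_simps fun_eq_iff)

text \<open>\<open>F\<close> is free, so preimages of the values on unit vectors define a lift of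
  \<open>\<theta>\<close>. Nonzero values are prescribed on the first \<open>n\<close> unit vectors
  only; this is enough on the image of the finitary idempotent \<open>e\<close>, and composing with
  \<open>e\<close> reduces to that image.\<close>

lemma lift_hom:
 assumes Y: "left_module R Y" and W: "submod R F W" and \<gamma>: "\<gamma> \<in> lmod_hom R (F\<lparr>carrier := W\<rparr>) Y"
  and \<theta>: "\<theta> \<in> lmod_hom R F Y" "!!u. u \<in> cF ==> \<theta> u \<in> \<gamma> ` W"
  and e: "e \<in> finE" "e \<bullet> e = e" "!!u. u \<in> cF ==> \<theta> (e u) = \<theta> u"
 shows "\<exists>l. l \<in> cE & l \<bullet> e = l & (\<forall>u\<in>cF. l u \<in> W) & (\<forall>u\<in>cF. \<gamma> (l u) = \<theta> u)"
proof -
 have eE: "e \<in> cE" by (rule finE_closed[OF e(1)])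
 obtain n where n: "proj n \<bullet> e = e" using e(1) by (auto simp: finE_def)
 have "\<exists>w. w \<in> W & \<gamma> w = \<theta> (unit_vec R i)" for i using \<theta>(2)[of "unit_vec R i"] by auto
 then obtain w where w: "w i \<in> W" "\<gamma> (w i) = \<theta> (unit_vec R i)" for i by metis
 note WF = submod_subset[OF W, THEN subsetD]
 define l where "l = lin F n w"
 have lh: "l \<in> lmod_hom R F F" unfolding l_def by (rule lin_hom[OF FM.is_left_module]) (use w WF in auto)
 then have lE: "l \<in> cE" by (simp add: end_ring_carrier)
 have lW: "l u \<in> W" if "u \<in> cF" for u
  unfolding l_def lin_def using that F_apply_R[OF that]
  by (simp, intro finsum_submod(2)[OF FM.is_left_module W] submod_smult[OF W]) (auto simp: w)
 have lh': "l \<in> lmod_hom R F (F\<lparr>carrier := W\<rparr>)"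
  by (rule lmod_homI) (use lW lmod_hom_undefined[OF lh] lmod_hom_add[OF lh] lmod_hom_smult[OF lh] in auto)
 have ph: "proj n \<in> lmod_hom R F F" using proj_closed by (simp add: end_ring_carrier)
 note WM = left_module_submod[OF FM.is_left_module W]
 have eq: "compose (cF) \<gamma> l = compose (cF) \<theta> (proj n)"
 proof (rule F_hom_eqI[OF Y])
  fix i
  have "\<gamma> \<zero>\<^sub>F = \<zero>\<^bsub>Y\<^esub>" using lmod_hom_zero[OF WM Y \<gamma>] by simp
  moreover have "l (unit_vec R i) = (if i < n then w i else \<zero>\<^sub>F)"
   unfolding l_def by (rule lin_unit[OF FM.is_left_module]) (use w WF in auto)
  ultimately show "compose (cF) \<gamma> l (unit_vec R i) = compose (cF) \<theta> (proj n) (unit_vec R i)"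
   using w lmod_hom_zero[OF FM.is_left_module Y \<theta>(1)] by (simp add: compose_def proj_unit)
 qed (rule lmod_hom_compose[OF FM.is_left_module] lh' ph \<gamma> \<theta>(1))+
 have g: "\<gamma> (l (e u)) = \<theta> u" if u: "u \<in> cF" for u
 proof -
  have eu: "e u \<in> cF" using u eE by simp
  have "\<gamma> (l (e u)) = \<theta> (proj n (e u))" using fun_cong[OF eq, of "e u"] eu by (simp add: compose_def)
  also have "proj n (e u) = e u" using n end_mult_apply[OF u, of R "proj n" e] by simp
  finally show ?thesis using e(3)[OF u] by simp
 qed
 show ?thesis
  by (rule exI[of _ "l \<bullet> e"]) (use lE eE e(2) lW g in "auto simp: E.m_assoc end_mult_apply")
qed

lemma fg_cover:
 assumes Q: "fg_module R Q"
 obtains n p where "p \<in> lmod_hom R F Q" "p ` cF = carrier Q" "\<forall>i\<ge>n. p (unit_vec R i) = \<zero>\<^bsub>Q\<^esub>"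
proof -
 have M: "left_module R Q" using Q by (simp add: fg_module_def)
 interpret Q: left_module R Q by (rule M)
 obtain B where B: "finite B" "B \<subseteq> carrier Q" "!!m. m \<in> carrier Q ==> \<exists>c\<in>B \<rightarrow>\<^sub>E carrier R. m = (\<Oplus>\<^bsub>Q\<^esub>b\<in>B. c b \<odot>\<^bsub>Q\<^esub> b)"
  using Q by (auto simp: fg_module_def)
 obtain h where h: "bij_betw h {..<card B} B" using ex_bij_betw_nat_finite[OF B(1)] by (auto simp: atLeast0LessThan)
 define p where "p = lin Q (card B) h"
 have hB: "h j \<in> carrier Q" "h j \<in> B" if "j < card B" for j using h B(2) that by (auto simp: bij_betw_def)
 have ph: "p \<in> lmod_hom R F Q" unfolding p_def by (rule lin_hom[OF M]) (use hB in auto)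
 have pu: "p (unit_vec R i) = \<zero>\<^bsub>Q\<^esub>" if "i \<ge> card B" for i
  using lin_unit[OF M, of "card B" h i] hB that by (simp add: p_def)
 have "m \<in> p ` cF" if m: "m \<in> carrier Q" for m
 proof -
  obtain c where c: "c \<in> B \<rightarrow>\<^sub>E carrier R" "m = (\<Oplus>\<^bsub>Q\<^esub>b\<in>B. c b \<odot>\<^bsub>Q\<^esub> b)" using B(3)[OF m] by blast
  define u where "u = (%j. if j < card B then c (h j) else \<zero>)"
  have uF: "u \<in> cF"
   using c(1) hB(2) by (auto simp: free_on_carrier u_def intro: finite_subset[of _ "{..<card B}"])
  have "m = (\<Oplus>\<^bsub>Q\<^esub>b\<in>h ` {..<card B}. c b \<odot>\<^bsub>Q\<^esub> b)" using c(2) h by (simp add: bij_betw_def)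
  also have "... = (\<Oplus>\<^bsub>Q\<^esub>j\<in>{..<card B}. c (h j) \<odot>\<^bsub>Q\<^esub> h j)"
   by (rule Q.M.finsum_reindex) (use c(1) hB h B(2) in "auto simp: bij_betw_def intro!: Q.smult_closed")
  also have "... = (\<Oplus>\<^bsub>Q\<^esub>j\<in>{..<card B}. u j \<odot>\<^bsub>Q\<^esub> h j)"
   by (rule Q.M.finsum_cong') (use c(1) hB in "auto simp: u_def intro!: Q.smult_closed")
  also have "... = p u" using uF by (simp add: p_def lin_def)
  finally show ?thesis using uF by blast
 qed
 then show ?thesis
  using that[of p "card B"] ph lmod_hom_closed[OF ph] pu by auto
qed

primrec pres :: "nat => ('a, nat => 'a) module => bool" where
 "pres 0 G \<longleftrightarrow> left_module R G & carrier G = {\<zero>\<^bsub>G\<^esub>}"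
| "pres (Suc d) G \<longleftrightarrow> left_module R G & (carrier G = {\<zero>\<^bsub>G\<^esub>} \<or> (\<exists>Q q. fg_module R Q & projective_module R Q \<and>
   q \<in> lmod_hom R Q G & q ` carrier Q = carrier G & pres d (Q\<lparr>carrier := {x \<in> carrier Q. q x = \<zero>\<^bsub>G\<^esub>}\<rparr>)))"

lemma pres_module: "pres d G ==> left_module R G"
 by (cases d) auto

lemma pres_trivial: "left_module R G ==> carrier G = {\<zero>\<^bsub>G\<^esub>} ==> pres d G"
 by (cases d) auto

lemma pres_mono: "pres d G ==> d \<le> d' ==> pres d' G"
proof (induction d arbitrary: d' G)
 case 0
 then show ?case by (auto intro: pres_trivial)
next
 case (Suc d)
 obtain m where m: "d' = Suc m" "d \<le> m" using Suc.prems(2) by (cases d') auto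
 show ?case using Suc.prems(1) Suc.IH[OF _ m(2)] unfolding m(1) pres.simps by blast
qed

text \<open>The kernels of the differentials satisfy the recursion, beginning with the last one,
  which is zero by injectivity.\<close>

lemma resolution_pres:
 assumes M: "left_module R M" and res: "has_finite_projective_resolution R M"
 shows "\<exists>d. pres d M"
 using res unfolding has_finite_projective_resolution_def
proof (elim exE)
 fix n :: nat and Q d
 assume res: "Q 0 = M & (\<forall>i\<le>n. fg_module R (Q (Suc i)) & projective_module R (Q (Suc i))) \<and>
   (\<forall>i\<le>n. d i \<in> lmod_hom R (Q (Suc i)) (Q i)) & d 0 ` carrier (Q 1) = carrier M \<and>
   (\<forall>i<n. d (Suc i) ` carrier (Q (Suc (Suc i))) = {x \<in> carrier (Q (Suc i)). d i x = \<zero>\<^bsub>Q i\<^esub>}) \<and>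
   inj_on (d n) (carrier (Q (Suc n)))"
 have Q: "Q 0 = M" "!!i. i \<le> n ==> fg_module R (Q (Suc i)) & projective_module R (Q (Suc i))"
  "!!i. i \<le> n ==> d i \<in> lmod_hom R (Q (Suc i)) (Q i)" "d 0 ` carrier (Q 1) = carrier M"
  "!!i. i < n ==> d (Suc i) ` carrier (Q (Suc (Suc i))) = {x \<in> carrier (Q (Suc i)). d i x = \<zero>\<^bsub>Q i\<^esub>}"
  "inj_on (d n) (carrier (Q (Suc n)))"
  using res by simp_all
 define K where "K i = {x \<in> carrier (Q (Suc i)). d i x = \<zero>\<^bsub>Q i\<^esub>}" for i
 have lm: "left_module R (Q i)" if "i \<le> Suc n" for i
  using that Q(1) M Q(2)[of "i - 1"] by (cases i) (auto simp: fg_module_def)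
 have sub: "submod R (Q (Suc i)) (K i)" if "i \<le> n" for i
  unfolding K_def by (rule submod_kernel[OF lm lm Q(3)]) (use that in auto)
 note KM = left_module_submod[OF lm sub]
 have "pres j (Q (Suc (n - j))\<lparr>carrier := K (n - j)\<rparr>)" if "j \<le> n" for j
  using that
 proof (induction j)
  case 0
  have "x = \<zero>\<^bsub>Q (Suc n)\<^esub>" if "x \<in> K n" for x
  proof (rule inj_onD[OF Q(6)])
   show "d n x = d n \<zero>\<^bsub>Q (Suc n)\<^esub>" using that lmod_hom_zero[OF lm lm Q(3), of n] by (simp add: K_def)
  qed (use that submod_zero[OF sub, of n] in "simp_all add: K_def")
  then have "K n = {\<zero>\<^bsub>Q (Suc n)\<^esub>}" using submod_zero[OF sub[OF le_refl]] by blast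
  then show ?case using KM[of n] by simp
 next
  case (Suc j)
  define i where "i = n - Suc j"
  have i: "n - j = Suc i" "i < n" using Suc.prems by (auto simp: i_def)
  have h: "d (Suc i) \<in> lmod_hom R (Q (Suc (Suc i))) (Q (Suc i)\<lparr>carrier := K i\<rparr>)"
   using Q(3)[of "Suc i"] Q(5)[of i] i(2) by (auto simp: lmod_hom_def K_def)
  have "pres (Suc j) (Q (Suc i)\<lparr>carrier := K i\<rparr>)"
   unfolding pres.simps
   using KM[of i] Q(2)[of "Suc i"] h Q(5)[of i] Suc.IH Suc.prems i
   by (intro conjI disjI2 exI[of _ "Q (Suc (Suc i))"] exI[of _ "d (Suc i)"]) (auto simp: K_def)
  then show ?case by (simp add: i_def)
 qed
 from this[of n] have "pres (Suc n) M"
  unfolding pres.simps using Q(2,3)[of 0] Q(1,4) M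
  by (intro conjI disjI2 exI[of _ "Q 1"] exI[of _ "d 0"]) (auto simp: K_def)
 then show ?thesis by blast
qed

text \<open>A finitely generated projective module is a retract of \<open>F\<close>. The idempotent
  \<open>e\<close> takes its place, so that all covers live in one ring; the statements about
  \<open>\<pi>\<close> identify the kernel of the cover with \<open>G'\<close>.\<close>

lemma pres_cover:
 assumes "pres (Suc d) G"
 obtains e \<rho> G' \<pi> where "e \<in> finE" "e \<bullet> e = e" "\<rho> \<in> lmod_hom R F G" "\<forall>u\<in>cF. \<rho> (e u) = \<rho> u"
  "\<rho> ` cF = carrier G" "pres d G'"
  "\<pi> \<in> lmod_hom R (F\<lparr>carrier := {u \<in> cF. e u = u & \<rho> u = \<zero>\<^bsub>G\<^esub>}\<rparr>) G'"
  "\<pi> ` {u \<in> cF. e u = u & \<rho> u = \<zero>\<^bsub>G\<^esub>} = carrier G'"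
  "\<forall>u\<in>cF. e u = u \<longrightarrow> \<rho> u = \<zero>\<^bsub>G\<^esub> \<longrightarrow> \<pi> u = \<zero>\<^bsub>G'\<^esub> \<longrightarrow> u = \<zero>\<^sub>F"
proof -
 have G: "left_module R G" by (rule pres_module[OF assms])
 interpret G: left_module R G by (rule G)
 from assms consider (triv) "carrier G = {\<zero>\<^bsub>G\<^esub>}"
  | (proj) Q q where "fg_module R Q" "projective_module R Q" "q \<in> lmod_hom R Q G" "q ` carrier Q = carrier G"
   "pres d (Q\<lparr>carrier := {x \<in> carrier Q. q x = \<zero>\<^bsub>G\<^esub>}\<rparr>)"
  by auto
 then show ?thesis
 proof cases
  case triv
  have e: "\<zero>\<^sub>E \<in> finE" by (rule finEI[of _ 0]) auto
  have h: "(\<lambda>u\<in>cF. \<zero>\<^bsub>G\<^esub>) \<in> lmod_hom R F G" by (rule lmod_hom_zero_map[OF FM.is_left_module G])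
  have s: "{u \<in> cF. \<zero>\<^sub>E u = u & (\<lambda>u\<in>cF. \<zero>\<^bsub>G\<^esub>) u = \<zero>\<^bsub>G\<^esub>} = {\<zero>\<^sub>F}"
   by (auto simp: end_zero_apply cong: conj_cong)
  show ?thesis
  proof (rule that[of "\<zero>\<^sub>E" "\<lambda>u\<in>cF. \<zero>\<^bsub>G\<^esub>" G "\<lambda>u\<in>{\<zero>\<^sub>F}. \<zero>\<^bsub>G\<^esub>", OF e _ h], unfold s)
   show "pres d G" by (rule pres_trivial[OF G triv])
   show "(\<lambda>u\<in>{\<zero>\<^sub>F}. \<zero>\<^bsub>G\<^esub>) \<in> lmod_hom R (F\<lparr>carrier := {\<zero>\<^sub>F}\<rparr>) G" by (rule lmod_homI) auto
  qed (use triv in "auto simp: end_zero_apply")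
 next
  case proj
  have Q: "left_module R Q" using proj(1) by (simp add: fg_module_def)
  interpret Q: left_module R Q by (rule Q)
  obtain n p where p: "p \<in> lmod_hom R F Q" "p ` cF = carrier Q" "\<forall>i\<ge>n. p (unit_vec R i) = \<zero>\<^bsub>Q\<^esub>"
   by (rule fg_cover[OF proj(1)], rule that)
  obtain j where j: "j \<in> lmod_hom R Q F" "!!x. x \<in> carrier Q ==> p (j x) = x"
  proof -
   have "\<exists>g\<in>lmod_hom R Q F. \<forall>x\<in>carrier Q. p (g x) = (\<lambda>x\<in>carrier Q. x) x"
    using proj(2)[unfolded projective_module_def, THEN conjunct2, rule_format, of F Q p "\<lambda>x\<in>carrier Q. x"]
     FM.is_left_module Q p(1,2) lmod_hom_id[OF Q] by simp
   then obtain g where "g \<in> lmod_hom R Q F" "\<forall>x\<in>carrier Q. p (g x) = (\<lambda>x\<in>carrier Q. x) x" by (rule bexE)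
   then show ?thesis by (intro that[of g]) simp_all
  qed
  define e where "e = compose (cF) j p"
  have eE: "e \<in> cE" unfolding e_def end_ring_carrier by (rule lmod_hom_compose[OF FM.is_left_module p(1) j(1)])
  have e: "e u = j (p u)" if "u \<in> cF" for u using that by (simp add: e_def compose_def)
  note pc = lmod_hom_closed[OF p(1)] lmod_hom_closed[OF j(1)] lmod_hom_closed[OF proj(3)]
  have "e \<bullet> proj n = e"
  proof (rule E_eqI)
   fix i
   show "(e \<bullet> proj n) (unit_vec R i) = e (unit_vec R i)"
    using p(3) by (simp add: end_mult_apply proj_unit e lmod_hom_zero[OF FM.is_left_module Q p(1)])
  qed (use eE in auto)
  then have fin: "e \<in> finE" by (rule finEI[OF eE])
  define \<rho> where "\<rho> = compose (cF) q p"
  have \<rho>h: "\<rho> \<in> lmod_hom R F G" unfolding \<rho>_def by (rule lmod_hom_compose[OF FM.is_left_module p(1) proj(3)])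
  have \<rho>: "\<rho> u = q (p u)" if "u \<in> cF" for u using that by (simp add: \<rho>_def compose_def)
  let ?K = "{u \<in> cF. e u = u & \<rho> u = \<zero>\<^bsub>G\<^esub>}"
  let ?G' = "Q\<lparr>carrier := {x \<in> carrier Q. q x = \<zero>\<^bsub>G\<^esub>}\<rparr>"
  have img: "p ` ?K = carrier ?G'"
  proof
   show "p ` ?K \<subseteq> carrier ?G'" using pc \<rho> by auto
   show "carrier ?G' \<subseteq> p ` ?K"
   proof
    fix x assume "x \<in> carrier ?G'"
    then show "x \<in> p ` ?K" using pc j(2) e \<rho> by (intro image_eqI[of _ _ "j x"]) auto
   qed
  qed
  have sub: "submod R F ?K"
  proof (rule submodI)
   show "\<zero>\<^sub>F \<in> ?K" using eE \<rho>h lmod_hom_zero[OF FM.is_left_module G \<rho>h] lmod_hom_zero[OF FM.is_left_module FM.is_left_module, of e]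
    by (simp add: end_ring_carrier)
   fix u w assume "u \<in> ?K" "w \<in> ?K"
   then show "u \<oplus>\<^sub>F w \<in> ?K" using eE lmod_hom_add[of e R F F u w] lmod_hom_add[OF \<rho>h, of u w] by (simp add: end_ring_carrier)
  next
   fix a u assume "a \<in> carrier R" "u \<in> ?K"
   then show "a \<odot>\<^sub>F u \<in> ?K" using eE lmod_hom_smult[of e R F F a u] lmod_hom_smult[OF \<rho>h, of a u]
    by (simp add: end_ring_carrier FM.smult_closed)
  qed auto
  have rh: "restrict p ?K \<in> lmod_hom R (F\<lparr>carrier := ?K\<rparr>) ?G'"
  proof (rule lmod_homI)
   fix u assume "u \<in> carrier (F\<lparr>carrier := ?K\<rparr>)"
   then have "p u \<in> p ` ?K" "restrict p ?K u = p u" by auto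
   then show "restrict p ?K u \<in> carrier ?G'" by (simp only: img)
  next
   fix u w assume a: "u \<in> carrier (F\<lparr>carrier := ?K\<rparr>)" "w \<in> carrier (F\<lparr>carrier := ?K\<rparr>)"
   then have "u \<oplus>\<^sub>F w \<in> ?K" using submod_add[OF sub] by simp
   then show "restrict p ?K (u \<oplus>\<^bsub>F\<lparr>carrier := ?K\<rparr>\<^esub> w) = restrict p ?K u \<oplus>\<^bsub>?G'\<^esub> restrict p ?K w"
    using a lmod_hom_add[OF p(1), of u w] by simp
  next
   fix a u assume a: "a \<in> carrier R" "u \<in> carrier (F\<lparr>carrier := ?K\<rparr>)"
   then have "a \<odot>\<^sub>F u \<in> ?K" using submod_smult[OF sub] by simp
   then show "restrict p ?K (a \<odot>\<^bsub>F\<lparr>carrier := ?K\<rparr>\<^esub> u) = a \<odot>\<^bsub>?G'\<^esub> restrict p ?K u"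
    using a lmod_hom_smult[OF p(1), of a u] by simp
  qed auto
  show ?thesis
  proof (rule that[OF fin _ \<rho>h _ _ proj(5) rh])
   show "e \<bullet> e = e" by (rule FM.end_eqI) (use eE e pc j(2) in "auto simp: end_mult_apply")
   show "\<forall>u\<in>cF. \<rho> (e u) = \<rho> u" using e \<rho> pc j(2) by simp
   have "\<rho> ` cF = q ` p ` cF" unfolding image_image by (rule image_cong) (auto simp: \<rho>)
   then show "\<rho> ` cF = carrier G" by (simp add: p(2) proj(4))
   show "restrict p ?K ` ?K = carrier ?G'" using img by simp
   have "u = \<zero>\<^sub>F" if u: "u \<in> cF" "e u = u" "\<rho> u = \<zero>\<^bsub>G\<^esub>" "restrict p ?K u = \<zero>\<^bsub>?G'\<^esub>" for u
   proof -
    have "u = j (p u)" "p u = \<zero>\<^bsub>Q\<^esub>" using u e by auto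
    then show ?thesis using lmod_hom_zero[OF Q FM.is_left_module j(1)] by metis
   qed
   then show "\<forall>u\<in>cF. e u = u \<longrightarrow> \<rho> u = \<zero>\<^bsub>G\<^esub> \<longrightarrow> restrict p ?K u = \<zero>\<^bsub>?G'\<^esub> \<longrightarrow> u = \<zero>\<^sub>F" by blast
  qed
 qed
qed

text \<open>Induction on the rank: the values of the last coordinate form a left ideal, and
  subtracting a combination of lifts of its generators leaves one coordinate less. Generation is
  phrased through submodules containing \<open>B\<close>, which avoids merging the coefficients of
  two generating sets.\<close>

lemma noetherian_submod:
 assumes N: "left_noetherian R" and W: "submod R F W" "W \<subseteq> carrier (free_on R {..<n})"
 shows "fg_module R (F\<lparr>carrier := W\<rparr>)"
proof -
 have "\<exists>B. finite B & B \<subseteq> W & (\<forall>W'. submod R F W' & B \<subseteq> W' \<longrightarrow> W \<subseteq> W')"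
  using W
 proof (induction n arbitrary: W)
  case 0
  then have "u = \<zero>\<^sub>F" if "u \<in> W" for u
   using that by (auto simp: free_on_carrier free_on_simps fun_eq_iff dest!: subsetD)
  then have "W \<subseteq> {\<zero>\<^sub>F}" by blast
  then show ?case using submod_zero by (intro exI[of _ "{}"]) blast
 next
  case (Suc n)
  note WF = submod_subset[OF Suc.prems(1), THEN subsetD]
  define I where "I = (%u. u n) ` W"
  interpret RR: left_module R "regular_module R" by (rule left_module_regular)
  have subI: "submod R (regular_module R) I"
  proof (rule submodI)
   show "I \<subseteq> carrier (regular_module R)" using WF F_apply_R by (auto simp: I_def regular_module_def)
   show "\<zero>\<^bsub>regular_module R\<^esub> \<in> I" using submod_zero[OF Suc.prems(1)] by (auto simp: I_def regular_module_def free_on_simps)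
  next
   fix x y assume "x \<in> I" "y \<in> I"
   then obtain u w where uw: "u \<in> W" "w \<in> W" "x = u n" "y = w n" by (auto simp: I_def)
   then have "(u \<oplus>\<^sub>F w) n \<in> I" unfolding I_def using submod_add[OF Suc.prems(1)] by blast
   then show "x \<oplus>\<^bsub>regular_module R\<^esub> y \<in> I" using uw by (simp add: regular_module_def free_on_simps)
  next
   fix a x assume a: "a \<in> carrier R" and "x \<in> I"
   then obtain u where u: "u \<in> W" "x = u n" by (auto simp: I_def)
   then have "(a \<odot>\<^sub>F u) n \<in> I" unfolding I_def using submod_smult[OF Suc.prems(1) a] by blast
   then show "a \<odot>\<^bsub>regular_module R\<^esub> x \<in> I" using u by (simp add: regular_module_def free_on_simps)
  qed
  have IR: "I \<subseteq> carrier R" using submod_subset[OF subI] by (simp add: regular_module_def)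
  have "fg_module R ((regular_module R)\<lparr>carrier := I\<rparr>)"
   using N IR left_module_submod[OF RR.is_left_module subI] unfolding left_noetherian_def by blast
  then obtain B0 where B0: "finite B0" "B0 \<subseteq> I"
   "!!x. x \<in> I ==> \<exists>c\<in>B0 \<rightarrow>\<^sub>E carrier R. x = (\<Oplus>\<^bsub>(regular_module R)\<lparr>carrier := I\<rparr>\<^esub>b\<in>B0. c b \<odot>\<^bsub>regular_module R\<^esub> b)"
   by (auto simp: fg_module_def)
  have "\<forall>b\<in>B0. \<exists>u. u \<in> W & u n = b" using B0(2) by (auto simp: I_def)
  then obtain w where w: "!!b. b \<in> B0 ==> w b \<in> W & w b n = b" by metis
  define W0 where "W0 = {u \<in> W. u n = \<zero>}"
  have "submod R F W0"
   using Suc.prems(1) unfolding submod_def W0_def by (auto simp: free_on_simps)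
  moreover have "W0 \<subseteq> carrier (free_on R {..<n})"
  proof
   fix u assume u: "u \<in> W0"
   then have "u \<in> carrier (free_on R {..<Suc n})" "u n = \<zero>" using Suc.prems(2) by (auto simp: W0_def)
   then show "u \<in> carrier (free_on R {..<n})" by (auto simp: free_on_carrier less_Suc_eq)
  qed
  ultimately have "\<exists>B. finite B & B \<subseteq> W0 & (\<forall>W'. submod R F W' & B \<subseteq> W' \<longrightarrow> W0 \<subseteq> W')" by (rule Suc.IH)
  then obtain B1 where "finite B1 & B1 \<subseteq> W0 & (\<forall>W'. submod R F W' & B1 \<subseteq> W' \<longrightarrow> W0 \<subseteq> W')" by (rule exE)
  then have B1: "finite B1" "B1 \<subseteq> W0" "!!W'. submod R F W' ==> B1 \<subseteq> W' ==> W0 \<subseteq> W'" by simp_all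
  show ?case
  proof (intro exI[of _ "w ` B0 \<union> B1"] conjI allI impI subsetI)
   fix W' u assume W': "submod R F W' & w ` B0 \<union> B1 \<subseteq> W'" and u: "u \<in> W"
   obtain c where c: "c \<in> B0 \<rightarrow>\<^sub>E carrier R" "u n = (\<Oplus>\<^bsub>(regular_module R)\<lparr>carrier := I\<rparr>\<^esub>b\<in>B0. c b \<odot>\<^bsub>regular_module R\<^esub> b)"
    using B0(3)[of "u n"] u by (auto simp: I_def)
   have cb: "c b \<in> carrier R" if "b \<in> B0" for b using c(1) that by auto
   \<comment> \<open>A combination of the chosen lifts with the same last coordinate as
     \<open>u\<close>.\<close>
   define v where "v = (\<Oplus>\<^bsub>F\<^esub>b\<in>B0. c b \<odot>\<^sub>F w b)"
   have vW: "v \<in> W" unfolding v_def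
    by (rule finsum_submod(2)[OF FM.is_left_module Suc.prems(1)]) (use w cb submod_smult[OF Suc.prems(1)] in auto)
   have vW': "v \<in> W'" unfolding v_def
    by (rule finsum_submod(2)[OF FM.is_left_module conjunct1[OF W']], rule submod_smult[OF conjunct1[OF W']])
     (use cb W' in auto)
   have "u n = (\<Oplus>b\<in>B0. c b \<otimes> b)"
    using c(2) finsum_submod(1)[OF RR.is_left_module subI, of B0 "%b. c b \<odot>\<^bsub>regular_module R\<^esub> b"]
     submod_smult[OF subI cb] B0(2) by (simp add: subset_iff) (simp add: regular_module_def finsum_def finprod_def)
   moreover have "v n = (\<Oplus>b\<in>B0. (c b \<odot>\<^sub>F w b) n)"
    unfolding v_def by (rule free_on_finsum_apply) (use w cb WF FM.smult_closed in auto)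
   moreover have "(\<Oplus>b\<in>B0. (c b \<odot>\<^sub>F w b) n) = (\<Oplus>b\<in>B0. c b \<otimes> b)"
    by (rule finsum_cong') (use w cb B0(2) IR in "auto simp: free_on_simps")
   ultimately have un: "u n = v n" by simp
   have mv: "\<ominus>\<^sub>F v \<in> W" by (rule submod_uminus[OF FM.is_left_module Suc.prems(1) vW])
   have "(v \<oplus>\<^sub>F (\<ominus>\<^sub>F v)) n = \<zero>" using WF[OF vW] by (simp add: FM.M.r_neg) (simp add: free_on_simps)
   then have "u \<oplus>\<^sub>F (\<ominus>\<^sub>F v) \<in> W0" using submod_add[OF Suc.prems(1) u mv] un by (simp add: W0_def free_on_simps)
   then have "u \<oplus>\<^sub>F (\<ominus>\<^sub>F v) \<in> W'" using B1(3)[of W'] W' by auto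
   then have "(u \<oplus>\<^sub>F (\<ominus>\<^sub>F v)) \<oplus>\<^sub>F v \<in> W'" using submod_add[of R F W'] vW' W' by blast
   then show "u \<in> W'" using WF[OF u] WF[OF vW] by (simp add: FM.M.a_assoc FM.M.l_neg)
  next
   fix u assume "u \<in> w ` B0 \<union> B1"
   then show "u \<in> W" using w B1(2) by (auto simp: W0_def)
  qed (use B0(1) B1(1) in auto)
 qed
 then obtain B where "finite B & B \<subseteq> W & (\<forall>W'. submod R F W' & B \<subseteq> W' \<longrightarrow> W \<subseteq> W')" by (rule exE)
 then have B: "finite B" "B \<subseteq> W" "!!W'. submod R F W' ==> B \<subseteq> W' ==> W \<subseteq> W'" by simp_all
 note WF = submod_subset[OF W(1), THEN subsetD]
 have BF: "b \<in> cF" if "b \<in> B" for b using that B(2) WF by auto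
 \<comment> \<open>The span of \<open>B\<close> in terms of explicit combinations, which is the form
   that \<open>fg_module\<close> asks for.\<close>
 define W' where "W' = {\<Oplus>\<^bsub>F\<^esub>b\<in>B. c b \<odot>\<^sub>F b |c. c \<in> B \<rightarrow> carrier R}"
 have cl: "c b \<odot>\<^sub>F b \<in> cF" if "c \<in> B \<rightarrow> carrier R" "b \<in> B" for c b
  using that BF by (auto intro: FM.smult_closed)
 have "submod R F W'"
 proof (rule submodI)
  show "W' \<subseteq> cF" using cl by (auto simp: W'_def intro!: FM.M.finsum_closed)
  have "(\<Oplus>\<^bsub>F\<^esub>b\<in>B. \<zero> \<odot>\<^sub>F b) = (\<Oplus>\<^bsub>F\<^esub>b\<in>B. \<zero>\<^sub>F)" by (rule FM.M.finsum_cong') (use BF in auto)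
  then show "\<zero>\<^sub>F \<in> W'" unfolding W'_def by (intro CollectI exI[of _ "%_. \<zero>"]) (auto simp: FM.M.finsum_zero)
 next
  fix x y assume "x \<in> W'" "y \<in> W'"
  then obtain c c' where c: "c \<in> B \<rightarrow> carrier R" "c' \<in> B \<rightarrow> carrier R" "x = (\<Oplus>\<^bsub>F\<^esub>b\<in>B. c b \<odot>\<^sub>F b)" "y = (\<Oplus>\<^bsub>F\<^esub>b\<in>B. c' b \<odot>\<^sub>F b)"
   by (auto simp: W'_def)
  have "(\<Oplus>\<^bsub>F\<^esub>b\<in>B. (c b \<oplus> c' b) \<odot>\<^sub>F b) = (\<Oplus>\<^bsub>F\<^esub>b\<in>B. c b \<odot>\<^sub>F b \<oplus>\<^sub>F c' b \<odot>\<^sub>F b)"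
   by (rule FM.M.finsum_cong') (use c cl BF in "auto simp: FM.smult_l_distr Pi_iff")
  also have "... = x \<oplus>\<^sub>F y" unfolding c(3,4) by (rule FM.M.finsum_addf) (use c cl in auto)
  finally show "x \<oplus>\<^sub>F y \<in> W'" using c(1,2) unfolding W'_def by (intro CollectI exI[of _ "%b. c b \<oplus> c' b"]) auto
 next
  fix a x assume a: "a \<in> carrier R" and "x \<in> W'"
  then obtain c where c: "c \<in> B \<rightarrow> carrier R" "x = (\<Oplus>\<^bsub>F\<^esub>b\<in>B. c b \<odot>\<^sub>F b)" by (auto simp: W'_def)
  have "a \<odot>\<^sub>F x = (\<Oplus>\<^bsub>F\<^esub>b\<in>B. a \<odot>\<^sub>F (c b \<odot>\<^sub>F b))" unfolding c(2) by (rule FM.smult_finsum_right) (use a c cl in auto)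
  also have "... = (\<Oplus>\<^bsub>F\<^esub>b\<in>B. (a \<otimes> c b) \<odot>\<^sub>F b)"
   by (rule FM.M.finsum_cong') (use a c BF in "auto simp: FM.smult_assoc Pi_iff intro!: FM.smult_closed")
  finally show "a \<odot>\<^sub>F x \<in> W'" using a c(1) unfolding W'_def by (intro CollectI exI[of _ "%b. a \<otimes> c b"]) auto
 qed
 moreover have "B \<subseteq> W'"
 proof
  fix b assume b: "b \<in> B"
  have "(\<Oplus>\<^bsub>F\<^esub>x\<in>B. (if x = b then \<one> else \<zero>) \<odot>\<^sub>F x) = (if b = b then \<one> else \<zero>) \<odot>\<^sub>F b"
   by (rule FM.M.finsum_eq_term[OF B(1) b]) (use BF in "auto intro!: FM.smult_closed")
  then show "b \<in> W'" unfolding W'_def using BF[OF b] by (intro CollectI exI[of _ "%x. if x = b then \<one> else \<zero>"]) (auto simp: FM.smult_one)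
 qed
 ultimately have WW': "W \<subseteq> W'" by (rule B(3))
 show ?thesis
  unfolding fg_module_def
 proof (intro conjI exI[of _ B] ballI)
  fix m assume "m \<in> carrier (F\<lparr>carrier := W\<rparr>)"
  then obtain c where c: "c \<in> B \<rightarrow> carrier R" "m = (\<Oplus>\<^bsub>F\<^esub>b\<in>B. c b \<odot>\<^sub>F b)" using WW' by (auto simp: W'_def)
  have "(\<Oplus>\<^bsub>F\<^esub>b\<in>B. c b \<odot>\<^sub>F b) = (\<Oplus>\<^bsub>F\<^esub>b\<in>B. restrict c B b \<odot>\<^sub>F b)"
   by (rule FM.M.finsum_cong') (use c cl in auto)
  also have "... = (\<Oplus>\<^bsub>F\<lparr>carrier := W\<rparr>\<^esub>b\<in>B. restrict c B b \<odot>\<^sub>F b)"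
   by (rule finsum_submod(1)[OF FM.is_left_module W(1), symmetric]) (use c B(2) submod_smult[OF W(1)] in auto)
  finally show "\<exists>c\<in>B \<rightarrow>\<^sub>E carrier R. m = (\<Oplus>\<^bsub>F\<lparr>carrier := W\<rparr>\<^esub>b\<in>B. c b \<odot>\<^bsub>F\<lparr>carrier := W\<rparr>\<^esub> b)"
   using c by (intro bexI[of _ "restrict c B"]) auto
 qed (use B left_module_submod[OF FM.is_left_module W(1)] in auto)
qed

end

section \<open>Nilpotent endomorphisms over a regular ring\<close>

section \<open>Nilpotent endomorphisms\<close>

lemma (in ring) idem_minus:
 assumes "q \<in> carrier R" "a \<in> carrier R" "q \<otimes> q = q" "a \<otimes> q = a" "q \<otimes> a = a" "a \<otimes> a = a"
 shows "(q \<ominus> a) \<otimes> (q \<ominus> a) = q \<ominus> a"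
proof -
 have "(q \<ominus> a) \<otimes> (q \<ominus> a) = q \<otimes> q \<ominus> a \<otimes> q \<ominus> q \<otimes> a \<oplus> a \<otimes> a" using assms(1,2) by algebra
 also have "... = q \<ominus> a \<ominus> a \<oplus> a" by (simp only: assms)
 also have "... = q \<ominus> a" using assms(1,2) by algebra
 finally show ?thesis .
qed

lemma submod_Int: "submod R M A ==> submod R M B ==> submod R M (A \<inter> B)"
 by (auto simp: submod_def)

context stable_setting
begin

lemma sout_slot_in:
 "N > 0 ==> u \<in> cF ==> i < N ==> j < N ==> sout N j (relabel R (slot_in N i) u) = (if j = i then u else \<zero>\<^sub>F)"
 by (auto simp: relabel_apply slot_at sout_def fun_eq_iff free_on_simps)

lemma submod_fixed: "\<phi> \<in> cE ==> submod R F {u \<in> cF. \<phi> u = u}"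
 by (rule submodI)
  (auto simp: E_hom lmod_hom_add lmod_hom_smult FM.smult_closed lmod_hom_zero[OF FM.is_left_module FM.is_left_module])

lemma restrict_hom:
 assumes W: "submod R F W" and \<phi>: "\<phi> \<in> cE" shows "restrict \<phi> W \<in> lmod_hom R (F\<lparr>carrier := W\<rparr>) F"
 by (rule lmod_homI)
  (use submod_subset[OF W] submod_add[OF W] submod_smult[OF W] \<phi> in
   \<open>auto simp: E_hom subset_iff lmod_hom_add lmod_hom_smult lmod_hom_closed\<close>)

lemma hom_diff:
 assumes Y: "left_module R Y" and W: "submod R F W" and \<gamma>: "\<gamma> \<in> lmod_hom R (F\<lparr>carrier := W\<rparr>) Y"
  and xy: "x \<in> W" "y \<in> W" "\<gamma> x = \<gamma> y"
 shows "x \<ominus>\<^sub>F y \<in> W" "\<gamma> (x \<ominus>\<^sub>F y) = \<zero>\<^bsub>Y\<^esub>"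
proof -
 interpret Y: left_module R Y by (rule Y)
 have c: "x \<in> cF" "y \<in> cF" using submod_subset[OF W] xy by auto
 show d: "x \<ominus>\<^sub>F y \<in> W"
  unfolding a_minus_def by (intro submod_add[OF W] submod_uminus[OF FM.is_left_module W] xy)
 have "x \<ominus>\<^sub>F y \<oplus>\<^sub>F y = x" using c by (simp add: a_minus_def FM.M.a_assoc FM.M.l_neg)
 then have "\<gamma> (x \<ominus>\<^sub>F y) \<oplus>\<^bsub>Y\<^esub> \<gamma> y = \<zero>\<^bsub>Y\<^esub> \<oplus>\<^bsub>Y\<^esub> \<gamma> y"
  using lmod_hom_add[OF \<gamma>, of "x \<ominus>\<^sub>F y" y] d xy lmod_hom_closed[OF \<gamma>, of y] by simp
 then show "\<gamma> (x \<ominus>\<^sub>F y) = \<zero>\<^bsub>Y\<^esub>"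
  using Y.M.add.r_cancel[of "\<gamma> y" "\<gamma> (x \<ominus>\<^sub>F y)" "\<zero>\<^bsub>Y\<^esub>"] lmod_hom_closed[OF \<gamma>] d xy by simp
qed

lemma finE_mult: "\<phi> \<in> cE ==> \<psi> \<in> finE ==> \<phi> \<bullet> \<psi> \<in> finE"
 by (rule finE_hat) (auto simp: hat_mult finE_closed intro!: finT_mult hat_finE)

end

context controlled_setting
begin

text \<open>A filtration of the image of \<open>P\<close> that reaches zero after \<open>k\<close>
  steps, each term carried by \<open>\<nu>\<close> into the next. Graded pieces are given up to
  isomorphism, as targets \<open>G i\<close> of surjections \<open>\<gamma> i\<close> with kernel
  \<open>M (Suc i)\<close>; \<open>d\<close> bounds the lengths of their resolutions.\<close>

definition nil_filtered where
 "nil_filtered k d P \<nu> M G \<gamma> \<longleftrightarrow> P \<in> finE & P \<bullet> P = P & \<nu> \<in> cE & P \<bullet> \<nu> = \<nu> & \<nu> \<bullet> P = \<nu> \<and>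
  M 0 = P ` cF & M k = {\<zero>\<^sub>F} & (\<forall>i<k. submod R F (M i)) & (\<forall>i<k. \<forall>u\<in>M i. \<nu> u \<in> M (Suc i)) \<and>
  (\<forall>i<k. pres d (G i)) & (\<forall>i<k. \<gamma> i \<in> lmod_hom R (F\<lparr>carrier := M i\<rparr>) (G i)) \<and>
  (\<forall>i<k. \<gamma> i ` M i = carrier (G i)) & (\<forall>i<k. {u \<in> M i. \<gamma> i u = \<zero>\<^bsub>G i\<^esub>} = M (Suc i))"

text \<open>
 Induction on the length of the resolutions of the graded pieces \<open>G i\<close> of a filtration which \<open>\<nu>\<close> moves up.
 Covering each piece by a projective module gives a surjection \<open>lam\<close> from a sum of projectives, on which
 \<open>\<nu>\<close> lifts to a strictly triangular map; the kernel of \<open>lam\<close> is filtered with shorter resolutions.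
\<close>

lemma filtered_controllable:
 assumes s: "s \<in> cT" "\<forall>f\<in>cT. f \<star> s = s \<star> f" and k: "k > 0"
  and "nil_filtered k d P \<nu> M G \<gamma>"
 shows "\<one>\<^sub>T \<oplus>\<^sub>T hat R \<nu> \<star> s \<in> controllable \<epsilon>"
 using assms(4)
proof (induction d arbitrary: P \<nu> M G \<gamma>)
 case 0
 have P: "P \<in> finE" "P \<bullet> P = P" "\<nu> \<in> cE" "P \<bullet> \<nu> = \<nu>" "\<nu> \<bullet> P = \<nu>"
  and M: "M 0 = P ` cF" "M k = {\<zero>\<^sub>F}" "!!i. i < k ==> submod R F (M i)"
   "!!i u. i < k ==> u \<in> M i ==> \<nu> u \<in> M (Suc i)"
  and \<gamma>: "!!i. i < k ==> pres 0 (G i)" "!!i. i < k ==> \<gamma> i \<in> lmod_hom R (F\<lparr>carrier := M i\<rparr>) (G i)"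
   "!!i. i < k ==> \<gamma> i ` M i = carrier (G i)" "!!i. i < k ==> {u \<in> M i. \<gamma> i u = \<zero>\<^bsub>G i\<^esub>} = M (Suc i)"
  using 0[unfolded nil_filtered_def] by simp_all
 \<comment> \<open>Resolutions of length 0 mean that the graded pieces vanish. The filtration is
   then constant, and it ends in zero, so \<open>P\<close> and \<open>\<nu>\<close> are
   zero.\<close>
 have step: "M i \<subseteq> M (Suc i)" if i: "i < k" for i
  using \<gamma>(1)[OF i] \<gamma>(3)[OF i] \<gamma>(4)[OF i] by auto
 have "M 0 \<subseteq> M i" if "i \<le> k" for i
  using that by (induction i) (use step in "auto dest!: Suc_le_lessD")
 then have P0: "P u = \<zero>\<^sub>F" if "u \<in> cF" for u using M(1,2) that by blast
 have "\<nu> = \<zero>\<^sub>E"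
 proof (rule FM.end_eqI[OF P(3)])
  fix u assume u: "u \<in> cF"
  have "\<nu> u = P (\<nu> u)" using end_mult_apply[OF u, of R P \<nu>] P(4) by simp
  then show "\<nu> u = \<zero>\<^sub>E u" using P0[of "\<nu> u"] P(3) u by (simp add: end_zero_apply)
 qed simp
 then show ?case using s SU.H_one by (simp add: hat_zero)
next
 case (Suc d)
 have P: "P \<in> finE" "P \<bullet> P = P" "\<nu> \<in> cE" "P \<bullet> \<nu> = \<nu>" "\<nu> \<bullet> P = \<nu>"
  and M: "M 0 = P ` cF" "M k = {\<zero>\<^sub>F}" "!!i. i < k ==> submod R F (M i)"
   "!!i u. i < k ==> u \<in> M i ==> \<nu> u \<in> M (Suc i)"
  and \<gamma>: "!!i. i < k ==> pres (Suc d) (G i)" "!!i. i < k ==> \<gamma> i \<in> lmod_hom R (F\<lparr>carrier := M i\<rparr>) (G i)"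
   "!!i. i < k ==> \<gamma> i ` M i = carrier (G i)" "!!i. i < k ==> {u \<in> M i. \<gamma> i u = \<zero>\<^bsub>G i\<^esub>} = M (Suc i)"
  using Suc.prems[unfolded nil_filtered_def] by (simp_all del: pres.simps)
 have PE: "P \<in> cE" by (rule finE_closed[OF P(1)])
 \<comment> \<open>Bundles the data of \<open>pres_cover\<close> so that they can be chosen for all
   \<open>i\<close> at once.\<close>
 define CV where "CV i e \<rho> G' \<pi> \<longleftrightarrow> e \<in> finE & e \<bullet> e = e & \<rho> \<in> lmod_hom R F (G i) \<and>
   (\<forall>u\<in>cF. \<rho> (e u) = \<rho> u) & \<rho> ` cF = carrier (G i) & pres d G' \<and>
   \<pi> \<in> lmod_hom R (F\<lparr>carrier := {u \<in> cF. e u = u & \<rho> u = \<zero>\<^bsub>G i\<^esub>}\<rparr>) G' \<and>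
   \<pi> ` {u \<in> cF. e u = u & \<rho> u = \<zero>\<^bsub>G i\<^esub>} = carrier G' \<and>
   (\<forall>u\<in>cF. e u = u \<longrightarrow> \<rho> u = \<zero>\<^bsub>G i\<^esub> \<longrightarrow> \<pi> u = \<zero>\<^bsub>G'\<^esub> \<longrightarrow> u = \<zero>\<^sub>F)"
  for i e \<rho> \<pi> and G' :: "('a, nat => 'a) module"
 have "\<exists>e \<rho> G' \<pi>. CV i e \<rho> G' \<pi>" if "i < k" for i
  unfolding CV_def by (rule pres_cover[OF \<gamma>(1)[OF that]], intro exI, intro conjI) assumption+
 then obtain e \<rho> G' \<pi> where CV: "!!i. i < k ==> CV i (e i) (\<rho> i) (G' i) (\<pi> i)" by metis
 have e: "e i \<in> finE" "e i \<bullet> e i = e i" and \<rho>: "\<rho> i \<in> lmod_hom R F (G i)" "!!u. u \<in> cF ==> \<rho> i (e i u) = \<rho> i u"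
   "\<rho> i ` cF = carrier (G i)" and G': "pres d (G' i)"
  and \<pi>: "\<pi> i \<in> lmod_hom R (F\<lparr>carrier := {u \<in> cF. e i u = u & \<rho> i u = \<zero>\<^bsub>G i\<^esub>}\<rparr>) (G' i)"
   "\<pi> i ` {u \<in> cF. e i u = u & \<rho> i u = \<zero>\<^bsub>G i\<^esub>} = carrier (G' i)"
   "!!u. u \<in> cF ==> e i u = u ==> \<rho> i u = \<zero>\<^bsub>G i\<^esub> ==> \<pi> i u = \<zero>\<^bsub>G' i\<^esub> ==> u = \<zero>\<^sub>F" if "i < k" for i
  using CV[OF that] unfolding CV_def by simp_all
 note Gm = pres_module[OF \<gamma>(1)] and G'm = pres_module[OF G']
 have eE: "e i \<in> cE" if "i < k" for i using e(1)[OF that] by (rule finE_closed)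
 have ee: "e i (e i u) = e i u" if "i < k" "u \<in> cF" for i u
  using e(2)[OF that(1)] end_mult_apply[OF that(2), of R "e i" "e i"] by simp
 have "submod R F {\<zero>\<^sub>F}" by (rule submodI) auto
 then have Mk: "submod R F (M i)" if "i \<le> k" for i
  using that M(2) M(3)[of i] by (cases "i = k") simp_all
 note MF = submod_subset[OF Mk, THEN subsetD]
 have Mdec: "M j \<subseteq> M i" if "i \<le> j" "j \<le> k" for i j
  using that
 proof (induction j rule: dec_induct)
  case (step n)
  then show ?case using \<gamma>(4)[of n] by auto
 qed simp
 \<comment> \<open>The cover of the graded piece \<open>G i\<close> is lifted to a map into
   \<open>M i\<close>.\<close>
 have "\<exists>l. l \<in> cE & l \<bullet> e i = l & (\<forall>u\<in>cF. l u \<in> M i) & (\<forall>u\<in>cF. \<gamma> i (l u) = \<rho> i u)" if i: "i < k" for i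
  by (rule lift_hom[OF Gm[OF i] M(3)[OF i] \<gamma>(2)[OF i] \<rho>(1)[OF i] _ e[OF i] \<rho>(2)[OF i]])
   (use lmod_hom_closed[OF \<rho>(1)[OF i]] \<gamma>(3)[OF i] in auto)
 then obtain l where l: "!!i. i < k ==> l i \<in> cE" "!!i. i < k ==> l i \<bullet> e i = l i"
  "!!i u. i < k ==> u \<in> cF ==> l i u \<in> M i" "!!i u. i < k ==> u \<in> cF ==> \<gamma> i (l i u) = \<rho> i u"
  by metis
 have le: "l i (e i u) = l i u" if "i < k" "u \<in> cF" for i u
  using l(2)[OF that(1)] end_mult_apply[OF that(2), of R "l i" "e i"] by simp
 have E0: "\<phi> \<zero>\<^sub>F = \<zero>\<^sub>F" if "\<phi> \<in> cE" for \<phi>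
  using lmod_hom_zero[OF FM.is_left_module FM.is_left_module] that by (simp add: E_hom)
 have Ea: "\<phi> (u \<oplus>\<^sub>F w) = \<phi> u \<oplus>\<^sub>F \<phi> w" if "\<phi> \<in> cE" "u \<in> cF" "w \<in> cF" for \<phi> u w
  using that by (simp add: E_hom lmod_hom_add)
 define si where "si i = relabel R (slot_in k i)" for i
 define so where "so i = relabel R (slot_out k i)" for i
 have siE: "si i \<in> cE" and soE: "so i \<in> cE" for i using k by (auto simp: si_def so_def)
 have so: "so j u = sout k j u" "sout k j u \<in> cF" if "u \<in> cF" for j u
  using that k by (auto simp: so_def relabel_slot_out sout_F)
 have so_si: "sout k j (si i u) = (if j = i then u else \<zero>\<^sub>F)" if "u \<in> cF" "i < k" "j < k" for i j u
  using that k by (simp add: si_def sout_slot_in)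
 have so0: "sout k j \<zero>\<^sub>F = \<zero>\<^sub>F" for j by (simp add: sout_def free_on_simps)
 \<comment> \<open>In the sum of the \<open>k\<close> covers, the projection onto those with index
   at least \<open>i\<close>. Strictly triangular means carrying the image of \<open>q i\<close>
   into that of \<open>q (Suc i)\<close>.\<close>
 define q where "q i = blockwise k (%j. if i \<le> j then e j else \<zero>\<^sub>E)" for i
 have "\<zero>\<^sub>E \<in> finE" by (rule finEI[of _ 0]) auto
 then have qfin: "q i \<in> finE" for i unfolding q_def using e by (intro blockwise_finE k) auto
 then have qE: "q i \<in> cE" for i by (rule finE_closed)
 have so_q: "sout k j (q i u) = (if i \<le> j then e j (sout k j u) else \<zero>\<^sub>F)" if "u \<in> cF" "j < k" for i j u
  using that so by (simp add: q_def blockwise_sout end_zero_apply)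
 note F_eqI = sout_eqI[OF k]
 have qq: "q i (q j u) = q (max i j) u" if u: "u \<in> cF" for i j u
  by (rule F_eqI) (use u qE so eE ee E0 in "auto simp: so_q")
 have qqE: "q i \<bullet> q j = q (max i j)" for i j
  by (rule FM.end_eqI) (use qE qq in "auto simp: end_mult_apply")
 have qk: "q k = \<zero>\<^sub>E"
  by (rule FM.end_eqI, use qE in auto, rule F_eqI) (auto simp: so_q end_zero_apply so0)
 have q_le: "q i u = u" if "q j u = u" "i \<le> j" "u \<in> cF" for i j u
  using qq[OF that(3), of i j] that by (simp add: max_def)
 \<comment> \<open>Assembles a map out of the sum of the covers from its components.\<close>
 define asm where "asm f = (\<Oplus>\<^bsub>E\<^esub>i\<in>{..<k}. f i \<bullet> so i)" for f
 have asmE: "asm f \<in> cE" if "!!i. i < k ==> f i \<in> cE" for f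
  unfolding asm_def using that soE by (intro E.finsum_closed) auto
 have asm: "asm f u = (\<Oplus>\<^bsub>F\<^esub>i\<in>{..<k}. f i (sout k i u))" if "!!i. i < k ==> f i \<in> cE" "u \<in> cF" for f u
 proof -
  have "asm f u = (\<Oplus>\<^bsub>F\<^esub>i\<in>{..<k}. (f i \<bullet> so i) u)"
   unfolding asm_def using that soE by (intro FM.end_finsum_apply) auto
  also have "... = (\<Oplus>\<^bsub>F\<^esub>i\<in>{..<k}. f i (sout k i u))"
   by (rule FM.M.finsum_cong') (use that so in "auto simp: end_mult_apply")
  finally show ?thesis .
 qed
 have asm_in: "asm f (q i u) \<in> W" if f: "!!j. j < k ==> f j \<in> cE" and u: "u \<in> cF" and W: "submod R F W"
  and fW: "!!j u. j < k ==> i \<le> j ==> u \<in> cF ==> f j u \<in> W" for f i u W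
 proof -
  have "asm f (q i u) = (\<Oplus>\<^bsub>F\<^esub>j\<in>{..<k}. f j (sout k j (q i u)))" by (rule asm) (use f u qE in auto)
  also have "... \<in> W"
   by (rule finsum_submod(2)[OF FM.is_left_module W])
    (use u f fW so eE E0 submod_zero[OF W] in "auto simp: so_q")
  finally show ?thesis .
 qed
 have asm_si: "asm f (si i u) = f i u" if f: "!!j. j < k ==> f j \<in> cE" and u: "u \<in> cF" "i < k" for f i u
 proof -
  have "asm f (si i u) = (\<Oplus>\<^bsub>F\<^esub>j\<in>{..<k}. f j (sout k j (si i u)))" by (rule asm) (use f u siE in auto)
  also have "... = f i (sout k i (si i u))"
   by (rule FM.M.finsum_eq_term) (use f u siE so E0 in "auto simp: so_si")
  finally show ?thesis using u by (simp add: so_si)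
 qed
 have asm_q0: "asm f \<bullet> q 0 = asm f" if f: "!!j. j < k ==> f j \<in> cE" "!!j. j < k ==> f j \<bullet> e j = f j" for f
 proof (rule FM.end_eqI)
  fix u assume u: "u \<in> cF"
  have "f j (e j (sout k j u)) = f j (sout k j u)" if "j < k" for j
   using f(2)[OF that] end_mult_apply[OF so(2)[OF u], of R "f j" "e j" j] by simp
  then have "asm f (q 0 u) = asm f u"
   using u f qE so by (simp add: asm) (rule FM.M.finsum_cong', auto simp: so_q)
  then show "(asm f \<bullet> q 0) u = asm f u" using u by (simp add: end_mult_apply)
 qed (use asmE f qE in auto)
 \<comment> \<open>The covering map from the sum of the covers to the image of \<open>P\<close>;
   \<open>sur\<close> below proves it surjective in every step of the filtration.\<close>
 define lam where "lam = asm l"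
 have lamE: "lam \<in> cE" unfolding lam_def by (rule asmE[of l, OF l(1)])
 have lam_q: "lam (q i u) \<in> M i" if "i \<le> k" "u \<in> cF" for i u
 proof -
  have "l j w \<in> M i" if "j < k" "i \<le> j" "w \<in> cF" for j w
   using l(3)[OF that(1,3)] Mdec[OF that(2)] that(1) by auto
  note lM = this
  show ?thesis unfolding lam_def by (rule asm_in[of l, OF l(1) that(2) Mk[OF that(1)]], assumption) (rule lM)
 qed
 have lam_si: "lam (si i u) = l i u" if "u \<in> cF" "i < k" for i u
  unfolding lam_def by (rule asm_si[of l, OF l(1) that])
 have lam_q0: "lam \<bullet> q 0 = lam" unfolding lam_def by (rule asm_q0[of l, OF l(1,2)])
 have q_si: "q i (si i u) = si i u" if "u \<in> cF" "i < k" "e i u = u" for i u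
  by (rule F_eqI) (use that siE eE E0 in "auto simp: so_q so_si")
 \<comment> \<open>Induction from the bottom of the filtration: an element whose image in
   \<open>G n\<close> agrees with that of \<open>m\<close> is lifted, and the difference lies in
   \<open>M (Suc n)\<close>, where preimages are known.\<close>
 have sur: "\<exists>z. z \<in> cF & q i z = z & lam z = m" if "i \<le> k" "m \<in> M i" for i m
  using that
 proof (induction i arbitrary: m rule: inc_induct)
  case base
  then show ?case using M(2) E0[OF qE] E0[OF lamE] by (intro exI[of _ "\<zero>\<^sub>F"]) auto
 next
  case (step n)
  have "\<gamma> n m \<in> \<rho> n ` cF" using \<gamma>(3)[OF step(2)] \<rho>(3)[OF step(2)] step(4) by auto
  then obtain u where u: "u \<in> cF" "\<gamma> n m = \<rho> n u" by auto
  have mF: "m \<in> cF" by (rule MF[of n]) (use step in auto)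
  have lF: "l n u \<in> cF" using l(1) step u by auto
  have "m \<ominus>\<^sub>F l n u \<in> {u \<in> M n. \<gamma> n u = \<zero>\<^bsub>G n\<^esub>}"
   using hom_diff[OF Gm M(3) \<gamma>(2) step(4) l(3)] step(2) u l(4) by simp
  then obtain w where w: "w \<in> cF" "q (Suc n) w = w" "lam w = m \<ominus>\<^sub>F l n u"
   using step(3) \<gamma>(4)[OF step(2)] by auto
  let ?z = "si n (e n u) \<oplus>\<^sub>F w"
  have c: "e n u \<in> cF" "si n (e n u) \<in> cF" using u step siE eE by auto
  have "q n ?z = ?z" using Ea[OF qE c(2) w(1)] q_si[OF c(1) step(2) ee[OF step(2) u(1)]] q_le[OF w(2) _ w(1)] by simp
  moreover have "lam ?z = m"
   using Ea[OF lamE c(2) w(1)] lam_si[OF c(1) step(2)] le[OF step(2) u(1)] w(3) mF lF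
   by (simp add: a_minus_def FM.M.a_lcomm[of "l n u" m] FM.M.r_neg)
  ultimately show ?case using c w by (intro exI[of _ ?z]) auto
 qed
 have sur': "m \<in> restrict lam {u \<in> cF. q i u = u} ` {u \<in> cF. q i u = u}" if "i \<le> k" "m \<in> M i" for i m
  using sur[OF that] by auto
 note fq = submod_fixed[OF qE] and rlam = restrict_hom[OF submod_fixed[OF qE] lamE]
 \<comment> \<open>On the cover of \<open>G i\<close> the lift of \<open>\<nu>\<close> can take its
   values in the covers from \<open>Suc i\<close> on, because \<open>\<nu>\<close> maps
   \<open>M i\<close> into \<open>M (Suc i)\<close> and \<open>lam\<close> covers the latter from
   there.\<close>
 define NV where "NV i n \<longleftrightarrow> n \<in> cE & n \<bullet> e i = n & (\<forall>u\<in>cF. n u \<in> {u \<in> cF. q (Suc i) u = u}) \<and>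
   (\<forall>u\<in>cF. restrict lam {u \<in> cF. q (Suc i) u = u} (n u) = (\<nu> \<bullet> l i) u)" for i n
 have "\<exists>n. NV i n" if i: "i < k" for i
  unfolding NV_def
 proof (rule lift_hom[OF FM.is_left_module fq rlam])
  show "\<nu> \<bullet> l i \<in> lmod_hom R F F" using P(3) l(1)[OF i] by (simp add: E_hom[symmetric])
  fix u assume u: "u \<in> cF"
  show "(\<nu> \<bullet> l i) u \<in> restrict lam {u \<in> cF. q (Suc i) u = u} ` {u \<in> cF. q (Suc i) u = u}"
   using i u by (intro sur') (auto simp: end_mult_apply M(4) l(3))
  show "(\<nu> \<bullet> l i) (e i u) = (\<nu> \<bullet> l i) u" using u le[OF i u] eE[OF i] by (simp add: end_mult_apply)
 qed (use e i in auto)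
 then obtain n where NV: "!!i. i < k ==> NV i (n i)" by metis
 have n: "n i \<in> cE" "n i \<bullet> e i = n i" "u \<in> cF ==> n i u \<in> {u \<in> cF. q (Suc i) u = u}"
  "u \<in> cF ==> restrict lam {u \<in> cF. q (Suc i) u = u} (n i u) = (\<nu> \<bullet> l i) u" if "i < k" for i u
  using NV[OF that] unfolding NV_def by blast+
 define Nn where "Nn = asm n"
 have NE: "Nn \<in> cE" unfolding Nn_def by (rule asmE[of n, OF n(1)])
 have lamn: "lam \<bullet> n i = \<nu> \<bullet> l i" if "i < k" for i
  by (rule FM.end_eqI) (use that n lamE P(3) l(1) in "auto simp: end_mult_apply")
 have lamN: "lam \<bullet> Nn = \<nu> \<bullet> lam"
 proof -
  have "lam \<bullet> Nn = (\<Oplus>\<^bsub>E\<^esub>i\<in>{..<k}. lam \<bullet> (n i \<bullet> so i))"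
   unfolding Nn_def asm_def by (rule E.finsum_rdistr) (use n soE lamE in auto)
  also have "... = (\<Oplus>\<^bsub>E\<^esub>i\<in>{..<k}. \<nu> \<bullet> (l i \<bullet> so i))"
   by (rule E.finsum_cong') (use n(1) soE lamE l(1) P(3) lamn in "auto simp: E.m_assoc[symmetric]")
  also have "... = \<nu> \<bullet> lam"
   unfolding lam_def asm_def by (rule E.finsum_rdistr[symmetric]) (use l soE P in auto)
  finally show ?thesis .
 qed
 have N_q: "q (Suc i) (Nn (q i u)) = Nn (q i u)" if "u \<in> cF" for i u
 proof -
  have nM: "n j w \<in> {u \<in> cF. q (Suc i) u = u}" if "j < k" "i \<le> j" "w \<in> cF" for j w
   using n(3)[OF that(1,3)] q_le[of "Suc j" "n j w" "Suc i"] that(2) by simp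
  have "Nn (q i u) \<in> {u \<in> cF. q (Suc i) u = u}"
   unfolding Nn_def by (rule asm_in[of n, OF n(1) that fq], assumption) (rule nM)
  then show ?thesis by simp
 qed
 have N_q0: "Nn \<bullet> q 0 = Nn" unfolding Nn_def by (rule asm_q0[of n, OF n(1,2)])
 have q0_N: "q 0 \<bullet> Nn = Nn"
 proof (rule FM.end_eqI)
  fix u assume u: "u \<in> cF"
  have "Nn (q 0 u) = Nn u" using N_q0 end_mult_apply[OF u, of R Nn "q 0"] by simp
  then show "(q 0 \<bullet> Nn) u = Nn u"
   using u NE q_le[OF N_q[OF u, of 0]] qE by (simp add: end_mult_apply)
 qed (use qE NE in auto)
 have finI: "\<phi> \<in> finE" if "\<phi> \<in> cE" "\<phi> \<bullet> \<psi> = \<phi>" "\<psi> \<in> finE" for \<phi> \<psi>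
  using finE_mult[OF that(1,3)] that(2) by simp
 have hs: "hat R \<phi> \<star> s \<star> hat R \<psi> = hat R (\<phi> \<bullet> \<psi>) \<star> s" "hat R \<phi> \<star> (hat R \<psi> \<star> s) = hat R (\<phi> \<bullet> \<psi>) \<star> s"
  if "\<phi> \<in> cE" "\<psi> \<in> cE" for \<phi> \<psi>
  using that s(1) bspec[OF s(2), of "hat R \<psi>"] by (simp_all add: hat_mult T.m_assoc)
 have fs: "hat R \<phi> \<star> s \<in> finT" if "\<phi> \<in> finE" for \<phi>
  using bspec[OF s(2), of "hat R \<phi>"] finE_closed[OF that] finT_mult[OF s(1) hat_finE[OF that]] by simp
 \<comment> \<open>The lift \<open>Nn\<close> is settled by strict triangularity alone. What
   separates it from \<open>\<nu>\<close> is its restriction to the kernel of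
   \<open>lam\<close>.\<close>
 have xH: "\<one>\<^sub>T \<oplus>\<^sub>T hat R Nn \<star> s \<in> controllable \<epsilon>"
 proof (rule SU.filtered_nilpotent[where q = "%i. hat R (q i)" and k = k])
  show "hat R (q (Suc i)) \<star> (hat R Nn \<star> s \<star> hat R (q i)) = hat R Nn \<star> s \<star> hat R (q i)" for i
  proof -
   have "q (Suc i) \<bullet> (Nn \<bullet> q i) = Nn \<bullet> q i"
    by (rule FM.end_eqI) (use NE qE N_q in "auto simp: end_mult_apply")
   then show ?thesis using NE qE by (simp add: hs)
  qed
 qed (use fs finI[OF NE N_q0 qfin] qfin hat_finE qE NE N_q0 in "auto simp: hs hat_mult[symmetric] qqE qk hat_zero")
 \<comment> \<open>A section of \<open>lam\<close>; it exists because the image of \<open>P\<close>,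
   a retract of \<open>F\<close>, is projective.\<close>
 have "\<exists>m. m \<in> cE & m \<bullet> P = m & (\<forall>u\<in>cF. m u \<in> {u \<in> cF. q 0 u = u}) \<and>
   (\<forall>u\<in>cF. restrict lam {u \<in> cF. q 0 u = u} (m u) = P u)"
 proof (rule lift_hom[OF FM.is_left_module fq rlam])
  show "P \<in> lmod_hom R F F" using PE by (simp add: E_hom[symmetric])
  fix u assume u: "u \<in> cF"
  show "P u \<in> restrict lam {u \<in> cF. q 0 u = u} ` {u \<in> cF. q 0 u = u}"
   using u by (intro sur') (auto simp: M(1))
  show "P (P u) = P u" using P(2) end_mult_apply[OF u, of R P P] by simp
 qed (use P in auto)
 then obtain m where m: "m \<in> cE" "m \<bullet> P = m" "!!u. u \<in> cF ==> q 0 (m u) = m u" "!!u. u \<in> cF ==> lam (m u) = P u"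
  by auto
 have lamm: "lam \<bullet> m = P" by (rule FM.end_eqI) (use m lamE PE in "auto simp: end_mult_apply")
 have q0m: "q 0 \<bullet> m = m" by (rule FM.end_eqI) (use m qE in "auto simp: end_mult_apply")
 have Plam: "P \<bullet> lam = lam"
 proof (rule FM.end_eqI)
  fix u assume u: "u \<in> cF"
  have "lam u = lam (q 0 u)" using lam_q0 end_mult_apply[OF u, of R lam "q 0"] by simp
  also have "... \<in> P ` cF" using lam_q[OF _ u, of 0] M(1) by simp
  finally obtain w where w: "w \<in> cF" "lam u = P w" by auto
  then show "(P \<bullet> lam) u = lam u" using u P(2) end_mult_apply[OF w(1), of R P P] by (simp add: end_mult_apply)
 qed (use PE lamE in auto)
 let ?a = "m \<bullet> lam"
 \<comment> \<open>The composite of \<open>lam\<close> and its section \<open>m\<close> is an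
   idempotent below \<open>q 0\<close>; its complement there is the projection onto the kernel of
   \<open>lam\<close>.\<close>
 define EK where "EK = q 0 \<ominus>\<^sub>E ?a"
 have aE: "?a \<in> cE" and EKE: "EK \<in> cE" using m lamE qE by (auto simp: EK_def)
 have a: "?a \<bullet> q 0 = ?a" "q 0 \<bullet> ?a = ?a" "?a \<bullet> ?a = ?a"
 proof -
  show "?a \<bullet> q 0 = ?a" using m(1) lamE qE lam_q0 by (simp add: E.m_assoc)
  show "q 0 \<bullet> ?a = ?a" using m(1) lamE qE q0m by (simp add: E.m_assoc[symmetric])
  have "?a \<bullet> ?a = m \<bullet> (lam \<bullet> m \<bullet> lam)" using m(1) lamE by (simp add: E.m_assoc)
  then show "?a \<bullet> ?a = ?a" by (simp add: lamm Plam)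
 qed
 have qq0: "q 0 \<bullet> q 0 = q 0" by (simp add: qqE)
 have EKEK: "EK \<bullet> EK = EK" unfolding EK_def by (rule E.idem_minus[OF qE aE qq0 a])
 have EKq: "EK \<bullet> q 0 = EK" "q 0 \<bullet> EK = EK"
  using qE aE a qq0 by (simp_all add: EK_def a_minus_def E.l_distr E.r_distr E.l_minus E.r_minus)
 have lamEK: "lam \<bullet> EK = \<zero>\<^sub>E"
 proof -
  have "lam \<bullet> EK = lam \<bullet> q 0 \<ominus>\<^sub>E lam \<bullet> m \<bullet> lam"
   using qE m(1) lamE by (simp add: EK_def a_minus_def E.r_distr E.r_minus E.m_assoc)
  then show ?thesis using lamE by (simp add: lam_q0 lamm Plam a_minus_def E.r_neg)
 qed
 let ?y = "m \<bullet> (\<nu> \<bullet> lam)"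
 have yE: "?y \<in> cE" using m P lamE by auto
 have EKN: "EK \<bullet> Nn = Nn \<ominus>\<^sub>E ?y"
 proof -
  have "EK \<bullet> Nn = q 0 \<bullet> Nn \<ominus>\<^sub>E m \<bullet> (lam \<bullet> Nn)"
   using qE m(1) lamE NE by (simp add: EK_def a_minus_def E.l_distr E.l_minus E.m_assoc)
  then show ?thesis by (simp add: q0_N lamN)
 qed
 \<comment> \<open>The restriction of \<open>Nn\<close> to the kernel of \<open>lam\<close>, which
   \<open>Nn\<close> preserves because lam Nn = \<nu> lam.\<close>
 define \<nu>K where "\<nu>K = Nn \<bullet> EK"
 have \<nu>KE: "\<nu>K \<in> cE" using NE EKE by (simp add: \<nu>K_def)
 have EK\<nu>: "EK \<bullet> \<nu>K = \<nu>K"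
 proof -
  have "EK \<bullet> \<nu>K = (Nn \<ominus>\<^sub>E ?y) \<bullet> EK" using NE EKE by (simp add: \<nu>K_def E.m_assoc[symmetric] EKN)
  also have "... = \<nu>K \<ominus>\<^sub>E m \<bullet> (\<nu> \<bullet> (lam \<bullet> EK))"
   using NE EKE m(1) P(3) lamE by (simp add: \<nu>K_def a_minus_def E.l_distr E.l_minus E.m_assoc)
  finally show ?thesis using m(1) P(3) \<nu>KE by (simp add: lamEK a_minus_def)
 qed
 have \<nu>EK: "\<nu>K \<bullet> EK = \<nu>K" using NE EKE by (simp add: \<nu>K_def E.m_assoc EKEK)
 \<comment> \<open>The kernel of \<open>lam\<close>, filtered by the number of leading blocks that
   vanish. Its graded pieces will be the kernels \<open>?D i\<close> of the covers, whose
   resolutions are shorter by one.\<close>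
 let ?K = "%i. {u \<in> cF. EK u = u} \<inter> {u \<in> cF. q i u = u}"
 have subK: "submod R F (?K i)" for i by (intro submod_Int submod_fixed EKE qE)
 let ?D = "%i. {u \<in> cF. e i u = u & \<rho> i u = \<zero>\<^bsub>G i\<^esub>}"
 have subD: "submod R F (?D i)" if "i < k" for i
 proof -
  have "?D i = {u \<in> cF. e i u = u} \<inter> {u \<in> cF. \<rho> i u = \<zero>\<^bsub>G i\<^esub>}" by auto
  then show ?thesis
   using submod_Int[OF submod_fixed[OF eE] submod_kernel[OF FM.is_left_module Gm \<rho>(1)], OF that that that] by simp
 qed
 have lamK: "lam u = \<zero>\<^sub>F" if "u \<in> ?K i" for i u
  using that lamEK end_mult_apply[of u F R lam EK] by (simp add: end_zero_apply)
 have split: "u = si i (sout k i u) \<oplus>\<^sub>F q (Suc i) u" if u: "u \<in> cF" "q i u = u" and i: "i < k" for i u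
 proof (rule F_eqI)
  fix j assume j: "j < k"
  have "sout k j u = (if i \<le> j then e j (sout k j u) else \<zero>\<^sub>F)" using so_q[OF u(1) j, of i] u(2) by simp
  then show "sout k j u = sout k j (si i (sout k i u) \<oplus>\<^sub>F q (Suc i) u)"
   using u(1) i j so[OF u(1)] eE[OF j]
   by (auto simp: sout_add so_si so_q not_less_eq_eq split: if_splits)
 qed
 \<comment> \<open>For \<open>u\<close> in the kernel of \<open>lam\<close>, the value of
   \<open>l i\<close> on the leading block is minus the value of \<open>lam\<close> on the later
   blocks. It therefore lies in \<open>M (Suc i)\<close>, where \<open>\<gamma> i\<close>
   vanishes.\<close>
 have soD: "sout k i u \<in> ?D i" if i: "i < k" and u: "u \<in> ?K i" for i u
 proof -
  have uF: "u \<in> cF" and qu: "q i u = u" using u by auto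
  have 1: "e i (sout k i u) = sout k i u" using so_q[OF uF i, of i] qu by simp
  have z: "lam (q (Suc i) u) \<in> M (Suc i)" using lam_q[OF _ uF, of "Suc i"] i by simp
  have c: "l i (sout k i u) \<in> cF" "lam (q (Suc i) u) \<in> cF" "si i (sout k i u) \<in> cF" "q (Suc i) u \<in> cF"
   using l(1)[OF i] so uF lamE qE siE by auto
  have "l i (sout k i u) \<oplus>\<^sub>F lam (q (Suc i) u) = \<zero>\<^sub>F"
   using lamK[OF u] arg_cong[OF split[OF uF qu i], of lam] Ea[OF lamE c(3,4)] lam_si[OF so(2)[OF uF] i] by simp
  then have "l i (sout k i u) = \<ominus>\<^sub>F lam (q (Suc i) u)"
   using c FM.M.minus_equality by metis
  then have "l i (sout k i u) \<in> M (Suc i)" using submod_uminus[OF FM.is_left_module Mk z] i by simp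
  then have "\<gamma> i (l i (sout k i u)) = \<zero>\<^bsub>G i\<^esub>" using \<gamma>(4)[OF i] by auto
  then show ?thesis using 1 so[OF uF] l(4)[OF i] by simp
 qed
 have mz: "u \<ominus>\<^sub>F \<zero>\<^sub>F = u" if "u \<in> cF" for u using that by (simp add: a_minus_def)
 \<comment> \<open>Conversely, later blocks complete an element of \<open>?D i\<close> to an element
   of the kernel; surjectivity of \<open>lam\<close> onto \<open>M (Suc i)\<close> provides
   them.\<close>
 have lift: "\<exists>u. u \<in> ?K i & sout k i u = w" if i: "i < k" and w: "w \<in> ?D i" for i w
 proof -
  have wF: "w \<in> cF" and ew: "e i w = w" using w by auto
  have "l i w \<in> M (Suc i)" using \<gamma>(4)[OF i] l(3,4)[OF i wF] w by auto
  then obtain z where z: "z \<in> cF" "q (Suc i) z = z" "lam z = l i w" using sur[of "Suc i"] i by auto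
  let ?u = "si i w \<ominus>\<^sub>F z"
  have c: "si i w \<in> cF" "?u \<in> cF" using wF z siE by auto
  have qu: "q i ?u = ?u" using E_diff[OF qE c(1) z(1)] q_si[OF wF i ew] q_le[OF z(2) _ z(1)] by simp
  have lu: "lam ?u = \<zero>\<^sub>F"
   using E_diff[OF lamE c(1) z(1)] lam_si[OF wF i] z(3) l(1)[OF i] wF by (simp add: a_minus_def FM.M.r_neg)
  have "EK ?u = q 0 ?u \<ominus>\<^sub>F m (lam ?u)"
   using c(2) aE qE by (simp add: EK_def FM.end_minus_apply end_mult_apply)
  also have "... = ?u \<ominus>\<^sub>F \<zero>\<^sub>F" by (simp only: lu E0[OF m(1)] q_le[OF qu le0 c(2)])
  also have "... = ?u" by (rule mz[OF c(2)])
  finally have EKu: "EK ?u = ?u" .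
  have "sout k i z = \<zero>\<^sub>F" using so_q[OF z(1) i, of "Suc i"] z(2) by simp
  then have "sout k i ?u = w" using sout_diff[OF k c(1) z(1), of i] so_si[OF wF i i] wF by (simp add: a_minus_def)
  then show ?thesis using EKu qu c(2) by (intro exI[of _ ?u]) simp
 qed
 have "\<one>\<^sub>T \<oplus>\<^sub>T hat R \<nu>K \<star> s \<in> controllable \<epsilon>"
 proof (rule Suc.IH[of EK \<nu>K ?K G' "%i. \<lambda>u\<in>?K i. \<pi> i (sout k i u)"],
   unfold nil_filtered_def, intro conjI allI impI ballI)
  show "EK \<in> finE" by (rule finI[OF EKE EKq(1) qfin])
  show "?K 0 = EK ` cF"
  proof
   show "?K 0 \<subseteq> EK ` cF" by force
   show "EK ` cF \<subseteq> ?K 0"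
   proof
    fix x assume "x \<in> EK ` cF"
    then obtain u where u: "u \<in> cF" "x = EK u" by auto
    then show "x \<in> ?K 0"
     using EKE end_mult_apply[OF u(1), of R EK EK] end_mult_apply[OF u(1), of R "q 0" EK] EKEK EKq(2) by simp
   qed
  qed
  show "?K k = {\<zero>\<^sub>F}" using E0[OF EKE] by (auto simp: qk end_zero_apply)
  fix i assume i: "i < k"
  show "\<nu>K u \<in> ?K (Suc i)" if "u \<in> ?K i" for u
  proof -
   have u: "u \<in> cF" "EK u = u" "q i u = u" using that by auto
   have "\<nu>K u = Nn u" using u by (simp add: \<nu>K_def end_mult_apply)
   moreover have "q (Suc i) (Nn u) = Nn u" using N_q[OF u(1), of i] u(3) by simp
   ultimately show ?thesis
    using EK\<nu> end_mult_apply[OF u(1), of R EK \<nu>K] NE u(1) by simp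
  qed
  show "pres d (G' i)" by (rule G'[OF i])
  have D: "sout k i u \<in> ?D i" if "u \<in> ?K i" for u by (rule soD[OF i that])
  note \<pi>i = \<pi>(1)[OF i]
  show "(\<lambda>u\<in>?K i. \<pi> i (sout k i u)) \<in> lmod_hom R (F\<lparr>carrier := ?K i\<rparr>) (G' i)"
  proof (rule lmod_homI)
   fix u assume u: "u \<in> carrier (F\<lparr>carrier := ?K i\<rparr>)"
   show "(\<lambda>u\<in>?K i. \<pi> i (sout k i u)) u \<in> carrier (G' i)" using u lmod_hom_closed[OF \<pi>i] D[of u] by simp
   fix w assume w: "w \<in> carrier (F\<lparr>carrier := ?K i\<rparr>)"
   have "u \<oplus>\<^sub>F w \<in> ?K i" by (rule submod_add[OF subK]) (use u w in simp_all)
   then show "(\<lambda>u\<in>?K i. \<pi> i (sout k i u)) (u \<oplus>\<^bsub>F\<lparr>carrier := ?K i\<rparr>\<^esub> w) =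
     (\<lambda>u\<in>?K i. \<pi> i (sout k i u)) u \<oplus>\<^bsub>G' i\<^esub> (\<lambda>u\<in>?K i. \<pi> i (sout k i u)) w"
    using u w D[of u] D[of w] lmod_hom_add[OF \<pi>i, of "sout k i u" "sout k i w"] by (simp add: sout_add)
  next
   fix a u assume a: "a \<in> carrier R" and u: "u \<in> carrier (F\<lparr>carrier := ?K i\<rparr>)"
   have "a \<odot>\<^sub>F u \<in> ?K i" by (rule submod_smult[OF subK a]) (use u in simp)
   moreover have "sout k i (a \<odot>\<^sub>F u) = a \<odot>\<^sub>F sout k i u" by (simp add: sout_def free_on_simps)
   ultimately show "(\<lambda>u\<in>?K i. \<pi> i (sout k i u)) (a \<odot>\<^bsub>F\<lparr>carrier := ?K i\<rparr>\<^esub> u) = a \<odot>\<^bsub>G' i\<^esub> (\<lambda>u\<in>?K i. \<pi> i (sout k i u)) u"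
    using u D[of u] lmod_hom_smult[OF \<pi>i a, of "sout k i u"] by simp
  qed auto
  show "(\<lambda>u\<in>?K i. \<pi> i (sout k i u)) ` ?K i = carrier (G' i)"
  proof -
   have "sout k i ` ?K i = ?D i"
   proof (intro equalityI subsetI)
    fix w assume "w \<in> sout k i ` ?K i"
    then obtain u where "u \<in> ?K i" "w = sout k i u" by (rule imageE)
    then show "w \<in> ?D i" using D[of u] by (simp only:)
   next
    fix w assume "w \<in> ?D i"
    from lift[OF i this] obtain u where "u \<in> ?K i & sout k i u = w" by (rule exE)
    then show "w \<in> sout k i ` ?K i" by (intro image_eqI[of _ _ u]) simp_all
   qed
   then have "\<pi> i ` sout k i ` ?K i = carrier (G' i)" using \<pi>(2)[OF i] by simp
   then show ?thesis unfolding image_image by (simp only: image_restrict_eq)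
  qed
  show "{u \<in> ?K i. (\<lambda>u\<in>?K i. \<pi> i (sout k i u)) u = \<zero>\<^bsub>G' i\<^esub>} = ?K (Suc i)"
  proof (intro equalityI subsetI)
   fix u assume "u \<in> {u \<in> ?K i. (\<lambda>u\<in>?K i. \<pi> i (sout k i u)) u = \<zero>\<^bsub>G' i\<^esub>}"
   then have u: "u \<in> ?K i" "\<pi> i (sout k i u) = \<zero>\<^bsub>G' i\<^esub>" by auto
   have "sout k i u = \<zero>\<^sub>F" using \<pi>(3)[OF i] D[OF u(1)] u(2) by simp
   then have "q (Suc i) u = u" using split[of u i] u(1) i E0[OF siE, of i] qE by auto
   then show "u \<in> ?K (Suc i)" using u(1) by auto
  next
   fix u assume "u \<in> ?K (Suc i)"
   then have u: "u \<in> cF" "EK u = u" "q (Suc i) u = u" by auto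
   have "sout k i u = \<zero>\<^sub>F" using so_q[OF u(1) i, of "Suc i"] u(3) by simp
   moreover have "\<pi> i \<zero>\<^sub>F = \<zero>\<^bsub>G' i\<^esub>"
    using lmod_hom_zero[OF left_module_submod[OF FM.is_left_module subD[OF i]] G'm[OF i] \<pi>i] by simp
   ultimately show "u \<in> {u \<in> ?K i. (\<lambda>u\<in>?K i. \<pi> i (sout k i u)) u = \<zero>\<^bsub>G' i\<^esub>}"
    using u q_le[OF u(3) _ u(1), of i] by simp
  qed
 qed (use EKEK EK\<nu> \<nu>EK \<nu>KE subK in auto)
 \<comment> \<open>With \<open>Nn\<close> and its restriction to the kernel both good, so is the
   block on the quotient; it turns out to be \<open>?y\<close>, the composite of \<open>lam\<close>,
   \<open>\<nu>\<close> and the section \<open>m\<close>.\<close>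
 then have "\<one>\<^sub>T \<oplus>\<^sub>T (hat R Nn \<star> s \<ominus>\<^sub>T hat R EK \<star> (hat R Nn \<star> s)) \<in> controllable \<epsilon>"
  using NE EKE EK\<nu> fs[OF finI[OF NE N_q0 qfin]] hat_finE[OF finI[OF EKE EKq(1) qfin]] xH
  by (intro SU.triangular_split) (auto simp: hs hat_mult[symmetric] EKEK \<nu>K_def)
 moreover have "hat R Nn \<star> s \<ominus>\<^sub>T hat R EK \<star> (hat R Nn \<star> s) = hat R ?y \<star> s"
 proof -
  have "hat R Nn \<star> s \<ominus>\<^sub>T hat R (Nn \<ominus>\<^sub>E ?y) \<star> s = (hat R Nn \<ominus>\<^sub>T hat R (Nn \<ominus>\<^sub>E ?y)) \<star> s"
   using NE yE s(1) by (simp add: a_minus_def T.l_distr T.l_minus)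
  also have "hat R Nn \<ominus>\<^sub>T hat R (Nn \<ominus>\<^sub>E ?y) = hat R (Nn \<ominus>\<^sub>E (Nn \<ominus>\<^sub>E ?y))"
   using NE yE by (simp add: hat_minus)
  also have "Nn \<ominus>\<^sub>E (Nn \<ominus>\<^sub>E ?y) = ?y"
   using NE yE by (simp add: a_minus_def E.minus_add E.a_assoc[symmetric] E.r_neg)
  finally show ?thesis using EKE NE by (simp add: hs EKN)
 qed
 ultimately have "\<one>\<^sub>T \<oplus>\<^sub>T hat R m \<star> (hat R (\<nu> \<bullet> lam) \<star> s) \<in> controllable \<epsilon>"
  using m(1) P(3) lamE by (simp add: hs)
 \<comment> \<open>Swapping m with \<nu> lam leaves \<nu> lam m = \<nu> P = \<nu>.\<close>
 then have "\<one>\<^sub>T \<oplus>\<^sub>T hat R (\<nu> \<bullet> lam) \<star> s \<star> hat R m \<in> controllable \<epsilon>"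
  by (rule SU.H_swap[OF hat_finE[OF finI[OF m(1,2) P(1)]] fs[OF finE_mult[OF P(3) finI[OF lamE lam_q0 qfin]]]])
 then show ?case using m(1) P(3,5) lamE by (simp add: hs E.m_assoc lamm)
qed

text \<open>Filter the first \<open>n\<close> coordinates by the kernels of the powers of \<nu>. The
  graded piece ker \<nu>^(j+1) / ker \<nu>^j is isomorphic to the image of ker \<nu>^(j+1) under
  \<nu>^j, a submodule of a free module of finite rank. It is finitely generated since
  \<open>R\<close> is noetherian, and so has a finite projective resolution.\<close>

lemma nilpotent_controllable:
 assumes reg: "regular_ring R" and s: "s \<in> cT" "\<forall>f\<in>cT. f \<star> s = s \<star> f"
  and \<nu>: "\<nu> \<in> finE" "\<nu> [^]\<^bsub>E\<^esub> (K :: nat) = \<zero>\<^sub>E"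
 shows "\<one>\<^sub>T \<oplus>\<^sub>T hat R \<nu> \<star> s \<in> controllable \<epsilon>"
proof -
 have \<nu>E: "\<nu> \<in> cE" by (rule finE_closed[OF \<nu>(1)])
 obtain n where n: "proj n \<bullet> \<nu> = \<nu>" "\<nu> \<bullet> proj n = \<nu>" using \<nu>(1) by (auto simp: finE_def)
 \<comment> \<open>One more than the exponent, so that the filtration has at least one step.\<close>
 define k where "k = Suc K"
 then have kp: "k > 0" by simp
 define pw where "pw j = \<nu> [^]\<^bsub>E\<^esub> (j :: nat)" for j
 have pwE: "pw j \<in> cE" for j using \<nu>E by (simp add: pw_def)
 have pw1: "pw (Suc j) u = pw j (\<nu> u)" if "u \<in> cF" for j u
  using that by (simp add: pw_def end_mult_apply)
 have pw2: "pw (Suc j) = \<nu> \<bullet> pw j" for j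
  using E.nat_pow_Suc2[OF \<nu>E, of j] by (simp add: pw_def)
 then have pw2': "pw (Suc j) u = \<nu> (pw j u)" if "u \<in> cF" for j u
  using that by (simp add: end_mult_apply)
 have pw0: "pw 0 u = u" if "u \<in> cF" for u using that by (simp add: pw_def end_one_apply)
 have pwk: "pw k = \<zero>\<^sub>E" using \<nu>E \<nu>(2) by (simp add: pw_def k_def)
 let ?M = "%i. {u \<in> cF. proj n u = u} \<inter> {u \<in> cF. pw (k - i) u = \<zero>\<^sub>F}"
 let ?g = "%i. pw (k - Suc i)"
 have subM: "submod R F (?M i)" for i
  using pwE by (intro submod_Int submod_fixed submod_kernel[OF FM.is_left_module FM.is_left_module]) (auto simp: E_hom[symmetric])
 have pp: "proj n (proj n u) = proj n u" if "u \<in> cF" for u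
  using that proj_mult[of n n] end_mult_apply[OF that, of R "proj n" "proj n"] by simp
 have p\<nu>: "proj n (\<nu> u) = \<nu> u" if "u \<in> cF" for u
  using n(1) end_mult_apply[OF that, of R "proj n" \<nu>] by simp
 have subG: "submod R F (?g i ` ?M i)" for i
  using pwE subM by (intro submod_image[OF FM.is_left_module FM.is_left_module]) (auto simp: E_hom[symmetric])
 have "?g i ` ?M i \<subseteq> carrier (free_on R {..<n})" for i
 proof
  fix x assume "x \<in> ?g i ` ?M i"
  then obtain u where u: "u \<in> cF" "proj n u = u" "x = ?g i u" by auto
  have xF: "x \<in> cF" using u pwE by simp
  have "proj n x = x"
   using u p\<nu>[OF E_closed[OF pwE u(1)]] by (cases "k - Suc i") (auto simp: pw2' pw0)
  then have "x j = \<zero>" if "j \<ge> n" for j using fun_cong[OF proj_apply[OF xF], of n j] that by simp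
  then show "x \<in> carrier (free_on R {..<n})" using xF by (auto simp: free_on_carrier)
 qed
 then have fg: "fg_module R (F\<lparr>carrier := ?g i ` ?M i\<rparr>)" for i
  by (rule noetherian_submod[OF conjunct1[OF reg[unfolded regular_ring_def]] subG])
 have "\<exists>d. pres d (F\<lparr>carrier := ?g i ` ?M i\<rparr>)" for i
 proof (rule resolution_pres)
  show "left_module R (F\<lparr>carrier := ?g i ` ?M i\<rparr>)" by (rule left_module_submod[OF FM.is_left_module subG])
  show "has_finite_projective_resolution R (F\<lparr>carrier := ?g i ` ?M i\<rparr>)"
   by (rule conjunct2[OF reg[unfolded regular_ring_def], rule_format, OF fg])
 qed
 then have "\<forall>i. \<exists>d. pres d (F\<lparr>carrier := ?g i ` ?M i\<rparr>)" by (rule allI)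
 from choice[OF this] obtain d where "\<forall>i. pres (d i) (F\<lparr>carrier := ?g i ` ?M i\<rparr>)" by (rule exE)
 note d = this[THEN spec]
 \<comment> \<open>The sum of the individual lengths is a bound for all of them.\<close>
 have pd: "pres (\<Sum>i<k. d i) (F\<lparr>carrier := ?g i ` ?M i\<rparr>)" if "i < k" for i
  by (rule pres_mono[OF d]) (use that in "auto intro!: member_le_sum")
 show ?thesis
 proof (rule filtered_controllable[OF s kp, where M = ?M and P = "proj n" and \<gamma> = "%i. restrict (?g i) (?M i)"
    and d = "\<Sum>i<k. d i" and G = "%i. F\<lparr>carrier := ?g i ` ?M i\<rparr>"],
   unfold nil_filtered_def, intro conjI allI impI ballI)
  show "?M 0 = proj n ` cF"
   using pp by (auto simp: pwk end_zero_apply) (metis image_eqI)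
  show "?M k = {\<zero>\<^sub>F}"
   using lmod_hom_zero[OF FM.is_left_module FM.is_left_module, of "proj n"] proj_closed
   by (auto simp: pw_def end_one_apply E_hom)
  fix i assume i: "i < k"
  then have ki: "k - i = Suc (k - Suc i)" by simp
  show "\<nu> u \<in> ?M (Suc i)" if "u \<in> ?M i" for u
  proof -
   have u: "u \<in> cF" "pw (k - i) u = \<zero>\<^sub>F" using that by auto
   then show ?thesis using pw1[OF u(1), of "k - Suc i"] p\<nu>[OF u(1)] \<nu>E by (simp add: ki)
  qed
  show "pres (\<Sum>i<k. d i) (F\<lparr>carrier := ?g i ` ?M i\<rparr>)" by (rule pd[OF i])
  have rh: "restrict (?g i) (?M i) \<in> lmod_hom R (F\<lparr>carrier := ?M i\<rparr>) F" by (rule restrict_hom[OF subM pwE])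
  show "restrict (?g i) (?M i) \<in> lmod_hom R (F\<lparr>carrier := ?M i\<rparr>) (F\<lparr>carrier := ?g i ` ?M i\<rparr>)"
   by (rule lmod_homI) (use lmod_hom_add[OF rh] lmod_hom_smult[OF rh] in auto)
  show "restrict (?g i) (?M i) ` ?M i = carrier (F\<lparr>carrier := ?g i ` ?M i\<rparr>)" by simp
  have "\<nu> \<zero>\<^sub>F = \<zero>\<^sub>F" using lmod_hom_zero[OF FM.is_left_module FM.is_left_module, of \<nu>] \<nu>E by (simp add: E_hom)
  then show "{u \<in> ?M i. restrict (?g i) (?M i) u = \<zero>\<^bsub>F\<lparr>carrier := ?g i ` ?M i\<rparr>\<^esub>} = ?M (Suc i)"
   by (auto simp: ki pw2')
 qed (use proj_finE proj_mult[of n n] \<nu>E n subM in "auto simp: k_def")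
qed

end

section \<open>Verifying the abstract hypotheses for the stable ring, and the conclusion\<close>

section \<open>Every stable unit is controllable\<close>

context stable_setting
begin

text \<open>Finitely many columns matter, and each of them involves finitely many degrees.\<close>

lemma lcoeff_finite:
 assumes x: "x \<in> finT" shows "\<exists>K. \<forall>k. \<bar>k\<bar> > K \<longrightarrow> lcoeff k x = \<zero>\<^sub>E"
proof -
 have xT: "x \<in> cT" by (rule finT_closed[OF x])
 obtain n where n: "x \<star> proj_T n = x" using x by (auto simp: finT_def)
 let ?S = "\<Union>i\<in>{..<n}. {k. x (iota 0 (unit_vec R i)) (of_int k) ~= (%i. \<zero>)}"
 have "finite {k. x (iota 0 (unit_vec R i)) (of_int k) ~= (%i. \<zero>)}" for i
 proof -
  have "finite {r. x (iota 0 (unit_vec R i)) r ~= (%i. \<zero>)}"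
   using xT V_carrier[of "x (iota 0 (unit_vec R i))"] by simp
  from finite_vimageI[OF this, of of_int] show ?thesis by (simp add: vimage_def inj_on_def)
 qed
 then have S: "finite ?S" by simp
 have "lcoeff k x = \<zero>\<^sub>E" if k: "k \<notin> ?S" for k
 proof (rule E_eqI)
  fix i
  have "lcoeff k x = lcoeff k x \<bullet> proj n" using n lcoeff_hat_right[OF xT, of "proj n" k] by simp
  then have "lcoeff k x (unit_vec R i) = lcoeff k x (proj n (unit_vec R i))"
   using end_mult_apply[OF unit_vec_F, of R "lcoeff k x" "proj n" i] by simp
  also have "... = (%i. \<zero>)"
   using k E_zero[OF lcoeff_closed[OF xT, of k]] by (auto simp: proj_unit free_on_simps lcoeff_apply)
  finally show "lcoeff k x (unit_vec R i) = \<zero>\<^sub>E (unit_vec R i)" by (simp add: end_zero_apply free_on_simps)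
 qed (use xT in auto)
 \<comment> \<open>The sum of the absolute values is a crude bound for the members of a finite
   set.\<close>
 moreover have "k \<notin> ?S" if "\<bar>k\<bar> > (\<Sum>k\<in>?S. \<bar>k\<bar>)" for k
  using that member_le_sum[of k ?S abs] S by auto
 ultimately show ?thesis by blast
qed

text \<open>Horner scheme: split off the constant coefficient and divide the rest by t.\<close>

lemma finT_laurent_poly:
 assumes "f \<in> finT" "!!k. k < 0 \<or> k > int d ==> lcoeff k f = \<zero>\<^sub>E"
 shows "f \<in> laurent_poly T (finT \<inter> hat R ` cE) (tau R 1) d"
 using assms
proof (induction d arbitrary: f)
 case 0
 have fT: "f \<in> cT" by (rule finT_closed[OF 0(1)])
 have "f = hat R (lcoeff 0 f)"
  by (rule lcoeff_eqI) (use fT 0(2) in "auto simp: lcoeff_hat", metis int_ops(1) linorder_neqE_linordered_idom)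
 then show ?case using 0(1) fT by auto
next
 case (Suc d)
 have fT: "f \<in> cT" by (rule finT_closed[OF Suc.prems(1)])
 define c where "c = hat R (lcoeff 0 f)"
 define y where "y = tau R (- 1) \<star> (f \<ominus>\<^sub>T c)"
 have cT: "c \<in> cT" "c \<in> hat R ` cE" using fT by (auto simp: c_def)
 obtain n where "f \<star> proj_T n = f" using Suc.prems(1) by (auto simp: finT_def)
 then have "lcoeff 0 f \<bullet> proj n = lcoeff 0 f" using lcoeff_hat_right[OF fT, of "proj n" 0] by simp
 then have cI: "c \<in> finT" unfolding c_def by (intro hat_finE finEI[OF lcoeff_closed[OF fT]])
 have yI: "y \<in> finT"
  unfolding y_def a_minus_def by (intro finT_mult finT_add finT_uminus cI Suc.prems(1)) simp
 have "y \<in> laurent_poly T (finT \<inter> hat R ` cE) (tau R 1) d"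
 proof (rule Suc.IH[OF yI])
  fix k :: int assume k: "k < 0 \<or> k > int d"
  have "lcoeff k y = lcoeff (k + 1) f \<ominus>\<^sub>E (if k + 1 = 0 then lcoeff 0 f else \<zero>\<^sub>E)"
   using fT cT(1) by (simp add: y_def lcoeff_tau a_minus_def lcoeff_add lcoeff_uminus) (simp add: c_def lcoeff_hat fT)
  also have "... = \<zero>\<^sub>E"
  proof (cases "k + 1 = 0")
   case True
   then show ?thesis using fT by (simp add: a_minus_def E.r_neg)
  next
   case False
   then have "lcoeff (k + 1) f = \<zero>\<^sub>E" using k by (intro Suc.prems(2)) auto
   then show ?thesis using False by (simp add: a_minus_def)
  qed
  finally show "lcoeff k y = \<zero>\<^sub>E" .
 qed
 moreover have "f = c \<oplus>\<^sub>T y \<star> tau R 1"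
 proof -
  have "y \<star> tau R 1 = tau R 1 \<star> y" by (rule tau_central[OF finT_closed[OF yI]])
  also have "... = f \<ominus>\<^sub>T c"
   using fT cT(1) by (simp add: y_def T.m_assoc[symmetric] tau_mult tau_zero)
  finally show ?thesis
   using fT cT(1) by (simp add: a_minus_def T.a_lcomm[of c f] T.r_neg)
 qed
 ultimately show ?case using cI cT(2) by auto
qed

lemma tau_pow: "tau R 1 [^]\<^bsub>T\<^esub> (n :: nat) = tau R (int n)"
 by (induction n) (simp_all add: tau_zero tau_mult add.commute)

lemma hat_pow: "\<phi> \<in> cE ==> hat R (\<phi> [^]\<^bsub>E\<^esub> (n :: nat)) = hat R \<phi> [^]\<^bsub>T\<^esub> n"
 by (induction n) (simp_all add: hat_one hat_mult)

lemma tau_minus_one_central: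
 assumes "f \<in> cT"
 shows "f \<star> (tau R k \<ominus>\<^sub>T tau R l) = (tau R k \<ominus>\<^sub>T tau R l) \<star> f"
 using assms tau_central[OF assms, of k] tau_central[OF assms, of l]
 by (simp add: a_minus_def T.r_distr T.l_distr T.r_minus T.l_minus)

end

context controlled_setting
begin

lemma GL_controllable:
 assumes reg: "regular_ring R" and g: "g \<in> GL" shows "g \<in> controllable \<epsilon>"
proof -
 \<comment> \<open>The central elements t - 1 and 1 - 1/t are both differences of powers of t, so
   one statement yields the two cases of \<open>H_nil\<close>.\<close>
 have nil: "\<one>\<^sub>T \<oplus>\<^sub>T \<nu> \<star> (tau R k \<ominus>\<^sub>T tau R l) \<in> controllable \<epsilon>"
  if \<nu>: "\<nu> \<in> finT \<inter> hat R ` cE" and n: "\<nu> [^]\<^bsub>T\<^esub> (n :: nat) = \<zero>\<^sub>T" for \<nu> n k l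
 proof -
  obtain \<phi> where \<phi>: "\<phi> \<in> cE" "\<nu> = hat R \<phi>" using \<nu> by auto
  have "\<phi> [^]\<^bsub>E\<^esub> n = \<zero>\<^sub>E"
   by (rule hat_inj) (use \<phi> n in "auto simp: hat_pow hat_zero")
  moreover have "\<phi> \<in> finE" using finE_hat[OF \<phi>(1)] \<phi>(2) \<nu> by simp
  ultimately show ?thesis
   unfolding \<phi>(2) by (intro nilpotent_controllable[OF reg]) (auto simp: tau_minus_one_central)
 qed
 interpret SL: stable_laurent T finT "hat R ` cE" "controllable \<epsilon>" S1 S2 R1 R2
  "tau R 1" "tau R (- 1)" "%k f. hat R (lcoeff k f)"
 proof unfold_locales
  show "tau R 1 \<in> cT" "tau R (- 1) \<in> cT" by simp_all
  show "tau R 1 \<star> tau R (- 1) = \<one>\<^sub>T" "tau R (- 1) \<star> tau R 1 = \<one>\<^sub>T" by (simp_all add: tau_mult tau_zero)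
  show "hat R (lcoeff k \<one>\<^sub>T) = (if k = 0 then \<one>\<^sub>T else \<zero>\<^sub>T)" for k
   unfolding hat_one[symmetric] by (simp add: lcoeff_hat hat_zero)
 next
  fix f assume f: "f \<in> cT"
  show "tau R 1 \<star> f = f \<star> tau R 1" "tau R (- 1) \<star> f = f \<star> tau R (- 1)"
   by (rule tau_central[OF f, symmetric])+
  fix k
  show "hat R (lcoeff k f) \<in> hat R ` cE" using f by simp
  show "hat R (lcoeff k (tau R 1 \<star> f)) = hat R (lcoeff (k - 1) f)" by (simp add: lcoeff_tau f)
  show "hat R (lcoeff k (f \<oplus>\<^sub>T g)) = hat R (lcoeff k f) \<oplus>\<^sub>T hat R (lcoeff k g)" if "g \<in> cT" for g
   using f that by (simp add: lcoeff_add hat_add)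
  fix a assume "a \<in> hat R ` cE"
  then obtain \<phi> where "\<phi> \<in> cE" "a = hat R \<phi>" by auto
  then show "hat R (lcoeff k (a \<star> f)) = a \<star> hat R (lcoeff k f)"
   "hat R (lcoeff k (f \<star> a)) = hat R (lcoeff k f) \<star> a"
   using f by (simp_all add: lcoeff_hat_left lcoeff_hat_right hat_mult)
 next
  fix x assume x: "x \<in> finT"
  show "x \<star> tau R 1 \<in> finT" using tau_central[OF finT_closed[OF x]] finT_mult[OF _ x] by simp
  obtain K where K: "\<bar>k\<bar> > K ==> lcoeff k x = \<zero>\<^sub>E" for k using lcoeff_finite[OF x] by auto
  then show "\<exists>K. \<forall>k. \<bar>k\<bar> > K \<longrightarrow> hat R (lcoeff k x) = \<zero>\<^sub>T" by (intro exI[of _ K]) (simp add: hat_zero)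
  \<comment> \<open>Multiplication by t^K moves the degrees from the range -K to K into the range 0
    to 2K.\<close>
  have "tau R 1 [^]\<^bsub>T\<^esub> nat K \<star> x \<in> laurent_poly T (finT \<inter> hat R ` cE) (tau R 1) (2 * nat K)"
  proof (rule finT_laurent_poly)
   show "tau R 1 [^]\<^bsub>T\<^esub> nat K \<star> x \<in> finT" by (intro finT_mult x) simp
   show "lcoeff k (tau R 1 [^]\<^bsub>T\<^esub> nat K \<star> x) = \<zero>\<^sub>E" if "k < 0 \<or> k > int (2 * nat K)" for k
    unfolding tau_pow lcoeff_tau[OF finT_closed[OF x]] by (rule K) (use that in auto)
  qed
  then show "\<exists>K d. tau R 1 [^]\<^bsub>T\<^esub> (K :: nat) \<star> x \<in> laurent_poly T (finT \<inter> hat R ` cE) (tau R 1) d"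
   by blast
 next
  fix g assume "g \<in> Units T" "g \<in> hat R ` cE" "inv\<^bsub>T\<^esub> g \<in> hat R ` cE" "g \<ominus>\<^sub>T \<one>\<^sub>T \<in> finT"
  then show "g \<in> controllable \<epsilon>" by (intro controllable_const[OF eps]) (auto simp: GL_def)
 next
  fix p assume p: "p \<in> finT \<inter> hat R ` cE" "p \<star> p = p"
  then obtain \<phi> where \<phi>: "\<phi> \<in> cE" "p = hat R \<phi>" by auto
  have "\<phi> \<bullet> \<phi> = \<phi>" by (rule hat_inj) (use \<phi> p(2) in "auto simp: hat_mult")
  moreover have "\<phi> \<in> finE" using finE_hat[OF \<phi>(1)] \<phi>(2) p by simp
  ultimately show "\<one>\<^sub>T \<ominus>\<^sub>T p \<oplus>\<^sub>T p \<star> tau R 1 \<in> controllable \<epsilon>"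
   unfolding \<phi>(2) by (intro corner_controllable)
 next
  fix \<nu> n assume "\<nu> \<in> finT \<inter> hat R ` cE" "\<nu> [^]\<^bsub>T\<^esub> (n :: nat) = \<zero>\<^sub>T"
  from nil[OF this, of 1 0] nil[OF this, of 0 "- 1"]
  show "\<one>\<^sub>T \<oplus>\<^sub>T \<nu> \<star> (tau R 1 \<ominus>\<^sub>T \<one>\<^sub>T) \<in> controllable \<epsilon>"
   "\<one>\<^sub>T \<oplus>\<^sub>T \<nu> \<star> (\<one>\<^sub>T \<ominus>\<^sub>T tau R (- 1)) \<in> controllable \<epsilon>"
   by (simp_all add: tau_zero)
 qed
 have gT: "g \<in> cT" by (rule GL_T[OF g])
 then have "\<one>\<^sub>T \<oplus>\<^sub>T (g \<ominus>\<^sub>T \<one>\<^sub>T) = g" by (simp add: a_minus_def T.a_lcomm[of "\<one>\<^sub>T" g] T.r_neg)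
 then show ?thesis using SL.all_units[of "g \<ominus>\<^sub>T \<one>\<^sub>T"] g by (simp add: GL_def)
qed

end

theorem proposition1p8:
 fixes R :: "('a, 'k) ring_scheme" and \<epsilon> :: real
 assumes "regular_ring R"
  and "\<epsilon> > 0"
  and "x \<in> carrier (K1 (laurent_free_cat R))"
 shows "\<exists>A \<xi>. eps_automorphism R \<epsilon> A \<xi> \<and> \<U> R (K1_class (\<T> R) A \<xi>) = x"
proof -
 have R: "ring R" using assms(1) by (simp add: regular_ring_def left_noetherian_def)
 interpret controlled_setting R \<epsilon>
  by (intro controlled_setting.intro stable_setting.intro controlled_setting_axioms.intro R assms(2))
 obtain z where z: "Poly_Mapping.keys z \<subseteq> cat_aut (laurent_free_cat R)"
  "x = K1_relgroup (laurent_free_cat R) #>\<^bsub>K1_gens (laurent_free_cat R)\<^esub> z"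
  by (rule K.K1_carrierE[OF assms(3)])
 \<comment> \<open>The class is that of a single stable unit. Controllability exchanges it for a
   controlled unit of the same class, and this is the one realised geometrically.\<close>
 obtain g where g: "g \<in> GL" "z \<approx>\<^sub>K kap g" using kap_surj[OF z(1)] by (rule bexE)
 have "g \<in> controllable \<epsilon>" by (rule GL_controllable[OF assms(1) g(1)])
 then obtain h p where h: "h \<in> GL" "kap g \<approx>\<^sub>K kap h" "ctl \<epsilon> p h" "ctl \<epsilon> p (inv\<^bsub>T\<^esub> h)"
  by (auto simp: controllable_def)
 obtain A \<xi> where \<xi>: "eps_automorphism R \<epsilon> A \<xi> & frag_of (\<U>\<^sub>o R A, \<U>\<^sub>h R A A \<xi>) \<approx>\<^sub>K kap h"
  using realize_controlled[OF h(1,3,4)] by (elim exE)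
 have "z \<approx>\<^sub>K frag_of (\<U>\<^sub>o R A, \<U>\<^sub>h R A A \<xi>)"
  by (rule K.equivN_trans[OF g(2) K.equivN_trans[OF h(2) K.equivN_sym[OF conjunct2[OF \<xi>]]]])
 then have "\<U> R (K1_class (\<T> R) A \<xi>) = x"
  unfolding forget_K1_class[OF R] z(2) by (rule K.K1_coset_eqI[symmetric])
 then show ?thesis using \<xi> by (intro exI[of _ A] exI[of _ \<xi>]) simp
qed

end
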